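(* Let $\alpha,\beta\in\mathbb{R}$, $\alpha\neq0$. Let $m$ be a Fourier multiplier on $\mathbb{R}^n$, with support in the set $\{\xi\in\mathbb{R}^n:|\xi|^\alpha\ge1\}$, satisfying $$|D^\gamma m(\xi)|\lesssim|\xi|^{-\beta+|\gamma|(\alpha-1)}$$ for every multi-index $\gamma\in\mathbb{N}^n$, and let $T$ be the associated multiplier operator. Then for any compactly supported bounded functions $f,g$ on $\mathbb{R}^n$, there exist sparse collections $\mathcal{S}$ and $\widetilde{\mathcal{S}}$ of dyadic cubes such that $$|\langle Tf,g\rangle|\le C(\alpha,\beta,r,s)\,\Lambda_{\mathcal{S},r,s'}(f,g)$$ and $$|\langle Tf,g\rangle|\le C(\alpha,\beta,r,s)\,\Lambda_{\widetilde{\mathcal{S}},s',r}(f,g)$$ for all pairs $(r,s')$ and $(s',r)$ such that $\alpha\cdot\beta>0$ and $$|\beta|>n|\alpha|(1/r-1/2),\qquad 1\le r\le s\le2$$ or $$|\beta|>n|\alpha|(1/r-1/s),\qquad 1\le r\le2\le s\le r'.$$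
   Context: The operator $T$ is given by $\widehat{Tf}=m\widehat f$, where $\widehat f$ is the Fourier transform of $f$ on $\mathbb{R}^n$; $\langle\cdot,\cdot\rangle$ is the $L^2(\mathbb{R}^n)$ pairing. The notation $A\lesssim B$ means $A\le CB$ for some constant $C$. For $1\le p\le\infty$, $p'$ denotes the conjugate exponent, $1/p+1/p'=1$. A collection $\mathcal{S}$ of dyadic cubes in $\mathbb{R}^n$ is $\eta$-sparse, for $0<\eta<1$, if there exist pairwise disjoint sets $\{E_Q:Q\in\mathcal{S}\}$ with $E_Q\subset Q$ and $|E_Q|>\eta|Q|$ for all $Q\in\mathcal{S}$; it is sparse if it is $\eta$-sparse for some $0<\eta<1$. For a dyadic cube $Q$ and $1\le p<\infty$, $\langle f\rangle_{p,Q}$ is defined by $\langle f\rangle_{p,Q}^p=|Q|^{-1}\int_Q|f|^p\,dx$, and $\langle f\rangle_{\infty,Q}$ is the essential supremum of $|f|$ over $Q$. The $(p,q)$ sparse form is $\Lambda_{\mathcal{S},p,q}(f,g)=\sum_{Q\in\mathcal{S}}|Q|\,\langle f\rangle_{p,Q}\,\langle g\rangle_{q,Q}$.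
   Formalization: The dyadic cubes of each sparse collection belong to a translated dyadic grid whose origin may depend on f and g; with only the standard grid the claim fails, e.g. for n=1 with f supported on [-1,0] and g on [0,1]. *)

theory Defs
  imports "HOL-Analysis.Analysis" "HOL-Probability.Essential_Supremum"
begin

section \<open>Symbols\<close>

definition partial_deriv :: "'n::finite \<Rightarrow> (real^'n \<Rightarrow> complex) \<Rightarrow> real^'n \<Rightarrow> complex" where
  "partial_deriv i m \<xi> = frechet_derivative m (at \<xi>) (axis i 1)"

text \<open>
  A multi-index \<open>\<gamma>\<close> is given by a list \<open>js\<close> of coordinate directions in which to differentiate:
  \<open>\<gamma> = count_list js\<close> and \<open>|\<gamma>| = length js\<close>.  Every \<open>\<gamma> :: 'n \<Rightarrow> nat\<close> arises in this way.  The order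
  of the list does not matter for the smooth functions considered below, whose mixed partial
  derivatives commute.
\<close>

definition iter_deriv :: "'n::finite list \<Rightarrow> (real^'n \<Rightarrow> complex) \<Rightarrow> real^'n \<Rightarrow> complex" where
  "iter_deriv js m = foldr partial_deriv js m"

text \<open>Infinite differentiability on an open set: all iterated partials are differentiable there
  (hence continuous).\<close>

definition smooth_on_open :: "(real^'n::finite) set \<Rightarrow> (real^'n \<Rightarrow> complex) \<Rightarrow> bool" where
  "smooth_on_open U m \<longleftrightarrow> (\<forall>js. \<forall>\<xi>\<in>U. iter_deriv js m differentiable (at \<xi>))"

text \<open>
  The family \<open>A\<close> collects the implied constants of the symbol estimates, one for each multi-index.
  The origin is exempt from the support condition and from the estimates: for \<open>\<alpha> < 0\<close> it is a limit
  point of the region \<open>|\<xi>|\<^sup>\<alpha> \<ge> 1\<close> at which \<open>|\<xi>|\<^sup>\<alpha>\<close> is not a real number (whereas \<open>0 powr \<alpha> = 0\<close>),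
  and the value of a multiplier at a single point is irrelevant.
\<close>

definition is_symbol ::
    "real \<Rightarrow> real \<Rightarrow> (('n::finite \<Rightarrow> nat) \<Rightarrow> real) \<Rightarrow> (real^'n \<Rightarrow> complex) \<Rightarrow> bool" where
  "is_symbol \<alpha> \<beta> A m \<longleftrightarrow>
     smooth_on_open (- {0}) m \<and>
     closure {\<xi>. m \<xi> \<noteq> 0} \<subseteq> insert 0 {\<xi>. norm \<xi> powr \<alpha> \<ge> 1} \<and>
     (\<forall>js. \<forall>\<xi>. \<xi> \<noteq> 0 \<longrightarrow>
        cmod (iter_deriv js m \<xi>)
          \<le> A (count_list js) * norm \<xi> powr (- \<beta> + real (length js) * (\<alpha> - 1)))"


section \<open>Multiplier operators\<close>

definition square_integrable :: "(real^'n::finite \<Rightarrow> complex) \<Rightarrow> bool" where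
  "square_integrable f \<longleftrightarrow>
     f \<in> borel_measurable lebesgue \<and> integrable lebesgue (\<lambda>x. (cmod (f x))\<^sup>2)"

definition fourier :: "(real^'n::finite \<Rightarrow> complex) \<Rightarrow> real^'n \<Rightarrow> complex" where
  "fourier f \<xi> = (LINT x|lebesgue. cis (- (\<xi> \<bullet> x)) * f x)"

definition L2_tendsto ::
    "(nat \<Rightarrow> real^'n::finite \<Rightarrow> complex) \<Rightarrow> (real^'n \<Rightarrow> complex) \<Rightarrow> bool" where
  "L2_tendsto u f \<longleftrightarrow> (\<lambda>k. \<integral>\<^sup>+x. ennreal ((cmod (u k x - f x))\<^sup>2) \<partial>lebesgue) \<longlonglongrightarrow> 0"

text \<open>
  \<open>F\<close> represents the Fourier--Plancherel transform of \<open>f \<in> L\<^sup>2\<close>: the continuous extension to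
  \<open>L\<^sup>2\<close> of the Fourier integral on \<open>L\<^sup>1 \<inter> L\<^sup>2\<close>.  This determines \<open>F\<close> from \<open>f\<close> up to null sets.
\<close>

definition has_fourier_transform ::
    "(real^'n::finite \<Rightarrow> complex) \<Rightarrow> (real^'n \<Rightarrow> complex) \<Rightarrow> bool" where
  "has_fourier_transform f F \<longleftrightarrow>
     square_integrable f \<and> square_integrable F \<and>
     (\<exists>u. (\<forall>k. integrable lebesgue (u k) \<and> square_integrable (u k)) \<and>
          L2_tendsto u f \<and> L2_tendsto (\<lambda>k. fourier (u k)) F)"

text \<open>The transform of \<open>T f\<close> is \<open>m\<close> times that of \<open>f\<close>, for all \<open>f\<close> in the natural \<open>L\<^sup>2\<close> domain; this
  is all of \<open>L\<^sup>2\<close> if \<open>m\<close> is bounded, as it is in the case \<open>\<alpha> \<beta> > 0\<close>.\<close>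

definition multiplier_operator ::
    "(real^'n::finite \<Rightarrow> complex) \<Rightarrow> ((real^'n \<Rightarrow> complex) \<Rightarrow> real^'n \<Rightarrow> complex) \<Rightarrow> bool" where
  "multiplier_operator m T \<longleftrightarrow>
     (\<forall>f F. has_fourier_transform f F \<and> square_integrable (\<lambda>\<xi>. m \<xi> * F \<xi>)
        \<longrightarrow> has_fourier_transform (T f) (\<lambda>\<xi>. m \<xi> * F \<xi>))"

definition L2_pairing :: "(real^'n::finite \<Rightarrow> complex) \<Rightarrow> (real^'n \<Rightarrow> complex) \<Rightarrow> complex" where
  "L2_pairing u v = (LINT x|lebesgue. u x * cnj (v x))"

definition bounded_compact_support :: "(real^'n::finite \<Rightarrow> complex) \<Rightarrow> bool" where
  "bounded_compact_support f \<longleftrightarrow>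
     f \<in> borel_measurable lebesgue \<and> bounded (range f) \<and> compact (closure {x. f x \<noteq> 0})"


section \<open>Sparse forms\<close>

text \<open>
  The dyadic cubes of all scales \<open>2\<^sup>k\<close>, \<open>k \<in> \<int>\<close>, of the dyadic grid with origin \<open>x0\<close>.  As usual in
  sparse domination, the grid is not tied to the coordinate origin: no cube of the grid with
  \<open>x0 = 0\<close> meets two different open orthants, so forms over that grid alone vanish for \<open>f\<close> and \<open>g\<close>
  supported in different orthants.
\<close>

definition dyadic_cube :: "real^'n::finite \<Rightarrow> int \<Rightarrow> int^'n \<Rightarrow> (real^'n) set" where
  "dyadic_cube x0 k v =
     {x. \<forall>i. x0 $ i + 2 powi k * of_int (v $ i) \<le> x $ i \<and>
             x $ i < x0 $ i + 2 powi k * (of_int (v $ i) + 1)}"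

definition dyadic_grid :: "real^'n::finite \<Rightarrow> (real^'n) set set" where
  "dyadic_grid x0 = {dyadic_cube x0 k v | k v. True}"

definition sparse_family :: "real \<Rightarrow> (real^'n::finite) set set \<Rightarrow> bool" where
  "sparse_family \<eta> S \<longleftrightarrow>
     0 < \<eta> \<and> \<eta> < 1 \<and> (\<exists>x0. S \<subseteq> dyadic_grid x0) \<and>
     (\<exists>E. disjoint_family_on E S \<and>
          (\<forall>Q\<in>S. E Q \<in> sets lebesgue \<and> E Q \<subseteq> Q \<and>
                  measure lebesgue (E Q) > \<eta> * measure lebesgue Q))"

text \<open>Exponents are extended reals in \<open>[1, \<infinity>]\<close>; note \<open>1 / \<infinity> = 0\<close> and \<open>inverse 0 = \<infinity>\<close>.\<close>

definition conj_exponent :: "ereal \<Rightarrow> ereal" where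
  "conj_exponent p = inverse (1 - 1 / p)"

definition lp_average :: "ereal \<Rightarrow> (real^'n::finite) set \<Rightarrow> (real^'n \<Rightarrow> complex) \<Rightarrow> real" where
  "lp_average p Q f =
     (if p = \<infinity>
      then real_of_ereal (esssup (restrict_space lebesgue Q) (\<lambda>x. ereal (cmod (f x))))
      else (1 / measure lebesgue Q * (LINT x:Q|lebesgue. cmod (f x) powr real_of_ereal p))
             powr (1 / real_of_ereal p))"

text \<open>The sum is taken in \<open>[0, \<infinity>]\<close>, so that it is meaningful without a convergence assumption.\<close>

definition sparse_form ::
    "(real^'n::finite) set set \<Rightarrow> ereal \<Rightarrow> ereal \<Rightarrow> (real^'n \<Rightarrow> complex) \<Rightarrow> (real^'n \<Rightarrow> complex)
      \<Rightarrow> ennreal" where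
  "sparse_form S p q f g =
     (\<Sum>\<^sub>\<infinity>Q\<in>S. ennreal (measure lebesgue Q * lp_average p Q f * lp_average q Q g))"

end

theory Submission
  imports Defs "HOL-Probability.Probability"
begin

text \<open>
  Cut the multiplier smoothly into pieces at dyadic frequencies \<open>R\<close> and put \<open>M = R powr \<alpha>\<close>, \<open>b = \<beta> / \<alpha>\<close>.
  Such a piece has size \<open>M powr -b\<close>, and by the symbol estimates its kernel decays rapidly beyond the
  distance \<open>M / R\<close>.  At the scale \<open>L = M powr (1 + \<epsilon>) / R\<close> the form of the piece is therefore essentially
  local, and interpolating between \<open>L\<^sup>1\<close> and \<open>L\<^sup>2\<close> bounds it by \<open>M powr ((1 + \<epsilon>) * n * (1 / p + 1 / q - 1) - b)\<close>
  times the integral over \<open>x\<close> of the product of the \<open>p\<close>- and \<open>q\<close>-averages of \<open>f\<close> and \<open>g\<close> over the cube of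
  size \<open>L\<close> centred at \<open>x\<close>.  These bounds are summable in \<open>R\<close> exactly when \<open>n * (1 / p + 1 / q - 1) < b\<close> and
  \<open>\<epsilon>\<close> is small, and both regions of exponents reduce to this condition since averages increase with the
  exponent.

  The local forms are dominated by a sparse form as follows.  For a suitable translate of the dyadic grid, at least
  half of each form comes from points \<open>x\<close> whose cube lies in a slightly larger cube of the grid, and
  stopping cubes that control all averages involved dominate the sum over grid cubes.  One sparse family
  has to serve all exponents; by monotonicity countably many exponent pairs suffice, and the losses for
  the \<open>i\<close>-th pair may grow with \<open>i\<close>.
\<close>

section \<open>Plancherel theory\<close>

text \<open>The order of the quantifiers shapes the proof: \<open>S\<close> may depend on
  \<open>m\<close>, \<open>f\<close>, \<open>g\<close> but not on the exponents, while the constant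
  may depend on the exponents but not on \<open>m\<close>, \<open>f\<close>, \<open>g\<close>. Both
  are possible because the condition on the exponents is strict, hence open: a pair in the region
  can be lowered slightly to a rational pair \<open>(p, q)\<close> that still satisfies n (1/p + 1/q
  - 1) < \<beta>/\<alpha>. The rational pairs form one fixed list, and the constant is the loss at a
  chosen entry. The condition is symmetric in \<open>p\<close> and \<open>q\<close>, so the same
  family serves both forms. All cubes of a sparse family lie in one grid, so the usual device of
  several adjacent grids is excluded; instead one translate is found by averaging, for all list
  entries at once. The margin \<epsilon> pays for localisation: beyond distance L = M powr (1 +
  \<epsilon>) / R each derivative of the piece gains M powr -\<epsilon>, and N of them must beat the
  volume factor (R L)^n = M powr ((1 + \<epsilon>) n). Since M grows geometrically along the pieces,
  for either sign of \<alpha>, what remains is a convergent geometric series.\<close>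

lemma lborel_prod_coordinates:
  fixes f :: "'a::euclidean_space \<Rightarrow> real \<Rightarrow> complex"
  assumes "\<And>b. b \<in> Basis \<Longrightarrow> integrable lborel (f b)"
  shows "integrable lborel (\<lambda>x::'a. \<Prod>b\<in>Basis. f b (x \<bullet> b))" (is ?I)
    and "(LINT x|lborel. (\<Prod>b\<in>Basis. f b (x \<bullet> b))) = (\<Prod>b\<in>Basis. LINT t|lborel. f b t)" (is ?E)
proof -
  interpret product_sigma_finite "\<lambda>_::'a. lborel :: real measure" ..
  have [measurable]: "f b \<in> borel_measurable borel" if "b \<in> Basis" for b
    using assms[OF that] by auto
  have m: "(\<lambda>x::'a. \<Prod>b\<in>Basis. f b (x \<bullet> b)) \<in> borel_measurable borel"
    by (intro borel_measurable_prod) (auto intro!: measurable_compose[of _ _ borel])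
  have s: "(\<Sum>c\<in>Basis. y c *\<^sub>R c) \<bullet> b = y b" if "b \<in> Basis" for b :: 'a and y :: "'a \<Rightarrow> real"
    using that by (simp add: inner_sum_left inner_Basis if_distrib cong: if_cong)
  have t: "(\<lambda>f. \<Sum>b\<in>Basis. f b *\<^sub>R b) \<in> Pi\<^sub>M Basis (\<lambda>_::'a. lborel :: real measure) \<rightarrow>\<^sub>M borel"
    by measurable
  show ?I
    using product_integrable_prod[of Basis f] assms
    by (subst lborel_eq, subst integrable_distr_eq[OF t m]) (simp add: s)
  show ?E
    using product_integral_prod[of Basis f] assms
    by (subst lborel_eq[where 'a='a], subst integral_distr[OF t m]) (simp add: s)
qed

text \<open>This is the characteristic function of the standard normal distribution, rescaled by
  \<open>t\<close>.\<close>

lemma has_bochner_integral_cis_gauss: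
  assumes "0 < t"
  shows "has_bochner_integral lborel (\<lambda>s. cis (s * z) * exp (- (t * s)\<^sup>2 / 2))
     (complex_of_real (sqrt (2 * pi) / t * exp (- (z / t)\<^sup>2 / 2)))"
proof -
  have i: "integrable lborel (\<lambda>s. std_normal_density s *\<^sub>R cis (u * s))" for u
  proof (rule Bochner_Integration.integrable_bound)
    show "integrable lborel (\<lambda>s. std_normal_density s :: real)"
      using integrable_normal_density[of 1 0] by simp
  qed (auto simp: cis_conv_exp)
  have e: "(LINT s|lborel. std_normal_density s *\<^sub>R cis (u * s)) = complex_of_real (exp (- u\<^sup>2 / 2))" for u
    using fun_cong[OF char_std_normal_distribution, of u]
    unfolding char_def by (subst (asm) integral_density) (auto simp: cis_conv_exp)
  have "has_bochner_integral lborel (\<lambda>s. std_normal_density s *\<^sub>R cis (z / t * s)) (complex_of_real (exp (- (z / t)\<^sup>2 / 2)))"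
    using i[of "z / t"] e[of "z / t"] by (simp add: has_bochner_integral_iff)
  then have "has_bochner_integral lborel (\<lambda>s. std_normal_density (t * s) *\<^sub>R cis (z / t * (t * s))) (complex_of_real (exp (- (z / t)\<^sup>2 / 2)) /\<^sub>R \<bar>t\<bar>)"
    using lborel_has_bochner_integral_real_affine_iff[of t "\<lambda>s. std_normal_density s *\<^sub>R cis (z / t * s)" _ 0] assms by simp
  then have "has_bochner_integral lborel (\<lambda>s. complex_of_real (sqrt (2 * pi)) * (std_normal_density (t * s) *\<^sub>R cis (z / t * (t * s)))) (complex_of_real (sqrt (2 * pi)) * (complex_of_real (exp (- (z / t)\<^sup>2 / 2)) /\<^sub>R \<bar>t\<bar>))"
    by (intro has_bochner_integral_mult_right) auto
  moreover have "complex_of_real (sqrt (2 * pi)) * (std_normal_density (t * s) *\<^sub>R cis (z / t * (t * s)))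
     = cis (s * z) * exp (- (t * s)\<^sup>2 / 2)" for s
    using assms by (simp add: std_normal_density_def scaleR_conv_of_real mult.commute flip: exp_of_real)
  moreover have "complex_of_real (sqrt (2 * pi)) * (complex_of_real (exp (- (z / t)\<^sup>2 / 2)) /\<^sub>R \<bar>t\<bar>)
    = complex_of_real (sqrt (2 * pi) / t * exp (- (z / t)\<^sup>2 / 2))"
    using assms by (simp add: scaleR_conv_of_real field_simps)
  ultimately show ?thesis by simp
qed

lemma cis_sum: "finite I \<Longrightarrow> cis (\<Sum>i\<in>I. f i) = (\<Prod>i\<in>I. cis (f i))"
  by (induction I rule: finite_induct) (auto simp: cis_mult[symmetric])

definition gauss :: "real \<Rightarrow> real^'n::finite \<Rightarrow> real" where
  "gauss t x = exp (- (t * norm x)\<^sup>2 / 2)"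

text \<open>The Fourier transform of \<open>gauss t\<close>. Its mass is
  \<open>(2 * pi) ^ CARD('n)\<close> for every positive \<open>t\<close>, because the transform is
  not normalised, and it concentrates at the origin as \<open>t\<close> tends to 0.\<close>

definition gauss_kernel :: "real \<Rightarrow> real^'n::finite \<Rightarrow> real" where
  "gauss_kernel t z = (sqrt (2 * pi) / t) ^ CARD('n) * gauss (1 / t) z"

lemma gauss_prod: "gauss t x = (\<Prod>b\<in>Basis. exp (- (t * (x \<bullet> b))\<^sup>2 / 2))"
proof -
  have "(norm x)\<^sup>2 = (\<Sum>b\<in>Basis. (x \<bullet> b)\<^sup>2)"
    unfolding power2_norm_eq_inner by (subst euclidean_inner) (simp add: power2_eq_square)
  then have "- (t * norm x)\<^sup>2 / 2 = (\<Sum>b\<in>Basis. - (t * (x \<bullet> b))\<^sup>2 / 2)"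
    by (simp add: power_mult_distrib sum_distrib_left sum_divide_distrib sum_negf)
  then show ?thesis
    unfolding gauss_def by (simp only: exp_sum finite_Basis)
qed

lemma gauss_fourier:
  fixes z :: "real^'n::finite"
  assumes "0 < t"
  shows "has_bochner_integral lborel (\<lambda>\<xi>. complex_of_real (gauss t \<xi>) * cis (\<xi> \<bullet> z))
    (complex_of_real (gauss_kernel t z))"
proof -
  define f where "f b s = cis (s * (z \<bullet> b)) * exp (- (t * s)\<^sup>2 / 2)" for b s
  have g: "has_bochner_integral lborel (f b) (complex_of_real (sqrt (2 * pi) / t * exp (- ((z \<bullet> b) / t)\<^sup>2 / 2)))" for b
    unfolding f_def using has_bochner_integral_cis_gauss[OF assms, of "z \<bullet> b"] by simp
  have i: "integrable lborel (f b)" for b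
    using g has_bochner_integral_iff by blast
  have eq: "(\<Prod>b\<in>Basis. f b (\<xi> \<bullet> b)) = complex_of_real (gauss t \<xi>) * cis (\<xi> \<bullet> z)" for \<xi> :: "real^'n"
    unfolding f_def by (subst euclidean_inner[of \<xi> z])
      (simp add: prod.distrib cis_sum gauss_prod mult.commute flip: exp_of_real)
  have eq2: "(\<Prod>b\<in>Basis. LINT s|lborel. f b s) = complex_of_real (gauss_kernel t z)"
    using g by (simp add: has_bochner_integral_iff gauss_kernel_def gauss_prod prod.distrib)
       (simp add: prod.distrib prod_dividef power_divide power_mult_distrib)
  show ?thesis
    using lborel_prod_coordinates[of f, OF i] unfolding eq eq2 by (simp add: has_bochner_integral_iff)
qed

lemma gauss_integral:
  assumes "0 < t"
  shows "has_bochner_integral lborel (gauss t :: real^'n::finite \<Rightarrow> real) ((sqrt (2 * pi) / t) ^ CARD('n))"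
proof -
  have "has_bochner_integral lborel (\<lambda>\<xi>::real^'n. complex_of_real (gauss t \<xi>)) (complex_of_real ((sqrt (2 * pi) / t) ^ CARD('n)))"
    using gauss_fourier[OF assms, of 0] by (simp add: gauss_kernel_def gauss_def)
  from has_bochner_integral_bounded_linear[OF bounded_linear_Re this] show ?thesis by simp
qed

lemma gauss_kernel_integral:
  assumes "0 < t"
  shows "has_bochner_integral lborel (gauss_kernel t :: real^'n::finite \<Rightarrow> real) ((2 * pi) ^ CARD('n))"
proof -
  have "(sqrt (2 * pi) / t) ^ CARD('n) * (sqrt (2 * pi) / (1 / t)) ^ CARD('n) = (2 * pi) ^ CARD('n)"
    unfolding power_mult_distrib[symmetric] using assms by simp
  then show ?thesis
    using has_bochner_integral_mult_right[OF gauss_integral[of "1 / t", where 'n='n], of "(sqrt (2 * pi) / t) ^ CARD('n)"] gauss_integral[of "1 / t", where 'n='n] assms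
    unfolding gauss_kernel_def[abs_def] by auto
qed

section \<open>Fourier integrals of integrable functions and kernels of multipliers\<close>

lemma borel_measurable_cis [measurable (raw)]:
  "f \<in> borel_measurable M \<Longrightarrow> (\<lambda>x. cis (f x)) \<in> borel_measurable M"
  unfolding cis_conv_exp by measurable

lemma borel_measurable_cnj [measurable (raw)]:
  "f \<in> borel_measurable M \<Longrightarrow> (\<lambda>x. cnj (f x)) \<in> borel_measurable M"
  by (erule measurable_compose) (auto intro: borel_measurable_continuous_onI continuous_intros)

text \<open>For a non-integrable \<open>f\<close> the left side is 0 by convention, so the bound can
  be applied before integrability has been discussed.\<close>

lemma norm_integral_le_nn_integral:
  fixes f :: "'a \<Rightarrow> 'b::{banach, second_countable_topology}"
  shows "ennreal (norm (integral\<^sup>L M f)) \<le> (\<integral>\<^sup>+x. ennreal (norm (f x)) \<partial>M)"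
  by (cases "integrable M f") (auto simp: integral_norm_bound_ennreal not_integrable_integral_eq)

lemma fourier_borel:
  fixes f :: "real^'n::finite \<Rightarrow> complex"
  assumes [measurable]: "f \<in> borel_measurable borel"
  shows "fourier f \<xi> = (LINT x|lborel. cis (- (\<xi> \<bullet> x)) * f x)"
  unfolding fourier_def by (rule integral_completion) measurable

lemma fourier_measurable [measurable]:
  fixes f :: "real^'n::finite \<Rightarrow> complex"
  assumes [measurable]: "f \<in> borel_measurable borel"
  shows "fourier f \<in> borel_measurable borel"
proof -
  have "(\<lambda>\<xi>. LINT x|lborel. cis (- (\<xi> \<bullet> x)) * f x) \<in> borel_measurable borel"
    by (rule lborel.borel_measurable_lebesgue_integral) (unfold case_prod_beta', measurable)
  then show ?thesis
    using fourier_borel[OF assms] by (simp cong: measurable_cong)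
qed

lemma integrable_cis_mult:
  assumes "integrable M f" and [measurable]: "h \<in> borel_measurable M"
  shows "integrable M (\<lambda>x. cis (h x) * f x :: complex)"
proof (rule Bochner_Integration.integrable_bound)
  show "integrable M f" by fact
  then show "(\<lambda>x. cis (h x) * f x) \<in> borel_measurable M" by measurable
qed (simp add: norm_mult)

lemma norm_fourier_le:
  fixes f :: "real^'n::finite \<Rightarrow> complex"
  assumes "integrable lborel f"
  shows "cmod (fourier f \<xi>) \<le> (LINT x|lborel. cmod (f x))"
proof -
  have "cmod (LINT x|lborel. cis (- (\<xi> \<bullet> x)) * f x) \<le> (LINT x|lborel. cmod (cis (- (\<xi> \<bullet> x)) * f x))"
    by (rule integral_norm_bound)
  then show ?thesis
    using assms by (simp add: fourier_borel norm_mult borel_measurable_integrable[of lborel f, simplified])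
qed

lemma integrable_mult_bounded:
  fixes w v :: "'a \<Rightarrow> complex"
  assumes "integrable M w" and [measurable]: "v \<in> borel_measurable M" and "\<And>x. cmod (v x) \<le> B"
  shows "integrable M (\<lambda>x. w x * v x)"
proof (rule Bochner_Integration.integrable_bound)
  show "integrable M (\<lambda>x. of_real B * w x)" using assms(1) by simp
  show "(\<lambda>x. w x * v x) \<in> borel_measurable M" using assms(1) by measurable
  show "AE x in M. cmod (w x * v x) \<le> cmod (of_real B * w x)"
  proof (intro AE_I2)
    fix x
    have "cmod (v x) \<le> \<bar>B\<bar>" using assms(3)[of x] by linarith
    then show "cmod (w x * v x) \<le> cmod (of_real B * w x)"
      by (simp add: norm_mult mult.commute mult_right_mono)
  qed
qed

lemma fourier_swap:
  fixes u w :: "real^'n::finite \<Rightarrow> complex"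
  assumes u: "integrable lborel u" and w: "integrable lborel w"
  shows "(LINT \<xi>|lborel. w \<xi> * fourier u \<xi>) = (LINT x|lborel. u x * (LINT \<xi>|lborel. w \<xi> * cis (- (\<xi> \<bullet> x))))"
proof -
  have [measurable]: "u \<in> borel_measurable borel" "w \<in> borel_measurable borel"
    using u w by auto
  define h where "h = (\<lambda>(\<xi>, x). w \<xi> * (cis (- (\<xi> \<bullet> x)) * u x))"
  have hm[measurable]: "h \<in> borel_measurable (lborel \<Otimes>\<^sub>M lborel)"
    unfolding h_def case_prod_beta' by measurable
  have "integrable (lborel \<Otimes>\<^sub>M lborel) h"
  proof (rule lborel_pair.Fubini_integrable[OF hm])
    have "(LINT x|lborel. norm (h (\<xi>, x))) = cmod (w \<xi>) * (LINT x|lborel. cmod (u x))" for \<xi>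
      by (simp add: h_def norm_mult)
    then show "integrable lborel (\<lambda>\<xi>. LINT x|lborel. norm (h (\<xi>, x)))"
      using w by simp
    show "AE \<xi> in lborel. integrable lborel (\<lambda>x. h (\<xi>, x))"
      using integrable_cis_mult[OF u] by (intro AE_I2) (simp add: h_def)
  qed
  then have "(LINT x|lborel. LINT \<xi>|lborel. h (\<xi>, x)) = (LINT \<xi>|lborel. LINT x|lborel. h (\<xi>, x))"
    using lborel_pair.Fubini_integral[of "\<lambda>\<xi> x. h (\<xi>, x)"] by simp
  moreover have "(LINT x|lborel. h (\<xi>, x)) = w \<xi> * fourier u \<xi>" for \<xi>
    by (simp add: h_def fourier_borel)
  moreover have "(LINT \<xi>|lborel. h (\<xi>, x)) = u x * (LINT \<xi>|lborel. w \<xi> * cis (- (\<xi> \<bullet> x)))" for x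
  proof -
    have "(LINT \<xi>|lborel. h (\<xi>, x)) = (LINT \<xi>|lborel. u x * (w \<xi> * cis (- (\<xi> \<bullet> x))))"
      by (intro Bochner_Integration.integral_cong) (auto simp: h_def)
    then show ?thesis
      using integrable_cis_mult[OF w, of "\<lambda>\<xi>. - (\<xi> \<bullet> x)"] by (simp add: mult.commute)
  qed
  ultimately show ?thesis by simp
qed

text \<open>Up to the factor (2 pi)^-n this is the convolution kernel of the operator with
  multiplier \<open>w\<close>.\<close>

definition inv_kernel :: "(real^'n::finite \<Rightarrow> complex) \<Rightarrow> real^'n \<Rightarrow> complex" where
  "inv_kernel w z = (LINT \<xi>|lborel. w \<xi> * cis (\<xi> \<bullet> z))"

text \<open>The multiplication formula \<open>fourier_swap\<close>, applied to \<open>u\<close> and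
  then to \<open>g\<close>, moves both transforms onto \<open>w\<close>. With a Gaussian
  \<open>w\<close> this drives Plancherel's theorem; with a frequency piece it exposes the kernel on
  which the far estimates rest.\<close>

lemma fourier_pairing_kernel:
  fixes u g w :: "real^'n::finite \<Rightarrow> complex"
  assumes u: "integrable lborel u" and g: "integrable lborel g" and w: "integrable lborel w"
  shows "(LINT \<xi>|lborel. w \<xi> * fourier u \<xi> * cnj (fourier g \<xi>)) =
    (LINT x|lborel. u x * (LINT y|lborel. cnj (g y) * inv_kernel w (y - x)))"
proof -
  have [measurable]: "u \<in> borel_measurable borel" "g \<in> borel_measurable borel" "w \<in> borel_measurable borel"
    using u g w by auto
  have wg: "integrable lborel (\<lambda>\<xi>. w \<xi> * cnj (fourier g \<xi>))"
    by (rule integrable_mult_bounded[OF w]) (auto intro: norm_fourier_le[OF g])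
  have "(LINT \<xi>|lborel. w \<xi> * fourier u \<xi> * cnj (fourier g \<xi>)) =
    (LINT x|lborel. u x * (LINT \<xi>|lborel. (w \<xi> * cnj (fourier g \<xi>)) * cis (- (\<xi> \<bullet> x))))"
    using fourier_swap[OF u wg] by (simp add: mult_ac)
  moreover have "(LINT \<xi>|lborel. (w \<xi> * cnj (fourier g \<xi>)) * cis (- (\<xi> \<bullet> x))) =
      (LINT y|lborel. cnj (g y) * inv_kernel w (y - x))" for x
  proof -
    \<comment> \<open>The character at \<open>x\<close> and a conjugation are absorbed into the
      weight, so that the second use of the multiplication formula produces the kernel at
      \<open>y - x\<close>.\<close>
    define w' where "w' = (\<lambda>\<xi>. cnj (w \<xi>) * cis (\<xi> \<bullet> x))"
    have w': "integrable lborel w'"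
      unfolding w'_def using w by (subst mult.commute) (intro integrable_cis_mult, auto)
    have ker: "cnj (LINT \<xi>|lborel. w' \<xi> * cis (- (\<xi> \<bullet> y))) = inv_kernel w (y - x)" for y
      unfolding inv_kernel_def Bochner_Integration.integral_cnj[symmetric]
      by (intro Bochner_Integration.integral_cong) (simp_all add: w'_def cis_cnj mult.assoc cis_mult inner_diff_right)
    have "(LINT \<xi>|lborel. (w \<xi> * cnj (fourier g \<xi>)) * cis (- (\<xi> \<bullet> x))) = cnj (LINT \<xi>|lborel. w' \<xi> * fourier g \<xi>)"
      unfolding Bochner_Integration.integral_cnj[symmetric]
      by (intro Bochner_Integration.integral_cong) (simp_all add: w'_def mult_ac cis_cnj)
    also have "\<dots> = (LINT y|lborel. cnj (g y) * cnj (LINT \<xi>|lborel. w' \<xi> * cis (- (\<xi> \<bullet> y))))"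
      unfolding fourier_swap[OF g w']
      by (subst Bochner_Integration.integral_cnj[symmetric]) (simp only: complex_cnj_mult)
    finally show ?thesis unfolding ker .
  qed
  ultimately show ?thesis by simp
qed

section \<open>Gaussian regularisation, Bessel's inequality and Parseval's identity\<close>

lemma nn_integral_translation:
  fixes c :: "'a::euclidean_space"
  assumes [measurable]: "f \<in> borel_measurable borel"
  shows "(\<integral>\<^sup>+x. f (c + x) \<partial>lborel) = (\<integral>\<^sup>+x. f x \<partial>lborel)"
proof -
  have "(\<integral>\<^sup>+x. f x \<partial>lborel) = (\<integral>\<^sup>+x. f x \<partial>distr lborel borel ((+) c))"
    by (simp add: lborel_distr_plus)
  also have "\<dots> = (\<integral>\<^sup>+x. f (c + x) \<partial>lborel)"
    by (subst nn_integral_distr) auto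
  finally show ?thesis by simp
qed

lemma lborel_integral_translation:
  fixes c :: "'a::euclidean_space" and f :: "'a \<Rightarrow> 'b::{banach,second_countable_topology}"
  assumes [measurable]: "f \<in> borel_measurable borel"
  shows "(LINT x|lborel. f (c + x)) = (LINT x|lborel. f x)"
proof -
  have "(LINT x|lborel. f x) = (LINT x|distr lborel borel ((+) c). f x)"
    by (simp add: lborel_distr_plus)
  also have "\<dots> = (LINT x|lborel. f (c + x))"
    by (subst integral_distr) auto
  finally show ?thesis by simp
qed

lemma lborel_integrable_translation:
  fixes c :: "'a::euclidean_space" and f :: "'a \<Rightarrow> 'b::{banach,second_countable_topology}"
  assumes "integrable lborel f"
  shows "integrable lborel (\<lambda>x. f (c + x))"
proof -
  have "integrable (distr lborel borel ((+) c)) f"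
    using assms by (simp add: lborel_distr_plus)
  then show ?thesis
    by (subst (asm) integrable_distr_eq) (use assms in auto)
qed

lemma gauss_measurable [measurable]: "gauss t \<in> borel_measurable borel"
  unfolding gauss_def by measurable

lemma gauss_kernel_measurable [measurable]: "gauss_kernel t \<in> borel_measurable borel"
  unfolding gauss_kernel_def by measurable

lemma gauss_kernel_nonneg: "0 < t \<Longrightarrow> 0 \<le> gauss_kernel t z"
  by (simp add: gauss_kernel_def gauss_def)

lemma gauss_kernel_commute: "gauss_kernel t (x - y) = gauss_kernel t (y - x)"
  by (simp add: gauss_kernel_def gauss_def norm_minus_commute)

lemma nn_integral_gauss_kernel:
  fixes x :: "real^'n::finite"
  assumes "0 < t"
  shows "(\<integral>\<^sup>+y. ennreal (gauss_kernel t (y - x)) \<partial>lborel) = ennreal ((2 * pi) ^ CARD('n))"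
proof -
  have "(\<integral>\<^sup>+y. ennreal (gauss_kernel t (- x + y)) \<partial>lborel) = (\<integral>\<^sup>+y. ennreal (gauss_kernel t (y::real^'n)) \<partial>lborel)"
    by (rule nn_integral_translation[of "\<lambda>y. ennreal (gauss_kernel t y)"]) measurable
  also have "\<dots> = ennreal ((2 * pi) ^ CARD('n))"
    using gauss_kernel_integral[OF assms, where 'n='n] gauss_kernel_nonneg[OF assms]
    by (subst nn_integral_eq_integral) (auto simp: has_bochner_integral_iff)
  finally show ?thesis by simp
qed

lemma inv_kernel_gauss: "0 < t \<Longrightarrow> inv_kernel (\<lambda>\<xi>. complex_of_real (gauss t \<xi>)) z = gauss_kernel t z"
  using gauss_fourier[of t z] by (simp add: inv_kernel_def has_bochner_integral_iff)

lemma integrable_gauss: "0 < t \<Longrightarrow> integrable lborel (\<lambda>\<xi>::real^'n::finite. complex_of_real (gauss t \<xi>))"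
  using gauss_integral[of t, where 'n='n] by (auto simp: has_bochner_integral_iff)

lemma gauss_tendsto_1: "(\<lambda>k. gauss (1 / real (Suc k)) x) \<longlonglongrightarrow> 1"
proof -
  have "(\<lambda>k. exp (- (1 / real (Suc k) * norm x)\<^sup>2 / 2)) \<longlonglongrightarrow> exp (- (0 * norm x)\<^sup>2 / 2)"
    by (intro tendsto_intros LIMSEQ_Suc lim_1_over_n) auto
  then show ?thesis by (simp add: gauss_def)
qed

text \<open>With a Gaussian weight the left side becomes a double integral against the positive
  kernel \<open>gauss_kernel t (y - x)\<close>, whose mass in each variable is (2 pi)^n. The
  inequality 2 a b <= a^2 + b^2 then bounds it as in Schur's test, uniformly in \<open>t\<close>,
  and Fatou's lemma removes the weight.\<close>

lemma bessel_inequality: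
  fixes u :: "real^'n::finite \<Rightarrow> complex"
  assumes u: "integrable lborel u"
  shows "(\<integral>\<^sup>+\<xi>. ennreal ((cmod (fourier u \<xi>))\<^sup>2) \<partial>lborel)
    \<le> ennreal ((2 * pi) ^ CARD('n)) * (\<integral>\<^sup>+x. ennreal ((cmod (u x))\<^sup>2) \<partial>lborel)" (is "_ \<le> ?c * ?U")
proof -
  have [measurable]: "u \<in> borel_measurable borel" using u by auto
  have *: "(\<integral>\<^sup>+\<xi>. ennreal (gauss t \<xi> * (cmod (fourier u \<xi>))\<^sup>2) \<partial>lborel) \<le> ?c * ?U" if t: "0 < t" for t
  proof -
    have g0: "0 \<le> gauss t \<xi>" for \<xi> :: "real^'n" by (simp add: gauss_def)
    have i: "integrable lborel (\<lambda>\<xi>. complex_of_real (gauss t \<xi>) * fourier u \<xi> * cnj (fourier u \<xi>))"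
      by (intro integrable_mult_bounded[OF integrable_mult_bounded[OF integrable_gauss[OF t]]])
         (auto intro: norm_fourier_le[OF u])
    have eq: "complex_of_real (gauss t \<xi>) * fourier u \<xi> * cnj (fourier u \<xi>) = of_real (gauss t \<xi> * (cmod (fourier u \<xi>))\<^sup>2)" for \<xi>
      by (simp only: mult.assoc complex_norm_square[symmetric] of_real_mult)
    have "(\<integral>\<^sup>+\<xi>. ennreal (gauss t \<xi> * (cmod (fourier u \<xi>))\<^sup>2) \<partial>lborel)
       = ennreal (LINT \<xi>|lborel. gauss t \<xi> * (cmod (fourier u \<xi>))\<^sup>2)"
      using i unfolding eq complex_of_real_integrable_eq by (intro nn_integral_eq_integral) (auto simp: g0)
    also have "\<dots> = ennreal (cmod (LINT \<xi>|lborel. complex_of_real (gauss t \<xi>) * fourier u \<xi> * cnj (fourier u \<xi>)))"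
      unfolding eq integral_complex_of_real by (auto simp: g0 integral_nonneg_AE)
    also have "\<dots> = ennreal (cmod (LINT x|lborel. u x * (LINT y|lborel. cnj (u y) * gauss_kernel t (y - x))))"
      by (subst fourier_pairing_kernel[OF u u integrable_gauss[OF t]]) (simp add: inv_kernel_gauss[OF t])
    also have "\<dots> \<le> (\<integral>\<^sup>+x. ennreal (cmod (u x * (LINT y|lborel. cnj (u y) * gauss_kernel t (y - x)))) \<partial>lborel)"
      by (rule norm_integral_le_nn_integral)
    also have "\<dots> \<le> (\<integral>\<^sup>+x. (\<integral>\<^sup>+y. ennreal ((cmod (u x))\<^sup>2 / 2) * ennreal (gauss_kernel t (y - x)) +
           ennreal ((cmod (u y))\<^sup>2 / 2) * ennreal (gauss_kernel t (y - x)) \<partial>lborel) \<partial>lborel)"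
    proof (rule nn_integral_mono)
      fix x
      have "ennreal (cmod (u x * (LINT y|lborel. cnj (u y) * gauss_kernel t (y - x))))
        = ennreal (cmod (u x)) * ennreal (cmod (LINT y|lborel. cnj (u y) * gauss_kernel t (y - x)))"
        by (simp add: norm_mult ennreal_mult)
      also have "\<dots> \<le> ennreal (cmod (u x)) * (\<integral>\<^sup>+y. ennreal (cmod (cnj (u y) * gauss_kernel t (y - x))) \<partial>lborel)"
        by (intro mult_left_mono norm_integral_le_nn_integral) auto
      also have "\<dots> = (\<integral>\<^sup>+y. ennreal (cmod (u x)) * ennreal (cmod (cnj (u y) * gauss_kernel t (y - x))) \<partial>lborel)"
        by (rule nn_integral_cmult[symmetric]) measurable
      also have "\<dots> \<le> (\<integral>\<^sup>+y. ennreal ((cmod (u x))\<^sup>2 / 2) * ennreal (gauss_kernel t (y - x)) +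
           ennreal ((cmod (u y))\<^sup>2 / 2) * ennreal (gauss_kernel t (y - x)) \<partial>lborel)"
      proof (rule nn_integral_mono)
        fix y
        have "cmod (u x) * (cmod (u y) * gauss_kernel t (y - x)) \<le>
          (cmod (u x))\<^sup>2 / 2 * gauss_kernel t (y - x) + (cmod (u y))\<^sup>2 / 2 * gauss_kernel t (y - x)"
          using mult_right_mono[OF sum_squares_bound[of "cmod (u x)" "cmod (u y)"] gauss_kernel_nonneg[OF t, of "y - x"]]
          by (simp add: algebra_simps)
        then show "ennreal (cmod (u x)) * ennreal (cmod (cnj (u y) * gauss_kernel t (y - x))) \<le>
          ennreal ((cmod (u x))\<^sup>2 / 2) * ennreal (gauss_kernel t (y - x)) + ennreal ((cmod (u y))\<^sup>2 / 2) * ennreal (gauss_kernel t (y - x))"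
          using gauss_kernel_nonneg[OF t, of "y - x"]
          by (simp add: norm_mult ennreal_mult[symmetric] ennreal_plus[symmetric] del: ennreal_plus)
      qed
      finally show "ennreal (cmod (u x * (LINT y|lborel. cnj (u y) * gauss_kernel t (y - x)))) \<le> \<dots>" .
    qed
    also have "\<dots> = (\<integral>\<^sup>+x. (\<integral>\<^sup>+y. ennreal ((cmod (u x))\<^sup>2 / 2) * ennreal (gauss_kernel t (y - x)) \<partial>lborel) \<partial>lborel) +
       (\<integral>\<^sup>+x. (\<integral>\<^sup>+y. ennreal ((cmod (u y))\<^sup>2 / 2) * ennreal (gauss_kernel t (y - x)) \<partial>lborel) \<partial>lborel)"
      by (simp add: nn_integral_add)
    also have "(\<integral>\<^sup>+x. (\<integral>\<^sup>+y. ennreal ((cmod (u y))\<^sup>2 / 2) * ennreal (gauss_kernel t (y - x)) \<partial>lborel) \<partial>lborel) =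
      (\<integral>\<^sup>+y. (\<integral>\<^sup>+x. ennreal ((cmod (u y))\<^sup>2 / 2) * ennreal (gauss_kernel t (x - y)) \<partial>lborel) \<partial>lborel)"
      by (subst lborel_pair.Fubini') (simp_all add: gauss_kernel_commute[of t] case_prod_beta')
    also have "(\<integral>\<^sup>+x. (\<integral>\<^sup>+y. ennreal ((cmod (u x))\<^sup>2 / 2) * ennreal (gauss_kernel t (y - x)) \<partial>lborel) \<partial>lborel)
       = (\<integral>\<^sup>+x. ennreal ((cmod (u x))\<^sup>2 / 2) * ?c \<partial>lborel)"
      by (simp add: nn_integral_cmult nn_integral_gauss_kernel[OF t])
    also have "\<dots> + \<dots> = (\<integral>\<^sup>+x. ?c * ennreal ((cmod (u x))\<^sup>2) \<partial>lborel)"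
      by (subst nn_integral_add[symmetric]) (auto intro!: nn_integral_cong simp: ennreal_mult''[symmetric] ennreal_plus[symmetric] mult.commute simp del: ennreal_plus)
    also have "\<dots> = ?c * ?U" by (rule nn_integral_cmult) measurable
    finally show ?thesis .
  qed
  have "(\<integral>\<^sup>+\<xi>. ennreal ((cmod (fourier u \<xi>))\<^sup>2) \<partial>lborel) =
     (\<integral>\<^sup>+\<xi>. liminf (\<lambda>k. ennreal (gauss (1 / real (Suc k)) \<xi> * (cmod (fourier u \<xi>))\<^sup>2)) \<partial>lborel)"
  proof (rule nn_integral_cong)
    fix \<xi> :: "real^'n"
    have "(\<lambda>k. ennreal (gauss (1 / real (Suc k)) \<xi> * (cmod (fourier u \<xi>))\<^sup>2)) \<longlonglongrightarrow> ennreal (1 * (cmod (fourier u \<xi>))\<^sup>2)"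
      by (intro tendsto_ennrealI tendsto_mult gauss_tendsto_1 tendsto_const)
    from lim_imp_Liminf[OF _ this] show "ennreal ((cmod (fourier u \<xi>))\<^sup>2) = liminf (\<lambda>k. ennreal (gauss (1 / real (Suc k)) \<xi> * (cmod (fourier u \<xi>))\<^sup>2))"
      by simp
  qed
  also have "\<dots> \<le> liminf (\<lambda>k. \<integral>\<^sup>+\<xi>. ennreal (gauss (1 / real (Suc k)) \<xi> * (cmod (fourier u \<xi>))\<^sup>2) \<partial>lborel)"
    by (rule nn_integral_liminf) measurable
  also have "\<dots> \<le> ?c * ?U"
    by (intro Liminf_le always_eventually allI *) auto
  finally show ?thesis .
qed

lemma Cauchy_Schwarz_complex:
  fixes a b :: "'a \<Rightarrow> complex"
  assumes [measurable]: "a \<in> borel_measurable M" "b \<in> borel_measurable M"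
  shows "(\<integral>\<^sup>+x. ennreal (cmod (a x * b x)) \<partial>M)\<^sup>2
     \<le> (\<integral>\<^sup>+x. ennreal ((cmod (a x))\<^sup>2) \<partial>M) * (\<integral>\<^sup>+x. ennreal ((cmod (b x))\<^sup>2) \<partial>M)"
  using Cauchy_Schwarz_nn_integral[of "\<lambda>x. ennreal (cmod (a x))" M "\<lambda>x. ennreal (cmod (b x))"]
  by (simp add: ennreal_mult[symmetric] norm_mult ennreal_power)

lemma integrable_mult_L2:
  fixes a b :: "'a \<Rightarrow> complex"
  assumes [measurable]: "a \<in> borel_measurable M" "b \<in> borel_measurable M"
    and a: "(\<integral>\<^sup>+x. ennreal ((cmod (a x))\<^sup>2) \<partial>M) < \<infinity>" and b: "(\<integral>\<^sup>+x. ennreal ((cmod (b x))\<^sup>2) \<partial>M) < \<infinity>"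
  shows "integrable M (\<lambda>x. a x * b x)"
proof (rule integrableI_bounded)
  have "(\<integral>\<^sup>+x. ennreal (cmod (a x * b x)) \<partial>M)\<^sup>2 < \<infinity>"
    using order.strict_trans1[OF Cauchy_Schwarz_complex[of a M b]] a b by (simp add: ennreal_mult_less_top)
  then show "(\<integral>\<^sup>+x. ennreal (cmod (a x * b x)) \<partial>M) < \<infinity>"
    by (simp add: power_less_top_ennreal)
qed measurable

text \<open>Cauchy-Schwarz gives continuity in one L^2 argument. The measure is a parameter because
  the lemma serves both \<open>lebesgue\<close>, where \<open>T f\<close> lives, and
  \<open>lborel\<close>.\<close>

lemma pairing_tendsto:
  fixes a b :: "'a \<Rightarrow> complex"
  assumes [measurable]: "a \<in> borel_measurable M" "b \<in> borel_measurable M" "\<And>k. c k \<in> borel_measurable M"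
    and a: "(\<integral>\<^sup>+x. ennreal ((cmod (a x))\<^sup>2) \<partial>M) < \<infinity>" and b: "(\<integral>\<^sup>+x. ennreal ((cmod (b x))\<^sup>2) \<partial>M) < \<infinity>"
    and c: "\<And>k. (\<integral>\<^sup>+x. ennreal ((cmod (c k x))\<^sup>2) \<partial>M) < \<infinity>"
    and lim: "(\<lambda>k. \<integral>\<^sup>+x. ennreal ((cmod (c k x - b x))\<^sup>2) \<partial>M) \<longlonglongrightarrow> 0"
  shows "(\<lambda>k. LINT x|M. c k x * a x) \<longlonglongrightarrow> (LINT x|M. b x * a x)"
proof -
  let ?A = "\<integral>\<^sup>+x. ennreal ((cmod (a x))\<^sup>2) \<partial>M"
  let ?d = "\<lambda>k. cmod ((LINT x|M. c k x * a x) - (LINT x|M. b x * a x))"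
  have le: "ennreal ((?d k)\<^sup>2) \<le> ?A * (\<integral>\<^sup>+x. ennreal ((cmod (c k x - b x))\<^sup>2) \<partial>M)" for k
  proof -
    have "(LINT x|M. c k x * a x) - (LINT x|M. b x * a x) = (LINT x|M. a x * (c k x - b x))"
      by (subst Bochner_Integration.integral_diff[symmetric])
        (auto intro!: integrable_mult_L2 a b c simp: algebra_simps)
    then have "ennreal (?d k) \<le> (\<integral>\<^sup>+x. ennreal (cmod (a x * (c k x - b x))) \<partial>M)"
      using norm_integral_le_nn_integral[of M "\<lambda>x. a x * (c k x - b x)"] by simp
    then have "(ennreal (?d k))\<^sup>2 \<le> (\<integral>\<^sup>+x. ennreal (cmod (a x * (c k x - b x))) \<partial>M)\<^sup>2"
      by (intro power_mono) auto
    also have "\<dots> \<le> ?A * (\<integral>\<^sup>+x. ennreal ((cmod (c k x - b x))\<^sup>2) \<partial>M)"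
      by (rule Cauchy_Schwarz_complex) measurable
    finally show ?thesis by (simp add: ennreal_power)
  qed
  have up: "(\<lambda>k. ?A * (\<integral>\<^sup>+x. ennreal ((cmod (c k x - b x))\<^sup>2) \<partial>M)) \<longlonglongrightarrow> 0"
    using ennreal_tendsto_cmult[OF _ lim, of ?A] a by simp
  have "(\<lambda>k. ennreal ((?d k)\<^sup>2)) \<longlonglongrightarrow> 0"
  proof (rule tendsto_sandwich[OF _ _ tendsto_const up])
    show "\<forall>\<^sub>F k in sequentially. ennreal ((?d k)\<^sup>2) \<le> ?A * (\<integral>\<^sup>+x. ennreal ((cmod (c k x - b x))\<^sup>2) \<partial>M)"
      using le by (rule always_eventually[OF allI])
  qed simp
  then have "(\<lambda>k. (?d k)\<^sup>2) \<longlonglongrightarrow> 0"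
    using tendsto_ennreal_iff[of "\<lambda>k. (?d k)\<^sup>2" sequentially 0] by simp
  then have "(\<lambda>k. sqrt ((?d k)\<^sup>2)) \<longlonglongrightarrow> sqrt 0"
    by (rule tendsto_real_sqrt)
  then have "?d \<longlonglongrightarrow> 0" by simp
  then show ?thesis using LIM_zero_cancel tendsto_norm_zero_iff by blast
qed

lemma lborel_integral_scaling:
  fixes f :: "'a::euclidean_space \<Rightarrow> 'b::{banach,second_countable_topology}"
  assumes [measurable]: "f \<in> borel_measurable borel" and "0 < t"
  shows "(LINT x|lborel. f x) = (LINT x|lborel. t ^ DIM('a) *\<^sub>R f (t *\<^sub>R x))"
proof -
  have "(LINT x|lborel. f x) = (LINT x|density (distr lborel borel (\<lambda>x. 0 + t *\<^sub>R x)) (\<lambda>_. \<bar>t\<bar>^DIM('a)). f x)"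
    using lborel_affine[of t "0::'a"] assms(2) by simp
  also have "\<dots> = (LINT x|distr lborel borel (\<lambda>x. t *\<^sub>R x). (\<bar>t\<bar>^DIM('a)) *\<^sub>R f x)"
    by (subst integral_density) auto
  also have "\<dots> = (LINT x|lborel. t ^ DIM('a) *\<^sub>R f (t *\<^sub>R x))"
    using assms(2) by (subst integral_distr) auto
  finally show ?thesis .
qed

text \<open>Substituting x + t y moves the scale from the Gaussian into the argument of
  \<open>h\<close>; then one fixed integrable Gaussian dominates all terms.\<close>

lemma gauss_approximate_identity:
  fixes h :: "real^'n::finite \<Rightarrow> complex"
  assumes h: "continuous_on UNIV h" and B: "\<And>x. cmod (h x) \<le> B"
  shows "(\<lambda>k. LINT y|lborel. h y * gauss_kernel (1 / real (Suc k)) (y - x)) \<longlonglongrightarrow> (2 * pi) ^ CARD('n) * h x"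
proof -
  have [measurable]: "h \<in> borel_measurable borel" by (rule borel_measurable_continuous_onI) fact
  let ?c = "complex_of_real (sqrt (2 * pi) ^ CARD('n))"
  have eq: "(LINT y|lborel. h y * gauss_kernel t (y - x)) = (LINT y|lborel. ?c * (complex_of_real (gauss 1 y) * h (x + t *\<^sub>R y)))"
    if t: "0 < t" for t
  proof -
    have "(LINT y|lborel. h y * gauss_kernel t (y - x)) = (LINT y|lborel. h (x + y) * gauss_kernel t y)"
      using lborel_integral_translation[of "\<lambda>y. h y * gauss_kernel t (y - x)" x] by simp
    also have "\<dots> = (LINT y|lborel. t ^ DIM(real^'n) *\<^sub>R (h (x + t *\<^sub>R y) * gauss_kernel t (t *\<^sub>R y)))"
      by (rule lborel_integral_scaling) (use t in measurable)
    also have "\<dots> = (LINT y|lborel. ?c * (complex_of_real (gauss 1 y) * h (x + t *\<^sub>R y)))"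
      using t by (intro Bochner_Integration.integral_cong)
        (simp_all add: gauss_kernel_def gauss_def scaleR_conv_of_real[of _ "_ :: complex"] power_divide)
    finally show ?thesis .
  qed
  have "(\<lambda>k. LINT y|lborel. ?c * (complex_of_real (gauss 1 y) * h (x + (1 / real (Suc k)) *\<^sub>R y)))
    \<longlonglongrightarrow> (LINT y|lborel. ?c * (complex_of_real (gauss 1 y) * h (x + 0 *\<^sub>R y)))"
  proof (rule integral_dominated_convergence[where w = "\<lambda>y. cmod ?c * (gauss 1 y * B)"])
    show "integrable lborel (\<lambda>y::real^'n. cmod ?c * (gauss 1 y * B))"
      using gauss_integral[of 1, where 'n='n] by (auto simp: has_bochner_integral_iff)
    show "AE y in lborel. (\<lambda>k. ?c * (complex_of_real (gauss 1 y) * h (x + (1 / real (Suc k)) *\<^sub>R y)))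
       \<longlonglongrightarrow> ?c * (complex_of_real (gauss 1 y) * h (x + 0 *\<^sub>R y))"
    proof (intro AE_I2 tendsto_mult tendsto_const)
      fix y
      have "isCont h (x + 0 *\<^sub>R y)" using h by (simp add: continuous_on_eq_continuous_at)
      then show "(\<lambda>k. h (x + (1 / real (Suc k)) *\<^sub>R y)) \<longlonglongrightarrow> h (x + 0 *\<^sub>R y)"
        by (rule isCont_tendsto_compose) (intro tendsto_intros LIMSEQ_Suc lim_1_over_n)
    qed
    show "AE y in lborel. cmod (?c * (complex_of_real (gauss 1 y) * h (x + (1 / real (Suc k)) *\<^sub>R y)))
       \<le> cmod ?c * (gauss 1 y * B)" for k
      by (intro AE_I2) (simp add: norm_mult gauss_def mult_left_mono B)
  qed measurable
  also have "(LINT y|lborel. ?c * (complex_of_real (gauss 1 y) * h (x + 0 *\<^sub>R y))) = (2 * pi) ^ CARD('n) * h x"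
  proof -
    have "(LINT y|lborel. complex_of_real (gauss 1 (y::real^'n))) = ?c"
      using gauss_integral[of 1, where 'n='n] by (simp add: has_bochner_integral_iff)
    moreover have "sqrt (2 * pi) ^ CARD('n) * sqrt (2 * pi) ^ CARD('n) = (2 * pi) ^ CARD('n)"
      unfolding power_mult_distrib[symmetric] by simp
    then have "?c * ?c = (2 * pi) ^ CARD('n)"
      by (metis of_real_mult of_real_numeral of_real_power)
    moreover have "(LINT y|lborel. ?c * (complex_of_real (gauss 1 y) * h (x + 0 *\<^sub>R y))) = ?c * ((LINT y|lborel. complex_of_real (gauss 1 (y::real^'n))) * h x)"
      by simp
    ultimately show ?thesis by (metis mult.assoc)
  qed
  finally show ?thesis by (simp add: eq)
qed

text \<open>The Gaussian-weighted pairing is evaluated in two ways. On the frequency side the weight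
  tends to 1; on the space side the kernel is an approximate identity, which converges at every
  point because \<open>g\<close> is continuous and bounded.\<close>

lemma parseval_continuous:
  fixes u g :: "real^'n::finite \<Rightarrow> complex"
  assumes u: "integrable lborel u" and u2: "(\<integral>\<^sup>+x. ennreal ((cmod (u x))\<^sup>2) \<partial>lborel) < \<infinity>"
    and g: "integrable lborel g" and g2: "(\<integral>\<^sup>+x. ennreal ((cmod (g x))\<^sup>2) \<partial>lborel) < \<infinity>"
    and cont: "continuous_on UNIV g" and B: "\<And>x. cmod (g x) \<le> B"
  shows "(LINT \<xi>|lborel. fourier u \<xi> * cnj (fourier g \<xi>)) = (2 * pi) ^ CARD('n) * (LINT x|lborel. u x * cnj (g x))"
proof -
  let ?t = "\<lambda>k. 1 / real (Suc k)"
  have [measurable]: "u \<in> borel_measurable borel" "g \<in> borel_measurable borel" using u g by auto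
  have f2: "(\<integral>\<^sup>+x. ennreal ((cmod (fourier v x))\<^sup>2) \<partial>lborel) < \<infinity>"
    if "integrable lborel v" "(\<integral>\<^sup>+x. ennreal ((cmod (v x))\<^sup>2) \<partial>lborel) < \<infinity>" for v :: "real^'n \<Rightarrow> complex"
    by (rule order.strict_trans1[OF bessel_inequality[OF that(1)]]) (use that in \<open>simp add: ennreal_mult_less_top\<close>)
  have "integrable lborel (\<lambda>\<xi>. fourier u \<xi> * cnj (fourier g \<xi>))"
    by (rule integrable_mult_L2) (use f2[OF u u2] f2[OF g g2] in auto)
  then have 1: "(\<lambda>k. LINT \<xi>|lborel. complex_of_real (gauss (?t k) \<xi>) * fourier u \<xi> * cnj (fourier g \<xi>))
    \<longlonglongrightarrow> (LINT \<xi>|lborel. fourier u \<xi> * cnj (fourier g \<xi>))"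
  proof (intro integral_dominated_convergence[where w = "\<lambda>\<xi>. cmod (fourier u \<xi> * cnj (fourier g \<xi>))"])
    have "(\<lambda>k. complex_of_real (gauss (?t k) \<xi>) * fourier u \<xi> * cnj (fourier g \<xi>)) \<longlonglongrightarrow> complex_of_real 1 * fourier u \<xi> * cnj (fourier g \<xi>)" for \<xi>
      by (intro tendsto_mult tendsto_of_real gauss_tendsto_1 tendsto_const)
    then show "AE \<xi> in lborel. (\<lambda>k. complex_of_real (gauss (?t k) \<xi>) * fourier u \<xi> * cnj (fourier g \<xi>)) \<longlonglongrightarrow> fourier u \<xi> * cnj (fourier g \<xi>)"
      by simp
    have "gauss (?t k) \<xi> \<le> 1" "0 \<le> gauss (?t k) \<xi>" for k and \<xi> :: "real^'n" by (auto simp: gauss_def)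
    then show "AE \<xi> in lborel. cmod (complex_of_real (gauss (?t k) \<xi>) * fourier u \<xi> * cnj (fourier g \<xi>)) \<le> cmod (fourier u \<xi> * cnj (fourier g \<xi>))" for k
      by (intro AE_I2) (simp add: norm_mult mult.assoc mult_left_le_one_le)
  qed auto
  have eq: "(LINT \<xi>|lborel. complex_of_real (gauss (?t k) \<xi>) * fourier u \<xi> * cnj (fourier g \<xi>)) =
     (LINT x|lborel. u x * (LINT y|lborel. cnj (g y) * gauss_kernel (?t k) (y - x)))" for k
    by (subst fourier_pairing_kernel[OF u g integrable_gauss]) (auto simp: inv_kernel_gauss)
  have "(\<lambda>k. LINT x|lborel. u x * (LINT y|lborel. cnj (g y) * gauss_kernel (?t k) (y - x)))
    \<longlonglongrightarrow> (LINT x|lborel. u x * ((2 * pi) ^ CARD('n) * cnj (g x)))"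
  proof (rule integral_dominated_convergence[where w = "\<lambda>x. cmod (u x) * (B * (2 * pi) ^ CARD('n))"])
    show "integrable lborel (\<lambda>x. cmod (u x) * (B * (2 * pi) ^ CARD('n)))" using u by simp
    have "continuous_on UNIV (\<lambda>x. cnj (g x))" using cont by (intro continuous_intros) auto
    then show "AE x in lborel. (\<lambda>k. u x * (LINT y|lborel. cnj (g y) * gauss_kernel (?t k) (y - x)))
      \<longlonglongrightarrow> u x * ((2 * pi) ^ CARD('n) * cnj (g x))"
      using B by (intro AE_I2 tendsto_mult tendsto_const gauss_approximate_identity) auto
    show "AE x in lborel. cmod (u x * (LINT y|lborel. cnj (g y) * gauss_kernel (?t k) (y - x)))
       \<le> cmod (u x) * (B * (2 * pi) ^ CARD('n))" for k
    proof (intro AE_I2)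
      fix x
      have t: "0 < ?t k" by simp
      have B0: "0 \<le> B" using B[of 0] norm_ge_zero[of "g 0"] by linarith
      have "ennreal (cmod (LINT y|lborel. cnj (g y) * gauss_kernel (?t k) (y - x))) \<le>
         (\<integral>\<^sup>+y. ennreal (cmod (cnj (g y) * gauss_kernel (?t k) (y - x))) \<partial>lborel)"
        by (rule norm_integral_le_nn_integral)
      also have "\<dots> \<le> (\<integral>\<^sup>+y. ennreal B * ennreal (gauss_kernel (?t k) (y - x)) \<partial>lborel)"
        using B B0
        by (intro nn_integral_mono)
          (simp add: norm_mult ennreal_mult[symmetric] mult_right_mono ennreal_leI gauss_kernel_nonneg[OF t] del: of_nat_Suc)
      also have "\<dots> = ennreal (B * (2 * pi) ^ CARD('n))"
        using B0 by (simp add: nn_integral_cmult nn_integral_gauss_kernel[OF t] ennreal_mult[symmetric] del: of_nat_Suc)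
      finally have "cmod (LINT y|lborel. cnj (g y) * gauss_kernel (?t k) (y - x)) \<le> B * (2 * pi) ^ CARD('n)"
        using B0 by (subst (asm) ennreal_le_iff) auto
      then show "cmod (u x * (LINT y|lborel. cnj (g y) * gauss_kernel (?t k) (y - x))) \<le> cmod (u x) * (B * (2 * pi) ^ CARD('n))"
        by (simp add: norm_mult mult_left_mono)
    qed
    show "(\<lambda>x. u x * (LINT y|lborel. cnj (g y) * gauss_kernel (?t k) (y - x))) \<in> borel_measurable lborel" for k
    proof -
      have "(\<lambda>x. LINT y|lborel. cnj (g y) * gauss_kernel (?t k) (y - x)) \<in> borel_measurable lborel"
        by (rule lborel.borel_measurable_lebesgue_integral) (unfold case_prod_beta', measurable)
      then show ?thesis by measurable
    qed
  qed measurable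
  from LIMSEQ_unique[OF 1[unfolded eq] this] show ?thesis
    unfolding mult.left_commute[of "u _"] by simp
qed

text \<open>The Borel counterpart of \<open>bounded_compact_support\<close>. Fubini arguments take
  place over products of \<open>lborel\<close>, so the functions of the statement are replaced by
  almost everywhere equal representatives of this kind.\<close>

definition borel_bounded_compact :: "(real^'n::finite \<Rightarrow> complex) \<Rightarrow> bool" where
  "borel_bounded_compact f \<longleftrightarrow> f \<in> borel_measurable borel \<and>
     (\<exists>B. \<forall>x. cmod (f x) \<le> B) \<and> (\<exists>\<rho>. \<forall>x. norm x > \<rho> \<longrightarrow> f x = 0)"

lemma borel_bounded_compactE:
  assumes "borel_bounded_compact f"
  obtains B \<rho> where "f \<in> borel_measurable borel" "0 < B" "\<And>x. cmod (f x) \<le> B" "0 < \<rho>" "\<And>x. norm x > \<rho> \<Longrightarrow> f x = 0"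
proof -
  obtain B \<rho> where *: "\<And>x. cmod (f x) \<le> B" "\<And>x. norm x > \<rho> \<Longrightarrow> f x = 0"
    using assms by (auto simp: borel_bounded_compact_def)
  show ?thesis
    by (rule that[of "max B 1" "max \<rho> 1"]) (use assms * in \<open>auto simp: borel_bounded_compact_def le_max_iff_disj\<close>)
qed

lemma integrable_indicator_cball: "integrable lborel (\<lambda>x::'a::euclidean_space. indicator (cball 0 \<rho>) x * (c::real))"
  using emeasure_bounded_finite[OF bounded_cball, of "0::'a" \<rho>]
  by (intro integrable_mult_left integrable_real_indicator) (auto simp: less_top)

lemma borel_bounded_compact_integrable:
  assumes "borel_bounded_compact f"
  shows "integrable lborel f"
proof -
  obtain B \<rho> where *: "f \<in> borel_measurable borel" "0 < B" "\<And>x. cmod (f x) \<le> B" "\<And>x. norm x > \<rho> \<Longrightarrow> f x = 0"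
    using borel_bounded_compactE[OF assms] by metis
  show ?thesis
    by (rule Bochner_Integration.integrable_bound[OF integrable_indicator_cball[of \<rho> B]])
      (use * in \<open>auto simp: indicator_def not_le\<close>)
qed

lemma borel_bounded_compact_L2:
  assumes "borel_bounded_compact f"
  shows "(\<integral>\<^sup>+x. ennreal ((cmod (f x))\<^sup>2) \<partial>lborel) < \<infinity>"
proof -
  obtain B \<rho> where *: "f \<in> borel_measurable borel" "0 < B" "\<And>x. cmod (f x) \<le> B" "\<And>x. norm x > \<rho> \<Longrightarrow> f x = 0"
    using borel_bounded_compactE[OF assms] by metis
  have "(\<integral>\<^sup>+x. ennreal ((cmod (f x))\<^sup>2) \<partial>lborel) \<le> (\<integral>\<^sup>+x. ennreal (B * cmod (f x)) \<partial>lborel)"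
    using * by (intro nn_integral_mono ennreal_leI) (simp add: power2_eq_square mult_right_mono)
  also have "\<dots> < \<infinity>"
    using borel_bounded_compact_integrable[OF assms] *(2)
    by (subst ennreal_mult) (auto simp: nn_integral_cmult integrable_iff_bounded ennreal_mult_less_top)
  finally show ?thesis .
qed

lemma fourier_L2_finite:
  fixes v :: "real^'n::finite \<Rightarrow> complex"
  assumes "integrable lborel v" "(\<integral>\<^sup>+x. ennreal ((cmod (v x))\<^sup>2) \<partial>lborel) < \<infinity>"
  shows "(\<integral>\<^sup>+x. ennreal ((cmod (fourier v x))\<^sup>2) \<partial>lborel) < \<infinity>"
  by (rule order.strict_trans1[OF bessel_inequality[OF assms(1)]]) (use assms in \<open>simp add: ennreal_mult_less_top\<close>)

lemma fourier_diff:
  fixes u v :: "real^'n::finite \<Rightarrow> complex"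
  assumes "integrable lborel u" "integrable lborel v"
  shows "fourier (\<lambda>x. u x - v x) \<xi> = fourier u \<xi> - fourier v \<xi>"
proof -
  have [measurable]: "u \<in> borel_measurable borel" "v \<in> borel_measurable borel" using assms by auto
  have "fourier (\<lambda>x. u x - v x) \<xi> = (LINT x|lborel. cis (- (\<xi> \<bullet> x)) * u x - cis (- (\<xi> \<bullet> x)) * v x)"
    by (subst fourier_borel) (auto simp: right_diff_distrib)
  also have "\<dots> = fourier u \<xi> - fourier v \<xi>"
    by (subst Bochner_Integration.integral_diff) (auto intro!: integrable_cis_mult assms simp: fourier_borel)
  finally show ?thesis .
qed

text \<open>Measurability supplies continuous functions that converge almost everywhere. Composing
  with the retraction \<open>tr\<close> onto the disc of radius \<open>B\<close> and multiplying by
  the spatial cutoff \<open>cut\<close> bounds them uniformly on a common ball and leaves the limit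
  unchanged, so dominated convergence applies.\<close>

lemma continuous_approximation:
  fixes g :: "real^'n::finite \<Rightarrow> complex"
  assumes g: "borel_bounded_compact g"
  obtains h where "\<And>k::nat. continuous_on UNIV (h k)" "\<And>k. borel_bounded_compact (h k)"
    "(\<lambda>k. \<integral>\<^sup>+x. ennreal ((cmod (h k x - g x))\<^sup>2) \<partial>lborel) \<longlonglongrightarrow> 0"
proof -
  obtain B \<rho> where [measurable]: "g \<in> borel_measurable borel" and B: "0 < B" "\<And>x. cmod (g x) \<le> B"
    and \<rho>: "0 < \<rho>" "\<And>x. norm x > \<rho> \<Longrightarrow> g x = 0"
    using borel_bounded_compactE[OF g] by metis
  have "g measurable_on UNIV"
    by (rule lebesgue_measurable_imp_measurable_on) (auto intro: measurable_completion)
  then obtain N G where N: "negligible N" and G: "\<And>k. continuous_on UNIV (G k)"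
    and lim: "\<And>x. x \<notin> N \<Longrightarrow> (\<lambda>k. G k x) \<longlonglongrightarrow> g x"
    unfolding measurable_on_def by auto
  define tr where "tr z = (B / max B (cmod z)) *\<^sub>R z" for z
  define cut :: "real^'n \<Rightarrow> real" where "cut x = max 0 (min 1 (\<rho> + 1 - norm x))" for x
  define h where "h k x = cut x *\<^sub>R tr (G k x)" for k x
  have tr: "continuous_on UNIV tr" unfolding tr_def using B by (intro continuous_intros) auto
  have trB: "cmod (tr z) \<le> B" for z
    using B by (auto simp: tr_def max_def field_simps)
  have cut: "continuous_on UNIV cut" unfolding cut_def by (intro continuous_intros)
  have h: "continuous_on UNIV (h k)" for k
    unfolding h_def by (intro continuous_intros cut continuous_on_compose2[OF tr G]) auto
  have hB: "cmod (h k x) \<le> B" for k x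
    using mult_mono[of "cut x" 1, OF _ trB] by (auto simp: h_def cut_def)
  have h0: "h k x = 0" if "norm x > \<rho> + 1" for k x using that by (simp add: h_def cut_def)
  have [measurable]: "h k \<in> borel_measurable borel" for k by (rule borel_measurable_continuous_onI[OF h])
  have hc: "borel_bounded_compact (h k)" for k
    using hB h0 unfolding borel_bounded_compact_def by (intro conjI) (measurable, blast+)
  have hlim: "(\<lambda>k. h k x) \<longlonglongrightarrow> g x" if "x \<notin> N" for x
  proof -
    have "isCont tr (g x)" using tr by (simp add: continuous_on_eq_continuous_at)
    then have "(\<lambda>k. h k x) \<longlonglongrightarrow> cut x *\<^sub>R tr (g x)"
      unfolding h_def by (intro tendsto_intros isCont_tendsto_compose[OF _ lim[OF that]])
    moreover have "cut x *\<^sub>R tr (g x) = g x"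
      using B(1) B(2)[of x] \<rho> by (cases "norm x > \<rho>") (auto simp: tr_def cut_def max_def)
    ultimately show ?thesis by simp
  qed
  have "(\<lambda>k. \<integral>\<^sup>+x. ennreal ((cmod (h k x - g x))\<^sup>2) \<partial>lborel) \<longlonglongrightarrow> integral\<^sup>N lborel (\<lambda>x::real^'n. 0)"
  proof (rule nn_integral_dominated_convergence[where w = "\<lambda>x. ennreal (indicator (cball 0 (\<rho> + 1)) x * (2 * B)\<^sup>2)"])
    show "(\<integral>\<^sup>+x. ennreal (indicator (cball (0::real^'n) (\<rho> + 1)) x * (2 * B)\<^sup>2) \<partial>lborel) < \<infinity>"
      using integrable_indicator_cball[of "\<rho> + 1" "(2 * B)\<^sup>2", where 'a="real^'n"]
      unfolding integrable_iff_bounded real_norm_def by (simp add: abs_mult)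
    have "(cmod (h k x - g x))\<^sup>2 \<le> (2 * B)\<^sup>2" for k x
      by (rule power_mono) (use norm_triangle_ineq4[of "h k x" "g x"] hB[of k x] B(2)[of x] in \<open>auto simp: algebra_simps\<close>)
    then show "AE x in lborel. ennreal ((cmod (h k x - g x))\<^sup>2) \<le> ennreal (indicator (cball 0 (\<rho> + 1)) x * (2 * B)\<^sup>2)" for k
      using h0 \<rho> by (intro AE_I2 ennreal_leI) (auto simp: indicator_def)
    have "AE x in lborel. x \<notin> N"
      using N by (metis AE_not_in negligible_iff_null_sets AE_completion_iff null_sets_completion_iff2 eventually_mono AE_iff_null_sets completion.complete2 null_sets_completion_iff)
    then show "AE x in lborel. (\<lambda>k. ennreal ((cmod (h k x - g x))\<^sup>2)) \<longlonglongrightarrow> 0"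
    proof (rule eventually_mono)
      fix x assume "x \<notin> N"
      then have "(\<lambda>k. ennreal ((cmod (h k x - g x))\<^sup>2)) \<longlonglongrightarrow> ennreal ((cmod (g x - g x))\<^sup>2)"
        by (intro tendsto_intros hlim)
      then show "(\<lambda>k. ennreal ((cmod (h k x - g x))\<^sup>2)) \<longlonglongrightarrow> 0" by simp
    qed
  qed (measurable, auto)
  then show ?thesis using that[OF h hc] by simp
qed

text \<open>Continuous functions are dense, and Bessel's inequality turns the L^2 convergence of the
  approximants into L^2 convergence of their transforms.\<close>

lemma parseval:
  fixes u g :: "real^'n::finite \<Rightarrow> complex"
  assumes u: "integrable lborel u" and u2: "(\<integral>\<^sup>+x. ennreal ((cmod (u x))\<^sup>2) \<partial>lborel) < \<infinity>"
    and g: "borel_bounded_compact g"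
  shows "(LINT \<xi>|lborel. fourier u \<xi> * cnj (fourier g \<xi>)) = (2 * pi) ^ CARD('n) * (LINT x|lborel. u x * cnj (g x))"
proof -
  obtain h where h: "\<And>k::nat. continuous_on UNIV (h k)" "\<And>k. borel_bounded_compact (h k)"
    and lim: "(\<lambda>k. \<integral>\<^sup>+x. ennreal ((cmod (h k x - g x))\<^sup>2) \<partial>lborel) \<longlonglongrightarrow> 0"
    using continuous_approximation[OF g] by blast
  note I = borel_bounded_compact_integrable[OF g] borel_bounded_compact_integrable[OF h(2)]
  note J = borel_bounded_compact_L2[OF g] borel_bounded_compact_L2[OF h(2)]
  have [measurable]: "u \<in> borel_measurable borel" "g \<in> borel_measurable borel" "\<And>k. h k \<in> borel_measurable borel"
    using u I by auto
  have flim: "(\<lambda>k. \<integral>\<^sup>+x. ennreal ((cmod (fourier (h k) x - fourier g x))\<^sup>2) \<partial>lborel) \<longlonglongrightarrow> 0"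
  proof (rule tendsto_sandwich[OF _ _ tendsto_const])
    show "\<forall>\<^sub>F k in sequentially. (\<integral>\<^sup>+x. ennreal ((cmod (fourier (h k) x - fourier g x))\<^sup>2) \<partial>lborel)
      \<le> ennreal ((2 * pi) ^ CARD('n)) * (\<integral>\<^sup>+x. ennreal ((cmod (h k x - g x))\<^sup>2) \<partial>lborel)"
    proof (intro always_eventually allI)
      fix k
      show "(\<integral>\<^sup>+x. ennreal ((cmod (fourier (h k) x - fourier g x))\<^sup>2) \<partial>lborel)
        \<le> ennreal ((2 * pi) ^ CARD('n)) * (\<integral>\<^sup>+x. ennreal ((cmod (h k x - g x))\<^sup>2) \<partial>lborel)"
        using bessel_inequality[of "\<lambda>x. h k x - g x"] I by (simp add: fourier_diff)
    qed
    show "(\<lambda>k. ennreal ((2 * pi) ^ CARD('n)) * (\<integral>\<^sup>+x. ennreal ((cmod (h k x - g x))\<^sup>2) \<partial>lborel)) \<longlonglongrightarrow> 0"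
      using ennreal_tendsto_cmult[OF _ lim, of "ennreal ((2 * pi) ^ CARD('n))"] by simp
  qed simp
  have 1: "(\<lambda>k. LINT x|lborel. cnj (fourier (h k) x) * fourier u x) \<longlonglongrightarrow> (LINT x|lborel. cnj (fourier g x) * fourier u x)"
    by (rule pairing_tendsto) (use flim fourier_L2_finite[OF u u2] fourier_L2_finite[OF I(1) J(1)] fourier_L2_finite[OF I(2) J(2)] in
        \<open>simp_all flip: complex_cnj_diff\<close>)
  have 2: "(\<lambda>k. LINT x|lborel. cnj (h k x) * u x) \<longlonglongrightarrow> (LINT x|lborel. cnj (g x) * u x)"
    by (rule pairing_tendsto) (use lim u2 J in \<open>simp_all flip: complex_cnj_diff\<close>)
  have eq: "(LINT x|lborel. cnj (fourier (h k) x) * fourier u x) = (2 * pi) ^ CARD('n) * (LINT x|lborel. cnj (h k x) * u x)" for k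
  proof -
    obtain B where "\<And>x. cmod (h k x) \<le> B" using h(2)[of k] by (auto simp: borel_bounded_compact_def)
    from parseval_continuous[OF u u2 I(2) J(2) h(1) this] show ?thesis by (simp add: mult.commute)
  qed
  have "(\<lambda>k. (2 * pi) ^ CARD('n) * (LINT x|lborel. cnj (h k x) * u x)) \<longlonglongrightarrow> (2 * pi) ^ CARD('n) * (LINT x|lborel. cnj (g x) * u x)"
    by (intro tendsto_mult tendsto_const 2)
  from LIMSEQ_unique[OF 1[unfolded eq] this] show ?thesis by (simp add: mult.commute)
qed

section \<open>Lebesgue measurable functions and their Borel representatives\<close>

lemma lebesgue_borel_version:
  fixes f :: "real^'n::finite \<Rightarrow> complex"
  assumes "f \<in> borel_measurable lebesgue"
  obtains g where "g \<in> borel_measurable borel" "AE x in lborel. f x = g x"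
proof -
  have *: "(\<lambda>x. Re (f x)) \<in> borel_measurable lebesgue" "(\<lambda>x. Im (f x)) \<in> borel_measurable lebesgue"
    using assms unfolding borel_measurable_complex_iff by auto
  obtain a where [measurable]: "a \<in> borel_measurable lborel" and a: "AE x in lborel. Re (f x) = a x"
    using completion_ex_borel_measurable_real[OF *(1)] by blast
  obtain b where [measurable]: "b \<in> borel_measurable lborel" and b: "AE x in lborel. Im (f x) = b x"
    using completion_ex_borel_measurable_real[OF *(2)] by blast
  show ?thesis
  proof (rule that)
    show "(\<lambda>x. Complex (a x) (b x)) \<in> borel_measurable borel"
      unfolding borel_measurable_complex_iff by simp
    show "AE x in lborel. f x = Complex (a x) (b x)"
      using a b by eventually_elim (simp add: complex_eq_iff)
  qed
qed

lemma integral_lebesgue_borel_version: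
  fixes h :: "_ \<Rightarrow> 'b::{banach, second_countable_topology}"
  assumes "f \<in> borel_measurable lebesgue" and "AE x in lborel. f x = h x" and [measurable]: "h \<in> borel_measurable borel"
  shows "(LINT x|lebesgue. f x) = (LINT x|lborel. h x)"
proof -
  have "(LINT x|lebesgue. f x) = (LINT x|lebesgue. h x)"
    using assms by (intro integral_cong_AE AE_completion) (auto intro: measurable_completion)
  then show ?thesis by (simp add: integral_completion)
qed

lemma nn_integral_lebesgue_borel_version:
  assumes "AE x in lborel. f x = h x" and [measurable]: "h \<in> borel_measurable borel"
  shows "(\<integral>\<^sup>+x. f x \<partial>lebesgue) = (\<integral>\<^sup>+x. h x \<partial>lborel)"
proof -
  have "(\<integral>\<^sup>+x. f x \<partial>lebesgue) = (\<integral>\<^sup>+x. h x \<partial>lebesgue)"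
    using assms by (intro nn_integral_cong_AE AE_completion)
  then show ?thesis by (simp add: nn_integral_completion)
qed

lemma lebesgue_measurable_borel [measurable_dest]:
  "f \<in> borel_measurable borel \<Longrightarrow> f \<in> borel_measurable lebesgue"
  by (auto intro: measurable_completion)

lemma square_integrable_iff:
  "square_integrable f \<longleftrightarrow> f \<in> borel_measurable lebesgue \<and> (\<integral>\<^sup>+x. ennreal ((cmod (f x))\<^sup>2) \<partial>lebesgue) < \<infinity>"
  unfolding square_integrable_def by (auto simp: integrable_iff_bounded)

lemma square_integrable_borel:
  assumes [measurable]: "f \<in> borel_measurable borel"
  shows "square_integrable f \<longleftrightarrow> (\<integral>\<^sup>+x. ennreal ((cmod (f x))\<^sup>2) \<partial>lborel) < \<infinity>"
  unfolding square_integrable_iff by (subst nn_integral_completion) (auto intro: measurable_completion)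

lemma borel_bounded_compact_version:
  fixes f :: "real^'n::finite \<Rightarrow> complex"
  assumes f: "bounded_compact_support f"
  obtains g where "borel_bounded_compact g" "AE x in lborel. f x = g x"
proof -
  obtain B where B: "\<And>x. cmod (f x) \<le> B"
    using f by (auto simp: bounded_compact_support_def bounded_iff)
  have "bounded {x. f x \<noteq> 0}"
    using f by (metis bounded_compact_support_def bounded_subset closure_subset compact_imp_bounded)
  then obtain \<rho> where \<rho>: "\<And>x. f x \<noteq> 0 \<Longrightarrow> norm x \<le> \<rho>"
    by (auto simp: bounded_iff)
  obtain h where [measurable]: "h \<in> borel_measurable borel" and h: "AE x in lborel. f x = h x"
    using lebesgue_borel_version[of f] f unfolding bounded_compact_support_def by blast
  \<comment> \<open>\<open>h\<close> agrees with \<open>f\<close> only almost everywhere; truncating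
    it by the bounds of \<open>f\<close> makes these bounds hold at every point.\<close>
  define g where "g x = (if cmod (h x) \<le> B \<and> norm x \<le> \<rho> then h x else 0)" for x
  show ?thesis
  proof (rule that)
    have "g \<in> borel_measurable borel" unfolding g_def by measurable
    moreover have "cmod (g x) \<le> max B 0" for x by (auto simp: g_def)
    ultimately show "borel_bounded_compact g"
      unfolding borel_bounded_compact_def by (intro conjI exI[of _ "max B 0"] exI[of _ \<rho>]) (auto simp: g_def)
    show "AE x in lborel. f x = g x"
      using h
    proof eventually_elim
      case (elim x)
      then show ?case using B[of x] \<rho>[of x] by (auto simp: g_def)
    qed
  qed
qed

lemma bounded_compact_lebesgue:
  assumes "bounded_compact_support f"
  shows "integrable lebesgue f" "square_integrable f"
proof -
  obtain g where g: "borel_bounded_compact g" "AE x in lborel. f x = g x"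
    using borel_bounded_compact_version[OF assms] by blast
  have f: "f \<in> borel_measurable lebesgue" using assms by (simp add: bounded_compact_support_def)
  have [measurable]: "g \<in> borel_measurable borel" using g by (simp add: borel_bounded_compact_def)
  have "(\<integral>\<^sup>+x. ennreal (cmod (f x)) \<partial>lebesgue) = (\<integral>\<^sup>+x. ennreal (cmod (g x)) \<partial>lborel)"
    using g(2) by (intro nn_integral_lebesgue_borel_version) (auto elim: eventually_mono)
  then show "integrable lebesgue f"
    using f borel_bounded_compact_integrable[OF g(1)] by (simp add: integrable_iff_bounded)
  have "(\<integral>\<^sup>+x. ennreal ((cmod (f x))\<^sup>2) \<partial>lebesgue) = (\<integral>\<^sup>+x. ennreal ((cmod (g x))\<^sup>2) \<partial>lborel)"
    using g(2) by (intro nn_integral_lebesgue_borel_version) (auto elim: eventually_mono)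
  then show "square_integrable f"
    using f borel_bounded_compact_L2[OF g(1)] by (simp add: square_integrable_iff)
qed

lemma fourier_cong_AE:
  fixes f g :: "real^'n::finite \<Rightarrow> complex"
  assumes "f \<in> borel_measurable lebesgue" "AE x in lborel. f x = g x" and [measurable]: "g \<in> borel_measurable borel"
  shows "fourier f = fourier g"
proof
  fix \<xi> :: "real^'n"
  have A: "(\<lambda>x. cis (- (\<xi> \<bullet> x))) \<in> borel_measurable lebesgue"
    by (rule lebesgue_measurable_borel) measurable
  show "fourier f \<xi> = fourier g \<xi>"
    unfolding fourier_borel[OF assms(3)] unfolding fourier_def
  proof (rule integral_lebesgue_borel_version)
    show "(\<lambda>x. cis (- (\<xi> \<bullet> x)) * f x) \<in> borel_measurable lebesgue"
      by (rule borel_measurable_times[OF A assms(1)])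
    show "AE x in lborel. cis (- (\<xi> \<bullet> x)) * f x = cis (- (\<xi> \<bullet> x)) * g x"
      using assms(2) by eventually_elim simp
  qed measurable
qed

text \<open>\<open>T f\<close> is accessible only as the L^2 limit of functions \<open>u k\<close>
  whose transforms converge to \<open>m\<close> times the transform of \<open>f\<close>. Parseval's
  identity holds for each of them against \<open>g0\<close>, and both of its sides pass to the
  limit.\<close>

lemma multiplier_pairing:
  fixes m :: "real^'n::finite \<Rightarrow> complex"
  assumes m[measurable]: "m \<in> borel_measurable borel" and mB: "\<And>\<xi>. \<xi> \<noteq> 0 \<Longrightarrow> cmod (m \<xi>) \<le> B"
    and T: "multiplier_operator m T"
    and f: "bounded_compact_support f" and g: "bounded_compact_support g"
    and f0: "borel_bounded_compact f0" "AE x in lborel. f x = f0 x"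
    and g0: "borel_bounded_compact g0" "AE x in lborel. g x = g0 x"
  shows "(2 * pi) ^ CARD('n) * L2_pairing (T f) g = (LINT \<xi>|lborel. m \<xi> * fourier f0 \<xi> * cnj (fourier g0 \<xi>))"
proof -
  have [measurable]: "f0 \<in> borel_measurable borel" "g0 \<in> borel_measurable borel"
    using f0 g0 by (auto simp: borel_bounded_compact_def)
  have ff: "fourier f = fourier f0"
    using f f0 by (intro fourier_cong_AE) (auto simp: bounded_compact_support_def)
  note F2 = fourier_L2_finite[OF borel_bounded_compact_integrable borel_bounded_compact_L2]
  let ?F = "fourier f0" and ?G = "fourier g0"
  have sqF: "square_integrable ?F"
    by (subst square_integrable_borel) (use F2[OF f0(1) f0(1)] in auto)
  \<comment> \<open>\<open>f\<close> itself lies in L^1 and L^2, so the constant sequence witnesses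
    its transform.\<close>
  have fT: "has_fourier_transform f ?F"
    unfolding has_fourier_transform_def
    using sqF bounded_compact_lebesgue[OF f] by (auto intro!: exI[of _ "\<lambda>_. f"] simp: L2_tendsto_def ff)
  have ae0: "AE \<xi> in lborel. \<xi> \<noteq> (0::real^'n)"
    by (rule AE_lborel_singleton)
  have mF2: "(\<integral>\<^sup>+\<xi>. ennreal ((cmod (m \<xi> * ?F \<xi>))\<^sup>2) \<partial>lborel) < \<infinity>"
  proof -
    have "(\<integral>\<^sup>+\<xi>. ennreal ((cmod (m \<xi> * ?F \<xi>))\<^sup>2) \<partial>lborel) \<le> (\<integral>\<^sup>+\<xi>. ennreal (B\<^sup>2) * ennreal ((cmod (?F \<xi>))\<^sup>2) \<partial>lborel)"
    proof (rule nn_integral_mono_AE, use ae0 in eventually_elim)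
      case (elim \<xi>)
      then show ?case
        by (subst ennreal_mult[symmetric])
          (auto intro!: ennreal_leI mult_right_mono power_mono mB simp: norm_mult power_mult_distrib)
    qed
    also have "\<dots> < \<infinity>"
      using F2[OF f0(1) f0(1)] by (subst nn_integral_cmult) (auto simp: ennreal_mult_less_top)
    finally show ?thesis .
  qed
  have "square_integrable (\<lambda>\<xi>. m \<xi> * ?F \<xi>)"
    by (subst square_integrable_borel) (use mF2 in auto)
  then have "has_fourier_transform (T f) (\<lambda>\<xi>. m \<xi> * ?F \<xi>)"
    using T fT unfolding multiplier_operator_def by blast
  then obtain u where Tf: "square_integrable (T f)" and u: "\<And>k. integrable lebesgue (u k)" "\<And>k. square_integrable (u k)"
    and u1: "L2_tendsto u (T f)" and u2: "L2_tendsto (\<lambda>k. fourier (u k)) (\<lambda>\<xi>. m \<xi> * ?F \<xi>)"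
    unfolding has_fourier_transform_def by blast
  have um: "u k \<in> borel_measurable lebesgue" for k using u(2)[of k] by (simp add: square_integrable_def)
  have "\<exists>v. v \<in> borel_measurable borel \<and> (AE x in lborel. u k x = v x)" for k
    using lebesgue_borel_version[OF um[of k]] by blast
  then obtain v where [measurable]: "\<And>k. v k \<in> borel_measurable borel" and uv: "\<And>k. AE x in lborel. u k x = v k x"
    by metis
  have fuv: "fourier (u k) = fourier (v k)" for k
    by (intro fourier_cong_AE um uv) measurable
  have v1: "integrable lborel (v k)" for k
  proof -
    have "(\<integral>\<^sup>+x. ennreal (cmod (u k x)) \<partial>lebesgue) = (\<integral>\<^sup>+x. ennreal (cmod (v k x)) \<partial>lborel)"
      using uv[of k] by (intro nn_integral_lebesgue_borel_version) (auto elim: eventually_mono)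
    then show ?thesis using u(1)[of k] by (simp add: integrable_iff_bounded)
  qed
  have v2: "(\<integral>\<^sup>+x. ennreal ((cmod (v k x))\<^sup>2) \<partial>lborel) < \<infinity>" for k
  proof -
    have "(\<integral>\<^sup>+x. ennreal ((cmod (u k x))\<^sup>2) \<partial>lebesgue) = (\<integral>\<^sup>+x. ennreal ((cmod (v k x))\<^sup>2) \<partial>lborel)"
      using uv[of k] by (intro nn_integral_lebesgue_borel_version) (auto elim: eventually_mono)
    then show ?thesis using u(2)[of k] by (simp add: square_integrable_iff)
  qed
  have gm: "g \<in> borel_measurable lebesgue" using g by (simp add: bounded_compact_support_def)
  have "(\<lambda>k. LINT x|lebesgue. u k x * cnj (g x)) \<longlonglongrightarrow> (LINT x|lebesgue. T f x * cnj (g x))"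
    by (rule pairing_tendsto)
      (use um gm Tf u u1 bounded_compact_lebesgue(2)[OF g] in \<open>auto simp: square_integrable_iff L2_tendsto_def\<close>)
  moreover have "(LINT x|lebesgue. u k x * cnj (g x)) = (LINT x|lborel. v k x * cnj (g0 x))" for k
  proof (rule integral_lebesgue_borel_version)
    show "(\<lambda>x. u k x * cnj (g x)) \<in> borel_measurable lebesgue" using um[of k] gm by measurable
    show "AE x in lborel. u k x * cnj (g x) = v k x * cnj (g0 x)"
      using uv[of k] g0(2) by eventually_elim simp
  qed measurable
  ultimately have l1: "(\<lambda>k. (2 * pi) ^ CARD('n) * (LINT x|lborel. v k x * cnj (g0 x))) \<longlonglongrightarrow> (2 * pi) ^ CARD('n) * L2_pairing (T f) g"
    unfolding L2_pairing_def by (intro tendsto_mult tendsto_const) simp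
  have l2: "(2 * pi) ^ CARD('n) * (LINT x|lborel. v k x * cnj (g0 x)) = (LINT \<xi>|lborel. fourier (v k) \<xi> * cnj (?G \<xi>))" for k
    using parseval[OF v1 v2 g0(1)] by simp
  have l3: "(\<lambda>k. LINT \<xi>|lborel. fourier (v k) \<xi> * cnj (?G \<xi>)) \<longlonglongrightarrow> (LINT \<xi>|lborel. (m \<xi> * ?F \<xi>) * cnj (?G \<xi>))"
  proof (rule pairing_tendsto)
    show "(\<lambda>k. \<integral>\<^sup>+\<xi>. ennreal ((cmod (fourier (v k) \<xi> - m \<xi> * ?F \<xi>))\<^sup>2) \<partial>lborel) \<longlonglongrightarrow> 0"
      using u2 unfolding L2_tendsto_def fuv
      by (subst (asm) nn_integral_completion) auto
  qed (use mF2 F2[OF g0(1) g0(1)] fourier_L2_finite[OF v1 v2] in auto)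
  show ?thesis using LIMSEQ_unique[OF l1[unfolded l2] l3] .
qed

section \<open>Kernel decay of frequency pieces\<close>

lemma antiderivative_continuous_UNIV:
  fixes f :: "real \<Rightarrow> real"
  assumes "continuous_on UNIV f"
  obtains F where "\<And>x. (F has_real_derivative f x) (at x)"
proof
  fix x :: real
  let ?c = "\<bar>x\<bar> + 1"
  have "((\<lambda>u. LBINT y=ereal 0..ereal u. f y) has_vector_derivative f x) (at x within {- ?c..?c})"
    by (rule interval_integral_FTC2) (use assms in \<open>auto intro: continuous_on_subset\<close>)
  then have "((\<lambda>u. LBINT y=ereal 0..ereal u. f y) has_vector_derivative f x) (at x)"
    by (subst (asm) at_within_interior) (auto simp: interior_atLeastAtMost_real)
  then show "((\<lambda>u. LBINT y=ereal 0..ereal u. f y) has_real_derivative f x) (at x)"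
    by (simp add: has_real_derivative_iff_has_vector_derivative)
qed

text \<open>\<open>s k\<close> is the \<open>k\<close>-th derivative of \<open>s 0\<close>.  Steps are built by averaging over unit intervals;
  the derivative of such an average is a difference, whence the bound \<open>2 ^ k\<close>.\<close>

definition smooth_step :: "nat \<Rightarrow> (nat \<Rightarrow> real \<Rightarrow> real) \<Rightarrow> bool" where
  "smooth_step N s \<longleftrightarrow> continuous_on UNIV (s 0) \<and>
     (\<forall>k<N. \<forall>t. (s k has_real_derivative s (Suc k) t) (at t)) \<and>
     (\<forall>k\<le>N. \<forall>t. \<bar>s k t\<bar> \<le> 2 ^ k) \<and>
     (\<forall>k\<le>N. \<forall>t\<le>0. s k t = 0) \<and>
     (\<forall>k\<le>N. \<forall>t\<ge>real (Suc N). s k t = (if k = 0 then 1 else 0))"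

lemma smooth_step_exists: "\<exists>s. smooth_step N s"
proof (induction N)
  case 0
  show ?case
    by (rule exI[of _ "\<lambda>_ t. max 0 (min 1 t)"]) (auto simp: smooth_step_def intro!: continuous_intros)
next
  case (Suc N)
  then obtain s where s: "smooth_step N s" ..
  have cont: "continuous_on UNIV (s 0)"
    and der: "\<And>k t. k < N \<Longrightarrow> (s k has_real_derivative s (Suc k) t) (at t)"
    and bd: "\<And>k t. k \<le> N \<Longrightarrow> \<bar>s k t\<bar> \<le> 2 ^ k"
    and z: "\<And>k t. k \<le> N \<Longrightarrow> t \<le> 0 \<Longrightarrow> s k t = 0"
    and o: "\<And>k t. k \<le> N \<Longrightarrow> t \<ge> real (Suc N) \<Longrightarrow> s k t = (if k = 0 then 1 else 0)"
    using s by (simp_all add: smooth_step_def)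
  obtain F where F: "\<And>x. (F has_real_derivative s 0 x) (at x)"
    using antiderivative_continuous_UNIV[OF cont] by blast
  define s' where "s' k t = (case k of 0 \<Rightarrow> F t - F (t - 1) | Suc k \<Rightarrow> s k t - s k (t - 1))" for k t
  \<comment> \<open>The average over [t - 1, t] is a value of \<open>s 0\<close> inside that
    interval, so bounds and constancy carry over; the transition region lengthens by one, which
    accounts for \<open>real (Suc N)\<close> in the definition.\<close>
  have mvt: "\<exists>x. t - 1 < x \<and> x < t \<and> s' 0 t = s 0 x" for t
  proof -
    have "\<exists>z. t - 1 < z \<and> z < t \<and> F t - F (t - 1) = (t - (t - 1)) * s 0 z"
      by (rule MVT2) (use F in auto)
    then show ?thesis by (simp add: s'_def)
  qed
  have shift: "((\<lambda>t. G (t - 1)) has_real_derivative D) (at t)" if "(G has_real_derivative D) (at (t - 1))" for G D and t :: real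
  proof -
    have "((\<lambda>t. t - 1) has_real_derivative 1) (at t)" by (auto intro!: derivative_eq_intros)
    from DERIV_chain2[where g = "\<lambda>t. t - 1", OF that this] show ?thesis by simp
  qed
  have der': "(s' k has_real_derivative s' (Suc k) t) (at t)" if "k < Suc N" for k t
  proof (cases k)
    case 0
    have "((\<lambda>t. F t - F (t - 1)) has_real_derivative s 0 t - s 0 (t - 1)) (at t)"
      by (intro DERIV_diff shift F)
    then show ?thesis by (simp add: 0 s'_def[abs_def])
  next
    case (Suc j)
    have "((\<lambda>t. s j t - s j (t - 1)) has_real_derivative s (Suc j) t - s (Suc j) (t - 1)) (at t)"
      using that Suc by (intro DERIV_diff shift der) auto
    then show ?thesis by (simp add: Suc s'_def[abs_def])
  qed
  have "smooth_step (Suc N) s'"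
    unfolding smooth_step_def
  proof (intro conjI allI impI)
    show "continuous_on UNIV (s' 0)"
      using der'[of 0] by (auto intro!: continuous_at_imp_continuous_on DERIV_isCont)
    show "(s' k has_real_derivative s' (Suc k) t) (at t)" if "k < Suc N" for k t
      using der'[OF that] .
    fix k t assume k: "k \<le> Suc N"
    show "\<bar>s' k t\<bar> \<le> 2 ^ k"
    proof (cases k)
      case 0
      then show ?thesis using mvt[of t] bd[of 0] by auto
    next
      case (Suc j)
      then show ?thesis using bd[of j t] bd[of j "t - 1"] k by (auto simp: s'_def)
    qed
    show "s' k t = 0" if "t \<le> 0"
    proof (cases k)
      case 0
      obtain x where "x < t" "s' 0 t = s 0 x" using mvt[of t] by auto
      then show ?thesis using z[of 0 x] 0 that by auto
    next
      case (Suc j)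
      then show ?thesis using z[of j t] z[of j "t - 1"] k that by (auto simp: s'_def)
    qed
    show "s' k t = (if k = 0 then 1 else 0)" if "t \<ge> real (Suc (Suc N))"
    proof (cases k)
      case 0
      obtain x where "t - 1 < x" "s' 0 t = s 0 x" using mvt[of t] by auto
      then show ?thesis using o[of 0 x] 0 that by auto
    next
      case (Suc j)
      then show ?thesis using o[of j t] o[of j "t - 1"] k that by (auto simp: s'_def)
    qed
  qed
  then show ?case by blast
qed

text \<open>\<open>\<psi> k\<close> is the \<open>k\<close>-th derivative of the bump
  \<open>\<psi> 0\<close>, recorded up to the order \<open>N\<close> that the kernel decay consumes.
  A single bound \<open>C\<close> covers all orders.\<close>

definition cutoff :: "nat \<Rightarrow> real \<Rightarrow> (nat \<Rightarrow> real \<Rightarrow> real) \<Rightarrow> bool" where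
  "cutoff N C \<psi> \<longleftrightarrow> C \<ge> 1 \<and> (\<forall>k<N. \<forall>t. (\<psi> k has_real_derivative \<psi> (Suc k) t) (at t)) \<and>
     continuous_on UNIV (\<psi> 0) \<and>
     (\<forall>k\<le>N. \<forall>t. \<bar>\<psi> k t\<bar> \<le> C) \<and>
     (\<forall>k\<le>N. \<forall>t. \<bar>t\<bar> \<le> 1 \<longrightarrow> \<psi> k t = (if k = 0 then 1 else 0)) \<and>
     (\<forall>k\<le>N. \<forall>t. \<bar>t\<bar> \<ge> 2 \<longrightarrow> \<psi> k t = 0)"

lemma cutoff_exists: "\<exists>C \<psi>. cutoff N C \<psi>"
proof -
  obtain s where s: "smooth_step N s" using smooth_step_exists[of N] ..
  have cont: "continuous_on UNIV (s 0)"
    and der: "\<And>k t. k < N \<Longrightarrow> (s k has_real_derivative s (Suc k) t) (at t)"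
    and bd: "\<And>k t. k \<le> N \<Longrightarrow> \<bar>s k t\<bar> \<le> 2 ^ k"
    and z: "\<And>k t. k \<le> N \<Longrightarrow> t \<le> 0 \<Longrightarrow> s k t = 0"
    and o: "\<And>k t. k \<le> N \<Longrightarrow> t \<ge> real (Suc N) \<Longrightarrow> s k t = (if k = 0 then 1 else 0)"
    using s by (simp_all add: smooth_step_def)
  \<comment> \<open>The transition of \<open>s\<close> occupies [0, N + 1]. Dilation by
    \<open>c\<close> compresses it to unit length, so that the difference defining
    \<open>\<psi> 0\<close> rises on [-2, -1] and falls on [1, 2]; the factor \<open>c ^ k\<close>
    is the chain rule.\<close>
  define c where "c = real (Suc N)"
  have c: "c \<ge> 1" by (simp add: c_def)
  define \<psi> where "\<psi> k t = c ^ k * (s k (c * (t + 2)) - s k (c * (t - 1)))" for k t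
  have "cutoff N ((2 * c) ^ N * 2) \<psi>"
    unfolding cutoff_def
  proof (intro conjI allI impI)
    have "1 \<le> (2 * c) ^ N" using c by (intro one_le_power) auto
    then show "(1::real) \<le> (2 * c) ^ N * 2" by linarith
    show "(\<psi> k has_real_derivative \<psi> (Suc k) t) (at t)" if "k < N" for k t
    proof -
      have *: "((\<lambda>t. s k (c * (t + a))) has_real_derivative s (Suc k) (c * (t + a)) * c) (at t)" for a
        by (rule DERIV_chain2[OF der[OF that]]) (auto intro!: derivative_eq_intros)
      show ?thesis
        using DERIV_cmult[OF DERIV_diff[OF *[of 2] *[of "- 1"]], of "c ^ k"]
        unfolding \<psi>_def by (simp add: algebra_simps)
    qed
    show "continuous_on UNIV (\<psi> 0)"
      unfolding \<psi>_def by (intro continuous_intros continuous_on_compose2[OF cont]) auto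
    fix k t assume k: "k \<le> N"
    show "\<bar>\<psi> k t\<bar> \<le> (2 * c) ^ N * 2"
    proof -
      have "\<bar>s k (c * (t + 2)) - s k (c * (t - 1))\<bar> \<le> 2 ^ k * 2"
        using bd[OF k, of "c * (t + 2)"] bd[OF k, of "c * (t - 1)"] by linarith
      then have "c ^ k * \<bar>s k (c * (t + 2)) - s k (c * (t - 1))\<bar> \<le> c ^ k * (2 ^ k * 2)"
        using c by (intro mult_left_mono) auto
      also have "\<dots> = (2 * c) ^ k * 2" by (simp add: power_mult_distrib)
      also have "\<dots> \<le> (2 * c) ^ N * 2" using c k by (intro mult_right_mono power_increasing) auto
      finally show ?thesis using c by (simp add: \<psi>_def abs_mult)
    qed
    show "\<psi> k t = (if k = 0 then 1 else 0)" if "\<bar>t\<bar> \<le> 1"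
    proof -
      have "c * (t - 1) \<le> 0" "c * (t + 2) \<ge> c * 1"
        using c that by (auto intro!: mult_nonneg_nonpos mult_left_mono)
      then show ?thesis using z[OF k] o[OF k] by (simp add: \<psi>_def c_def)
    qed
    show "\<psi> k t = 0" if "\<bar>t\<bar> \<ge> 2"
    proof (cases "t \<ge> 2")
      case True
      then have "c * (t - 1) \<ge> c * 1" "c * (t + 2) \<ge> c * 1" using c by (auto intro!: mult_left_mono)
      then show ?thesis using o[OF k] by (simp add: \<psi>_def c_def)
    next
      case False
      then have "c * (t - 1) \<le> 0" "c * (t + 2) \<le> 0" using c that by (auto intro!: mult_nonneg_nonpos)
      then show ?thesis using z[OF k] by (simp add: \<psi>_def)
    qed
  qed
  then show ?thesis by blast
qed

text \<open>A function \<open>w 0\<close> with its first \<open>N\<close> derivatives in the single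
  direction \<open>e\<close>. Pure derivatives suffice because decay of the kernel in coordinate
  \<open>i\<close> is read off from differences in direction \<open>i\<close> alone.\<close>

definition line_tower :: "nat \<Rightarrow> 'a::real_vector \<Rightarrow> (nat \<Rightarrow> 'a \<Rightarrow> complex) \<Rightarrow> bool" where
  "line_tower N e w \<longleftrightarrow>
    (\<forall>k<N. \<forall>\<xi>. ((\<lambda>t. w k (\<xi> + t *\<^sub>R e)) has_vector_derivative w (Suc k) \<xi>) (at 0))"

lemma line_towerD:
  "line_tower N e w \<Longrightarrow> k < N \<Longrightarrow> ((\<lambda>t. w k (\<xi> + t *\<^sub>R e)) has_vector_derivative w (Suc k) \<xi>) (at 0)"
  by (simp add: line_tower_def)

lemma line_tower_Suc: "line_tower (Suc N) e w \<Longrightarrow> line_tower N e (\<lambda>k. w (Suc k))"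
  by (simp add: line_tower_def)

lemma line_tower_mono: "line_tower N e w \<Longrightarrow> M \<le> N \<Longrightarrow> line_tower M e w"
  by (simp add: line_tower_def)

text \<open>Leibniz' rule without binomial coefficients: the induction hypothesis is applied to
  \<open>u' v\<close> and \<open>u v'\<close> separately, and each derivative doubles the number of
  terms, whence \<open>(2 * l) ^ k\<close>. The open set \<open>Z\<close> shields points where
  \<open>u\<close> may fail to be differentiable, in the application the origin; \<open>S\<close> is
  the region on which \<open>u\<close> is controlled.\<close>

lemma product_tower:
  fixes u v :: "nat \<Rightarrow> real^'n::finite \<Rightarrow> complex"
  assumes "open Z"
    and "\<And>k \<xi>. k < N \<Longrightarrow> \<xi> \<notin> Z \<Longrightarrow> ((\<lambda>t. u k (\<xi> + t *\<^sub>R e)) has_vector_derivative u (Suc k) \<xi>) (at 0)"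
    and "line_tower N e v"
    and "\<And>k \<xi>. k \<le> N \<Longrightarrow> \<xi> \<in> Z \<Longrightarrow> v k \<xi> = 0"
    and "\<And>k \<xi>. k \<le> N \<Longrightarrow> \<xi> \<notin> S \<Longrightarrow> v k \<xi> = 0"
    and "\<And>k \<xi>. k \<le> N \<Longrightarrow> \<xi> \<in> S \<Longrightarrow> cmod (u k \<xi>) \<le> U * l ^ k"
    and "\<And>k \<xi>. k \<le> N \<Longrightarrow> cmod (v k \<xi>) \<le> V * l ^ k"
    and "0 \<le> l" "0 \<le> U" "0 \<le> V"
  shows "\<exists>w. w 0 = (\<lambda>\<xi>. u 0 \<xi> * v 0 \<xi>) \<and>
     line_tower N e w \<and>
     (\<forall>\<xi>\<in>Z. \<forall>k\<le>N. w k \<xi> = 0) \<and>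
     (\<forall>k\<le>N. \<forall>\<xi>. cmod (w k \<xi>) \<le> U * V * (2 * l) ^ k)"
  using assms
proof (induction N arbitrary: u v U V)
  case 0
  show ?case
  proof (intro exI[of _ "\<lambda>_ \<xi>. u 0 \<xi> * v 0 \<xi>"] conjI allI impI ballI)
    fix k :: nat and \<xi> :: "real^'n" assume "k \<le> 0"
    have "cmod (u 0 \<xi> * v 0 \<xi>) \<le> U * V"
      using 0(5)[of 0 \<xi>] 0(6)[of 0 \<xi>] 0(7)[of 0 \<xi>] 0(9,10)
      by (cases "\<xi> \<in> S") (auto simp: norm_mult intro!: mult_mono)
    then show "cmod (u 0 \<xi> * v 0 \<xi>) \<le> U * V * (2 * l) ^ k" using \<open>k \<le> 0\<close> by simp
  qed (use 0(4) in \<open>auto simp: line_tower_def\<close>)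
next
  case (Suc N)
  have "\<exists>w. w 0 = (\<lambda>\<xi>. u (Suc 0) \<xi> * v 0 \<xi>) \<and>
     line_tower N e w \<and>
     (\<forall>\<xi>\<in>Z. \<forall>k\<le>N. w k \<xi> = 0) \<and>
     (\<forall>k\<le>N. \<forall>\<xi>. cmod (w k \<xi>) \<le> (U * l) * V * (2 * l) ^ k)"
  proof (rule Suc.IH[of "\<lambda>k. u (Suc k)" v "U * l" V, OF Suc.prems(1)])
    show "cmod (u (Suc k) \<xi>) \<le> U * l * l ^ k" if "k \<le> N" "\<xi> \<in> S" for k \<xi>
      using Suc.prems(6)[of "Suc k" \<xi>] that by (simp add: mult_ac)
  qed (use Suc.prems(2,4-10) line_tower_mono[OF Suc.prems(3)] in auto)
  then obtain w1 where w1: "w1 0 = (\<lambda>\<xi>. u (Suc 0) \<xi> * v 0 \<xi>)"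
     "line_tower N e w1"
     "\<And>k \<xi>. \<xi> \<in> Z \<Longrightarrow> k \<le> N \<Longrightarrow> w1 k \<xi> = 0"
     "\<And>k \<xi>. k \<le> N \<Longrightarrow> cmod (w1 k \<xi>) \<le> (U * l) * V * (2 * l) ^ k"
    by blast
  have "\<exists>w. w 0 = (\<lambda>\<xi>. u 0 \<xi> * v (Suc 0) \<xi>) \<and>
     line_tower N e w \<and>
     (\<forall>\<xi>\<in>Z. \<forall>k\<le>N. w k \<xi> = 0) \<and>
     (\<forall>k\<le>N. \<forall>\<xi>. cmod (w k \<xi>) \<le> U * (V * l) * (2 * l) ^ k)"
  proof (rule Suc.IH[of u "\<lambda>k. v (Suc k)" U "V * l", OF Suc.prems(1)])
    show "cmod (v (Suc k) \<xi>) \<le> V * l * l ^ k" if "k \<le> N" for k \<xi>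
      using Suc.prems(7)[of "Suc k" \<xi>] that by (simp add: mult_ac)
  qed (use Suc.prems(2,4-10) line_tower_Suc[OF Suc.prems(3)] in auto)
  then obtain w2 where w2: "w2 0 = (\<lambda>\<xi>. u 0 \<xi> * v (Suc 0) \<xi>)"
     "line_tower N e w2"
     "\<And>k \<xi>. \<xi> \<in> Z \<Longrightarrow> k \<le> N \<Longrightarrow> w2 k \<xi> = 0"
     "\<And>k \<xi>. k \<le> N \<Longrightarrow> cmod (w2 k \<xi>) \<le> U * (V * l) * (2 * l) ^ k"
    by blast
  define w where "w k \<xi> = (case k of 0 \<Rightarrow> u 0 \<xi> * v 0 \<xi> | Suc j \<Rightarrow> w1 j \<xi> + w2 j \<xi>)" for k \<xi>
  have wz: "w k \<xi> = 0" if "\<xi> \<in> Z" "k \<le> Suc N" for k \<xi>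
    using that w1(3)[of \<xi>] w2(3)[of \<xi>] Suc.prems(4)[of 0 \<xi>] by (auto simp: w_def split: nat.split)
  have b0: "cmod (u 0 \<xi> * v 0 \<xi>) \<le> U * V" for \<xi>
    using Suc.prems(5)[of 0 \<xi>] Suc.prems(6)[of 0 \<xi>] Suc.prems(7)[of 0 \<xi>] Suc.prems(9,10)
    by (cases "\<xi> \<in> S") (auto simp: norm_mult intro!: mult_mono)
  have tw: "line_tower (Suc N) e w"
    unfolding line_tower_def
  proof (intro allI impI)
    fix k \<xi> assume k: "k < Suc N"
    show "((\<lambda>t. w k (\<xi> + t *\<^sub>R e)) has_vector_derivative w (Suc k) \<xi>) (at 0)"
    proof (cases k)
      case (Suc j)
      then show ?thesis
        using line_towerD[OF w1(2), of j \<xi>] line_towerD[OF w2(2), of j \<xi>] k by (simp add: w_def[abs_def] has_vector_derivative_add)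
    next
      case 0
      show ?thesis
      proof (cases "\<xi> \<in> Z")
        case True
        \<comment> \<open>The line stays in the open set \<open>Z\<close> for small times, where the
          product vanishes identically; its derivative is therefore 0.\<close>
        let ?V = "(\<lambda>t. \<xi> + t *\<^sub>R e) -` Z"
        have V: "open ?V"
          by (rule open_vimage[OF Suc.prems(1)]) (intro continuous_intros)
        have "((\<lambda>t. w k (\<xi> + t *\<^sub>R e)) has_vector_derivative 0) (at 0)"
          by (rule has_vector_derivative_transform_within_open[OF has_vector_derivative_const V])
            (use True wz k in auto)
        then show ?thesis using wz[OF True, of "Suc k"] k by simp
      next
        case False
        show ?thesis
          using has_vector_derivative_mult[OF Suc.prems(2)[of 0, OF _ False] line_towerD[OF Suc.prems(3), of 0 \<xi>]]
          unfolding 0 by (simp add: w_def[abs_def] w1(1) w2(1) add.commute)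
      qed
    qed
  qed
  have bw: "cmod (w k \<xi>) \<le> U * V * (2 * l) ^ k" if k: "k \<le> Suc N" for k \<xi>
  proof -
    show "cmod (w k \<xi>) \<le> U * V * (2 * l) ^ k"
    proof (cases k)
      case (Suc j)
      have "cmod (w k \<xi>) \<le> cmod (w1 j \<xi>) + cmod (w2 j \<xi>)" by (simp add: Suc w_def norm_triangle_ineq)
      also have "\<dots> \<le> (U * l) * V * (2 * l) ^ j + U * (V * l) * (2 * l) ^ j"
        using k Suc by (intro add_mono w1 w2) auto
      finally show ?thesis by (simp add: Suc mult_ac)
    qed (use b0 in \<open>simp add: w_def\<close>)
  qed
  have "w 0 = (\<lambda>\<xi>. u 0 \<xi> * v 0 \<xi>)" by (auto simp: w_def)
  with tw bw wz show ?case by blast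
qed

section \<open>Finite differences and the decay of inverse Fourier transforms\<close>

definition fdiff :: "'a::real_vector \<Rightarrow> ('a \<Rightarrow> complex) \<Rightarrow> 'a \<Rightarrow> complex" where
  "fdiff v w \<xi> = w (\<xi> + v) - w \<xi>"

lemma line_tower_at:
  fixes e :: "'a::real_normed_vector"
  assumes "line_tower N e w" "k < N"
  shows "((\<lambda>t. w k (\<xi> + t *\<^sub>R e)) has_vector_derivative w (Suc k) (\<xi> + t *\<^sub>R e)) (at t)"
proof -
  have "((\<lambda>s. w k ((\<xi> + t *\<^sub>R e) + s *\<^sub>R e)) has_vector_derivative w (Suc k) (\<xi> + t *\<^sub>R e)) (at (t - t))"
    using line_towerD[OF assms, of "\<xi> + t *\<^sub>R e"] by simp
  moreover have "((\<lambda>s. s - t) has_vector_derivative 1) (at t)"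
    by (auto intro!: derivative_eq_intros)
  ultimately have "(((\<lambda>s. w k ((\<xi> + t *\<^sub>R e) + s *\<^sub>R e)) \<circ> (\<lambda>s. s - t)) has_vector_derivative 1 *\<^sub>R w (Suc k) (\<xi> + t *\<^sub>R e)) (at t)"
    by (intro vector_diff_chain_at) auto
  then show ?thesis by (simp add: o_def algebra_simps)
qed

text \<open>A difference of a tower is a tower that is one derivative shorter, and the mean value
  inequality trades its top derivative for a factor \<open>\<bar>h\<bar>\<close>.\<close>

lemma fdiff_bound:
  fixes e :: "'a::real_normed_vector"
  assumes "line_tower N e w" "\<And>\<xi>. cmod (w N \<xi>) \<le> B"
  shows "cmod ((fdiff (h *\<^sub>R e) ^^ N) (w 0) \<xi>) \<le> B * \<bar>h\<bar> ^ N"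
  using assms
proof (induction N arbitrary: w B \<xi>)
  case (Suc N)
  let ?w = "\<lambda>k. fdiff (h *\<^sub>R e) (w k)"
  have "line_tower N e ?w"
    unfolding line_tower_def
  proof (intro allI impI)
    fix k \<xi> assume k: "k < N"
    have "((\<lambda>t. w k ((\<xi> + h *\<^sub>R e) + t *\<^sub>R e) - w k (\<xi> + t *\<^sub>R e)) has_vector_derivative
        w (Suc k) (\<xi> + h *\<^sub>R e) - w (Suc k) \<xi>) (at 0)"
      by (intro has_vector_derivative_diff line_towerD[OF Suc.prems(1)]) (use k in auto)
    then show "((\<lambda>t. ?w k (\<xi> + t *\<^sub>R e)) has_vector_derivative ?w (Suc k) \<xi>) (at 0)"
      by (simp add: fdiff_def algebra_simps)
  qed
  moreover have "cmod (?w N \<xi>) \<le> B * \<bar>h\<bar>" for \<xi>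
  proof -
    have "norm (w N (\<xi> + h *\<^sub>R e) - w N (\<xi> + 0 *\<^sub>R e)) \<le> B * norm (h - 0)"
    proof (rule differentiable_bound[where S = UNIV and f = "\<lambda>t. w N (\<xi> + t *\<^sub>R e)" and f' = "\<lambda>t x. x *\<^sub>R w (Suc N) (\<xi> + t *\<^sub>R e)"])
      show "((\<lambda>t. w N (\<xi> + t *\<^sub>R e)) has_derivative (\<lambda>x. x *\<^sub>R w (Suc N) (\<xi> + t *\<^sub>R e))) (at t within UNIV)" for t
        using line_tower_at[OF Suc.prems(1), of N] by (simp add: has_vector_derivative_def)
      show "onorm (\<lambda>x. x *\<^sub>R w (Suc N) (\<xi> + t *\<^sub>R e)) \<le> B" for t
        by (rule onorm_le) (simp add: mult.commute[of B] mult_left_mono Suc.prems(2))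
    qed auto
    then show ?thesis by (simp add: fdiff_def)
  qed
  ultimately have "cmod ((fdiff (h *\<^sub>R e) ^^ N) (?w 0) \<xi>) \<le> B * \<bar>h\<bar> * \<bar>h\<bar> ^ N"
    by (rule Suc.IH)
  then show ?case by (simp add: funpow_Suc_right mult_ac del: funpow.simps)
qed simp

lemma integrable_fdiff:
  fixes w :: "real^'n::finite \<Rightarrow> complex"
  assumes "integrable lborel w"
  shows "integrable lborel (fdiff v w)"
  unfolding fdiff_def[abs_def] using lborel_integrable_translation[OF assms, of v] assms
  by (auto simp: add.commute)

lemma integrable_mult_cis:
  fixes w :: "real^'n::finite \<Rightarrow> complex"
  assumes "integrable lborel w"
  shows "integrable lborel (\<lambda>\<xi>. w \<xi> * cis (\<xi> \<bullet> z))"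
  using integrable_cis_mult[OF assms, of "\<lambda>\<xi>. \<xi> \<bullet> z"] by (simp add: mult.commute)

lemma inv_kernel_fdiff:
  fixes w :: "real^'n::finite \<Rightarrow> complex"
  assumes w: "integrable lborel w"
  shows "inv_kernel (fdiff v w) z = (cis (- (v \<bullet> z)) - 1) * inv_kernel w z"
proof -
  have [measurable]: "w \<in> borel_measurable borel" using w by auto
  have i: "integrable lborel (\<lambda>\<xi>. w (\<xi> + v))"
    using lborel_integrable_translation[OF w, of v] by (simp add: add.commute)
  have "inv_kernel (fdiff v w) z = (LINT \<xi>|lborel. w (\<xi> + v) * cis (\<xi> \<bullet> z) - w \<xi> * cis (\<xi> \<bullet> z))"
    by (simp add: inv_kernel_def fdiff_def left_diff_distrib)
  also have "\<dots> = (LINT \<xi>|lborel. w (\<xi> + v) * cis (\<xi> \<bullet> z)) - inv_kernel w z"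
    unfolding inv_kernel_def by (intro Bochner_Integration.integral_diff integrable_mult_cis w i)
  also have "(LINT \<xi>|lborel. w (\<xi> + v) * cis (\<xi> \<bullet> z)) = (LINT \<xi>|lborel. cis (- (v \<bullet> z)) * (w (v + \<xi>) * cis ((v + \<xi>) \<bullet> z)))"
    by (intro Bochner_Integration.integral_cong) (simp_all add: inner_add_left cis_mult add.commute mult.left_commute)
  also have "\<dots> = cis (- (v \<bullet> z)) * (LINT \<xi>|lborel. w (v + \<xi>) * cis ((v + \<xi>) \<bullet> z))"
    by simp
  also have "(LINT \<xi>|lborel. w (v + \<xi>) * cis ((v + \<xi>) \<bullet> z)) = inv_kernel w z"
    unfolding inv_kernel_def by (rule lborel_integral_translation[of "\<lambda>\<xi>. w \<xi> * cis (\<xi> \<bullet> z)"]) measurable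
  finally show ?thesis by (simp add: left_diff_distrib)
qed

lemma inv_kernel_fdiff_power:
  fixes w :: "real^'n::finite \<Rightarrow> complex"
  assumes w: "integrable lborel w"
  shows "integrable lborel ((fdiff v ^^ N) w) \<and>
    inv_kernel ((fdiff v ^^ N) w) z = (cis (- (v \<bullet> z)) - 1) ^ N * inv_kernel w z"
  by (induction N) (auto simp: w integrable_fdiff inv_kernel_fdiff mult_ac)

lemma fdiff_power_support:
  fixes w :: "real^'n::finite \<Rightarrow> complex"
  assumes "\<And>\<xi> j. \<bar>\<xi> $ j\<bar> > \<rho> \<Longrightarrow> w \<xi> = 0" "\<And>j. \<bar>v $ j\<bar> \<le> a" "\<bar>\<xi> $ j\<bar> > \<rho> + real N * a"
  shows "(fdiff v ^^ N) w \<xi> = 0"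
  using assms(3)
proof (induction N arbitrary: \<xi>)
  case (Suc N)
  have "\<bar>(\<xi> + v) $ j\<bar> > \<rho> + real N * a" "\<bar>\<xi> $ j\<bar> > \<rho> + real N * a"
    using Suc.prems assms(2)[of j] by (auto simp: algebra_simps abs_if split: if_splits)
  then show ?case using Suc.IH by (simp add: fdiff_def)
qed (use assms(1) in auto)

text \<open>\<open>l\<close> is half the side length, and the set is empty for negative
  \<open>l\<close>.\<close>

definition sup_cube :: "real^'n::finite \<Rightarrow> real \<Rightarrow> (real^'n) set" where
  "sup_cube x l = {y. \<forall>i. \<bar>y $ i - x $ i\<bar> \<le> l}"

lemma sup_cube_eq_cbox: "sup_cube x l = cbox (\<chi> i. x $ i - l) (\<chi> i. x $ i + l)"
  by (auto simp: sup_cube_def mem_box_cart abs_le_iff algebra_simps)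

lemma sup_cube_measurable [measurable]: "sup_cube x l \<in> sets borel"
  by (simp add: sup_cube_eq_cbox)

lemma emeasure_sup_cube: "0 \<le> l \<Longrightarrow> emeasure lborel (sup_cube (x :: real^'n::finite) l) = ennreal ((2 * l) ^ CARD('n))"
  unfolding sup_cube_eq_cbox
  by (subst emeasure_lborel_cbox_eq)
     (auto simp: Basis_vec_def inner_axis prod.UNION_disjoint prod.reindex inj_on_def axis_eq_axis
        cart_eq_inner_axis[symmetric] prod_constant)

lemma measure_sup_cube: "0 \<le> l \<Longrightarrow> measure lborel (sup_cube (x :: real^'n::finite) l) = (2 * l) ^ CARD('n)"
  by (simp add: measure_def emeasure_sup_cube)

lemma norm_integral_support_le:
  fixes u :: "real^'n::finite \<Rightarrow> complex"
  assumes "\<And>\<xi>. cmod (u \<xi>) \<le> B" "\<And>\<xi> j. \<bar>\<xi> $ j\<bar> > \<rho> \<Longrightarrow> u \<xi> = 0" "0 \<le> \<rho>"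
  shows "cmod (LINT \<xi>|lborel. u \<xi>) \<le> B * (2 * \<rho>) ^ CARD('n)"
proof -
  have B: "0 \<le> B" using assms(1)[of 0] norm_ge_zero[of "u 0"] by linarith
  have "ennreal (cmod (LINT \<xi>|lborel. u \<xi>)) \<le> (\<integral>\<^sup>+\<xi>. ennreal (cmod (u \<xi>)) \<partial>lborel)"
    by (rule norm_integral_le_nn_integral)
  also have "\<dots> \<le> (\<integral>\<^sup>+\<xi>. ennreal B * indicator (sup_cube (0::real^'n) \<rho>) \<xi> \<partial>lborel)"
  proof (rule nn_integral_mono)
    fix \<xi> :: "real^'n"
    show "ennreal (cmod (u \<xi>)) \<le> ennreal B * indicator (sup_cube 0 \<rho>) \<xi>"
      using assms(1)[of \<xi>] assms(2)[of \<xi>] by (cases "\<xi> \<in> sup_cube 0 \<rho>") (auto simp: sup_cube_def intro: ennreal_leI leI)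
  qed
  also have "\<dots> = ennreal (B * (2 * \<rho>) ^ CARD('n))"
    using assms(3) B by (subst nn_integral_cmult_indicator) (auto simp: emeasure_sup_cube ennreal_mult)
  finally show ?thesis using B assms(3) by (subst (asm) ennreal_le_iff) auto
qed

text \<open>A translation of \<open>w\<close> by \<open>pi / z\<^sub>i\<close> in direction \<open>i\<close> changes the sign of the exponential, so each
  difference of \<open>w\<close> with this step doubles \<open>inv_kernel w z\<close>; no integration by parts is needed.\<close>

lemma inv_kernel_decay:
  fixes w :: "nat \<Rightarrow> real^'n::finite \<Rightarrow> complex"
  assumes w: "integrable lborel (w 0)" and tw: "line_tower N (axis i 1) w"
    and B: "\<And>\<xi>. cmod (w N \<xi>) \<le> B"
    and supp: "\<And>\<xi> j. \<bar>\<xi> $ j\<bar> > \<rho> \<Longrightarrow> w 0 \<xi> = 0" and "0 \<le> \<rho>" and z: "z $ i \<noteq> 0"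
  shows "cmod (inv_kernel (w 0) z) \<le> (B * (pi / \<bar>z $ i\<bar>) ^ N) / 2 ^ N * (2 * (\<rho> + N * (pi / \<bar>z $ i\<bar>))) ^ CARD('n)"
proof -
  define h where "h = pi / z $ i"
  let ?v = "h *\<^sub>R axis i 1 :: real^'n"
  have ah: "\<bar>h\<bar> = pi / \<bar>z $ i\<bar>" by (simp add: h_def)
  have "?v \<bullet> z = pi" using z by (simp add: h_def inner_axis')
  moreover have "cis (- pi) = - 1" by (simp add: complex_eq_iff)
  ultimately have "cmod (inv_kernel ((fdiff ?v ^^ N) (w 0)) z) = 2 ^ N * cmod (inv_kernel (w 0) z)"
    using inv_kernel_fdiff_power[OF w, where v = ?v and N = N and z = z] by (simp add: norm_mult norm_power)
  moreover have "cmod (inv_kernel ((fdiff ?v ^^ N) (w 0)) z) \<le> (B * \<bar>h\<bar> ^ N) * (2 * (\<rho> + N * \<bar>h\<bar>)) ^ CARD('n)"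
    unfolding inv_kernel_def
  proof (rule norm_integral_support_le)
    show "cmod ((fdiff ?v ^^ N) (w 0) \<xi> * cis (\<xi> \<bullet> z)) \<le> B * \<bar>h\<bar> ^ N" for \<xi>
      using fdiff_bound[OF tw B, of h \<xi>] by (simp add: norm_mult)
    show "(fdiff ?v ^^ N) (w 0) \<xi> * cis (\<xi> \<bullet> z) = 0" if "\<rho> + N * \<bar>h\<bar> < \<bar>\<xi> $ j\<bar>" for \<xi> j
      using fdiff_power_support[OF supp _ that, where v = ?v] by (auto simp: axis_def)
  qed (use \<open>0 \<le> \<rho>\<close> in auto)
  ultimately show ?thesis unfolding ah[symmetric] by (simp add: field_simps)
qed

text \<open>The \<open>k\<close>-th derivative in direction \<open>i\<close> of the product cutoff
  adapted to the cube of radius \<open>R\<close>. For \<open>k = 0\<close> the value does not depend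
  on \<open>i\<close>.\<close>

definition box_cutoff :: "(nat \<Rightarrow> real \<Rightarrow> real) \<Rightarrow> real \<Rightarrow> 'n \<Rightarrow> nat \<Rightarrow> real^'n::finite \<Rightarrow> real" where
  "box_cutoff \<psi> R i k \<xi> = (\<Prod>j\<in>UNIV - {i}. \<psi> 0 (\<xi> $ j / R)) * (\<psi> k (\<xi> $ i / R) / R ^ k)"

lemma box_cutoff_0: "box_cutoff \<psi> R i 0 \<xi> = (\<Prod>j\<in>UNIV. \<psi> 0 (\<xi> $ j / R))"
  unfolding box_cutoff_def by (simp add: prod.remove[of UNIV i])

lemma box_cutoff_tower:
  fixes i :: "'n::finite"
  assumes "cutoff N C \<psi>" "0 < R"
  shows "line_tower N (axis i 1) (\<lambda>k \<xi>. complex_of_real (box_cutoff \<psi> R i k \<xi>))"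
  unfolding line_tower_def
proof (intro allI impI)
  fix k and \<xi> :: "real^'n" assume k: "k < N"
  define P where "P = (\<Prod>j\<in>UNIV - {i}. \<psi> 0 (\<xi> $ j / R))"
  have eq: "box_cutoff \<psi> R i k (\<xi> + t *\<^sub>R axis i 1) = P / R ^ k * \<psi> k ((\<xi> $ i + t) / R)" for t
    by (auto simp: box_cutoff_def P_def axis_def intro!: prod.cong)
  have "((\<lambda>t. \<psi> k ((\<xi> $ i + t) / R)) has_real_derivative \<psi> (Suc k) ((\<xi> $ i + 0) / R) * (1 / R)) (at 0)"
    using assms k unfolding cutoff_def
    by (intro DERIV_chain2[where g = "\<lambda>t. (\<xi> $ i + t) / R"]) (auto intro!: derivative_eq_intros)
  from DERIV_cmult[OF this, of "P / R ^ k"]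
  have "((\<lambda>t. box_cutoff \<psi> R i k (\<xi> + t *\<^sub>R axis i 1)) has_real_derivative box_cutoff \<psi> R i (Suc k) \<xi>) (at 0)"
    unfolding eq by (simp add: box_cutoff_def P_def field_simps)
  then show "((\<lambda>t. complex_of_real (box_cutoff \<psi> R i k (\<xi> + t *\<^sub>R axis i 1))) has_vector_derivative
      complex_of_real (box_cutoff \<psi> R i (Suc k) \<xi>)) (at 0)"
    unfolding has_real_derivative_iff_has_vector_derivative
    by (rule bounded_linear.has_vector_derivative[OF bounded_linear_of_real])
qed

lemma box_cutoff_inner:
  assumes "cutoff N C \<psi>" "0 < R" "k \<le> N" "\<And>j. \<bar>\<xi> $ j\<bar> \<le> R"
  shows "box_cutoff \<psi> R i k \<xi> = (if k = 0 then 1 else 0)"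
proof -
  have "\<bar>\<xi> $ j / R\<bar> \<le> 1" for j using assms(2,4) by simp
  then show ?thesis using assms(1,3) unfolding box_cutoff_def cutoff_def by simp
qed

lemma box_cutoff_outer:
  assumes "cutoff N C \<psi>" "0 < R" "k \<le> N" "\<bar>\<xi> $ j\<bar> \<ge> 2 * R"
  shows "box_cutoff \<psi> R i k \<xi> = 0"
proof -
  have "\<bar>\<xi> $ j / R\<bar> \<ge> 2" using assms(2,4) by (simp add: field_simps)
  then have "\<psi> 0 (\<xi> $ j / R) = 0" "\<psi> k (\<xi> $ j / R) = 0"
    using assms(1,3) unfolding cutoff_def by auto
  then show ?thesis
    by (cases "j = i") (auto simp: box_cutoff_def)
qed

lemma box_cutoff_bound:
  fixes \<xi> :: "real^'n::finite"
  assumes "cutoff N C \<psi>" "0 < R" "k \<le> N"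
  shows "\<bar>box_cutoff \<psi> R i k \<xi>\<bar> \<le> C ^ CARD('n) * (1 / R) ^ k"
proof -
  have b: "\<bar>\<psi> l t\<bar> \<le> C" if "l \<le> N" for l t using assms that by (auto simp: cutoff_def)
  have C: "1 \<le> C" using assms by (auto simp: cutoff_def)
  have "\<bar>\<Prod>j\<in>UNIV - {i}. \<psi> 0 (\<xi> $ j / R)\<bar> \<le> (\<Prod>j\<in>UNIV - {i}. C)"
    unfolding abs_prod by (intro prod_mono) (auto intro: b)
  then have "\<bar>\<Prod>j\<in>UNIV - {i}. \<psi> 0 (\<xi> $ j / R)\<bar> * \<bar>\<psi> k (\<xi> $ i / R)\<bar> \<le> C ^ (CARD('n) - 1) * C"
    using C b[OF assms(3)] by (intro mult_mono) auto
  also have "\<dots> = C ^ CARD('n)"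
    by (metis Suc_diff_1 power_Suc2 zero_less_card_finite)
  finally show ?thesis
    using assms(2) by (simp add: box_cutoff_def abs_mult power_divide divide_right_mono)
qed

section \<open>Symbols restricted to dyadic annuli\<close>

lemma symbol_line_derivative:
  assumes "is_symbol \<alpha> \<beta> A m" "\<xi> \<noteq> 0"
  shows "((\<lambda>t. iter_deriv (replicate k i) m (\<xi> + t *\<^sub>R axis i 1)) has_vector_derivative iter_deriv (replicate (Suc k) i) m \<xi>) (at 0)"
proof -
  let ?u = "iter_deriv (replicate k i) m"
  have "?u differentiable (at \<xi>)"
    using assms by (auto simp: is_symbol_def smooth_on_open_def)
  then have "(?u has_derivative frechet_derivative ?u (at \<xi>)) (at (\<xi> + 0 *\<^sub>R axis i 1))"
    by (simp add: frechet_derivative_works)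
  moreover have "((\<lambda>t. \<xi> + t *\<^sub>R axis i 1) has_vector_derivative axis i 1) (at 0)"
    by (auto intro!: derivative_eq_intros)
  ultimately have "((?u \<circ> (\<lambda>t. \<xi> + t *\<^sub>R axis i 1)) has_vector_derivative frechet_derivative ?u (at \<xi>) (axis i 1)) (at 0)"
    by (intro vector_derivative_diff_chain_within[where S = UNIV, simplified]) (auto intro: has_derivative_at_withinI)
  then show ?thesis
    by (simp add: o_def iter_deriv_def partial_deriv_def)
qed

lemma symbol_measurable:
  assumes "is_symbol \<alpha> \<beta> A m"
  shows "m \<in> borel_measurable borel"
proof (rule borel_measurable_continuous_countable_exceptions[of "{0}"])
  have "m differentiable (at \<xi>)" if "\<xi> \<noteq> 0" for \<xi>
    using assms that unfolding is_symbol_def smooth_on_open_def iter_deriv_def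
    by (auto dest: spec[of _ "[]"])
  then show "continuous_on (- {0}) m"
    by (intro continuous_at_imp_continuous_on) (auto intro: differentiable_imp_continuous_within)
qed simp

lemma symbol_bound:
  assumes "is_symbol \<alpha> \<beta> A m" "\<xi> \<noteq> 0"
  shows "cmod (iter_deriv (replicate k i) m \<xi>) \<le> A (count_list (replicate k i)) * norm \<xi> powr (- \<beta> + real k * (\<alpha> - 1))"
  using assms unfolding is_symbol_def by (metis length_replicate)

lemma symbol_zero:
  assumes "is_symbol \<alpha> \<beta> A m" "\<xi> \<noteq> 0" "norm \<xi> powr \<alpha> < 1"
  shows "m \<xi> = 0"
  using assms closure_subset[of "{\<xi>. m \<xi> \<noteq> 0}"] unfolding is_symbol_def by force

text \<open>A difference of two boxes: it vanishes where all coordinates are at most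
  \<open>R\<close> in modulus and where one of them is at least \<open>4 * R\<close>. Along a dyadic
  sequence of radii these differences telescope.\<close>

definition annulus_cutoff :: "(nat \<Rightarrow> real \<Rightarrow> real) \<Rightarrow> real \<Rightarrow> real^'n::finite \<Rightarrow> real" where
  "annulus_cutoff \<psi> R \<xi> = (\<Prod>j\<in>UNIV. \<psi> 0 (\<xi> $ j / (2 * R))) - (\<Prod>j\<in>UNIV. \<psi> 0 (\<xi> $ j / R))"

text \<open>On an annulus, \<open>x\<close> and \<open>R\<close> are comparable, so powers may be
  exchanged at a bounded cost whatever the sign of the exponent.\<close>

lemma powr_annulus_le:
  fixes R x L e E :: real
  assumes "0 < R" "R \<le> x" "x \<le> L * R" "\<bar>e\<bar> \<le> E"
  shows "x powr e \<le> L powr E * R powr e"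
proof -
  have L: "1 \<le> L" using order_trans[OF assms(2,3)] assms(1) by simp
  have "(x / R) powr e \<le> L powr E"
  proof (cases "0 \<le> e")
    case True
    have "(x / R) powr e \<le> L powr e" using assms True by (intro powr_mono2) (auto simp: field_simps)
    also have "\<dots> \<le> L powr E" using L assms True by (intro powr_mono) auto
    finally show ?thesis .
  next
    case False
    have "(x / R) powr e \<le> (x / R) powr 0" using assms False by (intro powr_mono) auto
    also have "\<dots> \<le> 1" using assms by simp
    also have "1 \<le> L powr E" using L assms by (intro ge_one_powr_ge_zero) auto
    finally show ?thesis .
  qed
  then show ?thesis using assms by (simp add: powr_divide field_simps)
qed

lemma norm_le_sup_bound:
  fixes \<xi> :: "real^'n::finite"
  assumes "\<And>j. \<bar>\<xi> $ j\<bar> \<le> r"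
  shows "norm \<xi> \<le> real CARD('n) * r"
proof -
  have "norm \<xi> \<le> (\<Sum>j\<in>UNIV. \<bar>\<xi> $ j\<bar>)" by (rule norm_le_l1_cart)
  also have "\<dots> \<le> (\<Sum>j\<in>(UNIV::'n set). r)" by (intro sum_mono assms)
  finally show ?thesis by simp
qed

text \<open>\<open>K\<close> is uniform in \<open>m\<close> and \<open>R\<close>. A derivative costs
  \<open>R powr (\<alpha> - 1)\<close> on the symbol and \<open>1 / R\<close> on the cutoff; since
  \<open>c \<le> R powr \<alpha>\<close>, the first cost dominates up to \<open>1 / c\<close>, and
  \<open>inv_kernel_decay\<close> converts \<open>N\<close> derivatives into the stated decay. The
  condition \<open>c \<le> R * \<bar>z $ i\<bar>\<close> keeps the supports of the differences
  within a multiple of \<open>R\<close>.\<close>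

lemma symbol_annulus:
  fixes A :: "('n::finite \<Rightarrow> nat) \<Rightarrow> real"
  assumes \<psi>: "cutoff N C \<psi>" and c: "0 < c" "c \<le> 1"
  shows "\<exists>K>0. \<forall>(m :: real^'n \<Rightarrow> complex) R. is_symbol \<alpha> \<beta> A m \<longrightarrow> 0 < R \<longrightarrow> c \<le> R powr \<alpha> \<longrightarrow>
    integrable lborel (\<lambda>\<xi>. m \<xi> * complex_of_real (annulus_cutoff \<psi> R \<xi>)) \<and>
    (\<forall>\<xi>. cmod (m \<xi> * complex_of_real (annulus_cutoff \<psi> R \<xi>)) \<le> K * R powr (- \<beta>)) \<and>
    (\<forall>\<xi> j. \<bar>\<xi> $ j\<bar> > 4 * R \<longrightarrow> m \<xi> * complex_of_real (annulus_cutoff \<psi> R \<xi>) = 0) \<and>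
    (\<forall>z i. c \<le> R * \<bar>z $ i\<bar> \<longrightarrow> cmod (inv_kernel (\<lambda>\<xi>. m \<xi> * complex_of_real (annulus_cutoff \<psi> R \<xi>)) z)
        \<le> K * R powr (- \<beta>) * R ^ CARD('n) * (R powr (\<alpha> - 1) / \<bar>z $ i\<bar>) ^ N)"
proof -
  let ?n = "CARD('n)"
  \<comment> \<open>Only pure derivatives of order at most \<open>N\<close> enter, so finitely many
    of the implied constants have to be bounded.\<close>
  define Am where "Am = (\<Sum>i\<in>UNIV. \<Sum>k\<le>N. \<bar>A (count_list (replicate k i))\<bar>)"
  define E where "E = \<bar>\<beta>\<bar> + real N * \<bar>\<alpha> - 1\<bar>"
  define U0 where "U0 = Am * (4 * real ?n) powr E"
  define V where "V = 2 * C ^ ?n"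
  define K where "K = U0 * V + U0 * V * (pi / c) ^ N * (2 * (4 + real N * (pi / c))) ^ ?n + 1"
  have Am: "\<bar>A (count_list (replicate k i))\<bar> \<le> Am" if "k \<le> N" for k i
  proof -
    have "\<bar>A (count_list (replicate k i))\<bar> \<le> (\<Sum>k\<le>N. \<bar>A (count_list (replicate k i))\<bar>)"
      by (rule member_le_sum[of k "{..N}" "\<lambda>k. \<bar>A (count_list (replicate k i))\<bar>"]) (use that in auto)
    also have "\<dots> \<le> Am" unfolding Am_def
      by (rule member_le_sum[of i UNIV "\<lambda>i. \<Sum>k\<le>N. \<bar>A (count_list (replicate k i))\<bar>"]) (auto intro: sum_nonneg)
    finally show ?thesis .
  qed
  have Am0: "0 \<le> Am" unfolding Am_def by (intro sum_nonneg) auto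
  have C: "1 \<le> C" using \<psi> by (simp add: cutoff_def)
  have U0: "0 \<le> U0" "0 \<le> V" using Am0 C by (auto simp: U0_def V_def)
  have K1: "U0 * V \<le> K" and K2: "U0 * V * (pi / c) ^ N * (2 * (4 + real N * (pi / c))) ^ ?n \<le> K" and K0: "0 < K"
  proof -
    have "0 \<le> U0 * V" "0 \<le> U0 * V * (pi / c) ^ N * (2 * (4 + real N * (pi / c))) ^ ?n"
      using U0 c by auto
    then show "U0 * V \<le> K" "U0 * V * (pi / c) ^ N * (2 * (4 + real N * (pi / c))) ^ ?n \<le> K" "0 < K"
      by (auto simp: K_def)
  qed
  show ?thesis
  proof (intro exI[of _ K] conjI K0 allI impI)
    fix m :: "real^'n \<Rightarrow> complex" and R :: real
    assume m: "is_symbol \<alpha> \<beta> A m" and R: "0 < R" and cR: "c \<le> R powr \<alpha>"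
    \<comment> \<open>The common cost of one derivative, for the symbol and for the cutoff.\<close>
    define l where "l = R powr (\<alpha> - 1) / c"
    define U where "U = U0 * R powr (- \<beta>)"
    define v where "v i k \<xi> = complex_of_real (box_cutoff \<psi> (2 * R) i k \<xi> - box_cutoff \<psi> R i k \<xi>)" for i k and \<xi> :: "real^'n"
    \<comment> \<open>Here \<open>norm \<xi>\<close> lies between \<open>R\<close> and a dimensional
      multiple of \<open>R\<close>. Outside this set the cutoff and its derivatives vanish, in
      particular on the ball of radius \<open>R\<close> that contains the origin.\<close>
    let ?S = "{\<xi> :: real^'n. R \<le> norm \<xi> \<and> (\<forall>j. \<bar>\<xi> $ j\<bar> < 4 * R)}"
    have l: "0 \<le> l" using c by (simp add: l_def)
    have U: "0 \<le> U" using U0 by (simp add: U_def)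
    have Rl: "1 / R \<le> l"
    proof -
      have "R powr (\<alpha> - 1) = R powr \<alpha> / R" using R by (simp add: powr_diff)
      then show ?thesis using cR c R unfolding l_def by (simp add: field_simps)
    qed
    have v0: "v i 0 \<xi> = complex_of_real (annulus_cutoff \<psi> R \<xi>)" for i \<xi>
      by (simp add: v_def annulus_cutoff_def box_cutoff_0)
    have vz: "v i k \<xi> = 0" if "k \<le> N" "norm \<xi> < R" for i k \<xi>
    proof -
      have lt: "\<bar>\<xi> $ j\<bar> < R" for j using component_le_norm_cart[of \<xi> j] that by linarith
      have "\<bar>\<xi> $ j\<bar> \<le> R" "\<bar>\<xi> $ j\<bar> \<le> 2 * R" for j
        using lt[of j] R by linarith+
      then show ?thesis
        using box_cutoff_inner[OF \<psi> R that(1), of \<xi> i] box_cutoff_inner[OF \<psi> _ that(1), of "2 * R" \<xi> i] R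
        by (simp add: v_def)
    qed
    have vo: "v i k \<xi> = 0" if "k \<le> N" "\<bar>\<xi> $ j\<bar> \<ge> 4 * R" for i k \<xi> j
      using box_cutoff_outer[OF \<psi> R that(1), of \<xi> j i] box_cutoff_outer[OF \<psi> _ that(1), of "2 * R" \<xi> j i] R that
      by (simp add: v_def)
    have vb: "cmod (v i k \<xi>) \<le> V * l ^ k" if "k \<le> N" for i k \<xi>
    proof -
      have "cmod (v i k \<xi>) \<le> \<bar>box_cutoff \<psi> (2 * R) i k \<xi>\<bar> + \<bar>box_cutoff \<psi> R i k \<xi>\<bar>"
        unfolding v_def norm_of_real by (rule abs_triangle_ineq4)
      also have "\<dots> \<le> C ^ ?n * (1 / (2 * R)) ^ k + C ^ ?n * (1 / R) ^ k"
        using R by (intro add_mono box_cutoff_bound[OF \<psi> _ that]) auto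
      also have "\<dots> \<le> C ^ ?n * l ^ k + C ^ ?n * l ^ k"
      proof -
        have "1 / (2 * R) \<le> 1 / R" using R by (simp add: field_simps)
        then have "(1 / (2 * R)) ^ k \<le> l ^ k" "(1 / R) ^ k \<le> l ^ k" using R Rl by (intro power_mono; simp)+
        then show ?thesis using C by (intro add_mono mult_left_mono) auto
      qed
      finally show ?thesis by (simp add: V_def mult_ac)
    qed
    have ub: "cmod (iter_deriv (replicate k i) m \<xi>) \<le> U * l ^ k" if "k \<le> N" "\<xi> \<in> ?S" for k i \<xi>
    proof -
      have nR: "norm \<xi> \<le> 4 * real ?n * R"
        using norm_le_sup_bound[of \<xi> "4 * R"] that by (auto simp: less_imp_le mult_ac)
      have \<xi>: "\<xi> \<noteq> 0" using that R by auto
      have "cmod (iter_deriv (replicate k i) m \<xi>) \<le> A (count_list (replicate k i)) * norm \<xi> powr (- \<beta> + real k * (\<alpha> - 1))"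
        by (rule symbol_bound[OF m \<xi>])
      also have "\<dots> \<le> Am * norm \<xi> powr (- \<beta> + real k * (\<alpha> - 1))"
        using Am[OF that(1), of i] by (intro mult_right_mono) auto
      also have "\<dots> \<le> Am * ((4 * real ?n) powr E * R powr (- \<beta> + real k * (\<alpha> - 1)))"
      proof (intro mult_left_mono powr_annulus_le Am0 R nR)
        have "\<bar>real k * (\<alpha> - 1)\<bar> \<le> real N * \<bar>\<alpha> - 1\<bar>"
          using that(1) by (simp add: abs_mult mult_right_mono)
        then show "\<bar>- \<beta> + real k * (\<alpha> - 1)\<bar> \<le> E" by (simp add: E_def)
      qed (use that in auto)
      also have "\<dots> = U * (R powr (\<alpha> - 1)) ^ k"
      proof -
        have "R powr (real k * (\<alpha> - 1)) = (R powr (\<alpha> - 1)) ^ k"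
          using R powr_powr[of R "\<alpha> - 1" "real k"] powr_realpow[of "R powr (\<alpha> - 1)" k]
          by (simp add: mult.commute)
        then show ?thesis unfolding U_def U0_def powr_add by simp
      qed
      also have "\<dots> \<le> U * l ^ k"
        using c R U by (intro mult_left_mono power_mono) (auto simp: l_def field_simps)
      finally show ?thesis .
    qed
    let ?w = "\<lambda>\<xi>. m \<xi> * complex_of_real (annulus_cutoff \<psi> R \<xi>)"
    have ex: "\<exists>w. w 0 = ?w \<and> line_tower N (axis i 1) w \<and>
       (\<forall>\<xi>\<in>ball 0 R. \<forall>k\<le>N. w k \<xi> = 0) \<and> (\<forall>k\<le>N. \<forall>\<xi>. cmod (w k \<xi>) \<le> U * V * (2 * l) ^ k)" for i
    proof -
      have "\<exists>w. w 0 = (\<lambda>\<xi>. iter_deriv (replicate 0 i) m \<xi> * v i 0 \<xi>) \<and> line_tower N (axis i 1) w \<and>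
         (\<forall>\<xi>\<in>ball 0 R. \<forall>k\<le>N. w k \<xi> = 0) \<and> (\<forall>k\<le>N. \<forall>\<xi>. cmod (w k \<xi>) \<le> U * V * (2 * l) ^ k)"
      proof (rule product_tower[where S = ?S])
        show "((\<lambda>t. iter_deriv (replicate k i) m (\<xi> + t *\<^sub>R axis i 1)) has_vector_derivative iter_deriv (replicate (Suc k) i) m \<xi>) (at 0)"
          if "\<xi> \<notin> ball 0 R" for k \<xi>
          by (rule symbol_line_derivative[OF m]) (use that R in auto)
        have "line_tower N (axis i 1) (\<lambda>k \<xi>. complex_of_real (box_cutoff \<psi> (2 * R) i k \<xi>))"
             "line_tower N (axis i 1) (\<lambda>k \<xi>. complex_of_real (box_cutoff \<psi> R i k \<xi>))"
          using R by (auto intro!: box_cutoff_tower[OF \<psi>])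
        then show "line_tower N (axis i 1) (v i)"
          unfolding line_tower_def v_def of_real_diff by (auto intro: has_vector_derivative_diff)
        show "v i k \<xi> = 0" if "k \<le> N" "\<xi> \<in> ball 0 R" for k \<xi> using vz that by simp
        show "v i k \<xi> = 0" if "k \<le> N" "\<xi> \<notin> ?S" for k \<xi>
          using vz[OF that(1), of \<xi> i] vo[OF that(1)] that(2) by (auto simp: not_le not_less)
      qed (use ub vb l U U0 in auto)
      then show ?thesis by (simp add: v0 iter_deriv_def)
    qed
    show bound: "cmod (?w \<xi>) \<le> K * R powr (- \<beta>)" for \<xi>
    proof -
      obtain w where "w 0 = ?w" "\<forall>k\<le>N. \<forall>\<xi>. cmod (w k \<xi>) \<le> U * V * (2 * l) ^ k"
        using ex[of undefined] by blast
      then have "cmod (?w \<xi>) \<le> U * V" by (metis le0 mult.right_neutral power_0)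
      also have "\<dots> \<le> K * R powr (- \<beta>)" using mult_right_mono[OF K1, of "R powr (- \<beta>)"] by (simp add: U_def mult_ac)
      finally show ?thesis .
    qed
    show supp: "?w \<xi> = 0" if "\<bar>\<xi> $ j\<bar> > 4 * R" for \<xi> j
      using vo[of 0 \<xi> j undefined] that v0[of undefined \<xi>] by simp
    have \<psi>m: "\<psi> 0 \<in> borel_measurable borel"
      using \<psi> by (intro borel_measurable_continuous_onI) (simp add: cutoff_def)
    have am: "annulus_cutoff \<psi> R \<in> borel_measurable borel"
      unfolding annulus_cutoff_def
      by (intro borel_measurable_diff borel_measurable_prod measurable_compose[OF _ \<psi>m] borel_measurable_divide
          borel_measurable_const) (auto intro: borel_measurable_continuous_onI continuous_intros)
    have wm: "?w \<in> borel_measurable borel"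
      using symbol_measurable[OF m] am by measurable
    show int: "integrable lborel ?w"
    proof (rule Bochner_Integration.integrable_bound)
      show "integrable lborel (\<lambda>\<xi>::real^'n. indicator (sup_cube 0 (4 * R)) \<xi> * (K * R powr (- \<beta>)))"
        using R by (intro integrable_mult_left integrable_real_indicator) (auto simp: emeasure_sup_cube)
      show "AE \<xi> in lborel. cmod (?w \<xi>) \<le> norm (indicator (sup_cube 0 (4 * R)) \<xi> * (K * R powr (- \<beta>)))"
      proof (rule AE_I2)
        fix \<xi> :: "real^'n"
        show "cmod (?w \<xi>) \<le> norm (indicator (sup_cube 0 (4 * R)) \<xi> * (K * R powr (- \<beta>)))"
        proof (cases "\<xi> \<in> sup_cube 0 (4 * R)")
          case True
          then show ?thesis using bound[of \<xi>] K0 by (simp add: abs_mult)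
        next
          case False
          then obtain j where "\<bar>\<xi> $ j\<bar> > 4 * R" by (auto simp: sup_cube_def not_le)
          then show ?thesis using supp[of \<xi> j] by (simp only: norm_zero norm_ge_zero)
        qed
      qed
    qed (use wm in simp)
    fix z :: "real^'n" and i assume z: "c \<le> R * \<bar>z $ i\<bar>"
    obtain w where w: "w 0 = ?w" "line_tower N (axis i 1) w" "\<forall>k\<le>N. \<forall>\<xi>. cmod (w k \<xi>) \<le> U * V * (2 * l) ^ k"
      using ex[of i] by blast
    have z0: "z $ i \<noteq> 0" using z c by auto
    \<comment> \<open>The step length of the differences is at most a multiple of \<open>R\<close>,
      so \<open>N\<close> of them enlarge the support by a bounded factor.\<close>
    have zR: "pi / \<bar>z $ i\<bar> \<le> pi / c * R"
      using z c z0 by (simp add: field_simps)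
    have "cmod (inv_kernel (w 0) z) \<le> (U * V * (2 * l) ^ N * (pi / \<bar>z $ i\<bar>) ^ N) / 2 ^ N *
        (2 * (4 * R + N * (pi / \<bar>z $ i\<bar>))) ^ ?n"
      by (rule inv_kernel_decay) (use w int supp R z0 in auto)
    also have "\<dots> \<le> (U * V * (2 * l) ^ N * (pi / \<bar>z $ i\<bar>) ^ N) / 2 ^ N * (2 * (4 + real N * (pi / c)) * R) ^ ?n"
    proof (intro mult_left_mono power_mono)
      have "2 * (4 * R + real N * (pi / \<bar>z $ i\<bar>)) \<le> 2 * (4 * R + real N * (pi / c * R))"
        by (intro mult_left_mono add_left_mono zR) auto
      also have "\<dots> = 2 * (4 + real N * (pi / c)) * R" by (simp add: algebra_simps)
      finally show "2 * (4 * R + real N * (pi / \<bar>z $ i\<bar>)) \<le> 2 * (4 + real N * (pi / c)) * R" .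
    qed (use R U U0 l in auto)
    also have "\<dots> = (U0 * V * (pi / c) ^ N * (2 * (4 + real N * (pi / c))) ^ ?n) * (R powr (- \<beta>) * R ^ ?n * (R powr (\<alpha> - 1) / \<bar>z $ i\<bar>) ^ N)"
      by (simp add: U_def l_def power_mult_distrib power_divide)
    also have "\<dots> \<le> K * (R powr (- \<beta>) * R ^ ?n * (R powr (\<alpha> - 1) / \<bar>z $ i\<bar>) ^ N)"
      using R by (intro mult_right_mono K2) auto
    finally show "cmod (inv_kernel ?w z) \<le> K * R powr (- \<beta>) * R ^ ?n * (R powr (\<alpha> - 1) / \<bar>z $ i\<bar>) ^ N"
      by (simp add: w(1) mult.assoc)
  qed
qed

section \<open>Local forms\<close>

lemma borel_measurable_vec_component [measurable (raw)]:
  fixes f :: "'a \<Rightarrow> real^'n::finite"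
  shows "f \<in> borel_measurable M \<Longrightarrow> (\<lambda>x. f x $ i) \<in> borel_measurable M"
  by (rule measurable_compose[OF _ borel_measurable_nth])

lemma sup_cube_pred [measurable]:
  fixes f g :: "'a \<Rightarrow> real^'n::finite"
  assumes [measurable]: "f \<in> borel_measurable M" "g \<in> borel_measurable M"
  shows "Measurable.pred M (\<lambda>p. f p \<in> sup_cube (g p) l)"
  unfolding sup_cube_def mem_Collect_eq by measurable

lemma sup_cube_commute: "x \<in> sup_cube y l \<longleftrightarrow> y \<in> sup_cube x l"
  by (simp add: sup_cube_def abs_minus_commute)

definition test_fun :: "(real^'n::finite \<Rightarrow> real) \<Rightarrow> bool" where
  "test_fun F \<longleftrightarrow> F \<in> borel_measurable borel \<and> (\<forall>x. 0 \<le> F x) \<and>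
     (\<exists>B. \<forall>x. F x \<le> B) \<and> (\<exists>\<rho>. \<forall>x. norm x > \<rho> \<longrightarrow> F x = 0)"

lemma test_fun_cmod: "borel_bounded_compact f \<Longrightarrow> test_fun (\<lambda>x. cmod (f x))"
  unfolding borel_bounded_compact_def test_fun_def by auto

lemma test_fun_measurable: "test_fun F \<Longrightarrow> F \<in> borel_measurable borel"
  by (simp add: test_fun_def)

lemma test_fun_nonneg: "test_fun F \<Longrightarrow> 0 \<le> F x"
  by (simp add: test_fun_def)

lemma test_fun_powr_integrable:
  assumes F: "test_fun F" and p: "0 < p"
  shows "integrable lborel (\<lambda>x. F x powr p)"
proof -
  obtain B \<rho> where B: "\<And>x. F x \<le> B" and \<rho>: "\<And>x. norm x > \<rho> \<Longrightarrow> F x = 0"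
    using F by (auto simp: test_fun_def)
  have [measurable]: "F \<in> borel_measurable borel" by (rule test_fun_measurable[OF F])
  show ?thesis
  proof (rule Bochner_Integration.integrable_bound[OF integrable_indicator_cball[of \<rho> "B powr p"]])
    show "AE x in lborel. norm (F x powr p) \<le> norm (indicat_real (cball 0 \<rho>) x * B powr p)"
    proof (rule AE_I2)
      fix x
      show "norm (F x powr p) \<le> norm (indicat_real (cball 0 \<rho>) x * B powr p)"
        using B[of x] \<rho>[of x] test_fun_nonneg[OF F, of x] p
        by (cases "norm x > \<rho>") (auto simp: indicator_def intro: powr_mono2)
    qed
  qed simp
qed

text \<open>The form that \<open>lp_average\<close> takes for finite exponents when the data are
  Borel and nonnegative.\<close>

definition avg :: "real \<Rightarrow> (real^'n::finite) set \<Rightarrow> (real^'n \<Rightarrow> real) \<Rightarrow> real" where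
  "avg p E F = ((LINT x|lborel. indicator E x * F x powr p) / measure lborel E) powr (1 / p)"

lemma avg_nonneg: "0 \<le> avg p E F"
  by (simp add: avg_def)

lemma test_fun_powr_integrable_on:
  assumes "test_fun F" "0 < p" "E \<in> sets borel"
  shows "integrable lborel (\<lambda>x. indicator E x * F x powr p)"
  using integrable_mult_indicator[of E lborel "\<lambda>x. F x powr p"] test_fun_powr_integrable[OF assms(1,2)] assms(3)
  by simp

lemma avg_powr:
  assumes "0 < p" "0 < measure lborel E"
  shows "measure lborel E * avg p E F powr p = (LINT x|lborel. indicator E x * F x powr p)"
proof -
  have "0 \<le> (LINT x|lborel. indicator E x * F x powr p)" by (intro integral_nonneg_AE) auto
  then show ?thesis using assms by (simp add: avg_def powr_powr)
qed

text \<open>Young's inequality replaces Jensen's: with \<open>a\<close> the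
  \<open>q\<close>-average, (F/a)^p <= (p/q) (F/a)^q + 1 - p/q holds pointwise, and the right side
  has mean 1 over \<open>E\<close>. If \<open>a = 0\<close>, then \<open>F\<close> vanishes almost
  everywhere on \<open>E\<close>.\<close>

lemma avg_mono_exponent:
  fixes F :: "real^'n::finite \<Rightarrow> real"
  assumes F: "test_fun F" and E: "E \<in> sets borel" "0 < measure lborel E" and pq: "0 < p" "p \<le> q"
  shows "avg p E F \<le> avg q E F"
proof -
  let ?I = "\<lambda>p. LINT x|lborel. indicator E x * F x powr p"
  let ?\<mu> = "measure lborel E"
  note ip = test_fun_powr_integrable_on[OF F _ E(1)]
  have fin: "emeasure lborel E < \<infinity>"
    by (rule ccontr) (use E(2) in \<open>auto simp: measure_def not_less top_unique\<close>)
  have iE: "integrable lborel (\<lambda>x. indicat_real E x)" using E(1) fin by simp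
  define a where "a = avg q E F"
  have q: "0 < q" using pq by simp
  have aq: "?\<mu> * a powr q = ?I q" unfolding a_def by (rule avg_powr[OF q E(2)])
  show ?thesis
  proof (cases "a = 0")
    case True
    then have "?I q = 0" using aq by simp
    then have "AE x in lborel. indicator E x * F x powr q = 0"
      using integral_nonneg_eq_0_iff_AE[OF ip[OF q]] by simp
    then have "AE x in lborel. indicator E x * F x powr p = 0"
      by eventually_elim (auto simp: powr_eq_0_iff)
    then have "?I p = 0"
      by (intro integral_eq_zero_AE)
    then show ?thesis unfolding avg_def by simp
  next
    case False
    then have a: "0 < a" using avg_nonneg[of q E F] by (simp add: a_def)
    have "indicator E x * F x powr p \<le> a powr p * (p / q) / a powr q * (indicator E x * F x powr q) + a powr p * (1 - p / q) * indicator E x" for x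
    proof (cases "x \<in> E \<and> F x > 0")
      case True
      have "((F x / a) powr q) powr (p / q) * 1 powr (1 - p / q) \<le> p / q * (F x / a) powr q + (1 - p / q) * 1"
        using Youngs_inequality_0[of "p / q" "1 - p / q" "(F x / a) powr q" 1] pq a True by simp
      then have "(F x / a) powr p \<le> p / q * (F x / a) powr q + (1 - p / q)"
        using q by (simp add: powr_powr)
      then have "a powr p * (F x / a) powr p \<le> a powr p * (p / q * (F x / a) powr q + (1 - p / q))"
        by (intro mult_left_mono) auto
      moreover have "a powr p * (F x / a) powr p = F x powr p"
        using a True by (simp add: powr_divide)
      ultimately show ?thesis using a True by (simp add: powr_divide algebra_simps)
    next
      case False
      then have "x \<notin> E \<or> F x = 0" using test_fun_nonneg[OF F, of x] by auto
      then show ?thesis using pq q by (auto simp: indicator_def)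
    qed
    then have "?I p \<le> (LINT x|lborel. a powr p * (p / q) / a powr q * (indicator E x * F x powr q) + a powr p * (1 - p / q) * indicator E x)"
      using ip[OF q] ip[OF pq(1)] iE by (intro integral_mono) auto
    also have "\<dots> = a powr p * (p / q) / a powr q * ?I q + a powr p * (1 - p / q) * ?\<mu>"
      using ip[OF q] iE E(1) by simp
    also have "\<dots> = a powr p * ?\<mu>"
      unfolding aq[symmetric] using a q by (simp add: field_simps)
    finally have "?I p / ?\<mu> \<le> a powr p" using E(2) by (simp add: field_simps)
    moreover have "0 \<le> ?I p" by (intro integral_nonneg_AE) auto
    ultimately have "avg p E F \<le> (a powr p) powr (1 / p)"
      unfolding avg_def using pq E(2) by (intro powr_mono2) auto
    then show ?thesis using a pq by (simp add: powr_powr a_def)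
  qed
qed

lemma avg_sup_cube_measurable [measurable]:
  fixes F :: "real^'n::finite \<Rightarrow> real"
  assumes [measurable]: "F \<in> borel_measurable borel"
  shows "(\<lambda>x. avg p (sup_cube x l) F) \<in> borel_measurable borel"
proof -
  have eq: "indicator (sup_cube x l) y = indicat_real {p. snd p \<in> sup_cube (fst p) l} (x, y)" for x y :: "real^'n"
    by (simp add: indicator_def)
  have [measurable]: "{p :: (real^'n) \<times> (real^'n). snd p \<in> sup_cube (fst p) l} \<in> sets (borel \<Otimes>\<^sub>M borel)"
    using sup_cube_pred[of snd "borel \<Otimes>\<^sub>M borel" fst l] by (simp add: pred_def space_pair_measure)
  have "(\<lambda>x. LINT y|lborel. indicator (sup_cube x l) y * F y powr p) \<in> borel_measurable borel"
    unfolding eq by (rule lborel.borel_measurable_lebesgue_integral) (unfold case_prod_beta', measurable)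
  moreover have "measure lborel (sup_cube x l) = measure lborel (sup_cube (0::real^'n) l)" for x :: "real^'n"
  proof (cases "0 \<le> l")
    case False
    then have "sup_cube y l = {}" for y :: "real^'n"
      by (auto simp: sup_cube_def not_le intro: order.strict_trans2[OF _ abs_ge_zero])
    then show ?thesis by simp
  qed (simp add: measure_sup_cube)
  then have "(\<lambda>x. measure lborel (sup_cube (x::real^'n) l)) = (\<lambda>x. measure lborel (sup_cube (0::real^'n) l))" by auto
  ultimately show ?thesis unfolding avg_def by measurable
qed

text \<open>Integrating over all centres makes the form independent of any grid; the choice of a
  grid is postponed to the sparse domination.\<close>

definition local_form :: "real \<Rightarrow> real \<Rightarrow> real \<Rightarrow> (real^'n::finite \<Rightarrow> real) \<Rightarrow> (real^'n \<Rightarrow> real) \<Rightarrow> ennreal" where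
  "local_form p q l F G = (\<integral>\<^sup>+x. ennreal (avg p (sup_cube x l) F * avg q (sup_cube x l) G) \<partial>lborel)"

lemma local_form_mono_exponent:
  fixes F G :: "real^'n::finite \<Rightarrow> real"
  assumes "test_fun F" "test_fun G" "0 < l" "0 < p" "p \<le> p'" "0 < q" "q \<le> q'"
  shows "local_form p q l F G \<le> local_form p' q' l F G"
  unfolding local_form_def
proof (intro nn_integral_mono ennreal_leI mult_mono avg_nonneg)
  fix x :: "real^'n"
  have "0 < measure lborel (sup_cube x l)" using assms(3) by (simp add: measure_sup_cube)
  then show "avg p (sup_cube x l) F \<le> avg p' (sup_cube x l) F" "avg q (sup_cube x l) G \<le> avg q' (sup_cube x l) G"
    using assms by (auto intro!: avg_mono_exponent)
qed

lemma nn_integral_eq_avg1: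
  fixes F :: "real^'n::finite \<Rightarrow> real"
  assumes F: "test_fun F" and l: "0 < l"
  shows "(\<integral>\<^sup>+y. ennreal (F y) * indicator (sup_cube z l) y \<partial>lborel) = ennreal ((2 * l) ^ CARD('n) * avg 1 (sup_cube z l) F)"
proof -
  have m: "measure lborel (sup_cube z l) = (2 * l) ^ CARD('n)" using l by (simp add: measure_sup_cube)
  have "(\<integral>\<^sup>+y. ennreal (F y) * indicator (sup_cube z l) y \<partial>lborel) = (\<integral>\<^sup>+y. ennreal (indicator (sup_cube z l) y * F y powr 1) \<partial>lborel)"
    using test_fun_nonneg[OF F] by (intro nn_integral_cong) (auto simp: indicator_def)
  also have "\<dots> = ennreal (LINT y|lborel. indicator (sup_cube z l) y * F y powr 1)"
    by (intro nn_integral_eq_integral test_fun_powr_integrable_on[OF F]) auto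
  also have "(LINT y|lborel. indicator (sup_cube z l) y * F y powr 1) = (2 * l) ^ CARD('n) * avg 1 (sup_cube z l) F powr 1"
    using l by (subst avg_powr[symmetric]) (auto simp: m)
  also have "avg 1 (sup_cube z l) F powr 1 = avg 1 (sup_cube z l) F"
    using avg_nonneg[of 1 "sup_cube z l" F] by simp
  finally show ?thesis .
qed

text \<open>If \<open>y\<close> is within \<open>l\<close> of \<open>x\<close>, then both lie in the
  cube of radius \<open>2 * l\<close> about every \<open>z\<close> within \<open>l\<close> of
  \<open>x\<close>. Averaging over these \<open>z\<close>, a set of measure (2 l)^n, gives the
  constant (4 l)^n (4 l)^n / (2 l)^n = (8 l)^n.\<close>

lemma double_integral_le_local_form:
  fixes F G :: "real^'n::finite \<Rightarrow> real"
  assumes F: "test_fun F" and G: "test_fun G" and l: "0 < l"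
  shows "(\<integral>\<^sup>+x. \<integral>\<^sup>+y. ennreal (F x) * ennreal (G y) * indicator (sup_cube x l) y \<partial>lborel \<partial>lborel)
     \<le> ennreal ((8 * l) ^ CARD('n)) * local_form 1 1 (2 * l) F G"
proof -
  let ?n = "CARD('n)"
  have [measurable]: "F \<in> borel_measurable borel" "G \<in> borel_measurable borel"
    using F G by (auto intro: test_fun_measurable)
  let ?c = "ennreal (1 / (2 * l) ^ ?n)"
  let ?H = "\<lambda>x y z. ennreal (F x) * indicator (sup_cube z (2 * l)) x * (ennreal (G y) * indicator (sup_cube z (2 * l)) y)"
  have ind: "indicator (sup_cube z r) x = (if x \<in> sup_cube z r then 1 else 0 :: ennreal)" for z x :: "real^'n" and r
    by (simp add: indicator_def)
  have "(\<integral>\<^sup>+x. \<integral>\<^sup>+y. ennreal (F x) * ennreal (G y) * indicator (sup_cube x l) y \<partial>lborel \<partial>lborel)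
    \<le> (\<integral>\<^sup>+x. \<integral>\<^sup>+y. (\<integral>\<^sup>+z. ?c * ?H x y z \<partial>lborel) \<partial>lborel \<partial>lborel)"
  proof (intro nn_integral_mono)
    fix x y :: "real^'n"
    show "ennreal (F x) * ennreal (G y) * indicator (sup_cube x l) y \<le> (\<integral>\<^sup>+z. ?c * ?H x y z \<partial>lborel)"
    proof (cases "y \<in> sup_cube x l")
      case True
      have "ennreal (F x) * ennreal (G y) * indicator (sup_cube x l) y = ?c * (ennreal (F x) * ennreal (G y)) * emeasure lborel (sup_cube x l)"
      proof -
        have "?c * ennreal ((2 * l) ^ ?n) = 1" using l by (simp add: ennreal_mult[symmetric])
        then show ?thesis using True l by (simp add: emeasure_sup_cube mult.assoc mult.left_commute)
      qed
      also have "\<dots> = (\<integral>\<^sup>+z. ?c * (ennreal (F x) * ennreal (G y)) * indicator (sup_cube x l) z \<partial>lborel)"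
        by (rule nn_integral_cmult_indicator[symmetric]) simp
      also have "\<dots> \<le> (\<integral>\<^sup>+z. ?c * ?H x y z \<partial>lborel)"
      proof (rule nn_integral_mono)
        fix z
        show "?c * (ennreal (F x) * ennreal (G y)) * indicator (sup_cube x l) z \<le> ?c * ?H x y z"
        proof (cases "z \<in> sup_cube x l")
          case z: True
          have "\<bar>x $ i - z $ i\<bar> \<le> 2 * l" "\<bar>y $ i - z $ i\<bar> \<le> 2 * l" for i
          proof -
            have "\<bar>z $ i - x $ i\<bar> \<le> l" "\<bar>y $ i - x $ i\<bar> \<le> l" using z True by (auto simp: sup_cube_def)
            then show "\<bar>x $ i - z $ i\<bar> \<le> 2 * l" "\<bar>y $ i - z $ i\<bar> \<le> 2 * l" using l by linarith+
          qed
          then have "x \<in> sup_cube z (2 * l)" "y \<in> sup_cube z (2 * l)" by (auto simp: sup_cube_def)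
          then show ?thesis using z by (simp add: mult.assoc)
        qed simp
      qed
      finally show ?thesis .
    qed simp
  qed
  also have "\<dots> = (\<integral>\<^sup>+x. \<integral>\<^sup>+z. \<integral>\<^sup>+y. ?c * ?H x y z \<partial>lborel \<partial>lborel \<partial>lborel)"
    unfolding ind by (intro nn_integral_cong lborel_pair.Fubini') (unfold case_prod_beta', measurable)
  also have "\<dots> = (\<integral>\<^sup>+z. \<integral>\<^sup>+x. \<integral>\<^sup>+y. ?c * ?H x y z \<partial>lborel \<partial>lborel \<partial>lborel)"
    unfolding ind by (intro lborel_pair.Fubini') (unfold case_prod_beta', measurable)
  also have "\<dots> = (\<integral>\<^sup>+z. ?c * ((\<integral>\<^sup>+x. ennreal (F x) * indicator (sup_cube z (2 * l)) x \<partial>lborel) *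
      (\<integral>\<^sup>+y. ennreal (G y) * indicator (sup_cube z (2 * l)) y \<partial>lborel)) \<partial>lborel)"
    by (intro nn_integral_cong) (simp add: nn_integral_cmult nn_integral_multc)
  also have "\<dots> = (\<integral>\<^sup>+z. ennreal ((8 * l) ^ ?n) * ennreal (avg 1 (sup_cube z (2 * l)) F * avg 1 (sup_cube z (2 * l)) G) \<partial>lborel)"
  proof (rule nn_integral_cong)
    fix z
    have "(2 * (2 * l)) ^ ?n * (2 * (2 * l)) ^ ?n = (8 * l) ^ ?n * (2 * l) ^ ?n"
      unfolding power_mult_distrib[symmetric] by (simp add: mult.commute)
    moreover have "0 < (2 * l) ^ ?n" using l by simp
    ultimately have "1 / (2 * l) ^ ?n * (((2 * (2 * l)) ^ ?n * a) * ((2 * (2 * l)) ^ ?n * b)) = (8 * l) ^ ?n * (a * b)" for a b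
      by (simp add: divide_eq_eq mult_ac del: power_mult_distrib) (metis mult.assoc mult.commute)
    then show "?c * ((\<integral>\<^sup>+x. ennreal (F x) * indicator (sup_cube z (2 * l)) x \<partial>lborel) *
      (\<integral>\<^sup>+y. ennreal (G y) * indicator (sup_cube z (2 * l)) y \<partial>lborel)) =
      ennreal ((8 * l) ^ ?n) * ennreal (avg 1 (sup_cube z (2 * l)) F * avg 1 (sup_cube z (2 * l)) G)"
      using l by (simp only: nn_integral_eq_avg1[OF F, of "2 * l" z] nn_integral_eq_avg1[OF G, of "2 * l" z]
          ennreal_mult[symmetric] avg_nonneg mult_nonneg_nonneg zero_le_power zero_le_numeral less_imp_le zero_le_divide_1_iff mult_pos_pos zero_less_numeral)
  qed
  also have "\<dots> = ennreal ((8 * l) ^ ?n) * local_form 1 1 (2 * l) F G"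
    unfolding local_form_def by (rule nn_integral_cmult) measurable
  finally show ?thesis .
qed

section \<open>Bilinear forms localised in frequency\<close>

lemma borel_bounded_compact_restrict:
  assumes f: "borel_bounded_compact f" and h: "h \<in> borel_measurable borel" "\<And>x. h x = f x \<or> h x = 0"
  shows "borel_bounded_compact h"
proof -
  obtain B \<rho> where *: "f \<in> borel_measurable borel" "0 < B" "\<And>x. cmod (f x) \<le> B" "0 < \<rho>" "\<And>x. norm x > \<rho> \<Longrightarrow> f x = 0"
    using borel_bounded_compactE[OF f] by metis
  have "cmod (h x) \<le> B" for x using h(2)[of x] *(2) *(3)[of x] by auto
  moreover have "h x = 0" if "norm x > \<rho>" for x using h(2)[of x] *(5)[OF that] by auto
  ultimately show ?thesis
    unfolding borel_bounded_compact_def using h(1) by blast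
qed

lemma fourier_zero_AE:
  fixes f :: "real^'n::finite \<Rightarrow> complex"
  assumes [measurable]: "f \<in> borel_measurable borel" and "AE x in lborel. f x = 0"
  shows "fourier f \<xi> = 0"
  unfolding fourier_borel[OF assms(1)] by (rule integral_eq_zero_AE) (use assms(2) in eventually_elim, simp)

text \<open>The two halves of a splitting at height \<open>t\<close>: large values are controlled in
  L^1 and small values in L^2, each by the \<open>p\<close>-th power at the price of a power of
  \<open>t\<close>.\<close>

lemma cmod_split_le:
  fixes f :: "'a \<Rightarrow> complex"
  assumes "0 < t" "1 \<le> p" "p \<le> 2"
  shows "t < cmod z \<Longrightarrow> cmod z \<le> t powr (1 - p) * cmod z powr p"
    and "cmod z \<le> t \<Longrightarrow> (cmod z)\<^sup>2 \<le> t powr (2 - p) * cmod z powr p"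
proof -
  assume z: "t < cmod z"
  have "cmod z = cmod z powr (1 - p) * cmod z powr p"
    using z assms by (simp flip: powr_add)
  also have "\<dots> \<le> t powr (1 - p) * cmod z powr p"
    using z assms by (intro mult_right_mono powr_mono2') auto
  finally show "cmod z \<le> t powr (1 - p) * cmod z powr p" .
next
  assume z: "cmod z \<le> t"
  show "(cmod z)\<^sup>2 \<le> t powr (2 - p) * cmod z powr p"
  proof (cases "z = 0")
    case False
    have "(cmod z)\<^sup>2 = cmod z powr (2 - p) * cmod z powr p"
      using False by (simp flip: powr_add)
    also have "\<dots> \<le> t powr (2 - p) * cmod z powr p"
      using z assms by (intro mult_right_mono powr_mono2) auto
    finally show ?thesis .
  qed simp
qed

lemma two_pi_power_pos: "0 < (2 * pi) ^ k" "1 \<le> (2 * pi) ^ k"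
  using pi_gt3 one_le_power[of "2 * pi" k] by simp_all

text \<open>Splitting \<open>f\<close> at the height \<open>(S * V) powr (1 / p)\<close> balances the trivial bound for the
  \<open>L\<^sup>1\<close> part with Bessel's inequality for the \<open>L\<^sup>2\<close> part; this replaces Riesz--Thorin interpolation.\<close>

lemma fourier_local_L2:
  fixes f :: "real^'n::finite \<Rightarrow> complex"
  assumes f: "borel_bounded_compact f" and p: "1 \<le> p" "p \<le> 2" and \<rho>: "0 < \<rho>"
  defines "V \<equiv> (2 * \<rho>) ^ CARD('n)" and "S \<equiv> LINT x|lborel. cmod (f x) powr p"
  shows "(\<integral>\<^sup>+\<xi>. ennreal ((cmod (fourier f \<xi>))\<^sup>2) * indicator (sup_cube 0 \<rho>) \<xi> \<partial>lborel)
    \<le> ennreal (4 * (2 * pi) ^ CARD('n) * (S * V) powr (2 / p) / V)"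
proof -
  let ?c = "(2 * pi) ^ CARD('n)"
  have [measurable]: "f \<in> borel_measurable borel" using f by (simp add: borel_bounded_compact_def)
  have ip: "integrable lborel (\<lambda>x. cmod (f x) powr p)"
    by (rule test_fun_powr_integrable[OF test_fun_cmod[OF f]]) (use p in auto)
  have S0: "0 \<le> S" unfolding S_def by (intro integral_nonneg_AE) auto
  have V: "0 < V" using \<rho> by (simp add: V_def)
  show ?thesis
  proof (cases "S = 0")
    case True
    then have "AE x in lborel. cmod (f x) powr p = 0"
      unfolding S_def by (subst (asm) integral_nonneg_eq_0_iff_AE[OF ip]) auto
    then have "AE x in lborel. f x = 0" by eventually_elim (auto simp: powr_eq_0_iff)
    then show ?thesis by (simp add: fourier_zero_AE)
  next
    case False
    then have S: "0 < S" using S0 by simp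
    define t where "t = (S * V) powr (1 / p)"
    have t: "0 < t" using S V by (simp add: t_def)
    have tp: "t powr p = S * V" using S V p by (simp add: t_def powr_powr)
    have t2: "t\<^sup>2 = (S * V) powr (2 / p)"
      unfolding t_def using S V by (simp add: powr_powr flip: powr_realpow)
    define f1 where "f1 x = (if t < cmod (f x) then f x else 0)" for x
    define f2 where "f2 x = f x - f1 x" for x
    have [measurable]: "f1 \<in> borel_measurable borel" unfolding f1_def by measurable
    have [measurable]: "f2 \<in> borel_measurable borel" unfolding f2_def by measurable
    have f1: "borel_bounded_compact f1" by (rule borel_bounded_compact_restrict[OF f]) (auto simp: f1_def)
    have f2: "borel_bounded_compact f2" by (rule borel_bounded_compact_restrict[OF f]) (auto simp: f2_def f1_def)
    note i1 = borel_bounded_compact_integrable[OF f1] and i2 = borel_bounded_compact_integrable[OF f2]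
    have n1: "(LINT x|lborel. cmod (f1 x)) \<le> t powr (1 - p) * S"
      unfolding S_def Bochner_Integration.integral_mult_right_zero[symmetric]
    proof (rule integral_mono)
      show "cmod (f1 x) \<le> t powr (1 - p) * cmod (f x) powr p" for x
        using cmod_split_le(1)[OF t p, of "f x"] by (auto simp: f1_def)
    qed (use i1 ip in auto)
    have n2: "(\<integral>\<^sup>+x. ennreal ((cmod (f2 x))\<^sup>2) \<partial>lborel) \<le> ennreal (t powr (2 - p) * S)"
    proof -
      have "(\<integral>\<^sup>+x. ennreal ((cmod (f2 x))\<^sup>2) \<partial>lborel) \<le> (\<integral>\<^sup>+x. ennreal (t powr (2 - p) * cmod (f x) powr p) \<partial>lborel)"
        using cmod_split_le(2)[OF t p] by (intro nn_integral_mono ennreal_leI) (auto simp: f2_def f1_def)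
      also have "\<dots> = ennreal (LINT x|lborel. t powr (2 - p) * cmod (f x) powr p)"
        using ip by (intro nn_integral_eq_integral) auto
      finally show ?thesis by (simp add: S_def)
    qed
    have "fourier f \<xi> = fourier f1 \<xi> + fourier f2 \<xi>" for \<xi>
      using fourier_diff[OF borel_bounded_compact_integrable[OF f] i1, of \<xi>] by (simp add: f2_def[abs_def])
    then have sq: "(cmod (fourier f \<xi>))\<^sup>2 \<le> 2 * (cmod (fourier f1 \<xi>))\<^sup>2 + 2 * (cmod (fourier f2 \<xi>))\<^sup>2" for \<xi>
      using power_mono[OF norm_triangle_ineq[of "fourier f1 \<xi>" "fourier f2 \<xi>"], of 2]
        sum_squares_bound[of "cmod (fourier f1 \<xi>)" "cmod (fourier f2 \<xi>)"] by (simp add: power2_sum)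
    have "(\<integral>\<^sup>+\<xi>. ennreal ((cmod (fourier f \<xi>))\<^sup>2) * indicator (sup_cube 0 \<rho>) \<xi> \<partial>lborel)
      \<le> (\<integral>\<^sup>+\<xi>. ennreal (2 * (t powr (1 - p) * S)\<^sup>2) * indicator (sup_cube 0 \<rho>) \<xi> + 2 * ennreal ((cmod (fourier f2 \<xi>))\<^sup>2) \<partial>lborel)"
    proof (rule nn_integral_mono)
      fix \<xi> :: "real^'n"
      have "(cmod (fourier f1 \<xi>))\<^sup>2 \<le> (t powr (1 - p) * S)\<^sup>2"
        using norm_fourier_le[OF i1, of \<xi>] n1 by (intro power_mono) auto
      then have "ennreal ((cmod (fourier f \<xi>))\<^sup>2) \<le> ennreal (2 * (t powr (1 - p) * S)\<^sup>2 + 2 * (cmod (fourier f2 \<xi>))\<^sup>2)"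
        using sq[of \<xi>] by (intro ennreal_leI) linarith
      also have "\<dots> = ennreal (2 * (t powr (1 - p) * S)\<^sup>2) + 2 * ennreal ((cmod (fourier f2 \<xi>))\<^sup>2)"
        by (simp add: ennreal_mult)
      finally show "ennreal ((cmod (fourier f \<xi>))\<^sup>2) * indicator (sup_cube 0 \<rho>) \<xi> \<le>
        ennreal (2 * (t powr (1 - p) * S)\<^sup>2) * indicator (sup_cube 0 \<rho>) \<xi> + 2 * ennreal ((cmod (fourier f2 \<xi>))\<^sup>2)"
        by (auto simp: indicator_def)
    qed
    also have "\<dots> = ennreal (2 * (t powr (1 - p) * S)\<^sup>2) * ennreal V + 2 * (\<integral>\<^sup>+\<xi>. ennreal ((cmod (fourier f2 \<xi>))\<^sup>2) \<partial>lborel)"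
      using \<rho> by (simp add: nn_integral_add nn_integral_cmult nn_integral_cmult_indicator emeasure_sup_cube V_def)
    also have "\<dots> \<le> ennreal (2 * (t powr (1 - p) * S)\<^sup>2) * ennreal V + 2 * (ennreal ?c * ennreal (t powr (2 - p) * S))"
      by (intro add_left_mono mult_left_mono order_trans[OF bessel_inequality[OF i2]] n2) auto
    also have "\<dots> = ennreal (2 * ((t powr (1 - p) * S)\<^sup>2 * V) + 2 * (?c * (t powr (2 - p) * S)))"
      using V S two_pi_power_pos[of "CARD('n)"] by (simp add: ennreal_mult mult.assoc)
    also have "\<dots> \<le> ennreal (4 * ?c * (S * V) powr (2 / p) / V)"
    proof (rule ennreal_leI)
      \<comment> \<open>Because \<open>t powr p = S * V\<close>, the squared L^1 bound times the
        volume \<open>V\<close> and the L^2 bound are both multiples of t^2 / V.\<close>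
      have a: "t powr (1 - p) * S = t / V" and b: "t powr (2 - p) * S = t\<^sup>2 / V"
        using t S V by (simp_all add: powr_diff tp field_simps)
      have "2 * ((t powr (1 - p) * S)\<^sup>2 * V) + 2 * (?c * (t powr (2 - p) * S)) = 2 * (t\<^sup>2 / V) + 2 * ?c * (t\<^sup>2 / V)"
        unfolding a b using V by (simp add: power2_eq_square)
      also have "\<dots> \<le> 2 * ?c * (t\<^sup>2 / V) + 2 * ?c * (t\<^sup>2 / V)"
        using two_pi_power_pos(2)[of "CARD('n)"] V by (intro add_right_mono mult_right_mono) auto
      finally show "2 * ((t powr (1 - p) * S)\<^sup>2 * V) + 2 * (?c * (t powr (2 - p) * S)) \<le> 4 * ?c * (S * V) powr (2 / p) / V"
        by (simp add: t2 mult_ac)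
    qed
    finally show ?thesis .
  qed
qed

text \<open>By Parseval's identity this is (2 pi)^n times the pairing of \<open>g\<close> with the
  image of \<open>f\<close> under the operator with multiplier \<open>w\<close>.\<close>

definition freq_form :: "(real^'n::finite \<Rightarrow> complex) \<Rightarrow> (real^'n \<Rightarrow> complex) \<Rightarrow> (real^'n \<Rightarrow> complex) \<Rightarrow> complex" where
  "freq_form w f g = (LINT \<xi>|lborel. w \<xi> * fourier f \<xi> * cnj (fourier g \<xi>))"

text \<open>Cauchy-Schwarz on the frequency cube that carries \<open>w\<close>, followed by
  \<open>fourier_local_L2\<close> for each factor. Each of the two bounds contributes the square
  root of 1 / V.\<close>

lemma freq_form_bound:
  fixes f g w :: "real^'n::finite \<Rightarrow> complex"
  assumes f: "borel_bounded_compact f" and g: "borel_bounded_compact g"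
    and w: "\<And>\<xi>. cmod (w \<xi>) \<le> D" "\<And>\<xi> j. \<bar>\<xi> $ j\<bar> > \<rho> \<Longrightarrow> w \<xi> = 0" and \<rho>: "0 < \<rho>"
    and p: "1 \<le> p" "p \<le> 2" and q: "1 \<le> q" "q \<le> 2"
  defines "V \<equiv> (2 * \<rho>) ^ CARD('n)"
  shows "cmod (freq_form w f g) \<le> 4 * (2 * pi) ^ CARD('n) * D *
    ((LINT x|lborel. cmod (f x) powr p) * V) powr (1 / p) * ((LINT x|lborel. cmod (g x) powr q) * V) powr (1 / q) / V"
proof -
  let ?S = "(LINT x|lborel. cmod (f x) powr p) * V" and ?T = "(LINT x|lborel. cmod (g x) powr q) * V"
  let ?c = "4 * (2 * pi) ^ CARD('n)"
  let ?I = "\<lambda>\<xi>. indicator (sup_cube 0 \<rho>) \<xi> :: complex"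
  have V: "0 < V" using \<rho> by (simp add: V_def)
  have S: "0 \<le> ?S" "0 \<le> ?T" using V by (auto intro!: mult_nonneg_nonneg integral_nonneg_AE)
  have D: "0 \<le> D" using w(1)[of 0] norm_ge_zero[of "w 0"] by linarith
  have [measurable]: "f \<in> borel_measurable borel" "g \<in> borel_measurable borel"
    using f g by (auto simp: borel_bounded_compact_def)
  have "ennreal (cmod (freq_form w f g)) \<le> (\<integral>\<^sup>+\<xi>. ennreal (cmod (w \<xi> * fourier f \<xi> * cnj (fourier g \<xi>))) \<partial>lborel)"
    unfolding freq_form_def by (rule norm_integral_le_nn_integral)
  also have "\<dots> \<le> (\<integral>\<^sup>+\<xi>. ennreal D * ennreal (cmod ((fourier f \<xi> * ?I \<xi>) * (fourier g \<xi> * ?I \<xi>))) \<partial>lborel)"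
  proof (rule nn_integral_mono)
    fix \<xi> :: "real^'n"
    show "ennreal (cmod (w \<xi> * fourier f \<xi> * cnj (fourier g \<xi>))) \<le> ennreal D * ennreal (cmod ((fourier f \<xi> * ?I \<xi>) * (fourier g \<xi> * ?I \<xi>)))"
    proof (cases "\<xi> \<in> sup_cube 0 \<rho>")
      case True
      then show ?thesis using w(1)[of \<xi>] D
        by (simp add: norm_mult mult.assoc ennreal_mult[symmetric] ennreal_leI mult_right_mono)
    next
      case False
      then obtain j where "\<bar>\<xi> $ j\<bar> > \<rho>" by (auto simp: sup_cube_def not_le)
      then show ?thesis using w(2) by simp
    qed
  qed
  also have "\<dots> = ennreal D * (\<integral>\<^sup>+\<xi>. ennreal (cmod ((fourier f \<xi> * ?I \<xi>) * (fourier g \<xi> * ?I \<xi>))) \<partial>lborel)"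
    by (rule nn_integral_cmult) measurable
  finally have le: "ennreal (cmod (freq_form w f g)) \<le> ennreal D * (\<integral>\<^sup>+\<xi>. ennreal (cmod ((fourier f \<xi> * ?I \<xi>) * (fourier g \<xi> * ?I \<xi>))) \<partial>lborel)" .
  have fI: "(\<lambda>\<xi>. fourier h \<xi> * ?I \<xi>) \<in> borel_measurable lborel" if "h \<in> borel_measurable borel" for h :: "real^'n \<Rightarrow> complex"
    using fourier_measurable[OF that] by (intro borel_measurable_times) auto
  note CS = Cauchy_Schwarz_complex[OF fI fI, of f g]
  note CS = CS[OF \<open>f \<in> borel_measurable borel\<close> \<open>g \<in> borel_measurable borel\<close>]
  have "(ennreal (cmod (freq_form w f g)))\<^sup>2 \<le> (ennreal D * (\<integral>\<^sup>+\<xi>. ennreal (cmod ((fourier f \<xi> * ?I \<xi>) * (fourier g \<xi> * ?I \<xi>))) \<partial>lborel))\<^sup>2"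
    by (rule power_mono[OF le]) simp
  also have "\<dots> \<le> (ennreal D)\<^sup>2 * ((\<integral>\<^sup>+\<xi>. ennreal ((cmod (fourier f \<xi> * ?I \<xi>))\<^sup>2) \<partial>lborel) * (\<integral>\<^sup>+\<xi>. ennreal ((cmod (fourier g \<xi> * ?I \<xi>))\<^sup>2) \<partial>lborel))"
    unfolding power_mult_distrib[of "ennreal D"]
    by (rule mult_left_mono[OF CS]) simp
  also have "\<dots> \<le> (ennreal D)\<^sup>2 * (ennreal (?c * ?S powr (2 / p) / V) * ennreal (?c * ?T powr (2 / q) / V))"
  proof (intro mult_left_mono mult_mono)
    have eq: "(\<integral>\<^sup>+\<xi>. ennreal ((cmod (fourier h \<xi> * ?I \<xi>))\<^sup>2) \<partial>lborel) =
       (\<integral>\<^sup>+\<xi>. ennreal ((cmod (fourier h \<xi>))\<^sup>2) * indicator (sup_cube 0 \<rho>) \<xi> \<partial>lborel)" for h :: "real^'n \<Rightarrow> complex"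
      by (intro nn_integral_cong) (auto simp: indicator_def)
    show "(\<integral>\<^sup>+\<xi>. ennreal ((cmod (fourier f \<xi> * ?I \<xi>))\<^sup>2) \<partial>lborel) \<le> ennreal (?c * ?S powr (2 / p) / V)"
      unfolding eq V_def by (rule fourier_local_L2[OF f p \<rho>])
    show "(\<integral>\<^sup>+\<xi>. ennreal ((cmod (fourier g \<xi> * ?I \<xi>))\<^sup>2) \<partial>lborel) \<le> ennreal (?c * ?T powr (2 / q) / V)"
      unfolding eq V_def by (rule fourier_local_L2[OF g q \<rho>])
  qed auto
  also have "\<dots> = ennreal ((?c * D * ?S powr (1 / p) * ?T powr (1 / q) / V)\<^sup>2)"
  proof -
    have sq: "a powr (2 / r) = (a powr (1 / r))\<^sup>2" if "0 \<le> a" for a r :: real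
      using that by (cases "a = 0") (simp_all add: powr_powr flip: powr_realpow)
    have "D\<^sup>2 * ((?c * ?S powr (2 / p) / V) * (?c * ?T powr (2 / q) / V)) = (?c * D * ?S powr (1 / p) * ?T powr (1 / q) / V)\<^sup>2"
      unfolding sq[OF S(1)] sq[OF S(2)] by (simp add: power_mult_distrib power_divide power2_eq_square)
    moreover have "0 \<le> ?c * ?S powr (2 / p) / V" "0 \<le> ?c * ?T powr (2 / q) / V"
      using V two_pi_power_pos(1)[of "CARD('n)"] by auto
    ultimately show ?thesis using D by (simp only: ennreal_power ennreal_mult[symmetric] zero_le_power2 mult_nonneg_nonneg)
  qed
  finally have "(cmod (freq_form w f g))\<^sup>2 \<le> (?c * D * ?S powr (1 / p) * ?T powr (1 / q) / V)\<^sup>2"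
    by (subst (asm) ennreal_power) (auto simp: ennreal_le_iff)
  then show ?thesis
    by (rule power2_le_imp_le) (use D V two_pi_power_pos(1)[of "CARD('n)"] in auto)
qed

section \<open>Half-open cubes and lattice cells\<close>

definition hcube :: "real^'n::finite \<Rightarrow> real \<Rightarrow> (real^'n) set" where
  "hcube a l = {x. \<forall>i. a $ i \<le> x $ i \<and> x $ i < a $ i + l}"

lemma hcube_measurable [measurable]: "hcube (a :: real^'n::finite) l \<in> sets borel"
proof -
  have "Measurable.pred borel (\<lambda>x::real^'n. \<forall>i. a $ i \<le> x $ i \<and> x $ i < a $ i + l)" by measurable
  then show ?thesis unfolding hcube_def by (simp add: pred_def)
qed

lemma emeasure_cart_boxes:
  fixes a :: "real^'n::finite"
  assumes "0 < l"
  shows "emeasure lborel (box a (\<chi> i. a $ i + l)) = ennreal (l ^ CARD('n))"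
    "emeasure lborel (cbox a (\<chi> i. a $ i + l)) = ennreal (l ^ CARD('n))"
  using assms
  by (simp_all add: emeasure_lborel_cbox_eq emeasure_lborel_box_eq Basis_vec_def inner_axis prod.UNION_disjoint
      prod.reindex inj_on_def axis_eq_axis cart_eq_inner_axis[symmetric] prod_constant)

lemma emeasure_hcube:
  fixes a :: "real^'n::finite"
  assumes "0 < l"
  shows "emeasure lborel (hcube a l) = ennreal (l ^ CARD('n))"
proof (rule antisym)
  have "emeasure lborel (hcube a l) \<le> emeasure lborel (cbox a (\<chi> i. a $ i + l))"
    by (rule emeasure_mono) (auto simp: hcube_def mem_box_cart less_imp_le)
  then show "emeasure lborel (hcube a l) \<le> ennreal (l ^ CARD('n))"
    using emeasure_cart_boxes[OF assms, of a] by simp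
  have "emeasure lborel (box a (\<chi> i. a $ i + l)) \<le> emeasure lborel (hcube a l)"
    by (rule emeasure_mono) (auto simp: hcube_def mem_box_cart less_imp_le)
  then show "ennreal (l ^ CARD('n)) \<le> emeasure lborel (hcube a l)"
    using emeasure_cart_boxes[OF assms, of a] by simp
qed

lemma measure_hcube: "0 < l \<Longrightarrow> measure lborel (hcube (a :: real^'n::finite) l) = l ^ CARD('n)"
  by (simp add: measure_def emeasure_hcube)

text \<open>A tiling of space by cubes of arbitrary side \<open>l\<close>, used only to localise a
  single piece; it is unrelated to the dyadic grid of the sparse family.\<close>

definition cell :: "real \<Rightarrow> int^'n::finite \<Rightarrow> (real^'n) set" where
  "cell l v = hcube (\<chi> i. l * of_int (v $ i)) l"

lemma mem_cell_iff:
  assumes "0 < l"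
  shows "x \<in> cell l v \<longleftrightarrow> v = (\<chi> i. \<lfloor>x $ i / l\<rfloor>)"
proof -
  have "l * of_int k \<le> y \<and> y < l * of_int k + l \<longleftrightarrow> k = \<lfloor>y / l\<rfloor>" for k :: int and y
    using assms by (subst eq_commute) (simp add: floor_eq_iff field_simps)
  then show ?thesis by (simp add: cell_def hcube_def vec_eq_iff)
qed

lemma finite_bounded_int_vec:
  assumes "finite A"
  shows "finite {v :: int^'n::finite. \<forall>i. v $ i \<in> A}"
proof (rule finite_subset)
  show "{v :: int^'n. \<forall>i. v $ i \<in> A} \<subseteq> vec_lambda ` (Pi\<^sub>E UNIV (\<lambda>_. A))"
  proof
    fix v :: "int^'n" assume "v \<in> {v. \<forall>i. v $ i \<in> A}"
    then have "v = vec_lambda (\<lambda>i. v $ i)" "(\<lambda>i. v $ i) \<in> Pi\<^sub>E UNIV (\<lambda>_. A)" by auto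
    then show "v \<in> vec_lambda ` (Pi\<^sub>E UNIV (\<lambda>_. A))" by blast
  qed
  show "finite (vec_lambda ` (Pi\<^sub>E UNIV (\<lambda>_. A)) :: (int^'n) set)"
    using assms by (intro finite_imageI finite_PiE) auto
qed

lemma cell_support:
  fixes f :: "real^'n::finite \<Rightarrow> complex"
  assumes f: "borel_bounded_compact f" and l: "0 < l"
  obtains A :: "(int^'n) set" where "finite A" "\<And>x. f x \<noteq> 0 \<Longrightarrow> (\<chi> i. \<lfloor>x $ i / l\<rfloor>) \<in> A"
proof -
  obtain \<rho> where \<rho>: "\<And>x. norm x > \<rho> \<Longrightarrow> f x = 0" using f by (auto simp: borel_bounded_compact_def)
  show ?thesis
  proof
    show "finite {v :: int^'n. \<forall>i. v $ i \<in> {- \<lceil>\<rho> / l\<rceil> - 1..\<lceil>\<rho> / l\<rceil>}}" by (intro finite_bounded_int_vec) auto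
    fix x assume "f x \<noteq> 0"
    then have "norm x \<le> \<rho>" using \<rho>[of x] by force
    then have "\<bar>x $ i\<bar> \<le> \<rho>" for i using component_le_norm_cart[of x i] by linarith
    then have "- (\<rho> / l) \<le> x $ i / l" "x $ i / l \<le> \<rho> / l" for i
      using l by (auto simp: abs_le_iff field_simps minus_le_iff)
    then have "- \<lceil>\<rho> / l\<rceil> - 1 \<le> \<lfloor>x $ i / l\<rfloor>" "\<lfloor>x $ i / l\<rfloor> \<le> \<lceil>\<rho> / l\<rceil>" for i
      by (smt (verit, best) ceiling_correct floor_correct le_floor_iff of_int_minus of_int_1 of_int_diff of_int_le_iff)+
    then show "(\<chi> i. \<lfloor>x $ i / l\<rfloor>) \<in> {v. \<forall>i. v $ i \<in> {- \<lceil>\<rho> / l\<rceil> - 1..\<lceil>\<rho> / l\<rceil>}}" by simp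
  qed
qed

section \<open>Near and far interactions of a frequency piece\<close>

lemma integrable_freq_form:
  assumes "integrable lborel w" "borel_bounded_compact f" "borel_bounded_compact g"
  shows "integrable lborel (\<lambda>\<xi>. w \<xi> * fourier f \<xi> * cnj (fourier g \<xi>))"
proof -
  note i = borel_bounded_compact_integrable
  have [measurable]: "f \<in> borel_measurable borel" "g \<in> borel_measurable borel"
    using assms by (auto simp: borel_bounded_compact_def)
  show ?thesis
    by (intro integrable_mult_bounded[OF integrable_mult_bounded[OF assms(1)]])
       (auto intro: norm_fourier_le[OF i[OF assms(2)]] norm_fourier_le[OF i[OF assms(3)]])
qed

lemma freq_form_diff_right:
  assumes w: "integrable lborel w" and "borel_bounded_compact f" "borel_bounded_compact g" "borel_bounded_compact h"
  shows "freq_form w f (\<lambda>x. g x - h x) = freq_form w f g - freq_form w f h"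
proof -
  have "fourier (\<lambda>x. g x - h x) \<xi> = fourier g \<xi> - fourier h \<xi>" for \<xi>
    by (intro fourier_diff borel_bounded_compact_integrable assms)
  then have "freq_form w f (\<lambda>x. g x - h x) =
    (LINT \<xi>|lborel. w \<xi> * fourier f \<xi> * cnj (fourier g \<xi>) - w \<xi> * fourier f \<xi> * cnj (fourier h \<xi>))"
    by (simp add: freq_form_def right_diff_distrib)
  also have "\<dots> = freq_form w f g - freq_form w f h"
    unfolding freq_form_def by (intro Bochner_Integration.integral_diff integrable_freq_form assms)
  finally show ?thesis .
qed

lemma freq_form_sum_left:
  fixes f :: "'a \<Rightarrow> real^'n::finite \<Rightarrow> complex"
  assumes w: "integrable lborel w" and "finite A" and f: "\<And>v. v \<in> A \<Longrightarrow> borel_bounded_compact (f v)" and g: "borel_bounded_compact g"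
  shows "freq_form w (\<lambda>x. \<Sum>v\<in>A. f v x) g = (\<Sum>v\<in>A. freq_form w (f v) g)"
proof -
  have m: "f v \<in> borel_measurable borel" if "v \<in> A" for v using f[OF that] by (simp add: borel_bounded_compact_def)
  have "fourier (\<lambda>x. \<Sum>v\<in>A. f v x) \<xi> = (\<Sum>v\<in>A. fourier (f v) \<xi>)" for \<xi>
  proof -
    have "fourier (\<lambda>x. \<Sum>v\<in>A. f v x) \<xi> = (LINT x|lborel. (\<Sum>v\<in>A. cis (- (\<xi> \<bullet> x)) * f v x))"
      using m by (subst fourier_borel) (auto simp: sum_distrib_left)
    also have "\<dots> = (\<Sum>v\<in>A. LINT x|lborel. cis (- (\<xi> \<bullet> x)) * f v x)"
      by (intro Bochner_Integration.integral_sum integrable_cis_mult borel_bounded_compact_integrable f) auto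
    also have "\<dots> = (\<Sum>v\<in>A. fourier (f v) \<xi>)" using m by (intro sum.cong) (auto simp: fourier_borel)
    finally show ?thesis .
  qed
  then have "freq_form w (\<lambda>x. \<Sum>v\<in>A. f v x) g = (LINT \<xi>|lborel. (\<Sum>v\<in>A. w \<xi> * fourier (f v) \<xi> * cnj (fourier g \<xi>)))"
    by (simp add: freq_form_def sum_distrib_left sum_distrib_right)
  also have "\<dots> = (\<Sum>v\<in>A. freq_form w (f v) g)"
    unfolding freq_form_def by (intro Bochner_Integration.integral_sum integrable_freq_form w f g)
  finally show ?thesis .
qed

lemma freq_form_kernel_bound:
  fixes f g w :: "real^'n::finite \<Rightarrow> complex"
  assumes w: "integrable lborel w" and f: "borel_bounded_compact f" and g: "borel_bounded_compact g"
  shows "ennreal (cmod (freq_form w f g)) \<le>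
    (\<integral>\<^sup>+x. \<integral>\<^sup>+y. ennreal (cmod (f x)) * (ennreal (cmod (g y)) * ennreal (cmod (inv_kernel w (y - x)))) \<partial>lborel \<partial>lborel)"
proof -
  note i = borel_bounded_compact_integrable[OF f] borel_bounded_compact_integrable[OF g]
  have [measurable]: "f \<in> borel_measurable borel" "g \<in> borel_measurable borel" "w \<in> borel_measurable borel" using i w by auto
  have [measurable]: "inv_kernel w \<in> borel_measurable borel"
    unfolding inv_kernel_def[abs_def]
    by (rule lborel.borel_measurable_lebesgue_integral) (unfold case_prod_beta', measurable)
  have "ennreal (cmod (freq_form w f g)) \<le> (\<integral>\<^sup>+x. ennreal (cmod (f x * (LINT y|lborel. cnj (g y) * inv_kernel w (y - x)))) \<partial>lborel)"
    unfolding freq_form_def fourier_pairing_kernel[OF i w] by (rule norm_integral_le_nn_integral)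
  also have "\<dots> \<le> (\<integral>\<^sup>+x. \<integral>\<^sup>+y. ennreal (cmod (f x)) * (ennreal (cmod (g y)) * ennreal (cmod (inv_kernel w (y - x)))) \<partial>lborel \<partial>lborel)"
  proof (rule nn_integral_mono)
    fix x
    have "ennreal (cmod (f x * (LINT y|lborel. cnj (g y) * inv_kernel w (y - x)))) =
       ennreal (cmod (f x)) * ennreal (cmod (LINT y|lborel. cnj (g y) * inv_kernel w (y - x)))"
      by (simp add: norm_mult ennreal_mult)
    also have "\<dots> \<le> ennreal (cmod (f x)) * (\<integral>\<^sup>+y. ennreal (cmod (cnj (g y) * inv_kernel w (y - x))) \<partial>lborel)"
      by (intro mult_left_mono norm_integral_le_nn_integral) auto
    also have "\<dots> = (\<integral>\<^sup>+y. ennreal (cmod (f x)) * ennreal (cmod (cnj (g y) * inv_kernel w (y - x))) \<partial>lborel)"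
      by (rule nn_integral_cmult[symmetric]) measurable
    finally show "ennreal (cmod (f x * (LINT y|lborel. cnj (g y) * inv_kernel w (y - x)))) \<le>
       (\<integral>\<^sup>+y. ennreal (cmod (f x)) * (ennreal (cmod (g y)) * ennreal (cmod (inv_kernel w (y - x)))) \<partial>lborel)"
      by (simp add: norm_mult ennreal_mult)
  qed
  finally show ?thesis .
qed

text \<open>The decay is applied in the coordinate where \<open>y - x\<close> is largest, which
  turns it into decay in the sup distance; \<open>h\<close> is the dyadic size of that distance
  relative to \<open>L\<close>.\<close>

lemma far_kernel_dyadic:
  fixes x y :: "real^'n::finite"
  assumes L: "0 < L" and K: "\<And>z i. L \<le> \<bar>z $ i\<bar> \<Longrightarrow> cmod (k z) \<le> K / \<bar>z $ i\<bar> ^ N" "0 \<le> K"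
    and y: "L \<le> \<bar>y $ i - x $ i\<bar>"
  shows "\<exists>h::nat. cmod (k (y - x)) \<le> K / (2 ^ h * L) ^ N \<and> y \<in> sup_cube x (2 ^ (h + 1) * L)"
proof -
  define M where "M = Max (range (\<lambda>j. \<bar>(y - x) $ j\<bar>))"
  have M: "\<bar>(y - x) $ j\<bar> \<le> M" for j unfolding M_def by (intro Max_ge) auto
  have "M \<in> range (\<lambda>j. \<bar>(y - x) $ j\<bar>)" unfolding M_def by (intro Max_in) auto
  then obtain j where j: "M = \<bar>(y - x) $ j\<bar>" by auto
  have MgeL: "L \<le> M" using M[of i] y by simp
  define h where "h = nat \<lfloor>log 2 (M / L)\<rfloor>"
  have "0 \<le> \<lfloor>log 2 (M / L)\<rfloor>" using MgeL L by (simp add: zero_le_log_cancel_iff)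
  then have h: "real h \<le> log 2 (M / L)" "log 2 (M / L) < real h + 1" unfolding h_def by linarith+
  have pos: "0 < M / L" using MgeL L by simp
  have "2 ^ h \<le> M / L" using h(1) pos by (simp add: le_log_iff powr_realpow)
  moreover have "M / L < 2 ^ (h + 1)"
    using h(2) pos by (simp add: log_less_iff powr_add powr_realpow)
  ultimately have h': "2 ^ h * L \<le> M" "M \<le> 2 ^ (h + 1) * L" using L by (simp_all add: field_simps)
  have "cmod (k (y - x)) \<le> K / M ^ N" using K(1)[of "y - x" j] MgeL j by simp
  also have "\<dots> \<le> K / (2 ^ h * L) ^ N" using h'(1) L K(2) MgeL by (intro divide_left_mono power_mono) auto
  finally show ?thesis using M h'(2) by (intro exI[of _ h]) (auto simp: sup_cube_def intro: order_trans)
qed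

text \<open>For each \<open>y\<close> in the cell, the cube of radius \<open>2 * L\<close> about
  \<open>y\<close> contains the supports of \<open>f'\<close> and \<open>g'\<close>. The frequency
  bound therefore holds with the averages at any such \<open>y\<close>, and averaging it over the
  cell produces the integral on the right.\<close>

lemma near_bound:
  fixes f g w :: "real^'n::finite \<Rightarrow> complex"
  assumes f: "borel_bounded_compact f" and g: "borel_bounded_compact g"
    and w: "\<And>\<xi>. cmod (w \<xi>) \<le> D" "\<And>\<xi> j. \<bar>\<xi> $ j\<bar> > \<rho> \<Longrightarrow> w \<xi> = 0" and \<rho>: "0 < \<rho>" and L: "0 < L"
    and p: "1 \<le> p" "p \<le> 2" and q: "1 \<le> q" "q \<le> 2"
    and f': "borel_bounded_compact f'" "\<And>x. cmod (f' x) \<le> (if x \<in> cell L v then cmod (f x) else 0)"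
    and g': "borel_bounded_compact g'" "\<And>x y. y \<in> cell L v \<Longrightarrow> cmod (g' x) \<le> (if x \<in> sup_cube y (2 * L) then cmod (g x) else 0)"
  shows "ennreal (cmod (freq_form w f' g')) \<le>
    ennreal (4 * (2 * pi) ^ CARD('n) * D * 4 ^ CARD('n) * ((4 * L) ^ CARD('n) * (2 * \<rho>) ^ CARD('n)) powr (1 / p + 1 / q - 1)) *
    (\<integral>\<^sup>+x. ennreal (avg p (sup_cube x (2 * L)) (\<lambda>x. cmod (f x)) * avg q (sup_cube x (2 * L)) (\<lambda>x. cmod (g x))) * indicator (cell L v) x \<partial>lborel)"
proof -
  let ?n = "CARD('n)"
  define V where "V = (2 * \<rho>) ^ ?n"
  define \<mu> where "\<mu> = (4 * L) ^ ?n"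
  define c where "c = 4 * (2 * pi) ^ ?n * D"
  let ?F = "\<lambda>x. cmod (f x)" and ?G = "\<lambda>x. cmod (g x)"
  let ?a = "\<lambda>x. avg p (sup_cube x (2 * L)) ?F" and ?b = "\<lambda>x. avg q (sup_cube x (2 * L)) ?G"
  have V: "0 < V" and \<mu>: "0 < \<mu>" using \<rho> L by (auto simp: V_def \<mu>_def)
  have D: "0 \<le> D" using w(1)[of 0] norm_ge_zero[of "w 0"] by linarith
  have c: "0 \<le> c" using D by (simp add: c_def)
  note tf = test_fun_cmod[OF f] test_fun_cmod[OF g] test_fun_cmod[OF f'(1)] test_fun_cmod[OF g'(1)]
  have [measurable]: "?F \<in> borel_measurable borel" "?G \<in> borel_measurable borel"
    using tf by (auto intro: test_fun_measurable)
  have m: "measure lborel (sup_cube x (2 * L)) = \<mu>" for x :: "real^'n"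
    using L by (simp add: measure_sup_cube \<mu>_def)
  have S: "((LINT x|lborel. cmod (h' x) powr r) * V) powr (1 / r) \<le> (\<mu> * V) powr (1 / r) * avg r (sup_cube y (2 * L)) (\<lambda>x. cmod (h x))"
    if r: "1 \<le> r" and h: "borel_bounded_compact h" "borel_bounded_compact h'"
      "\<And>x. cmod (h' x) \<le> (if x \<in> sup_cube y (2 * L) then cmod (h x) else 0)" for r and h h' :: "real^'n \<Rightarrow> complex" and y
  proof -
    have "(LINT x|lborel. cmod (h' x) powr r) \<le> (LINT x|lborel. indicator (sup_cube y (2 * L)) x * cmod (h x) powr r)"
    proof (rule integral_mono)
      show "integrable lborel (\<lambda>x. cmod (h' x) powr r)" using r by (intro test_fun_powr_integrable test_fun_cmod h) auto
      show "integrable lborel (\<lambda>x. indicator (sup_cube y (2 * L)) x * cmod (h x) powr r)"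
        using r by (intro test_fun_powr_integrable_on test_fun_cmod h) auto
      show "cmod (h' x) powr r \<le> indicator (sup_cube y (2 * L)) x * cmod (h x) powr r" for x
        using h(3)[of x] r by (cases "x \<in> sup_cube y (2 * L)") (auto intro: powr_mono2)
    qed
    also have "\<dots> = \<mu> * avg r (sup_cube y (2 * L)) (\<lambda>x. cmod (h x)) powr r"
      using r \<mu> by (subst avg_powr[symmetric]) (auto simp: m)
    finally have "(LINT x|lborel. cmod (h' x) powr r) * V \<le> \<mu> * avg r (sup_cube y (2 * L)) (\<lambda>x. cmod (h x)) powr r * V"
      using V by (intro mult_right_mono) auto
    then have "(LINT x|lborel. cmod (h' x) powr r) * V \<le> (\<mu> * V) * avg r (sup_cube y (2 * L)) (\<lambda>x. cmod (h x)) powr r"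
      by (simp add: mult_ac)
    then have "((LINT x|lborel. cmod (h' x) powr r) * V) powr (1 / r) \<le> ((\<mu> * V) * avg r (sup_cube y (2 * L)) (\<lambda>x. cmod (h x)) powr r) powr (1 / r)"
      using V r by (intro powr_mono2) (auto intro!: mult_nonneg_nonneg integral_nonneg_AE)
    also have "\<dots> = (\<mu> * V) powr (1 / r) * avg r (sup_cube y (2 * L)) (\<lambda>x. cmod (h x))"
      using \<mu> V r avg_nonneg[of r "sup_cube y (2 * L)" "\<lambda>x. cmod (h x)"] by (simp add: powr_mult powr_powr)
    finally show ?thesis .
  qed
  have cellsub: "x \<in> sup_cube y (2 * L)" if "x \<in> cell L v" "y \<in> cell L v" for x y
  proof -
    have "\<bar>x $ i - y $ i\<bar> \<le> 2 * L" for i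
    proof -
      have "L * of_int (v $ i) \<le> x $ i" "x $ i < L * of_int (v $ i) + L" "L * of_int (v $ i) \<le> y $ i" "y $ i < L * of_int (v $ i) + L"
        using that by (auto simp: cell_def hcube_def)
      then show ?thesis by linarith
    qed
    then show ?thesis by (simp add: sup_cube_def)
  qed
  define e where "e = c * ((\<mu> * V) powr (1 / p + 1 / q) / V)"
  have e: "0 \<le> e" using c V by (simp add: e_def)
  have pt: "cmod (freq_form w f' g') \<le> e * (?a y * ?b y)" if y: "y \<in> cell L v" for y
  proof -
    have "cmod (freq_form w f' g') \<le> c * ((LINT x|lborel. cmod (f' x) powr p) * V) powr (1 / p) * ((LINT x|lborel. cmod (g' x) powr q) * V) powr (1 / q) / V"
      unfolding c_def V_def by (rule freq_form_bound[OF f'(1) g'(1) w \<rho> p q])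
    also have "\<dots> \<le> c * ((\<mu> * V) powr (1 / p) * ?a y) * ((\<mu> * V) powr (1 / q) * ?b y) / V"
    proof (intro divide_right_mono mult_mono mult_left_mono c)
      have "cmod (f' x) \<le> (if x \<in> sup_cube y (2 * L) then cmod (f x) else 0)" for x
        using f'(2)[of x] cellsub[OF _ y, of x] by (cases "x \<in> cell L v") (auto intro: order_trans)
      then show "((LINT x|lborel. cmod (f' x) powr p) * V) powr (1 / p) \<le> (\<mu> * V) powr (1 / p) * ?a y"
        by (intro S p f f'(1))
      show "((LINT x|lborel. cmod (g' x) powr q) * V) powr (1 / q) \<le> (\<mu> * V) powr (1 / q) * ?b y"
        by (intro S q g g'(1) g'(2)[OF y])
    qed (use V c in \<open>auto intro!: mult_nonneg_nonneg avg_nonneg\<close>)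
    also have "\<dots> = e * (?a y * ?b y)" by (simp add: e_def powr_add)
    finally show ?thesis .
  qed
  have Ln: "0 < L ^ ?n" using L by simp
  have emc: "emeasure lborel (cell L v) = ennreal (L ^ ?n)" unfolding cell_def by (rule emeasure_hcube[OF L])
  have mc[measurable]: "cell L v \<in> sets borel" unfolding cell_def by measurable
  have "ennreal (cmod (freq_form w f' g')) * ennreal (L ^ ?n) = (\<integral>\<^sup>+x. ennreal (cmod (freq_form w f' g')) * indicator (cell L v) x \<partial>lborel)"
    by (subst nn_integral_cmult_indicator) (auto simp: emc)
  also have "\<dots> \<le> (\<integral>\<^sup>+x. ennreal e * (ennreal (?a x * ?b x) * indicator (cell L v) x) \<partial>lborel)"
  proof (rule nn_integral_mono)
    fix x
    show "ennreal (cmod (freq_form w f' g')) * indicator (cell L v) x \<le> ennreal e * (ennreal (?a x * ?b x) * indicator (cell L v) x)"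
      using pt[of x] e by (cases "x \<in> cell L v") (auto simp: ennreal_mult[symmetric] avg_nonneg intro!: ennreal_leI)
  qed
  also have "\<dots> = ennreal e * (\<integral>\<^sup>+x. ennreal (?a x * ?b x) * indicator (cell L v) x \<partial>lborel)"
    by (rule nn_integral_cmult) measurable
  finally have "ennreal (1 / L ^ ?n) * (ennreal (cmod (freq_form w f' g')) * ennreal (L ^ ?n)) \<le>
     ennreal (1 / L ^ ?n) * (ennreal e * (\<integral>\<^sup>+x. ennreal (?a x * ?b x) * indicator (cell L v) x \<partial>lborel))"
    by (intro mult_left_mono) auto
  moreover have "ennreal (1 / L ^ ?n) * (ennreal (cmod (freq_form w f' g')) * ennreal (L ^ ?n)) = ennreal (cmod (freq_form w f' g'))"
    using Ln L by (simp add: ennreal_mult[symmetric])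
  moreover have "ennreal (1 / L ^ ?n) * (ennreal e * X) = ennreal (c * 4 ^ ?n * (\<mu> * V) powr (1 / p + 1 / q - 1)) * X" for X
  proof -
    \<comment> \<open>\<open>4 ^ ?n\<close> is the volume \<open>\<mu>\<close> of the averaging cube
      divided by the volume of the cell; the division by \<open>V\<close> lowers the exponent of
      \<open>\<mu> * V\<close> by one once the other factor \<open>\<mu>\<close> has been
      used.\<close>
    have "1 / L ^ ?n * e = c * 4 ^ ?n * (\<mu> * V) powr (1 / p + 1 / q - 1)"
      using Ln V \<mu> unfolding e_def powr_diff by (simp add: \<mu>_def power_mult_distrib field_simps)
    then show ?thesis using Ln e by (simp add: ennreal_mult[symmetric] mult.assoc[symmetric])
  qed
  ultimately show ?thesis by (simp add: c_def \<mu>_def V_def)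
qed

lemma ennreal_le_suminf: "f k \<le> (\<Sum>k. f k)" for f :: "nat \<Rightarrow> ennreal"
  using sum_le_suminf[of f "{k}"] by simp

text \<open>The kernel is dominated by a sum over dyadic shells. The bound keeps \<open>f'\<close>
  but uses the full \<open>g\<close>, so that it does not depend on how \<open>g'\<close> varies
  with the cell and can be summed over the pieces of \<open>f\<close>.\<close>

lemma far_bound:
  fixes f g w :: "real^'n::finite \<Rightarrow> complex"
  assumes w: "integrable lborel w" and L: "0 < L"
    and K: "\<And>z i. L \<le> \<bar>z $ i\<bar> \<Longrightarrow> cmod (inv_kernel w z) \<le> K / \<bar>z $ i\<bar> ^ N" "0 \<le> K"
    and f': "borel_bounded_compact f'" and g': "borel_bounded_compact g'" "\<And>x. cmod (g' x) \<le> cmod (g x)"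
    and sep: "\<And>x y. f' x \<noteq> 0 \<Longrightarrow> g' y \<noteq> 0 \<Longrightarrow> \<exists>i. L \<le> \<bar>y $ i - x $ i\<bar>"
  shows "ennreal (cmod (freq_form w f' g')) \<le> (\<integral>\<^sup>+x. ennreal (cmod (f' x)) *
     (\<integral>\<^sup>+y. ennreal (cmod (g y)) * (\<Sum>h. ennreal (K / (2 ^ h * L) ^ N) * indicator (sup_cube x (2 ^ (h + 1) * L)) y) \<partial>lborel) \<partial>lborel)"
proof -
  have "ennreal (cmod (freq_form w f' g')) \<le>
    (\<integral>\<^sup>+x. \<integral>\<^sup>+y. ennreal (cmod (f' x)) * (ennreal (cmod (g' y)) * ennreal (cmod (inv_kernel w (y - x)))) \<partial>lborel \<partial>lborel)"
    by (rule freq_form_kernel_bound[OF w f' g'(1)])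
  also have "\<dots> \<le> (\<integral>\<^sup>+x. ennreal (cmod (f' x)) *
     (\<integral>\<^sup>+y. ennreal (cmod (g y)) * (\<Sum>h. ennreal (K / (2 ^ h * L) ^ N) * indicator (sup_cube x (2 ^ (h + 1) * L)) y) \<partial>lborel) \<partial>lborel)"
  proof (rule nn_integral_mono)
    fix x
    have [measurable]: "g' \<in> borel_measurable borel" "w \<in> borel_measurable borel" using g' w by (auto simp: borel_bounded_compact_def)
    have [measurable]: "inv_kernel w \<in> borel_measurable borel"
      unfolding inv_kernel_def[abs_def]
      by (rule lborel.borel_measurable_lebesgue_integral) (unfold case_prod_beta', measurable)
    have "(\<integral>\<^sup>+y. ennreal (cmod (f' x)) * (ennreal (cmod (g' y)) * ennreal (cmod (inv_kernel w (y - x)))) \<partial>lborel) =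
      ennreal (cmod (f' x)) * (\<integral>\<^sup>+y. ennreal (cmod (g' y)) * ennreal (cmod (inv_kernel w (y - x))) \<partial>lborel)"
      by (rule nn_integral_cmult) measurable
    also have "\<dots> \<le> ennreal (cmod (f' x)) *
     (\<integral>\<^sup>+y. ennreal (cmod (g y)) * (\<Sum>h. ennreal (K / (2 ^ h * L) ^ N) * indicator (sup_cube x (2 ^ (h + 1) * L)) y) \<partial>lborel)"
    proof (cases "f' x = 0")
      case False
      show ?thesis
      proof (intro mult_left_mono nn_integral_mono)
        fix y
        let ?t = "\<lambda>h::nat. ennreal (K / (2 ^ h * L) ^ N) * indicator (sup_cube x (2 ^ (h + 1) * L)) y"
        show "ennreal (cmod (g' y)) * ennreal (cmod (inv_kernel w (y - x))) \<le> ennreal (cmod (g y)) * (\<Sum>h. ?t h)"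
        proof (cases "g' y = 0")
          case g0: False
          obtain i where "L \<le> \<bar>y $ i - x $ i\<bar>" using sep[OF False g0] by blast
          then obtain h :: nat where h: "cmod (inv_kernel w (y - x)) \<le> K / (2 ^ h * L) ^ N" "y \<in> sup_cube x (2 ^ (h + 1) * L)"
            using far_kernel_dyadic[OF L K] by blast
          have "ennreal (cmod (inv_kernel w (y - x))) \<le> ?t h" using h by (simp add: ennreal_leI)
          also have "\<dots> \<le> (\<Sum>h. ?t h)" by (rule ennreal_le_suminf)
          finally show ?thesis using g'(2)[of y] by (intro mult_mono ennreal_leI) auto
        qed simp
      qed auto
    qed simp
    finally show "(\<integral>\<^sup>+y. ennreal (cmod (f' x)) * (ennreal (cmod (g' y)) * ennreal (cmod (inv_kernel w (y - x)))) \<partial>lborel) \<le> \<dots>" .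
  qed
  finally show ?thesis .
qed

text \<open>The threefold enlargement of a cell is the dividing line: a point outside is at least
  \<open>L\<close> away from the cell in some coordinate, while a point inside is within
  \<open>2 * L\<close> of every point of the cell, as \<open>cell_near\<close> shows.\<close>

lemma cell_far:
  assumes "x \<in> cell L v" "\<not> (\<forall>i. L * (of_int (v $ i) - 1) \<le> y $ i \<and> y $ i \<le> L * (of_int (v $ i) + 2))" "0 < L"
  shows "\<exists>i. L \<le> \<bar>y $ i - x $ i\<bar>"
proof -
  obtain i where i: "y $ i < L * (of_int (v $ i) - 1) \<or> L * (of_int (v $ i) + 2) < y $ i"
    using assms(2) by (auto simp: not_le)
  have "L * of_int (v $ i) \<le> x $ i" "x $ i < L * of_int (v $ i) + L" using assms(1) by (auto simp: cell_def hcube_def)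
  then have "L \<le> \<bar>y $ i - x $ i\<bar>" using i assms(3) by (auto simp: algebra_simps)
  then show ?thesis ..
qed

lemma cell_near:
  assumes "x \<in> cell L v" "\<forall>i. L * (of_int (v $ i) - 1) \<le> y $ i \<and> y $ i \<le> L * (of_int (v $ i) + 2)" "0 < L"
  shows "y \<in> sup_cube x (2 * L)"
  unfolding sup_cube_def
proof (intro CollectI allI)
  fix i
  have "L * of_int (v $ i) \<le> x $ i" "x $ i < L * of_int (v $ i) + L" using assms(1) by (auto simp: cell_def hcube_def)
  moreover have "L * of_int (v $ i) - L \<le> y $ i" "y $ i \<le> L * of_int (v $ i) + 2 * L" using assms(2)[rule_format, of i] by (auto simp: algebra_simps)
  ultimately show "\<bar>y $ i - x $ i\<bar> \<le> 2 * L" by linarith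
qed

text \<open>The shell of index \<open>h\<close> costs a volume (2^h L)^n and carries a kernel of
  size K (2^h L)^-N; as \<open>N\<close> exceeds the dimension, a factor 2^-h remains.\<close>

lemma far_sum_bound:
  fixes F G :: "real^'n::finite \<Rightarrow> real"
  assumes F: "test_fun F" and G: "test_fun G" and L: "0 < L" and K: "0 \<le> K" and N: "CARD('n) < N"
    and p: "1 \<le> p" and q: "1 \<le> q"
  shows "(\<integral>\<^sup>+x. ennreal (F x) *
     (\<integral>\<^sup>+y. ennreal (G y) * (\<Sum>h. ennreal (K / (2 ^ h * L) ^ N) * indicator (sup_cube x (2 ^ (h + 1) * L)) y) \<partial>lborel) \<partial>lborel)
    \<le> ennreal (16 ^ CARD('n) * K * L ^ CARD('n) / L ^ N) * (\<Sum>h. ennreal ((1 / 2) ^ h) * local_form p q (2 ^ (h + 2) * L) F G)"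
proof -
  let ?n = "CARD('n)"
  have [measurable]: "F \<in> borel_measurable borel" "G \<in> borel_measurable borel"
    using F G by (auto intro: test_fun_measurable)
  define k where "k h = ennreal (K / (2 ^ h * L) ^ N)" for h :: nat
  have ind: "indicator (sup_cube z r) x = (if x \<in> sup_cube z r then 1 else 0 :: ennreal)" for z x :: "real^'n" and r
    by (simp add: indicator_def)
  have "(\<integral>\<^sup>+x. ennreal (F x) * (\<integral>\<^sup>+y. ennreal (G y) * (\<Sum>h. k h * indicator (sup_cube x (2 ^ (h + 1) * L)) y) \<partial>lborel) \<partial>lborel)
    = (\<integral>\<^sup>+x. (\<Sum>h. k h * (\<integral>\<^sup>+y. ennreal (F x) * ennreal (G y) * indicator (sup_cube x (2 ^ (h + 1) * L)) y \<partial>lborel)) \<partial>lborel)"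
  proof (rule nn_integral_cong)
    fix x
    have "ennreal (F x) * (\<integral>\<^sup>+y. ennreal (G y) * (\<Sum>h. k h * indicator (sup_cube x (2 ^ (h + 1) * L)) y) \<partial>lborel)
      = (\<integral>\<^sup>+y. ennreal (F x) * (ennreal (G y) * (\<Sum>h. k h * indicator (sup_cube x (2 ^ (h + 1) * L)) y)) \<partial>lborel)"
      by (rule nn_integral_cmult[symmetric]) measurable
    also have "\<dots> = (\<integral>\<^sup>+y. (\<Sum>h. k h * (ennreal (F x) * ennreal (G y) * indicator (sup_cube x (2 ^ (h + 1) * L)) y)) \<partial>lborel)"
      by (simp add: mult_ac flip: ennreal_suminf_cmult)
    also have "\<dots> = (\<Sum>h. \<integral>\<^sup>+y. k h * (ennreal (F x) * ennreal (G y) * indicator (sup_cube x (2 ^ (h + 1) * L)) y) \<partial>lborel)"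
      by (rule nn_integral_suminf) measurable
    also have "\<dots> = (\<Sum>h. k h * (\<integral>\<^sup>+y. ennreal (F x) * ennreal (G y) * indicator (sup_cube x (2 ^ (h + 1) * L)) y \<partial>lborel))"
      by (intro suminf_cong nn_integral_cmult) measurable
    finally show "ennreal (F x) * (\<integral>\<^sup>+y. ennreal (G y) * (\<Sum>h. k h * indicator (sup_cube x (2 ^ (h + 1) * L)) y) \<partial>lborel) = \<dots>" .
  qed
  also have "\<dots> = (\<Sum>h. \<integral>\<^sup>+x. k h * (\<integral>\<^sup>+y. ennreal (F x) * ennreal (G y) * indicator (sup_cube x (2 ^ (h + 1) * L)) y \<partial>lborel) \<partial>lborel)"
    unfolding ind by (rule nn_integral_suminf) measurable
  also have "\<dots> = (\<Sum>h. k h * (\<integral>\<^sup>+x. \<integral>\<^sup>+y. ennreal (F x) * ennreal (G y) * indicator (sup_cube x (2 ^ (h + 1) * L)) y \<partial>lborel \<partial>lborel))"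
    unfolding ind by (intro suminf_cong nn_integral_cmult) measurable
  also have "\<dots> \<le> (\<Sum>h. ennreal (16 ^ ?n * K * L ^ ?n / L ^ N) * (ennreal ((1 / 2) ^ h) * local_form p q (2 ^ (h + 2) * L) F G))"
  proof (rule suminf_le)
    fix h :: nat
    have r: "0 < 2 ^ (h + 1) * L" using L by simp
    have "k h * (\<integral>\<^sup>+x. \<integral>\<^sup>+y. ennreal (F x) * ennreal (G y) * indicator (sup_cube x (2 ^ (h + 1) * L)) y \<partial>lborel \<partial>lborel)
      \<le> k h * (ennreal ((8 * (2 ^ (h + 1) * L)) ^ ?n) * local_form 1 1 (2 * (2 ^ (h + 1) * L)) F G)"
      by (intro mult_left_mono double_integral_le_local_form F G r) auto
    also have "\<dots> \<le> k h * (ennreal ((8 * (2 ^ (h + 1) * L)) ^ ?n) * local_form p q (2 * (2 ^ (h + 1) * L)) F G)"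
      using p q r by (intro mult_left_mono local_form_mono_exponent F G) auto
    also have "\<dots> = ennreal (K / (2 ^ h * L) ^ N * (16 * (2 ^ h * L)) ^ ?n) * local_form p q (2 ^ (h + 2) * L) F G"
    proof -
      have "ennreal (K / (2 ^ h * L) ^ N * (16 * (2 ^ h * L)) ^ ?n) = k h * ennreal ((16 * (2 ^ h * L)) ^ ?n)"
        unfolding k_def using K L by (intro ennreal_mult) auto
      moreover have "8 * (2 ^ (h + 1) * L) = 16 * (2 ^ h * L)" "2 * (2 ^ (h + 1) * L) = 2 ^ (h + 2) * L" by auto
      ultimately show ?thesis by (simp only: mult.assoc)
    qed
    also have "\<dots> \<le> ennreal (16 ^ ?n * K * L ^ ?n / L ^ N * (1 / 2) ^ h) * local_form p q (2 ^ (h + 2) * L) F G"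
    proof (intro mult_right_mono ennreal_leI)
      \<comment> \<open>This is where \<open>N\<close> has to be at least one larger than the
        dimension.\<close>
      have "((2::real) ^ h) ^ ?n * 2 ^ h = (2 ^ h) ^ Suc ?n" by simp
      also have "\<dots> \<le> (2 ^ h) ^ N" using N by (intro power_increasing) auto
      finally have "((2::real) ^ h) ^ ?n / (2 ^ h) ^ N \<le> (1 / 2) ^ h"
        by (simp add: field_simps power_one_over)
      then have "16 ^ ?n * K * L ^ ?n / L ^ N * (((2::real) ^ h) ^ ?n / (2 ^ h) ^ N) \<le> 16 ^ ?n * K * L ^ ?n / L ^ N * (1 / 2) ^ h"
        using K L by (intro mult_left_mono) auto
      then show "K / (2 ^ h * L) ^ N * (16 * (2 ^ h * L)) ^ ?n \<le> 16 ^ ?n * K * L ^ ?n / L ^ N * (1 / 2) ^ h"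
        by (simp add: power_mult_distrib mult_ac)
    qed auto
    also have "\<dots> = ennreal (16 ^ ?n * K * L ^ ?n / L ^ N) * (ennreal ((1 / 2) ^ h) * local_form p q (2 ^ (h + 2) * L) F G)"
      by (subst ennreal_mult) (use K L in \<open>auto simp: mult.assoc\<close>)
    finally show "k h * (\<integral>\<^sup>+x. \<integral>\<^sup>+y. ennreal (F x) * ennreal (G y) * indicator (sup_cube x (2 ^ (h + 1) * L)) y \<partial>lborel \<partial>lborel)
      \<le> ennreal (16 ^ ?n * K * L ^ ?n / L ^ N) * (ennreal ((1 / 2) ^ h) * local_form p q (2 ^ (h + 2) * L) F G)" .
  qed auto
  also have "\<dots> = ennreal (16 ^ ?n * K * L ^ ?n / L ^ N) * (\<Sum>h. ennreal ((1 / 2) ^ h) * local_form p q (2 ^ (h + 2) * L) F G)"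
    by (rule ennreal_suminf_cmult)
  finally show ?thesis unfolding k_def .
qed

lemma nn_integral_cells_le:
  fixes \<psi> :: "real^'n::finite \<Rightarrow> ennreal"
  assumes "finite A" "0 < L" and [measurable]: "\<psi> \<in> borel_measurable borel"
  shows "(\<Sum>v\<in>A. \<integral>\<^sup>+x. \<psi> x * indicator (cell L v) x \<partial>lborel) \<le> (\<integral>\<^sup>+x. \<psi> x \<partial>lborel)"
proof -
  have [measurable]: "cell L v \<in> sets borel" for v :: "int^'n" unfolding cell_def by measurable
  have "(\<Sum>v\<in>A. \<integral>\<^sup>+x. \<psi> x * indicator (cell L v) x \<partial>lborel) = (\<integral>\<^sup>+x. (\<Sum>v\<in>A. \<psi> x * indicator (cell L v) x) \<partial>lborel)"
    by (rule nn_integral_sum[symmetric]) measurable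
  also have "\<dots> \<le> (\<integral>\<^sup>+x. \<psi> x \<partial>lborel)"
  proof (rule nn_integral_mono)
    fix x :: "real^'n"
    have "(\<Sum>v\<in>A. \<psi> x * indicator (cell L v) x) = (\<Sum>v\<in>A. if v = (\<chi> i. \<lfloor>x $ i / L\<rfloor>) then \<psi> x else 0)"
      by (intro sum.cong) (auto simp: indicator_def mem_cell_iff[OF assms(2)])
    also have "\<dots> \<le> \<psi> x" using assms(1) by simp
    finally show "(\<Sum>v\<in>A. \<psi> x * indicator (cell L v) x) \<le> \<psi> x" .
  qed
  finally show ?thesis .
qed

text \<open>\<open>f\<close> is cut along the cells, and for each cell \<open>g\<close> is cut into
  its part on the threefold enlargement and the rest. The near bounds add up because the cells are
  disjoint, the far bounds because the pieces of \<open>f\<close> are.\<close>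

lemma piece_near_far_bound:
  fixes f g w :: "real^'n::finite \<Rightarrow> complex"
  assumes f: "borel_bounded_compact f" and g: "borel_bounded_compact g" and wi: "integrable lborel w"
    and w: "\<And>\<xi>. cmod (w \<xi>) \<le> D" "\<And>\<xi> j. \<bar>\<xi> $ j\<bar> > \<rho> \<Longrightarrow> w \<xi> = 0" and \<rho>: "0 < \<rho>" and L: "0 < L"
    and K: "\<And>z i. L \<le> \<bar>z $ i\<bar> \<Longrightarrow> cmod (inv_kernel w z) \<le> K / \<bar>z $ i\<bar> ^ N" "0 \<le> K" and N: "CARD('n) < N"
    and p: "1 \<le> p" "p \<le> 2" and q: "1 \<le> q" "q \<le> 2"
  defines "F \<equiv> \<lambda>x. cmod (f x)" and "G \<equiv> \<lambda>x. cmod (g x)"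
  shows "ennreal (cmod (freq_form w f g)) \<le>
    ennreal (4 * (2 * pi) ^ CARD('n) * D * 4 ^ CARD('n) * ((4 * L) ^ CARD('n) * (2 * \<rho>) ^ CARD('n)) powr (1 / p + 1 / q - 1)) * local_form p q (2 * L) F G +
    ennreal (16 ^ CARD('n) * K * L ^ CARD('n) / L ^ N) * (\<Sum>h. ennreal ((1 / 2) ^ h) * local_form p q (2 ^ (h + 2) * L) F G)"
    (is "_ \<le> ?near * _ + ?far")
proof -
  obtain A :: "(int^'n) set" where A: "finite A" "\<And>x. f x \<noteq> 0 \<Longrightarrow> (\<chi> i. \<lfloor>x $ i / L\<rfloor>) \<in> A"
    using cell_support[OF f L] by blast
  have [measurable]: "f \<in> borel_measurable borel" "g \<in> borel_measurable borel" using f g by (auto simp: borel_bounded_compact_def)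
  have [measurable]: "cell L v \<in> sets borel" for v :: "int^'n" unfolding cell_def by measurable
  define fv where "fv v x = (if x \<in> cell L v then f x else 0)" for v x
  define gv where "gv v x = (if \<forall>i. L * (of_int (v $ i) - 1) \<le> x $ i \<and> x $ i \<le> L * (of_int (v $ i) + 2) then g x else 0)" for v :: "int^'n" and x
  have fvm: "fv v \<in> borel_measurable borel" for v unfolding fv_def by measurable
  have gvm: "gv v \<in> borel_measurable borel" for v unfolding gv_def by measurable
  have fv: "borel_bounded_compact (fv v)" for v by (rule borel_bounded_compact_restrict[OF f fvm]) (auto simp: fv_def)
  have gv: "borel_bounded_compact (gv v)" for v by (rule borel_bounded_compact_restrict[OF g gvm]) (auto simp: gv_def)
  have gd: "borel_bounded_compact (\<lambda>x. g x - gv v x)" for v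
    by (rule borel_bounded_compact_restrict[OF g]) (use gvm in \<open>auto simp: gv_def\<close>)
  have fsum: "f = (\<lambda>x. \<Sum>v\<in>A. fv v x)"
  proof
    fix x
    have "(\<Sum>v\<in>A. fv v x) = (\<Sum>v\<in>A. if v = (\<chi> i. \<lfloor>x $ i / L\<rfloor>) then f x else 0)"
      by (intro sum.cong) (auto simp: fv_def mem_cell_iff[OF L])
    then show "f x = (\<Sum>v\<in>A. fv v x)" using A by (cases "f x = 0") auto
  qed
  define \<psi> where "\<psi> x = ennreal (avg p (sup_cube x (2 * L)) F * avg q (sup_cube x (2 * L)) G)" for x
  have [measurable]: "F \<in> borel_measurable borel" "G \<in> borel_measurable borel" unfolding F_def G_def by measurable
  have \<psi>m: "\<psi> \<in> borel_measurable borel" unfolding \<psi>_def by measurable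
  let ?H = "\<lambda>x. \<integral>\<^sup>+y. ennreal (G y) * (\<Sum>h. ennreal (K / (2 ^ h * L) ^ N) * indicator (sup_cube x (2 ^ (h + 1) * L)) y) \<partial>lborel"
  have ind: "indicator (sup_cube z r) x = (if x \<in> sup_cube z r then 1 else 0 :: ennreal)" for z x :: "real^'n" and r
    by (simp add: indicator_def)
  have Hm[measurable]: "?H \<in> borel_measurable borel"
    unfolding ind by measurable
  have near: "ennreal (cmod (freq_form w (fv v) (gv v))) \<le> ?near * (\<integral>\<^sup>+x. \<psi> x * indicator (cell L v) x \<partial>lborel)" for v
    unfolding \<psi>_def F_def G_def
  proof (rule near_bound[OF f g w \<rho> L p q fv _ gv])
    show "cmod (fv v x) \<le> (if x \<in> cell L v then cmod (f x) else 0)" for x by (simp add: fv_def)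
    show "cmod (gv v x) \<le> (if x \<in> sup_cube y (2 * L) then cmod (g x) else 0)" if "y \<in> cell L v" for x y
      using cell_near[OF that _ L, of x] by (auto simp: gv_def)
  qed
  have far: "ennreal (cmod (freq_form w (fv v) (\<lambda>x. g x - gv v x))) \<le> (\<integral>\<^sup>+x. ennreal (cmod (fv v x)) * ?H x \<partial>lborel)" for v
    unfolding G_def
  proof (rule far_bound[OF wi L K fv gd])
    show "cmod (g x - gv v x) \<le> cmod (g x)" for x by (simp add: gv_def)
    show "\<exists>i. L \<le> \<bar>y $ i - x $ i\<bar>" if "fv v x \<noteq> 0" "g y - gv v y \<noteq> 0" for x y
      by (rule cell_far[OF _ _ L, of x v]) (use that in \<open>auto simp: fv_def gv_def split: if_splits\<close>)
  qed
  have "freq_form w f g = (\<Sum>v\<in>A. freq_form w (fv v) g)"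
    by (subst fsum) (rule freq_form_sum_left[OF wi A(1) fv g])
  also have "\<dots> = (\<Sum>v\<in>A. freq_form w (fv v) (gv v) + freq_form w (fv v) (\<lambda>x. g x - gv v x))"
    by (simp add: freq_form_diff_right[OF wi fv g gv])
  finally have "cmod (freq_form w f g) \<le> (\<Sum>v\<in>A. cmod (freq_form w (fv v) (gv v)) + cmod (freq_form w (fv v) (\<lambda>x. g x - gv v x)))"
    by (auto intro!: order_trans[OF norm_sum] sum_mono norm_triangle_ineq)
  then have "ennreal (cmod (freq_form w f g)) \<le> ennreal (\<Sum>v\<in>A. cmod (freq_form w (fv v) (gv v)) + cmod (freq_form w (fv v) (\<lambda>x. g x - gv v x)))"
    by (rule ennreal_leI)
  also have "\<dots> = (\<Sum>v\<in>A. ennreal (cmod (freq_form w (fv v) (gv v))) + ennreal (cmod (freq_form w (fv v) (\<lambda>x. g x - gv v x))))"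
    by (subst sum_ennreal[symmetric]) (auto intro!: sum.cong)
  also have "\<dots> \<le> (\<Sum>v\<in>A. ?near * (\<integral>\<^sup>+x. \<psi> x * indicator (cell L v) x \<partial>lborel) + (\<integral>\<^sup>+x. ennreal (cmod (fv v x)) * ?H x \<partial>lborel))"
    by (intro sum_mono add_mono near far)
  also have "\<dots> = ?near * (\<Sum>v\<in>A. \<integral>\<^sup>+x. \<psi> x * indicator (cell L v) x \<partial>lborel) + (\<Sum>v\<in>A. \<integral>\<^sup>+x. ennreal (cmod (fv v x)) * ?H x \<partial>lborel)"
    by (simp add: sum.distrib sum_distrib_left)
  also have "\<dots> \<le> ?near * local_form p q (2 * L) F G + ?far"
  proof (intro add_mono mult_left_mono)
    show "(\<Sum>v\<in>A. \<integral>\<^sup>+x. \<psi> x * indicator (cell L v) x \<partial>lborel) \<le> local_form p q (2 * L) F G"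
      unfolding local_form_def using nn_integral_cells_le[OF A(1) L \<psi>m] by (simp add: \<psi>_def)
    have "(\<Sum>v\<in>A. \<integral>\<^sup>+x. ennreal (cmod (fv v x)) * ?H x \<partial>lborel) = (\<integral>\<^sup>+x. (\<Sum>v\<in>A. ennreal (cmod (fv v x)) * ?H x) \<partial>lborel)"
      by (rule nn_integral_sum[symmetric]) (use fvm in measurable)
    also have "\<dots> \<le> (\<integral>\<^sup>+x. ennreal (F x) * ?H x \<partial>lborel)"
    proof (rule nn_integral_mono)
      fix x
      have "(\<Sum>v\<in>A. cmod (fv v x)) = (\<Sum>v\<in>A. if v = (\<chi> i. \<lfloor>x $ i / L\<rfloor>) then cmod (f x) else 0)"
        by (intro sum.cong) (auto simp: fv_def mem_cell_iff[OF L])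
      also have "\<dots> \<le> F x" using A(1) by (simp add: F_def)
      finally have "ennreal (\<Sum>v\<in>A. cmod (fv v x)) \<le> ennreal (F x)" by (rule ennreal_leI)
      then show "(\<Sum>v\<in>A. ennreal (cmod (fv v x)) * ?H x) \<le> ennreal (F x) * ?H x"
        unfolding sum_distrib_right[symmetric] by (intro mult_right_mono) auto
    qed
    also have "\<dots> \<le> ?far"
      using far_sum_bound[OF test_fun_cmod[OF f] test_fun_cmod[OF g] L K(2) N p(1) q(1)] by (simp add: F_def G_def)
    finally show "(\<Sum>v\<in>A. \<integral>\<^sup>+x. ennreal (cmod (fv v x)) * ?H x \<partial>lborel) \<le> ?far" .
  qed auto
  finally show ?thesis .
qed

text \<open>One series for both contributions: the near form is its term \<open>h = 0\<close>, and
  the far forms are its terms with the index raised by one, which doubles their weight.\<close>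

lemma piece_local_form_bound:
  fixes f g w :: "real^'n::finite \<Rightarrow> complex"
  assumes f: "borel_bounded_compact f" and g: "borel_bounded_compact g" and wi: "integrable lborel w"
    and w: "\<And>\<xi>. cmod (w \<xi>) \<le> D" "\<And>\<xi> j. \<bar>\<xi> $ j\<bar> > \<rho> \<Longrightarrow> w \<xi> = 0" and \<rho>: "0 < \<rho>" and L: "0 < L"
    and K: "\<And>z i. L \<le> \<bar>z $ i\<bar> \<Longrightarrow> cmod (inv_kernel w z) \<le> K / \<bar>z $ i\<bar> ^ N" "0 \<le> K" and N: "CARD('n) < N"
    and p: "1 \<le> p" "p \<le> 2" and q: "1 \<le> q" "q \<le> 2"
  shows "ennreal (cmod (freq_form w f g)) \<le>
    ennreal (4 * (2 * pi) ^ CARD('n) * D * 4 ^ CARD('n) * ((4 * L) ^ CARD('n) * (2 * \<rho>) ^ CARD('n)) powr (1 / p + 1 / q - 1)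
       + 2 * (16 ^ CARD('n) * K * L ^ CARD('n) / L ^ N)) *
    (\<Sum>h. ennreal ((1 / 2) ^ h) * local_form p q (2 ^ (h + 1) * L) (\<lambda>x. cmod (f x)) (\<lambda>x. cmod (g x)))"
proof -
  let ?t = "\<lambda>h::nat. ennreal ((1 / 2) ^ h) * local_form p q (2 ^ (h + 1) * L) (\<lambda>x. cmod (f x)) (\<lambda>x. cmod (g x))"
  let ?c = "4 * (2 * pi) ^ CARD('n) * D * 4 ^ CARD('n) * ((4 * L) ^ CARD('n) * (2 * \<rho>) ^ CARD('n)) powr (1 / p + 1 / q - 1)"
  let ?d = "16 ^ CARD('n) * K * L ^ CARD('n) / L ^ N"
  have D: "0 \<le> D" using w(1)[of 0] norm_ge_zero[of "w 0"] by linarith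
  have cd: "0 \<le> ?c" "0 \<le> ?d" using D K(2) L by auto
  have 1: "local_form p q (2 * L) (\<lambda>x. cmod (f x)) (\<lambda>x. cmod (g x)) \<le> (\<Sum>h. ?t h)"
    using ennreal_le_suminf[of ?t 0] by simp
  have eq: "(\<Sum>h. ennreal ((1 / 2) ^ h) * local_form p q (2 ^ (h + 2) * L) (\<lambda>x. cmod (f x)) (\<lambda>x. cmod (g x))) = (\<Sum>h. 2 * ?t (Suc h))"
  proof (rule suminf_cong)
    fix h :: nat
    have "ennreal ((1 / 2) ^ h) = 2 * ennreal ((1 / 2) ^ Suc h)"
      using ennreal_mult[of 2 "(1 / 2) ^ Suc h"] by simp
    then show "ennreal ((1 / 2) ^ h) * local_form p q (2 ^ (h + 2) * L) (\<lambda>x. cmod (f x)) (\<lambda>x. cmod (g x)) = 2 * ?t (Suc h)"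
      by (simp add: mult.assoc)
  qed
  have "(\<Sum>h. ?t (Suc h)) \<le> (\<Sum>h. ?t h)"
    using suminf_offset[of ?t 1] by simp
  then have 2: "(\<Sum>h. ennreal ((1 / 2) ^ h) * local_form p q (2 ^ (h + 2) * L) (\<lambda>x. cmod (f x)) (\<lambda>x. cmod (g x))) \<le> 2 * (\<Sum>h. ?t h)"
    unfolding eq ennreal_suminf_cmult by (rule mult_left_mono) simp
  have "ennreal (cmod (freq_form w f g)) \<le> ennreal ?c * local_form p q (2 * L) (\<lambda>x. cmod (f x)) (\<lambda>x. cmod (g x)) +
     ennreal ?d * (\<Sum>h. ennreal ((1 / 2) ^ h) * local_form p q (2 ^ (h + 2) * L) (\<lambda>x. cmod (f x)) (\<lambda>x. cmod (g x)))"
    by (rule piece_near_far_bound[OF f g wi w \<rho> L K N p q])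
  also have "\<dots> \<le> ennreal ?c * (\<Sum>h. ?t h) + ennreal ?d * (2 * (\<Sum>h. ?t h))"
    by (intro add_mono mult_left_mono 1 2) auto
  also have "\<dots> = ennreal (?c + 2 * ?d) * (\<Sum>h. ?t h)"
  proof -
    have "ennreal (?c + 2 * ?d) = ennreal ?c + ennreal ?d * 2"
      using cd ennreal_mult[of ?d 2] by (simp add: mult.commute)
    then show ?thesis by (simp add: distrib_right mult.assoc)
  qed
  finally show ?thesis .
qed

section \<open>Dyadic decomposition of the symbol\<close>

definition smooth_box :: "(nat \<Rightarrow> real \<Rightarrow> real) \<Rightarrow> real \<Rightarrow> real^'n::finite \<Rightarrow> real" where
  "smooth_box \<psi> R \<xi> = (\<Prod>j\<in>UNIV. \<psi> 0 (\<xi> $ j / R))"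

lemma annulus_cutoff_eq: "annulus_cutoff \<psi> R \<xi> = smooth_box \<psi> (2 * R) \<xi> - smooth_box \<psi> R \<xi>"
  by (simp add: annulus_cutoff_def smooth_box_def)

lemma smooth_box_inner:
  assumes "cutoff N C \<psi>" "0 < R" "\<And>j. \<bar>\<xi> $ j\<bar> \<le> R"
  shows "smooth_box \<psi> R \<xi> = 1"
  using box_cutoff_inner[OF assms(1,2) le0 assms(3), where i = undefined] by (simp add: smooth_box_def box_cutoff_0)

lemma smooth_box_outer:
  assumes "cutoff N C \<psi>" "0 < R" "\<bar>\<xi> $ j\<bar> \<ge> 2 * R"
  shows "smooth_box \<psi> R \<xi> = 0"
  using box_cutoff_outer[OF assms(1,2) le0 assms(3), where i = undefined] by (simp add: smooth_box_def box_cutoff_0)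

lemma smooth_box_bound:
  fixes \<xi> :: "real^'n::finite"
  assumes "cutoff N C \<psi>" "0 < R"
  shows "\<bar>smooth_box \<psi> R \<xi>\<bar> \<le> C ^ CARD('n)"
  using box_cutoff_bound[OF assms le0, of undefined \<xi>] by (simp add: smooth_box_def box_cutoff_0)

text \<open>For \<alpha> > 0 the symbol lives on |\<xi>| >= 1 and the radii increase; the first box,
  with coordinates below \<open>1 / n\<close>, lies inside the unit ball. For \<alpha> < 0 it lives
  on 0 < |\<xi>| <= 1, apart from the origin, and the radii decrease; the first outer box equals 1
  on the unit ball. In both cases the \<open>\<alpha>\<close>-th power of the radius grows with
  \<open>i\<close>.\<close>

definition freq_radius :: "nat \<Rightarrow> real \<Rightarrow> nat \<Rightarrow> real" where
  "freq_radius n \<alpha> i = (if 0 < \<alpha> then 2 ^ i / (2 * real n) else 1 / 2 ^ Suc i)"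

lemma freq_radius_pos: "0 < n \<Longrightarrow> 0 < freq_radius n \<alpha> i"
  by (simp add: freq_radius_def)

lemma freq_radius_powr:
  assumes "0 < n" "\<alpha> \<noteq> 0"
  shows "freq_radius n \<alpha> i powr \<alpha> = freq_radius n \<alpha> 0 powr \<alpha> * (2 powr \<bar>\<alpha>\<bar>) ^ i"
proof -
  have p: "(2 powr \<bar>\<alpha>\<bar>) ^ i = 2 powr (real i * \<bar>\<alpha>\<bar>)" by (simp add: powr_powr mult.commute flip: powr_realpow)
  show ?thesis
  proof (cases "0 < \<alpha>")
    case True
    have "freq_radius n \<alpha> i = freq_radius n \<alpha> 0 * 2 powr real i" using True by (simp add: freq_radius_def powr_realpow)
    then show ?thesis using True assms(1) unfolding p by (simp add: powr_mult powr_powr freq_radius_pos less_imp_le)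
  next
    case False
    have "freq_radius n \<alpha> i = freq_radius n \<alpha> 0 * 2 powr (- real i)"
      using False by (simp add: freq_radius_def powr_minus powr_realpow field_simps)
    then show ?thesis using False assms(1) unfolding p by (simp add: powr_mult powr_powr freq_radius_pos less_imp_le)
  qed
qed

lemma sum_annuli:
  "(\<Sum>i<I. annulus_cutoff \<psi> (freq_radius n \<alpha> i) \<xi>) =
    (if 0 < \<alpha> then smooth_box \<psi> (freq_radius n \<alpha> I) \<xi> - smooth_box \<psi> (freq_radius n \<alpha> 0) \<xi>
     else smooth_box \<psi> 1 \<xi> - smooth_box \<psi> (2 * freq_radius n \<alpha> I) \<xi>)"
proof (induction I)
  case (Suc I)
  have "0 < \<alpha> \<Longrightarrow> 2 * freq_radius n \<alpha> I = freq_radius n \<alpha> (Suc I)"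
    "\<not> 0 < \<alpha> \<Longrightarrow> 2 * freq_radius n \<alpha> (Suc I) = freq_radius n \<alpha> I"
    by (simp_all add: freq_radius_def)
  then show ?case using Suc by (simp add: annulus_cutoff_eq)
qed (simp add: freq_radius_def)

lemma powr_less_one_cases:
  fixes x a :: real
  assumes "0 < x"
  shows "0 < a \<Longrightarrow> x < 1 \<Longrightarrow> x powr a < 1" "a < 0 \<Longrightarrow> 1 < x \<Longrightarrow> x powr a < 1"
  using powr_less_mono2[of a x 1] powr_less_mono2_neg[of a 1 x] assms by auto

text \<open>The sum telescopes to two boxes. One of them is fixed and harmless by the support of
  \<open>m\<close>; the other is eventually constant at each \<xi> different from 0. The partial
  sums are thus eventually equal to \<open>m \<xi>\<close>.\<close>

lemma symbol_sum_annuli: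
  fixes m :: "real^'n::finite \<Rightarrow> complex"
  assumes m: "is_symbol \<alpha> \<beta> A m" and \<alpha>: "\<alpha> \<noteq> 0" and \<psi>: "cutoff N C \<psi>" and \<xi>: "\<xi> \<noteq> 0"
  shows "(\<lambda>I. \<Sum>i<I. m \<xi> * complex_of_real (annulus_cutoff \<psi> (freq_radius CARD('n) \<alpha> i) \<xi>)) \<longlonglongrightarrow> m \<xi>"
proof (rule tendsto_eventually)
  let ?n = "CARD('n)"
  let ?R = "freq_radius ?n \<alpha>"
  have R: "0 < ?R i" for i by (simp add: freq_radius_pos)
  have "\<forall>\<^sub>F I in sequentially. m \<xi> * complex_of_real (\<Sum>i<I. annulus_cutoff \<psi> (?R i) \<xi>) = m \<xi>"
  proof (cases "0 < \<alpha>")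
    case True
    have a: "m \<xi> * complex_of_real (smooth_box \<psi> (?R 0) \<xi>) = 0"
    proof (cases "\<exists>j. \<bar>\<xi> $ j\<bar> \<ge> 2 * ?R 0")
      case True
      then show ?thesis using smooth_box_outer[OF \<psi> R] by auto
    next
      case False
      have "norm \<xi> \<noteq> 1 \<and> norm \<xi> \<le> 1"
      proof -
        have "\<bar>\<xi> $ j\<bar> < 1 / real ?n" for j using False True by (auto simp: not_le freq_radius_def)
        then have "(\<Sum>j\<in>UNIV. \<bar>\<xi> $ j\<bar>) < (\<Sum>j\<in>(UNIV::'n set). 1 / real ?n)" by (intro sum_strict_mono) auto
        then show ?thesis using norm_le_l1_cart[of \<xi>] by simp
      qed
      then have "norm \<xi> powr \<alpha> < 1" using True \<xi> by (intro powr_less_one_cases) auto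
      then show ?thesis using symbol_zero[OF m \<xi>] by simp
    qed
    obtain k where k: "norm \<xi> * (2 * real ?n) < 2 ^ k" using real_arch_pow[of 2] by auto
    have "norm \<xi> \<le> ?R I" if "k \<le> I" for I
    proof -
      have "norm \<xi> * (2 * real ?n) \<le> 2 ^ I" using k power_increasing[OF that, of "2::real"] by linarith
      then show ?thesis using True by (simp add: freq_radius_def field_simps)
    qed
    then have "\<forall>\<^sub>F I in sequentially. norm \<xi> \<le> ?R I" unfolding eventually_sequentially by blast
    then show ?thesis
    proof eventually_elim
      case (elim I)
      have "\<bar>\<xi> $ j\<bar> \<le> ?R I" for j using component_le_norm_cart[of \<xi> j] elim by linarith
      then have "smooth_box \<psi> (?R I) \<xi> = 1" by (intro smooth_box_inner[OF \<psi> R])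
      then show ?case using a True unfolding sum_annuli by (simp add: right_diff_distrib)
    qed
  next
    case False
    then have \<alpha>': "\<alpha> < 0" using \<alpha> by simp
    have a: "m \<xi> * complex_of_real (smooth_box \<psi> 1 \<xi>) = m \<xi>"
    proof (cases "norm \<xi> \<le> 1")
      case True
      have "\<bar>\<xi> $ j\<bar> \<le> 1" for j using component_le_norm_cart[of \<xi> j] True by linarith
      then show ?thesis by (simp add: smooth_box_inner[OF \<psi>])
    next
      case False
      then have "norm \<xi> powr \<alpha> < 1" using \<alpha>' \<xi> by (intro powr_less_one_cases) auto
      then show ?thesis using symbol_zero[OF m \<xi>] by simp
    qed
    obtain j where j: "\<xi> $ j \<noteq> 0" using \<xi> by (auto simp: vec_eq_iff)
    have "(\<lambda>I. 2 * (2 * ?R I)) \<longlonglongrightarrow> 0"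
    proof -
      have "(\<lambda>I. 2 * (1 / 2) ^ I :: real) \<longlonglongrightarrow> 2 * 0" by (intro tendsto_mult tendsto_const LIMSEQ_realpow_zero) auto
      then show ?thesis using False by (simp add: freq_radius_def[abs_def] power_one_over)
    qed
    then have "\<forall>\<^sub>F I in sequentially. 2 * (2 * ?R I) < \<bar>\<xi> $ j\<bar>"
      by (rule order_tendstoD(2)) (use j in simp)
    then show ?thesis
    proof eventually_elim
      case (elim I)
      have "smooth_box \<psi> (2 * ?R I) \<xi> = 0" using R[of I] elim by (intro smooth_box_outer[OF \<psi>, of _ _ j]) auto
      then show ?case using a False unfolding sum_annuli by (simp add: right_diff_distrib)
    qed
  qed
  then show "\<forall>\<^sub>F I in sequentially. (\<Sum>i<I. m \<xi> * complex_of_real (annulus_cutoff \<psi> (?R i) \<xi>)) = m \<xi>"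
    by (simp add: sum_distrib_left)
qed

text \<open>On the support, |\<xi>| powr -\<beta> is the power of |\<xi>| powr \<alpha> >= 1 with
  exponent -\<beta>/\<alpha>, which is negative.\<close>

lemma symbol_bounded:
  fixes m :: "real^'n::finite \<Rightarrow> complex"
  assumes m: "is_symbol \<alpha> \<beta> A m" and ab: "\<alpha> * \<beta> > 0" and \<xi>: "\<xi> \<noteq> 0"
  shows "cmod (m \<xi>) \<le> \<bar>A (count_list [])\<bar>"
proof (cases "norm \<xi> powr \<alpha> < 1")
  case True
  then show ?thesis using symbol_zero[OF m \<xi>] by simp
next
  case False
  have \<alpha>: "\<alpha> \<noteq> 0" using ab by auto
  have "cmod (m \<xi>) \<le> A (count_list []) * norm \<xi> powr (- \<beta>)"
    using symbol_bound[OF m \<xi>, of 0] by (simp add: iter_deriv_def)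
  also have "\<dots> \<le> \<bar>A (count_list [])\<bar> * 1"
  proof (intro mult_mono)
    have "norm \<xi> powr (- \<beta>) = (norm \<xi> powr \<alpha>) powr (- \<beta> / \<alpha>)" using \<alpha> by (simp add: powr_powr)
    also have "\<dots> \<le> (norm \<xi> powr \<alpha>) powr 0"
      using False ab by (intro powr_mono) (auto simp: zero_less_mult_iff zero_le_divide_iff)
    finally show "norm \<xi> powr (- \<beta>) \<le> 1" using \<xi> by simp
  qed auto
  finally show ?thesis by simp
qed

text \<open>Dominated convergence for the partial sums; the product of the two transforms is
  integrable by Bessel's inequality.\<close>

lemma freq_form_pieces:
  fixes m f g :: "real^'n::finite \<Rightarrow> complex"
  assumes m: "is_symbol \<alpha> \<beta> A m" and ab: "\<alpha> * \<beta> > 0" and \<psi>: "cutoff N C \<psi>"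
    and f: "borel_bounded_compact f" and g: "borel_bounded_compact g"
  defines "w \<equiv> \<lambda>i \<xi>. m \<xi> * complex_of_real (annulus_cutoff \<psi> (freq_radius CARD('n) \<alpha> i) \<xi>)"
  assumes wi: "\<And>i. integrable lborel (w i)"
  shows "ennreal (cmod (freq_form m f g)) \<le> (\<Sum>i. ennreal (cmod (freq_form (w i) f g)))"
proof -
  let ?n = "CARD('n)"
  have \<alpha>: "\<alpha> \<noteq> 0" using ab by auto
  have [measurable]: "f \<in> borel_measurable borel" "g \<in> borel_measurable borel" "m \<in> borel_measurable borel"
    using f g symbol_measurable[OF m] by (auto simp: borel_bounded_compact_def)
  have [measurable]: "w i \<in> borel_measurable borel" for i using wi[of i] by auto
  have fg: "integrable lborel (\<lambda>\<xi>. fourier f \<xi> * cnj (fourier g \<xi>))"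
    by (intro integrable_mult_L2)
      (use fourier_L2_finite[OF borel_bounded_compact_integrable borel_bounded_compact_L2, OF f f]
           fourier_L2_finite[OF borel_bounded_compact_integrable borel_bounded_compact_L2, OF g g] in auto)
  define B where "B = \<bar>A (count_list [])\<bar> * (2 * C ^ ?n)"
  have "(\<lambda>I. LINT \<xi>|lborel. (\<Sum>i<I. w i \<xi>) * (fourier f \<xi> * cnj (fourier g \<xi>))) \<longlonglongrightarrow> (LINT \<xi>|lborel. m \<xi> * (fourier f \<xi> * cnj (fourier g \<xi>)))"
  proof (rule integral_dominated_convergence[where w = "\<lambda>\<xi>. B * cmod (fourier f \<xi> * cnj (fourier g \<xi>))"])
    show "integrable lborel (\<lambda>\<xi>. B * cmod (fourier f \<xi> * cnj (fourier g \<xi>)))" using fg by simp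
    have ae: "AE \<xi> in lborel. \<xi> \<noteq> (0::real^'n)" by (rule AE_lborel_singleton)
    show "AE \<xi> in lborel. (\<lambda>I. (\<Sum>i<I. w i \<xi>) * (fourier f \<xi> * cnj (fourier g \<xi>))) \<longlonglongrightarrow> m \<xi> * (fourier f \<xi> * cnj (fourier g \<xi>))"
      using ae by eventually_elim (use symbol_sum_annuli[OF m \<alpha> \<psi>] in \<open>auto simp: w_def intro!: tendsto_mult\<close>)
    show "AE \<xi> in lborel. cmod ((\<Sum>i<I. w i \<xi>) * (fourier f \<xi> * cnj (fourier g \<xi>))) \<le> B * cmod (fourier f \<xi> * cnj (fourier g \<xi>))" for I
      using ae
    proof eventually_elim
      case (elim \<xi>)
      have "(\<Sum>i<I. w i \<xi>) = m \<xi> * complex_of_real (\<Sum>i<I. annulus_cutoff \<psi> (freq_radius ?n \<alpha> i) \<xi>)"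
        by (simp add: w_def sum_distrib_left)
      \<comment> \<open>Telescoping leaves only two boxes, so the bound is uniform in the number
        \<open>I\<close> of pieces.\<close>
      moreover have "\<bar>\<Sum>i<I. annulus_cutoff \<psi> (freq_radius ?n \<alpha> i) \<xi>\<bar> \<le> 2 * C ^ ?n"
      proof -
        have *: "\<bar>smooth_box \<psi> R \<xi> - smooth_box \<psi> R' \<xi>\<bar> \<le> 2 * C ^ ?n" if "0 < R" "0 < R'" for R R'
          using smooth_box_bound[OF \<psi> that(1), of \<xi>] smooth_box_bound[OF \<psi> that(2), of \<xi>] by linarith
        show ?thesis unfolding sum_annuli by (auto intro!: * simp: freq_radius_pos)
      qed
      ultimately have "cmod (\<Sum>i<I. w i \<xi>) \<le> B"
        unfolding B_def by (simp only: norm_mult norm_of_real) (intro mult_mono symbol_bounded[OF m ab elim], auto)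
      then show ?case by (simp only: norm_mult[of "sum _ _"]) (intro mult_right_mono, auto)
    qed
  qed measurable
  moreover have "(LINT \<xi>|lborel. (\<Sum>i<I. w i \<xi>) * (fourier f \<xi> * cnj (fourier g \<xi>))) = (\<Sum>i<I. freq_form (w i) f g)" for I
  proof -
    have "(LINT \<xi>|lborel. (\<Sum>i<I. w i \<xi>) * (fourier f \<xi> * cnj (fourier g \<xi>))) = (LINT \<xi>|lborel. (\<Sum>i<I. w i \<xi> * fourier f \<xi> * cnj (fourier g \<xi>)))"
      by (simp add: sum_distrib_right mult.assoc)
    also have "\<dots> = (\<Sum>i<I. freq_form (w i) f g)"
      unfolding freq_form_def by (intro Bochner_Integration.integral_sum integrable_freq_form wi f g)
    finally show ?thesis .
  qed
  ultimately have lim: "(\<lambda>I. \<Sum>i<I. freq_form (w i) f g) \<longlonglongrightarrow> freq_form m f g"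
    by (simp add: freq_form_def mult.assoc)
  have le: "ennreal (cmod (\<Sum>i<I. freq_form (w i) f g)) \<le> (\<Sum>i. ennreal (cmod (freq_form (w i) f g)))" for I
  proof -
    have "ennreal (cmod (\<Sum>i<I. freq_form (w i) f g)) \<le> ennreal (\<Sum>i<I. cmod (freq_form (w i) f g))"
      by (intro ennreal_leI norm_sum)
    also have "\<dots> = (\<Sum>i<I. ennreal (cmod (freq_form (w i) f g)))" by (simp add: sum_ennreal)
    also have "\<dots> \<le> (\<Sum>i. ennreal (cmod (freq_form (w i) f g)))" by (rule sum_le_suminf) auto
    finally show ?thesis .
  qed
  have "(\<lambda>I. ennreal (cmod (\<Sum>i<I. freq_form (w i) f g))) \<longlonglongrightarrow> ennreal (cmod (freq_form m f g))"
    by (intro tendsto_ennrealI tendsto_norm lim)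
  then show ?thesis by (rule LIMSEQ_le_const2) (use le in blast)
qed

section \<open>Summation over frequencies\<close>

lemma summable_powr_geometric:
  fixes M0 \<theta> d :: real
  assumes "0 < M0" "1 < \<theta>" "0 < d"
  shows "summable (\<lambda>i. (M0 * \<theta> ^ i) powr (- d))"
proof -
  have "(M0 * \<theta> ^ i) powr (- d) = M0 powr (- d) * (\<theta> powr (- d)) ^ i" for i
    using assms by (simp add: powr_mult powr_powr mult.commute flip: powr_realpow)
  moreover have "\<theta> powr (- d) < 1" using assms by (intro powr_less_one_cases) auto
  then have "summable (\<lambda>i. M0 powr (- d) * (\<theta> powr (- d)) ^ i)" by (intro summable_mult summable_geometric) auto
  ultimately show ?thesis by simp
qed

text \<open>\<epsilon> spends at most half of the gap between n \<kappa> and b. After that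
  \<open>N\<close> is taken so large that a gain of M powr -\<epsilon> per derivative outweighs the
  volume factor M powr ((1 + \<epsilon>) n).\<close>

lemma exponent_choice:
  fixes b \<kappa> :: real
  assumes "0 < n" "0 \<le> \<kappa>" "\<kappa> \<le> 1" "real n * \<kappa> < b"
  obtains \<epsilon> and N :: nat where "0 < \<epsilon>" "\<epsilon> \<le> 1" "0 < b - (1 + \<epsilon>) * (real n * \<kappa>)" "n < N" "(1 + \<epsilon>) * real n \<le> \<epsilon> * real N"
proof -
  define \<epsilon> where "\<epsilon> = min 1 ((b - real n * \<kappa>) / (2 * real n))"
  have \<epsilon>: "0 < \<epsilon>" "\<epsilon> \<le> 1" using assms by (auto simp: \<epsilon>_def)
  have "\<epsilon> * (real n * \<kappa>) \<le> \<epsilon> * real n" using \<epsilon> assms by (intro mult_left_mono) (auto intro: mult_left_le)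
  also have "\<dots> \<le> (b - real n * \<kappa>) / (2 * real n) * real n" by (intro mult_right_mono) (auto simp: \<epsilon>_def)
  also have "\<dots> = (b - real n * \<kappa>) / 2" using assms by simp
  finally have d: "0 < b - (1 + \<epsilon>) * (real n * \<kappa>)" using assms(4) by (simp add: algebra_simps)
  obtain N0 :: nat where N0: "(1 + \<epsilon>) * real n / \<epsilon> \<le> real N0" using real_arch_simple by blast
  show ?thesis
  proof (rule that[OF \<epsilon> d, of "max N0 (Suc n)"])
    have "(1 + \<epsilon>) * real n \<le> \<epsilon> * real N0" using N0 \<epsilon> by (simp add: field_simps)
    also have "\<dots> \<le> \<epsilon> * real (max N0 (Suc n))" using \<epsilon> by (intro mult_left_mono) auto
    finally show "(1 + \<epsilon>) * real n \<le> \<epsilon> * real (max N0 (Suc n))" .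
  qed simp
qed

text \<open>\<open>4 * L\<close> is the side of the cubes in the near form and
  \<open>2 * (4 * R)\<close> the side of the frequency cube carrying the piece; hence 32 and the
  product \<open>R * L\<close>.\<close>

lemma near_weight_eq:
  fixes M R L b \<epsilon> \<kappa> :: real
  assumes "0 < M" "0 < R" "R * L = M powr (1 + \<epsilon>)"
  shows "M powr (- b) * ((4 * L) ^ n * (2 * (4 * R)) ^ n) powr \<kappa> = (32 ^ n) powr \<kappa> * M powr (- (b - (1 + \<epsilon>) * (real n * \<kappa>)))"
proof -
  have "(4 * L) ^ n * (2 * (4 * R)) ^ n = (32 * (R * L)) ^ n"
    unfolding power_mult_distrib[symmetric] by (simp add: mult_ac)
  also have "\<dots> = 32 ^ n * M powr ((1 + \<epsilon>) * real n)"
    unfolding assms(3) power_mult_distrib using assms(1) by (simp add: powr_powr flip: powr_realpow)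
  finally have e: "(4 * L) ^ n * (2 * (4 * R)) ^ n = 32 ^ n * M powr ((1 + \<epsilon>) * real n)" .
  have "M powr (- b) * ((4 * L) ^ n * (2 * (4 * R)) ^ n) powr \<kappa> = (32 ^ n) powr \<kappa> * (M powr (- b) * M powr ((1 + \<epsilon>) * real n * \<kappa>))"
    unfolding e by (simp add: powr_mult powr_powr)
  also have "M powr (- b) * M powr ((1 + \<epsilon>) * real n * \<kappa>) = M powr (- (b - (1 + \<epsilon>) * (real n * \<kappa>)))"
    unfolding powr_add[symmetric] by (simp add: algebra_simps)
  finally show ?thesis .
qed

text \<open>\<open>r\<close> is the length M / R beyond which the kernel decays. The volume
  contributes (R L)^n = M powr ((1 + \<epsilon>) n) and the decay (r / L)^N = M powr (-\<epsilon>
  N); the total exponent is not positive, so the lower bound \<open>c\<close> for \<open>M\<close>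
  suffices.\<close>

lemma far_weight_le:
  fixes M R L b \<epsilon> c :: real
  assumes M: "0 < M" and R: "0 < R" and L: "0 < L" and RL: "R * L = M powr (1 + \<epsilon>)" and c: "0 < c" "c \<le> M"
    and N: "(1 + \<epsilon>) * real n \<le> \<epsilon> * real N" and r: "r * R = M"
  shows "M powr (- b) * R ^ n * r ^ N * L ^ n / L ^ N \<le> c powr (- (\<epsilon> * real N - (1 + \<epsilon>) * real n)) * M powr (- b)"
proof -
  have rL: "r / L = M powr (- \<epsilon>)"
  proof -
    have "r / L = M / (R * L)" using R L r by (simp add: field_simps)
    also have "\<dots> = M powr 1 / M powr (1 + \<epsilon>)" using RL M by simp
    also have "\<dots> = M powr (- \<epsilon>)" unfolding powr_diff[symmetric] by simp
    finally show ?thesis .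
  qed
  have eq: "M powr (- b) * R ^ n * r ^ N * L ^ n / L ^ N = M powr (- b) * ((R * L) ^ n * (r / L) ^ N)"
    by (simp add: power_mult_distrib power_divide)
  have "(R * L) ^ n * (r / L) ^ N = M powr ((1 + \<epsilon>) * real n) * M powr (- \<epsilon> * real N)"
    unfolding RL rL using M by (simp add: powr_powr flip: powr_realpow)
  also have "\<dots> = M powr (- (\<epsilon> * real N - (1 + \<epsilon>) * real n))"
    unfolding powr_add[symmetric] by (simp add: algebra_simps)
  also have "\<dots> \<le> c powr (- (\<epsilon> * real N - (1 + \<epsilon>) * real n))"
    using c N by (intro powr_mono2') auto
  finally have "M powr (- b) * ((R * L) ^ n * (r / L) ^ N) \<le> M powr (- b) * c powr (- (\<epsilon> * real N - (1 + \<epsilon>) * real n))"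
    by (intro mult_left_mono) auto
  then show ?thesis unfolding eq by (simp only: mult.commute)
qed

text \<open>\<open>W\<close> and \<open>\<Lambda>\<close> are fixed before \<open>m\<close>,
  \<open>f\<close> and \<open>g\<close>, as the final constant requires. \<open>W i\<close> is the
  sum of the near and far weights of piece \<open>i\<close>; both are geometric in \<open>i\<close>
  because \<open>M i\<close> is and because both exponents are negative.\<close>

lemma multiplier_bound:
  fixes A :: "('n::finite \<Rightarrow> nat) \<Rightarrow> real"
  assumes ab: "\<alpha> * \<beta> > 0" and p: "1 \<le> p" "p \<le> 2" and q: "1 \<le> q" "q \<le> 2"
    and gap: "real CARD('n) * (1 / p + 1 / q - 1) < \<beta> / \<alpha>"
  shows "\<exists>W \<Lambda>. (\<forall>i. 0 \<le> W i) \<and> summable W \<and> (\<forall>i. 0 < \<Lambda> i) \<and>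
    (\<forall>(m :: real^'n \<Rightarrow> complex) f g. is_symbol \<alpha> \<beta> A m \<longrightarrow> borel_bounded_compact f \<longrightarrow> borel_bounded_compact g \<longrightarrow>
      ennreal (cmod (freq_form m f g)) \<le> (\<Sum>i. ennreal (W i) * (\<Sum>h. ennreal ((1 / 2) ^ h) *
         local_form p q (2 ^ (h + 1) * \<Lambda> i) (\<lambda>x. cmod (f x)) (\<lambda>x. cmod (g x)))))"
proof -
  let ?n = "CARD('n)"
  define \<kappa> where "\<kappa> = 1 / p + 1 / q - 1"
  define b where "b = \<beta> / \<alpha>"
  have \<alpha>: "\<alpha> \<noteq> 0" using ab by auto
  have "1 / 2 \<le> 1 / p" "1 / p \<le> 1" "1 / 2 \<le> 1 / q" "1 / q \<le> 1" using p q by (auto simp: field_simps)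
  then have \<kappa>: "0 \<le> \<kappa>" "\<kappa> \<le> 1" by (auto simp: \<kappa>_def)
  have b: "0 < b" using ab by (auto simp: b_def zero_less_mult_iff zero_less_divide_iff)
  have "real ?n * \<kappa> < b" using gap by (simp add: \<kappa>_def b_def)
  then obtain \<epsilon> and N :: nat where \<epsilon>: "0 < \<epsilon>" "\<epsilon> \<le> 1" and d: "0 < b - (1 + \<epsilon>) * (real ?n * \<kappa>)"
    and N: "?n < N" "(1 + \<epsilon>) * real ?n \<le> \<epsilon> * real N"
    using exponent_choice[of ?n \<kappa> b] \<kappa> by (metis zero_less_card_finite)
  let ?R = "freq_radius ?n \<alpha>"
  define M where "M i = ?R i powr \<alpha>" for i
  define \<theta> where "\<theta> = 2 powr \<bar>\<alpha>\<bar>"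
  have R: "0 < ?R i" for i by (simp add: freq_radius_pos)
  have \<theta>: "1 < \<theta>" using \<alpha> by (simp add: \<theta>_def)
  have M: "0 < M i" for i using R[of i] by (simp add: M_def)
  have Mi: "M i = M 0 * \<theta> ^ i" for i unfolding M_def \<theta>_def by (rule freq_radius_powr[OF _ \<alpha>]) simp
  have M0: "M 0 \<le> M i" for i
    using M[of 0] one_le_power[of \<theta> i] \<theta> unfolding Mi[of i] by simp
  define c0 where "c0 = min 1 (M 0)"
  have c0: "0 < c0" "c0 \<le> 1" "c0 \<le> M i" for i using M[of 0] M0[of i] by (auto simp: c0_def)
  \<comment> \<open>The square is needed because the kernel bound is invoked only for R |z_j| >= M
    powr (1 + \<epsilon>), which is bounded below by c0 powr (1 + \<epsilon>) >= c0^2, as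
    \<open>c0\<close> and \<epsilon> are at most 1.\<close>
  have c: "0 < c0 ^ 2" "c0 ^ 2 \<le> 1" "c0 ^ 2 \<le> M i" for i
  proof -
    have "c0 * c0 \<le> c0" by (rule mult_left_le) (use c0(1,2) in auto)
    then show "0 < c0 ^ 2" "c0 ^ 2 \<le> 1" "c0 ^ 2 \<le> M i"
      using c0(1,2) c0(3)[of i] unfolding power2_eq_square by (simp, linarith+)
  qed
  obtain C \<psi> where \<psi>: "cutoff N C \<psi>" using cutoff_exists by blast
  obtain K where K0: "0 < K" and K: "\<And>(m :: real^'n \<Rightarrow> complex) R. is_symbol \<alpha> \<beta> A m \<Longrightarrow> 0 < R \<Longrightarrow> c0 ^ 2 \<le> R powr \<alpha> \<Longrightarrow>
    integrable lborel (\<lambda>\<xi>. m \<xi> * complex_of_real (annulus_cutoff \<psi> R \<xi>)) \<and>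
    (\<forall>\<xi>. cmod (m \<xi> * complex_of_real (annulus_cutoff \<psi> R \<xi>)) \<le> K * R powr (- \<beta>)) \<and>
    (\<forall>\<xi> j. \<bar>\<xi> $ j\<bar> > 4 * R \<longrightarrow> m \<xi> * complex_of_real (annulus_cutoff \<psi> R \<xi>) = 0) \<and>
    (\<forall>z i. c0 ^ 2 \<le> R * \<bar>z $ i\<bar> \<longrightarrow> cmod (inv_kernel (\<lambda>\<xi>. m \<xi> * complex_of_real (annulus_cutoff \<psi> R \<xi>)) z)
        \<le> K * R powr (- \<beta>) * R ^ ?n * (R powr (\<alpha> - 1) / \<bar>z $ i\<bar>) ^ N)"
    using symbol_annulus[OF \<psi> c(1,2), of \<alpha> \<beta> A] by blast
  define L where "L i = M i powr (1 + \<epsilon>) / ?R i" for i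
  have L: "0 < L i" for i using M[of i] R[of i] by (simp add: L_def)
  have RL: "?R i * L i = M i powr (1 + \<epsilon>)" for i using R[of i] by (simp add: L_def)
  have Rb: "?R i powr (- \<beta>) = M i powr (- b)" for i using \<alpha> by (simp add: M_def b_def powr_powr)
  have Ra: "?R i powr (\<alpha> - 1) * ?R i = M i" for i using R[of i] by (simp add: M_def powr_diff)
  define c1 where "c1 = 4 * (2 * pi) ^ ?n * K * 4 ^ ?n * (32 ^ ?n) powr \<kappa>"
  define c2 where "c2 = 2 * 16 ^ ?n * K * c0 powr (- (\<epsilon> * real N - (1 + \<epsilon>) * real ?n))"
  define W where "W i = c1 * M i powr (- (b - (1 + \<epsilon>) * (real ?n * \<kappa>))) + c2 * M i powr (- b)" for i
  have c12: "0 \<le> c1" "0 \<le> c2" using K0 by (auto simp: c1_def c2_def)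
  show ?thesis
  proof (rule exI[of _ W], rule exI[of _ L], intro conjI allI impI L)
    show "0 \<le> W i" for i using c12 by (simp add: W_def)
    show "summable W" unfolding W_def
      by (subst (1 2) Mi) (intro summable_add summable_mult summable_powr_geometric M \<theta> b d)
    fix m f g :: "real^'n \<Rightarrow> complex"
    assume m: "is_symbol \<alpha> \<beta> A m" and f: "borel_bounded_compact f" and g: "borel_bounded_compact g"
    let ?w = "\<lambda>i \<xi>. m \<xi> * complex_of_real (annulus_cutoff \<psi> (?R i) \<xi>)"
    have Ki: "integrable lborel (?w i)" "\<And>\<xi>. cmod (?w i \<xi>) \<le> K * M i powr (- b)"
      "\<And>\<xi> j. \<bar>\<xi> $ j\<bar> > 4 * ?R i \<Longrightarrow> ?w i \<xi> = 0"
      "\<And>z j. c0 ^ 2 \<le> ?R i * \<bar>z $ j\<bar> \<Longrightarrow> cmod (inv_kernel (?w i) z)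
        \<le> K * M i powr (- b) * ?R i ^ ?n * (?R i powr (\<alpha> - 1) / \<bar>z $ j\<bar>) ^ N" for i
      using K[OF m R c(3)[unfolded M_def], of i] unfolding Rb by blast+
    have "ennreal (cmod (freq_form m f g)) \<le> (\<Sum>i. ennreal (cmod (freq_form (?w i) f g)))"
      by (rule freq_form_pieces[OF m ab \<psi> f g Ki(1)])
    also have "\<dots> \<le> (\<Sum>i. ennreal (W i) * (\<Sum>h. ennreal ((1 / 2) ^ h) *
         local_form p q (2 ^ (h + 1) * L i) (\<lambda>x. cmod (f x)) (\<lambda>x. cmod (g x))))"
    proof (rule suminf_le)
      fix i
      let ?K = "K * M i powr (- b) * ?R i ^ ?n * (?R i powr (\<alpha> - 1)) ^ N"
      have R4: "0 < 4 * ?R i" using R by simp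
      have "ennreal (cmod (freq_form (?w i) f g)) \<le>
        ennreal (4 * (2 * pi) ^ ?n * (K * M i powr (- b)) * 4 ^ ?n * ((4 * L i) ^ ?n * (2 * (4 * ?R i)) ^ ?n) powr (1 / p + 1 / q - 1)
          + 2 * (16 ^ ?n * ?K * L i ^ ?n / L i ^ N)) *
        (\<Sum>h. ennreal ((1 / 2) ^ h) * local_form p q (2 ^ (h + 1) * L i) (\<lambda>x. cmod (f x)) (\<lambda>x. cmod (g x)))"
      proof (rule piece_local_form_bound[OF f g Ki(1) Ki(2) Ki(3) R4 L _ _ N(1) p q])
        show "0 \<le> ?K" using K0 R[of i] by simp
        fix z :: "real^'n" and j assume z: "L i \<le> \<bar>z $ j\<bar>"
        have "c0 ^ 2 \<le> c0 powr (1 + \<epsilon>)"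
          using c0(1,2) \<epsilon> powr_mono'[of "1 + \<epsilon>" 2 c0] by simp
        also have "\<dots> \<le> M i powr (1 + \<epsilon>)" using c0(1) c0(3)[of i] \<epsilon> by (intro powr_mono2) auto
        also have "\<dots> \<le> ?R i * \<bar>z $ j\<bar>" using z R[of i] unfolding RL[symmetric] by (intro mult_left_mono) auto
        finally show "cmod (inv_kernel (?w i) z) \<le> ?K / \<bar>z $ j\<bar> ^ N"
          using Ki(4)[of i z j] by (simp add: power_divide)
      qed
      also have "\<dots> \<le> ennreal (W i) * (\<Sum>h. ennreal ((1 / 2) ^ h) *
         local_form p q (2 ^ (h + 1) * L i) (\<lambda>x. cmod (f x)) (\<lambda>x. cmod (g x)))"
      proof (intro mult_right_mono ennreal_leI)
        have "4 * (2 * pi) ^ ?n * (K * M i powr (- b)) * 4 ^ ?n * ((4 * L i) ^ ?n * (2 * (4 * ?R i)) ^ ?n) powr \<kappa>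
          = 4 * (2 * pi) ^ ?n * K * 4 ^ ?n * (M i powr (- b) * ((4 * L i) ^ ?n * (2 * (4 * ?R i)) ^ ?n) powr \<kappa>)" by simp
        also have "\<dots> = c1 * M i powr (- (b - (1 + \<epsilon>) * (real ?n * \<kappa>)))"
          unfolding near_weight_eq[OF M R RL] c1_def by simp
        finally have 1: "4 * (2 * pi) ^ ?n * (K * M i powr (- b)) * 4 ^ ?n * ((4 * L i) ^ ?n * (2 * (4 * ?R i)) ^ ?n) powr \<kappa>
          = c1 * M i powr (- (b - (1 + \<epsilon>) * (real ?n * \<kappa>)))" .
        have "2 * (16 ^ ?n * ?K * L i ^ ?n / L i ^ N) =
          2 * 16 ^ ?n * K * (M i powr (- b) * ?R i ^ ?n * (?R i powr (\<alpha> - 1)) ^ N * L i ^ ?n / L i ^ N)" by simp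
        also have "\<dots> \<le> 2 * 16 ^ ?n * K * (c0 powr (- (\<epsilon> * real N - (1 + \<epsilon>) * real ?n)) * M i powr (- b))"
          using K0 by (intro mult_left_mono far_weight_le[OF M R L RL c0(1) c0(3) N(2) Ra]) auto
        also have "\<dots> = c2 * M i powr (- b)" by (simp add: c2_def)
        finally show "4 * (2 * pi) ^ ?n * (K * M i powr (- b)) * 4 ^ ?n * ((4 * L i) ^ ?n * (2 * (4 * ?R i)) ^ ?n) powr (1 / p + 1 / q - 1)
          + 2 * (16 ^ ?n * ?K * L i ^ ?n / L i ^ N) \<le> W i"
          using 1 unfolding \<kappa>_def[symmetric] W_def by linarith
      qed auto
      finally show "ennreal (cmod (freq_form (?w i) f g)) \<le> ennreal (W i) * (\<Sum>h. ennreal ((1 / 2) ^ h) *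
         local_form p q (2 ^ (h + 1) * L i) (\<lambda>x. cmod (f x)) (\<lambda>x. cmod (g x)))" .
    qed auto
    finally show "ennreal (cmod (freq_form m f g)) \<le> (\<Sum>i. ennreal (W i) * (\<Sum>h. ennreal ((1 / 2) ^ h) *
         local_form p q (2 ^ (h + 1) * L i) (\<lambda>x. cmod (f x)) (\<lambda>x. cmod (g x))))" .
  qed
qed

section \<open>Stopping cubes\<close>

text \<open>The frame of a stopping time argument: \<open>bad P Q\<close> is the condition under
  which the selection stops at \<open>Q\<close> when started from \<open>P\<close>. The last
  assumption is the only quantitative one, and finiteness of the set of ancestors makes maximal bad
  sets exist.\<close>

locale nested_family =
  fixes M :: "'a measure" and \<D> :: "'a set set" and Q0 :: "'a set" and bad :: "'a set \<Rightarrow> 'a set \<Rightarrow> bool"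
  assumes top: "Q0 \<in> \<D>" "\<And>Q. Q \<in> \<D> \<Longrightarrow> Q \<subseteq> Q0"
    and nonempty: "\<And>Q. Q \<in> \<D> \<Longrightarrow> Q \<noteq> {}"
    and nested: "\<And>A B. A \<in> \<D> \<Longrightarrow> B \<in> \<D> \<Longrightarrow> A \<inter> B = {} \<or> A \<subseteq> B \<or> B \<subseteq> A"
    and fin_up: "\<And>Q. Q \<in> \<D> \<Longrightarrow> finite {Q' \<in> \<D>. Q \<subseteq> Q'}"
    and countable: "countable \<D>"
    and sets: "\<And>Q. Q \<in> \<D> \<Longrightarrow> Q \<in> sets M"
    and finite_measure: "\<And>Q. Q \<in> \<D> \<Longrightarrow> emeasure M Q < \<infinity>"
    and bad_irrefl: "\<And>Q. Q \<in> \<D> \<Longrightarrow> \<not> bad Q Q"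
    and bad_small: "\<And>P \<C>. P \<in> \<D> \<Longrightarrow> \<C> \<subseteq> {Q \<in> \<D>. Q \<subseteq> P \<and> bad P Q} \<Longrightarrow> disjoint \<C> \<Longrightarrow>
        emeasure M (\<Union>\<C>) \<le> emeasure M P / 2"
begin

text \<open>Counts the ancestors of \<open>Q\<close>, itself included, and thus grows strictly as
  sets shrink; it serves as the induction measure and for selecting extremal sets.\<close>

definition depth :: "'a set \<Rightarrow> nat" where "depth Q = card {Q' \<in> \<D>. Q \<subseteq> Q'}"

lemma depth_less: "A \<in> \<D> \<Longrightarrow> B \<in> \<D> \<Longrightarrow> A \<subset> B \<Longrightarrow> depth B < depth A"
  unfolding depth_def by (rule psubset_card_mono[OF fin_up]) auto

definition children :: "'a set \<Rightarrow> 'a set set" where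
  "children P = {Q \<in> \<D>. Q \<subset> P \<and> bad P Q \<and> (\<forall>Q'\<in>\<D>. Q \<subset> Q' \<and> Q' \<subseteq> P \<longrightarrow> \<not> bad P Q')}"

lemma children_cover:
  assumes P: "P \<in> \<D>" and Q: "Q \<in> \<D>" "Q \<subseteq> P" "bad P Q"
  shows "\<exists>Q'\<in>children P. Q \<subseteq> Q'"
proof -
  let ?C = "\<lambda>Q'. Q' \<in> \<D> \<and> Q \<subseteq> Q' \<and> Q' \<subseteq> P \<and> bad P Q'"
  have "?C Q" using Q by simp
  then obtain Q' where Q': "?C Q'" "\<And>R. ?C R \<Longrightarrow> depth Q' \<le> depth R"
    using ex_has_least_nat[of ?C Q depth] by blast
  have "Q' \<noteq> P" using Q'(1) bad_irrefl[OF P] by auto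
  moreover have "\<not> bad P R" if "R \<in> \<D>" "Q' \<subset> R" "R \<subseteq> P" for R
    using Q'(2)[of R] depth_less[of Q' R] that Q'(1) by (metis leD psubset_imp_subset subset_trans)
  ultimately show ?thesis using Q'(1) unfolding children_def by blast
qed

lemma children_not_psubset: "A \<in> children P \<Longrightarrow> B \<in> children P \<Longrightarrow> \<not> A \<subset> B"
  unfolding children_def by auto

lemma children_disjoint: "disjoint (children P)"
  unfolding disjoint_def
proof (intro ballI impI)
  fix A B assume AB: "A \<in> children P" "B \<in> children P" "A \<noteq> B"
  then have "A \<inter> B = {} \<or> A \<subseteq> B \<or> B \<subseteq> A" by (intro nested) (auto simp: children_def)
  then show "A \<inter> B = {}"
    using children_not_psubset[OF AB(1,2)] children_not_psubset[OF AB(2,1)] AB(3) by blast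
qed

inductive_set stopping :: "'a set set" where
  stopping_top: "Q0 \<in> stopping"
| stopping_child: "P \<in> stopping \<Longrightarrow> Q \<in> children P \<Longrightarrow> Q \<in> stopping"

lemma stopping_subset: "P \<in> stopping \<Longrightarrow> P \<in> \<D>"
  by (induction rule: stopping.induct) (auto simp: top children_def)

text \<open>The generations of stopping sets respect inclusion: a stopping set strictly inside
  \<open>P\<close> was selected through a child of \<open>P\<close>. \<open>P\<close> is compared
  with the set \<open>P'\<close> from which \<open>X\<close> was selected. This makes the cores
  disjoint.\<close>

lemma stopping_nested:
  assumes "X \<in> stopping" "P \<in> stopping" "X \<subset> P"
  shows "\<exists>Q\<in>children P. X \<subseteq> Q"
  using assms
proof (induction "depth X" arbitrary: X P rule: less_induct)
  case less
  note D = stopping_subset[OF less.prems(1)] stopping_subset[OF less.prems(2)]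
  from less.prems(1) show ?case
  proof cases
    case stopping_top
    then show ?thesis using top(2)[OF D(2)] less.prems(3) by auto
  next
    case (stopping_child P')
    have P'D: "P' \<in> \<D>" by (rule stopping_subset[OF stopping_child(1)])
    have XP': "X \<subset> P'" using stopping_child(2) by (simp add: children_def)
    have "P \<inter> P' \<noteq> {}" using nonempty[OF D(1)] less.prems(3) XP' by blast
    then consider "P = P'" | "P' \<subset> P" | "P \<subset> P'" using nested[OF D(2) P'D] by blast
    then show ?thesis
    proof cases
      case 1
      then show ?thesis using stopping_child(2) by blast
    next
      case 2
      then show ?thesis
        using less.hyps[OF depth_less[OF D(1) P'D XP'] stopping_child(1) less.prems(2)] XP' by blast
    next
      case 3
      \<comment> \<open>Here \<open>P\<close> would lie in a child of \<open>P'\<close> that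
        strictly contains \<open>X\<close>, another child of \<open>P'\<close>; but children are
        maximal.\<close>
      obtain Q where "Q \<in> children P'" "P \<subseteq> Q"
        using less.hyps[OF depth_less[OF D less.prems(3)] less.prems(2) stopping_child(1) 3] by blast
      then show ?thesis using children_not_psubset[OF stopping_child(2)] less.prems(3) by blast
    qed
  qed
qed

text \<open>The smallest stopping set containing \<open>Q\<close> works: if \<open>Q\<close> were
  bad for it, then a child, again stopping and strictly smaller, would still contain
  \<open>Q\<close>.\<close>

lemma stopping_parent:
  assumes "Q \<in> \<D>"
  shows "\<exists>P\<in>stopping. Q \<subseteq> P \<and> \<not> bad P Q"
proof -
  let ?C = "\<lambda>P. P \<in> stopping \<and> Q \<subseteq> P"
  have fin: "finite {P. ?C P}"
    by (rule finite_subset[OF _ fin_up[OF assms]]) (auto intro: stopping_subset)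
  have "?C Q0" using top(2)[OF assms] stopping_top by simp
  obtain P where P: "?C P" "\<And>R. ?C R \<Longrightarrow> depth R \<le> depth P"
  proof -
    let ?m = "Max (depth ` {P. ?C P})"
    have "?m \<in> depth ` {P. ?C P}" using fin \<open>?C Q0\<close> by (intro Max_in) auto
    then obtain P where "?C P" "depth P = ?m" by auto
    moreover have "depth R \<le> ?m" if "?C R" for R using fin that by (intro Max_ge) auto
    ultimately show ?thesis using that by metis
  qed
  have "\<not> bad P Q"
  proof
    assume "bad P Q"
    have PD: "P \<in> \<D>" using stopping_subset P(1) by blast
    obtain Q' where Q': "Q' \<in> children P" "Q \<subseteq> Q'"
      using children_cover[OF PD assms _ \<open>bad P Q\<close>] P(1) by blast
    then have "?C Q'" using P(1) stopping_child by blast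
    moreover have "depth P < depth Q'" using Q'(1) PD by (intro depth_less) (auto simp: children_def)
    ultimately show False using P(2) by (metis leD)
  qed
  then show ?thesis using P(1) by blast
qed

text \<open>These are the disjoint large portions that witness sparseness.\<close>

definition core :: "'a set \<Rightarrow> 'a set" where "core P = P - \<Union>(children P)"

lemma children_countable: "countable (children P)"
  by (rule countable_subset[OF _ countable]) (auto simp: children_def)

lemma children_union_sets: "\<Union>(children P) \<in> sets M"
  by (intro sets.countable_Union children_countable) (auto simp: children_def sets)

lemma core_sets: "P \<in> \<D> \<Longrightarrow> core P \<in> sets M"
  unfolding core_def using children_union_sets sets by auto

lemma core_measure:
  assumes P: "P \<in> \<D>"
  shows "measure M P / 2 \<le> measure M (core P)"
proof -
  have le: "emeasure M (\<Union>(children P)) \<le> emeasure M P / 2"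
    by (rule bad_small[OF P _ children_disjoint]) (auto simp: children_def)
  have fP: "emeasure M P \<noteq> \<infinity>" using finite_measure[OF P] by simp
  have sub: "\<Union>(children P) \<subseteq> P" by (auto simp: children_def)
  have fC: "emeasure M (\<Union>(children P)) \<noteq> \<infinity>"
    using emeasure_mono[OF sub sets[OF P]] finite_measure[OF P] by (auto simp: top_unique)
  have "measure M (core P) = measure M P - measure M (\<Union>(children P))"
    unfolding core_def by (rule measure_Diff[OF fP sets[OF P] children_union_sets sub])
  moreover have "measure M (\<Union>(children P)) \<le> measure M P / 2"
  proof -
    have "ennreal (measure M (\<Union>(children P))) \<le> ennreal (measure M P / 2)"
      using le fP fC by (simp add: emeasure_eq_ennreal_measure divide_ennreal[symmetric])
    then show ?thesis by simp
  qed
  ultimately show ?thesis by simp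
qed

lemma core_disjoint: "disjoint_family_on core stopping"
  unfolding disjoint_family_on_def
proof (intro ballI impI)
  fix A B assume AB: "A \<in> stopping" "B \<in> stopping" "A \<noteq> B"
  have *: "core X \<inter> core P = {}" if "X \<in> stopping" "P \<in> stopping" "X \<subset> P" for X P
    using stopping_nested[OF that] by (auto simp: core_def)
  show "core A \<inter> core B = {}"
    using nested[OF stopping_subset[OF AB(1)] stopping_subset[OF AB(2)]] *[OF AB(1,2)] *[OF AB(2,1)] AB(3)
    by (auto simp: core_def)
qed

end

text \<open>Chebyshev's argument: on each selected set the mass of \<open>H\<close> exceeds
  \<open>c\<close> times the density on \<open>P\<close> times the measure of the set. The sets are
  disjoint and inside \<open>P\<close>, so together they carry at most the mass of
  \<open>P\<close>.\<close>

lemma density_selection_small: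
  fixes H :: "'a \<Rightarrow> real"
  assumes H: "integrable M H" "\<And>x. 0 \<le> H x" and P: "P \<in> sets M" "emeasure M P < \<infinity>" and c: "0 < c"
    and \<C>: "countable \<C>" "disjoint \<C>" "\<And>Q. Q \<in> \<C> \<Longrightarrow> Q \<in> sets M \<and> Q \<subseteq> P \<and> 0 < measure M Q"
    and sel: "\<And>Q. Q \<in> \<C> \<Longrightarrow> c * ((LINT x|M. indicator P x * H x) / measure M P) < (LINT x|M. indicator Q x * H x) / measure M Q"
  shows "emeasure M (\<Union>\<C>) \<le> ennreal (1 / c) * emeasure M P"
proof (cases "\<C> = {}")
  case False
  let ?I = "\<lambda>Q. LINT x|M. indicator Q x * H x"
  define a where "a = ?I P / measure M P"
  have iH: "integrable M (\<lambda>x. indicator Q x * H x)" if "Q \<in> sets M" for Q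
    using integrable_mult_indicator[OF that H(1)] by simp
  have nn: "(\<integral>\<^sup>+x. ennreal (H x) * indicator Q x \<partial>M) = ennreal (?I Q)" if "Q \<in> sets M" for Q
  proof -
    have "(\<integral>\<^sup>+x. ennreal (H x) * indicator Q x \<partial>M) = (\<integral>\<^sup>+x. ennreal (indicator Q x * H x) \<partial>M)"
      by (intro nn_integral_cong) (auto simp: indicator_def)
    also have "\<dots> = ennreal (?I Q)" using iH[OF that] H(2) by (intro nn_integral_eq_integral) auto
    finally show ?thesis .
  qed
  have mono: "?I Q \<le> ?I P" if "Q \<in> \<C>" for Q
    using \<C>(3)[OF that] P(1) H(2) by (intro integral_mono iH) (auto simp: indicator_def)
  have I0: "0 \<le> ?I Q" for Q using H(2) by (intro integral_nonneg_AE) auto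
  obtain Q where Q: "Q \<in> \<C>" using False by blast
  have mP: "0 < measure M P"
  proof -
    have "measure M Q \<le> measure M P"
      using \<C>(3)[OF Q] P by (intro measure_mono_fmeasurable) (auto simp: fmeasurable_def)
    then show ?thesis using \<C>(3)[OF Q] by linarith
  qed
  \<comment> \<open>If \<open>H\<close> had density 0 on \<open>P\<close>, it would have density 0
    on \<open>Q\<close> as well, contradicting the strict selection inequality.\<close>
  have a: "0 < a"
  proof (rule ccontr)
    assume "\<not> 0 < a"
    then have "?I P = 0" using I0[of P] mP by (simp add: a_def not_less divide_le_0_iff)
    then have "?I Q = 0" using mono[OF Q] I0[of Q] by simp
    then show False using sel[OF Q] \<open>?I P = 0\<close> by simp
  qed
  have one: "ennreal (c * a) * emeasure M R \<le> (\<integral>\<^sup>+x. ennreal (H x) * indicator R x \<partial>M)" if R: "R \<in> \<C>" for R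
  proof -
    have "c * a * measure M R \<le> ?I R" using sel[OF R] \<C>(3)[OF R] by (simp add: a_def field_simps)
    moreover have "emeasure M R = ennreal (measure M R)"
      using emeasure_mono[of R P M] \<C>(3)[OF R] P by (intro emeasure_eq_ennreal_measure) (auto simp: top_unique)
    ultimately show ?thesis using nn[of R] \<C>(3)[OF R] c a by (simp add: ennreal_mult[symmetric] ennreal_leI)
  qed
  have dj: "disjoint_family_on (\<lambda>Q. Q) \<C>"
    using \<C>(2) by (auto simp: disjoint_family_on_def disjoint_def)
  have "ennreal (c * a) * emeasure M (\<Union>\<C>) = ennreal (c * a) * (\<integral>\<^sup>+R. emeasure M R \<partial>count_space \<C>)"
    using emeasure_UN_countable[of \<C> "\<lambda>Q. Q" M] \<C> dj by simp
  also have "\<dots> = (\<integral>\<^sup>+R. ennreal (c * a) * emeasure M R \<partial>count_space \<C>)" by (simp add: nn_integral_cmult)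
  \<comment> \<open>Writing the masses as values of the measure with density \<open>H\<close> allows
    them to be added by countable additivity.\<close>
  also have "\<dots> \<le> (\<integral>\<^sup>+R. emeasure (density M (\<lambda>x. ennreal (H x))) R \<partial>count_space \<C>)"
  proof (rule nn_integral_mono)
    fix R assume "R \<in> space (count_space \<C>)"
    then show "ennreal (c * a) * emeasure M R \<le> emeasure (density M (\<lambda>x. ennreal (H x))) R"
      using one[of R] \<C>(3)[of R] H(1) by (subst emeasure_density) auto
  qed
  also have "\<dots> = emeasure (density M (\<lambda>x. ennreal (H x))) (\<Union>\<C>)"
    using emeasure_UN_countable[of \<C> "\<lambda>Q. Q" "density M (\<lambda>x. ennreal (H x))"] \<C> dj by simp
  also have "\<dots> \<le> emeasure (density M (\<lambda>x. ennreal (H x))) P"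
    using \<C>(3) P(1) by (intro emeasure_mono) auto
  also have "\<dots> = ennreal (?I P)" using nn[OF P(1)] H(1) P(1) by (subst emeasure_density) auto
  also have "\<dots> = ennreal a * emeasure M P"
    using mP P(2) a by (simp add: a_def emeasure_eq_ennreal_measure ennreal_mult[symmetric])
  finally have "ennreal (1 / (c * a)) * (ennreal (c * a) * emeasure M (\<Union>\<C>)) \<le> ennreal (1 / (c * a)) * (ennreal a * emeasure M P)"
    by (intro mult_left_mono) auto
  moreover have "ennreal (1 / (c * a)) * (ennreal (c * a) * X) = X" for X
    using c a by (simp add: mult.assoc[symmetric] ennreal_mult[symmetric])
  moreover have "ennreal (1 / (c * a)) * (ennreal a * X) = ennreal (1 / c) * X" for X
    using c a by (simp add: mult.assoc[symmetric] ennreal_mult[symmetric])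
  ultimately show ?thesis by simp
qed simp

text \<open>With the thresholds \<open>2 ^ (i + 2)\<close> the cubes on which some density jumps fill at most a proportion
  \<open>\<Sum>i. 2 ^ -(i + 2) = 1 / 2\<close> of \<open>P\<close>, however many densities are watched at the same time.\<close>

definition density_jump :: "'a measure \<Rightarrow> (nat \<Rightarrow> 'a \<Rightarrow> real) \<Rightarrow> 'a set \<Rightarrow> 'a set \<Rightarrow> bool" where
  "density_jump M H P Q \<longleftrightarrow> (\<exists>i. 2 ^ (i + 2) * ((LINT x|M. indicator P x * H i x) / measure M P) <
      (LINT x|M. indicator Q x * H i x) / measure M Q)"

lemma density_jump_small:
  assumes H: "\<And>i. integrable M (H i)" "\<And>i x. 0 \<le> H i x" and P: "P \<in> sets M" "emeasure M P < \<infinity>"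
    and \<C>: "countable \<C>" "disjoint \<C>" "\<And>Q. Q \<in> \<C> \<Longrightarrow> Q \<in> sets M \<and> Q \<subseteq> P \<and> 0 < measure M Q \<and> density_jump M H P Q"
  shows "emeasure M (\<Union>\<C>) \<le> emeasure M P / 2"
proof -
  define \<C>' where "\<C>' i = {Q \<in> \<C>. 2 ^ (i + 2) * ((LINT x|M. indicator P x * H i x) / measure M P) <
      (LINT x|M. indicator Q x * H i x) / measure M Q}" for i
  have sub: "\<C>' i \<subseteq> \<C>" for i by (auto simp: \<C>'_def)
  have cnt: "countable (\<C>' i)" for i using countable_subset[OF sub \<C>(1)] .
  have "\<Union>\<C> \<subseteq> (\<Union>i. \<Union>(\<C>' i))" using \<C>(3) by (fastforce simp: \<C>'_def density_jump_def)
  then have "emeasure M (\<Union>\<C>) \<le> emeasure M (\<Union>i. \<Union>(\<C>' i))"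
    using \<C>(3) sub cnt by (intro emeasure_mono sets.countable_UN sets.countable_Union image_subsetI) blast+
  also have "\<dots> \<le> (\<Sum>i. emeasure M (\<Union>(\<C>' i)))"
    using \<C>(3) sub cnt by (intro emeasure_subadditive_countably image_subsetI sets.countable_Union) blast+
  also have "\<dots> \<le> (\<Sum>i. ennreal (1 / 2 ^ (i + 2)) * emeasure M P)"
  proof (rule suminf_le)
    fix i
    show "emeasure M (\<Union>(\<C>' i)) \<le> ennreal (1 / 2 ^ (i + 2)) * emeasure M P"
    proof (rule density_selection_small[OF H P _ cnt])
      show "disjoint (\<C>' i)" using \<C>(2) sub[of i] by (auto simp: disjoint_def)
      show "Q \<in> sets M \<and> Q \<subseteq> P \<and> 0 < measure M Q" if "Q \<in> \<C>' i" for Q using \<C>(3) sub that by blast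
    qed (auto simp: \<C>'_def)
  qed auto
  also have "\<dots> = (\<Sum>i. ennreal (1 / 2 ^ (i + 2))) * emeasure M P" by (rule ennreal_suminf_multc)
  also have "(\<Sum>i. ennreal (1 / 2 ^ (i + 2))) = ennreal (1 / 2)"
  proof -
    have "(\<lambda>i. 1 / 4 * (1 / 2) ^ i :: real) sums (1 / 4 * (1 / (1 - 1 / 2)))"
      by (intro sums_mult geometric_sums) simp
    then have "(\<lambda>i. 1 / 2 ^ (i + 2) :: real) sums (1 / 2)" by (simp add: power_one_over)
    then show ?thesis by (intro suminf_ennreal_eq) auto
  qed
  also have "ennreal (1 / 2) * emeasure M P = emeasure M P / 2"
  proof -
    have "inverse (ennreal 2) = ennreal (inverse 2)" by (rule inverse_ennreal) simp
    moreover have "(1 / 2 :: real) = inverse 2" by simp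
    ultimately have "ennreal (1 / 2) = inverse 2" by (simp only: ennreal_numeral)
    then show ?thesis by (simp only: divide_ennreal_def mult.commute)
  qed
  finally show ?thesis .
qed

section \<open>Dyadic grids as nested families\<close>

lemma dyadic_cube_eq_hcube:
  "dyadic_cube x0 k v = hcube (\<chi> i. x0 $ i + 2 powi k * of_int (v $ i)) (2 powi k)"
  by (auto simp: dyadic_cube_def hcube_def algebra_simps)

lemma mem_dyadic_cube_iff: "x \<in> dyadic_cube x0 k v \<longleftrightarrow> v = (\<chi> i. \<lfloor>(x $ i - x0 $ i) / 2 powi k\<rfloor>)"
proof -
  have p: "(0::real) < 2 powi k" by simp
  have "x0 $ i + 2 powi k * of_int j \<le> y \<and> y < x0 $ i + 2 powi k * (of_int j + 1) \<longleftrightarrow> j = \<lfloor>(y - x0 $ i) / 2 powi k\<rfloor>" for i j y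
    using p by (subst eq_commute) (simp add: floor_eq_iff field_simps)
  then show ?thesis by (simp add: dyadic_cube_def vec_eq_iff)
qed

text \<open>The coarser quotient is the finer one divided by the integer 2^(k' - k), and the floor
  of such a quotient depends only on the floor of its numerator. Hence the grid is nested.\<close>

lemma floor_powi_coarser:
  fixes a b :: real
  assumes "\<lfloor>a / 2 powi k\<rfloor> = \<lfloor>b / 2 powi k\<rfloor>" "k \<le> k'"
  shows "\<lfloor>a / 2 powi k'\<rfloor> = \<lfloor>b / 2 powi k'\<rfloor>"
proof -
  define d where "d = nat (k' - k)"
  have e: "a / 2 powi k' = a / 2 powi k / real_of_int (2 ^ d)" for a :: real
  proof -
    have "(2::real) powi k' = 2 powi k * 2 powi (int d)" using assms(2) by (simp add: d_def flip: power_int_add)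
    then show ?thesis by simp
  qed
  show ?thesis unfolding e by (subst (1 2) floor_divide_real_eq_div) (use assms(1) in auto)
qed

lemma dyadic_cube_nested:
  assumes "x \<in> dyadic_cube x0 k v" "x \<in> dyadic_cube x0 k' v'" "k \<le> k'"
  shows "dyadic_cube x0 k v \<subseteq> dyadic_cube x0 k' v'"
proof
  fix y assume y: "y \<in> dyadic_cube x0 k v"
  have "\<lfloor>(x $ i - x0 $ i) / 2 powi k\<rfloor> = \<lfloor>(y $ i - x0 $ i) / 2 powi k\<rfloor>" for i
  proof -
    have "v $ i = \<lfloor>(x $ i - x0 $ i) / 2 powi k\<rfloor>" "v $ i = \<lfloor>(y $ i - x0 $ i) / 2 powi k\<rfloor>"
      using assms(1) y unfolding mem_dyadic_cube_iff vec_eq_iff by auto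
    then show ?thesis by simp
  qed
  then have "\<lfloor>(x $ i - x0 $ i) / 2 powi k'\<rfloor> = \<lfloor>(y $ i - x0 $ i) / 2 powi k'\<rfloor>" for i
    using floor_powi_coarser[OF _ assms(3)] by blast
  then show "y \<in> dyadic_cube x0 k' v'" using assms(2) unfolding mem_dyadic_cube_iff by simp
qed

lemma dyadic_cube_measure:
  fixes v :: "int^'n::finite"
  shows "emeasure lborel (dyadic_cube x0 k v) = ennreal ((2 powi k) ^ CARD('n))"
    "measure lborel (dyadic_cube x0 k v) = (2 powi k) ^ CARD('n)"
    "dyadic_cube x0 k v \<in> sets borel"
  unfolding dyadic_cube_eq_hcube by (auto simp: emeasure_hcube measure_hcube hcube_measurable)

lemma dyadic_cube_nonempty: "dyadic_cube x0 k v \<noteq> {}"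
proof -
  have "(\<chi> i. x0 $ i + 2 powi k * of_int (v $ i)) \<in> dyadic_cube x0 k v" by (simp add: dyadic_cube_def)
  then show ?thesis by blast
qed

lemma dyadic_cube_subset_scale:
  fixes v v' :: "int^'n::finite"
  assumes "dyadic_cube x0 k v \<subseteq> dyadic_cube x0 k' v'"
  shows "k \<le> k'"
proof (rule ccontr)
  assume "\<not> k \<le> k'"
  then have lt: "(2::real) powi k' < 2 powi k" by (intro power_int_strict_increasing) auto
  then have "((2::real) powi k') ^ CARD('n) < (2 powi k) ^ CARD('n)" by (intro power_strict_mono) auto
  moreover have "ennreal ((2 powi k) ^ CARD('n)) \<le> ennreal ((2 powi k') ^ CARD('n))"
    using emeasure_mono[OF assms, of lborel] by (simp add: dyadic_cube_measure)
  ultimately show False using lt by (simp add: ennreal_le_iff)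
qed

lemma countable_dyadic_grid: "countable (dyadic_grid (x0 :: real^'n::finite))"
proof -
  have "dyadic_grid x0 = (\<lambda>(k, v). dyadic_cube x0 k v) ` (UNIV \<times> UNIV)" by (auto simp: dyadic_grid_def)
  moreover have "countable \<dots>"
    by (rule countable_image, rule countable_SIGMA) auto
  ultimately show ?thesis by simp
qed

lemma dyadic_nested_family:
  fixes x0 :: "real^'n::finite" and K :: int and v0 :: "int^'n"
  assumes H: "\<And>i. integrable lborel (H i)" "\<And>i x. 0 \<le> H i x"
  defines "Q0 \<equiv> dyadic_cube x0 K v0"
  shows "nested_family lborel {Q \<in> dyadic_grid x0. Q \<subseteq> Q0} Q0 (density_jump lborel H)"
proof
  let ?D = "{Q \<in> dyadic_grid x0. Q \<subseteq> Q0}"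
  show "Q0 \<in> ?D" by (auto simp: Q0_def dyadic_grid_def)
  show "Q \<subseteq> Q0" if "Q \<in> ?D" for Q using that by simp
  have ex: "\<exists>k v. Q = dyadic_cube x0 k v" if "Q \<in> ?D" for Q using that by (auto simp: dyadic_grid_def)
  show ne: "Q \<noteq> {}" if "Q \<in> ?D" for Q using ex[OF that] dyadic_cube_nonempty by blast
  show "A \<inter> B = {} \<or> A \<subseteq> B \<or> B \<subseteq> A" if AB: "A \<in> ?D" "B \<in> ?D" for A B
  proof -
    obtain k v k' v' where *: "A = dyadic_cube x0 k v" "B = dyadic_cube x0 k' v'" using ex[OF AB(1)] ex[OF AB(2)] by blast
    show ?thesis
    proof (cases "A \<inter> B = {}")
      case False
      then obtain x where "x \<in> A" "x \<in> B" by blast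
      then show ?thesis using dyadic_cube_nested[of x x0 k v k' v'] dyadic_cube_nested[of x x0 k' v' k v] linear[of k k']
        unfolding * by blast
    qed simp
  qed
  show "finite {Q' \<in> ?D. Q \<subseteq> Q'}" if Q: "Q \<in> ?D" for Q
  proof -
    obtain k v where Qk: "Q = dyadic_cube x0 k v" using ex[OF Q] by blast
    obtain x where x: "x \<in> Q" using ne[OF Q] by blast
    \<comment> \<open>An ancestor of \<open>Q\<close> inside the top cube is determined by its
      scale, which lies between that of \<open>Q\<close> and \<open>K\<close>.\<close>
    have "{Q' \<in> ?D. Q \<subseteq> Q'} \<subseteq> (\<lambda>k'. dyadic_cube x0 k' (\<chi> i. \<lfloor>(x $ i - x0 $ i) / 2 powi k'\<rfloor>)) ` {k..K}"
    proof
      fix Q' assume Q': "Q' \<in> {Q' \<in> ?D. Q \<subseteq> Q'}"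
      then obtain k' v' where Qk': "Q' = dyadic_cube x0 k' v'" using ex[of Q'] by blast
      have "v' = (\<chi> i. \<lfloor>(x $ i - x0 $ i) / 2 powi k'\<rfloor>)" using x Q' unfolding Qk' by (auto simp: mem_dyadic_cube_iff)
      moreover have "k \<le> k'" using Q' unfolding Qk Qk' by (auto intro: dyadic_cube_subset_scale)
      moreover have "k' \<le> K" using Q' unfolding Qk' Q0_def by (auto intro: dyadic_cube_subset_scale)
      ultimately show "Q' \<in> (\<lambda>k'. dyadic_cube x0 k' (\<chi> i. \<lfloor>(x $ i - x0 $ i) / 2 powi k'\<rfloor>)) ` {k..K}"
        unfolding Qk' by auto
    qed
    then show ?thesis by (rule finite_subset) auto
  qed
  show cnt: "countable ?D" by (rule countable_subset[OF _ countable_dyadic_grid[of x0]]) auto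
  have ms: "Q \<in> sets lborel \<and> emeasure lborel Q < \<infinity> \<and> 0 < measure lborel Q" if "Q \<in> ?D" for Q
    using ex[OF that] by (auto simp: dyadic_cube_measure)
  show "Q \<in> sets lborel" "emeasure lborel Q < \<infinity>" if "Q \<in> ?D" for Q using ms[OF that] by auto
  show "\<not> density_jump lborel H Q Q" if "Q \<in> ?D" for Q
  proof -
    have "(LINT x|lborel. indicator Q x * H i x) / measure lborel Q \<le> 2 ^ (i + 2) * ((LINT x|lborel. indicator Q x * H i x) / measure lborel Q)" for i
    proof -
      have "0 \<le> (LINT x|lborel. indicator Q x * H i x)" using H(2) by (intro integral_nonneg_AE) auto
      then have "0 \<le> (LINT x|lborel. indicator Q x * H i x) / measure lborel Q" by simp
      moreover have "(1::real) \<le> 2 ^ (i + 2)" by (rule one_le_power) simp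
      ultimately show ?thesis using mult_right_mono[of 1 "2 ^ (i + 2)"] by fastforce
    qed
    then show ?thesis by (auto simp: density_jump_def not_less)
  qed
  fix P \<C> assume P: "P \<in> ?D" and C: "\<C> \<subseteq> {Q \<in> ?D. Q \<subseteq> P \<and> density_jump lborel H P Q}" "disjoint \<C>"
  show "emeasure lborel (\<Union>\<C>) \<le> emeasure lborel P / 2"
  proof (rule density_jump_small[OF H _ _ _ C(2)])
    show "countable \<C>" by (rule countable_subset[OF _ cnt]) (use C in auto)
    show "Q \<in> sets lborel \<and> Q \<subseteq> P \<and> 0 < measure lborel Q \<and> density_jump lborel H P Q" if "Q \<in> \<C>" for Q
    proof -
      have "Q \<in> ?D" "Q \<subseteq> P" "density_jump lborel H P Q" using subsetD[OF C(1) that] by auto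
      then show ?thesis using ms by simp
    qed
  qed (use ms[OF P] in auto)
qed

text \<open>A single family controls all densities \<open>H i\<close>, with a loss growing in
  \<open>i\<close>. The cores fill at least half of each cube; sparseness demands a strict
  inequality, so the parameter is lowered to 1/4.\<close>

lemma universal_sparse_family:
  fixes x0 :: "real^'n::finite"
  assumes H: "\<And>i. integrable lborel (H i)" "\<And>i x. 0 \<le> H i x"
  shows "\<exists>S. sparse_family (1 / 4) S \<and> S \<subseteq> {Q \<in> dyadic_grid x0. Q \<subseteq> dyadic_cube x0 K v0} \<and> dyadic_cube x0 K v0 \<in> S \<and>
    (\<forall>Q\<in>dyadic_grid x0. Q \<subseteq> dyadic_cube x0 K v0 \<longrightarrow> (\<exists>P\<in>S. Q \<subseteq> P \<and>
      (\<forall>i. (LINT x|lborel. indicator Q x * H i x) / measure lborel Q \<le> 2 ^ (i + 2) * ((LINT x|lborel. indicator P x * H i x) / measure lborel P))))"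
proof -
  let ?Q0 = "dyadic_cube x0 K v0"
  let ?D = "{Q \<in> dyadic_grid x0. Q \<subseteq> ?Q0}"
  interpret nested_family lborel ?D ?Q0 "density_jump lborel H"
    by (rule dyadic_nested_family[OF H])
  show ?thesis
  proof (intro exI[of _ stopping] conjI ballI impI)
    show "stopping \<subseteq> ?D" using stopping_subset by blast
    show "?Q0 \<in> stopping" by (rule stopping_top)
    show "sparse_family (1 / 4) stopping"
      unfolding sparse_family_def
    proof (intro conjI exI[of _ x0] exI[of _ core] ballI core_disjoint)
      show "stopping \<subseteq> dyadic_grid x0" using stopping_subset by blast
      fix Q assume Q: "Q \<in> stopping"
      note QD = stopping_subset[OF Q]
      have cb: "core Q \<in> sets borel" using core_sets[OF QD] by simp
      then show "core Q \<in> sets lebesgue" by simp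
      show "core Q \<subseteq> Q" by (auto simp: core_def)
      obtain k v where k: "Q = dyadic_cube x0 k v" using QD by (auto simp: dyadic_grid_def)
      have "0 < measure lborel Q" unfolding k by (simp add: dyadic_cube_measure)
      moreover have "Q \<in> sets lborel" unfolding k using dyadic_cube_measure(3) by simp
      then have "measure lebesgue Q = measure lborel Q" by (rule measure_completion)
      moreover have "measure lebesgue (core Q) = measure lborel (core Q)" using cb by (intro measure_completion) simp
      ultimately show "1 / 4 * measure lebesgue Q < measure lebesgue (core Q)"
        using core_measure[OF QD] by linarith
    qed auto
    fix Q assume "Q \<in> dyadic_grid x0" "Q \<subseteq> ?Q0"
    then have "\<exists>P\<in>stopping. Q \<subseteq> P \<and> \<not> density_jump lborel H P Q" by (intro stopping_parent) auto
    then show "\<exists>P\<in>stopping. Q \<subseteq> P \<and>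
      (\<forall>i. (LINT x|lborel. indicator Q x * H i x) / measure lborel Q \<le> 2 ^ (i + 2) * ((LINT x|lborel. indicator P x * H i x) / measure lborel P))"
      by (auto simp: density_jump_def not_less)
  qed
qed

section \<open>Sparse domination of local forms\<close>

text \<open>Inclusion is required only where \<open>F\<close> does not vanish, so \<open>E'\<close>
  may also be the top cube when \<open>E\<close> sticks out of it.\<close>

lemma avg_subset:
  fixes F :: "real^'n::finite \<Rightarrow> real"
  assumes F: "test_fun F" and p: "0 < p" and E: "E \<in> sets borel" "0 < measure lborel E" "E' \<in> sets borel" "0 < measure lborel E'"
    and sub: "\<And>x. x \<in> E \<Longrightarrow> F x \<noteq> 0 \<Longrightarrow> x \<in> E'"
  shows "avg p E F \<le> (measure lborel E' / measure lborel E) powr (1 / p) * avg p E' F"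
proof -
  let ?I = "\<lambda>E. LINT x|lborel. indicator E x * F x powr p"
  have I0: "0 \<le> ?I E" for E by (intro integral_nonneg_AE) auto
  have "?I E \<le> ?I E'"
    using sub p by (intro integral_mono test_fun_powr_integrable_on F E) (auto simp: indicator_def)
  then have "?I E / measure lborel E \<le> measure lborel E' / measure lborel E * (?I E' / measure lborel E')"
    using E by (simp add: divide_right_mono)
  then have "avg p E F \<le> (measure lborel E' / measure lborel E * (?I E' / measure lborel E')) powr (1 / p)"
    unfolding avg_def using p E I0 by (intro powr_mono2) auto
  then show ?thesis
    unfolding avg_def using E I0 by (simp add: powr_mult[symmetric])
qed

lemma avg_zero:
  assumes "\<And>x. x \<in> E \<Longrightarrow> F x = 0"
  shows "avg p E F = 0"
proof -
  have "(\<lambda>x. indicator E x * F x powr p) = (\<lambda>x. 0)" using assms by (auto simp: indicator_def fun_eq_iff)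
  then show ?thesis by (simp add: avg_def)
qed

text \<open>By Fubini the squared 2-averages integrate to the squared L^2 norm, whatever
  \<open>l\<close> is. The uniformity in \<open>l\<close> makes the weighted sums over scales
  finite, which the selection of a shift relies on.\<close>

lemma local_form_bounded:
  fixes F G :: "real^'n::finite \<Rightarrow> real"
  assumes F: "test_fun F" and G: "test_fun G" and l: "0 < l" and p: "0 < p" "p \<le> 2" and q: "0 < q" "q \<le> 2"
  shows "local_form p q l F G \<le> ennreal ((LINT x|lborel. F x powr 2) + (LINT x|lborel. G x powr 2))"
proof -
  let ?n = "CARD('n)"
  define \<mu> where "\<mu> = (2 * l) ^ ?n"
  have \<mu>: "0 < \<mu>" using l by (simp add: \<mu>_def)
  have m: "measure lborel (sup_cube x l) = \<mu>" for x :: "real^'n" using l by (simp add: measure_sup_cube \<mu>_def)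
  have sq: "(\<integral>\<^sup>+x. ennreal ((avg 2 (sup_cube x l) H)\<^sup>2) \<partial>lborel) = ennreal (LINT x|lborel. H x powr 2)"
    if H: "test_fun H" for H :: "real^'n \<Rightarrow> real"
  proof -
    have [measurable]: "H \<in> borel_measurable borel" by (rule test_fun_measurable[OF H])
    have ind: "indicator (sup_cube z r) x = (if x \<in> sup_cube z r then 1 else 0 :: ennreal)" for z x :: "real^'n" and r
      by (simp add: indicator_def)
    have "ennreal ((avg 2 (sup_cube x l) H)\<^sup>2) = ennreal (1 / \<mu>) * (\<integral>\<^sup>+y. ennreal (H y powr 2) * indicator (sup_cube x l) y \<partial>lborel)" for x
    proof -
      have "(\<integral>\<^sup>+y. ennreal (H y powr 2) * indicator (sup_cube x l) y \<partial>lborel) = (\<integral>\<^sup>+y. ennreal (indicator (sup_cube x l) y * H y powr 2) \<partial>lborel)"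
        by (intro nn_integral_cong) (auto simp: indicator_def)
      also have "\<dots> = ennreal (LINT y|lborel. indicator (sup_cube x l) y * H y powr 2)"
        by (intro nn_integral_eq_integral test_fun_powr_integrable_on H) auto
      also have "(LINT y|lborel. indicator (sup_cube x l) y * H y powr 2) = \<mu> * (avg 2 (sup_cube x l) H)\<^sup>2"
        using avg_powr[of 2 "sup_cube x l" H] \<mu> avg_nonneg[of 2 "sup_cube x l" H] by (simp add: m)
      finally show ?thesis using \<mu> by (simp add: ennreal_mult[symmetric])
    qed
    then have "(\<integral>\<^sup>+x. ennreal ((avg 2 (sup_cube x l) H)\<^sup>2) \<partial>lborel) =
        (\<integral>\<^sup>+x. ennreal (1 / \<mu>) * (\<integral>\<^sup>+y. ennreal (H y powr 2) * indicator (sup_cube x l) y \<partial>lborel) \<partial>lborel)" by simp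
    also have "\<dots> = ennreal (1 / \<mu>) * (\<integral>\<^sup>+x. \<integral>\<^sup>+y. ennreal (H y powr 2) * indicator (sup_cube x l) y \<partial>lborel \<partial>lborel)"
      unfolding ind by (intro nn_integral_cmult) measurable
    also have "(\<integral>\<^sup>+x. \<integral>\<^sup>+y. ennreal (H y powr 2) * indicator (sup_cube x l) y \<partial>lborel \<partial>lborel) =
       (\<integral>\<^sup>+y. \<integral>\<^sup>+x. ennreal (H y powr 2) * indicator (sup_cube x l) y \<partial>lborel \<partial>lborel)"
      unfolding ind by (intro lborel_pair.Fubini') (unfold case_prod_beta', measurable)
    also have "\<dots> = (\<integral>\<^sup>+y. \<integral>\<^sup>+x. ennreal (H y powr 2) * indicator (sup_cube y l) x \<partial>lborel \<partial>lborel)"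
    proof (intro nn_integral_cong)
      fix x y :: "real^'n"
      show "ennreal (H y powr 2) * indicator (sup_cube x l) y = ennreal (H y powr 2) * indicator (sup_cube y l) x"
        unfolding ind using sup_cube_commute[of x y l] by simp
    qed
    also have "\<dots> = (\<integral>\<^sup>+y. ennreal (H y powr 2) * ennreal \<mu> \<partial>lborel)"
      using l by (intro nn_integral_cong) (simp only: nn_integral_cmult_indicator emeasure_sup_cube \<mu>_def sup_cube_measurable sets_lborel less_imp_le)
    also have "\<dots> = (\<integral>\<^sup>+y. ennreal \<mu> * ennreal (H y powr 2) \<partial>lborel)"
      by (simp only: mult.commute)
    also have "\<dots> = ennreal \<mu> * ennreal (LINT y|lborel. H y powr 2)"
      using test_fun_powr_integrable[OF H, of 2] by (simp add: nn_integral_cmult nn_integral_eq_integral)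
    also have "ennreal (1 / \<mu>) * \<dots> = ennreal (LINT y|lborel. H y powr 2)"
      using \<mu> by (simp add: mult.assoc[symmetric] ennreal_mult[symmetric])
    finally show ?thesis .
  qed
  have [measurable]: "F \<in> borel_measurable borel" "G \<in> borel_measurable borel" using F G by (auto intro: test_fun_measurable)
  have "local_form p q l F G \<le> local_form 2 2 l F G" using p q l by (intro local_form_mono_exponent F G)
  also have "\<dots> \<le> (\<integral>\<^sup>+x. ennreal ((avg 2 (sup_cube x l) F)\<^sup>2) + ennreal ((avg 2 (sup_cube x l) G)\<^sup>2) \<partial>lborel)"
    unfolding local_form_def
  proof (rule nn_integral_mono)
    fix x
    let ?a = "avg 2 (sup_cube x l) F" and ?b = "avg 2 (sup_cube x l) G"
    have "0 \<le> ?a * ?b" by (intro mult_nonneg_nonneg avg_nonneg)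
    then have "?a * ?b \<le> ?a\<^sup>2 + ?b\<^sup>2" using sum_squares_bound[of ?a ?b] by linarith
    then have "ennreal (?a * ?b) \<le> ennreal (?a\<^sup>2 + ?b\<^sup>2)" by (rule ennreal_leI)
    then show "ennreal (?a * ?b) \<le> ennreal (?a\<^sup>2) + ennreal (?b\<^sup>2)" by simp
  qed
  also have "\<dots> = ennreal (LINT x|lborel. F x powr 2) + ennreal (LINT x|lborel. G x powr 2)"
    by (subst nn_integral_add) (auto simp: sq[OF F] sq[OF G])
  also have "\<dots> = ennreal ((LINT x|lborel. F x powr 2) + (LINT x|lborel. G x powr 2))"
    by (rule ennreal_plus[symmetric]) (auto intro!: integral_nonneg_AE)
  finally show ?thesis .
qed

text \<open>Closeness to a face of scale \<open>k\<close> in the grid whose origin has all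
  coordinates equal to \<open>t\<close>. Translations along the diagonal, a one-parameter family,
  are enough.\<close>

definition near_boundary :: "int \<Rightarrow> real \<Rightarrow> real \<Rightarrow> real^'n::finite \<Rightarrow> bool" where
  "near_boundary k l t x \<longleftrightarrow> (\<exists>i. \<exists>v::int. \<bar>x $ i - t - 2 powi k * of_int v\<bar> \<le> l)"

lemma near_boundary_measurable [measurable]:
  assumes [measurable]: "a \<in> borel_measurable M" "b \<in> borel_measurable M"
  shows "Measurable.pred M (\<lambda>y. near_boundary k l (a y) (b y :: real^'n::finite))"
  unfolding near_boundary_def by measurable

text \<open>For each coordinate the offending \<open>t\<close> form intervals of length
  \<open>2 * l\<close> with spacing \<open>2 powi k\<close>, and at most 3 T / 2 powi k of them can
  meet the window. Here \<open>2 powi k \<le> T\<close> and \<open>2 * l \<le> 2 powi k\<close>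
  absorb the end effects.\<close>

lemma near_boundary_measure:
  fixes x :: "real^'n::finite"
  assumes l: "0 < l" "2 ^ m * l \<le> 2 powi k" "1 \<le> m" and T: "2 powi k \<le> T"
  shows "emeasure lborel {t \<in> {a..a + T}. near_boundary k l t x} \<le> ennreal (6 * real CARD('n) * T / 2 ^ m)"
proof -
  define s :: real where "s = 2 powi k"
  have s: "0 < s" by (simp add: s_def)
  have T0: "0 < T" using T s unfolding s_def by linarith
  have ls: "2 * l \<le> s"
  proof -
    have "(2::real) ^ 1 \<le> 2 ^ m" using l(3) by (intro power_increasing) auto
    then have "2 * l \<le> 2 ^ m * l" using l(1) by (intro mult_right_mono) auto
    then show ?thesis using l(2) by (simp add: s_def)
  qed
  define V where "V i = {\<lceil>(x $ i - l - a - T) / s\<rceil>..\<lfloor>(x $ i + l - a) / s\<rfloor>}" for i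
  let ?J = "\<lambda>i v. {x $ i - s * of_int v - l..x $ i - s * of_int v + l}"
  have sub: "{t \<in> {a..a + T}. near_boundary k l t x} \<subseteq> (\<Union>i. \<Union>v\<in>V i. ?J i v)"
  proof
    fix t assume t: "t \<in> {t \<in> {a..a + T}. near_boundary k l t x}"
    then obtain i v where iv: "\<bar>x $ i - t - s * of_int v\<bar> \<le> l" by (auto simp: near_boundary_def s_def)
    have "(x $ i - l - a - T) / s \<le> of_int v" "of_int v \<le> (x $ i + l - a) / s"
      using iv t s by (auto simp: field_simps abs_le_iff)
    then have "v \<in> V i" by (simp add: V_def le_floor_iff ceiling_le_iff)
    moreover have "t \<in> ?J i v" using iv by (auto simp: abs_le_iff)
    ultimately show "t \<in> (\<Union>i. \<Union>v\<in>V i. ?J i v)" by blast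
  qed
  have card: "real (card (V i)) * (2 * l) \<le> 6 * T / 2 ^ m" for i
  proof -
    have "real (card (V i)) \<le> max 0 ((x $ i + l - a) / s - (x $ i - l - a - T) / s + 1)"
      unfolding V_def card_atLeastAtMost_int by linarith
    also have "(x $ i + l - a) / s - (x $ i - l - a - T) / s + 1 = (T + 2 * l) / s + 1"
      by (simp add: diff_divide_distrib[symmetric] add_divide_distrib[symmetric])
    also have "max 0 \<dots> \<le> 3 * (T / s)"
    proof -
      have "1 \<le> T / s" using T s by (simp add: s_def)
      moreover have "2 * l / s \<le> 1" using ls s by simp
      ultimately show ?thesis by (simp add: add_divide_distrib)
    qed
    finally have "real (card (V i)) * (2 * l) \<le> 3 * (T / s) * (2 * l)" using l by (intro mult_right_mono) auto
    also have "\<dots> = 6 * T * (l / s)" by simp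
    also have "\<dots> \<le> 6 * T * (1 / 2 ^ m)"
    proof (intro mult_left_mono)
      show "l / s \<le> 1 / 2 ^ m" using l(2) s by (simp add: s_def field_simps)
      show "0 \<le> 6 * T" using T0 by simp
    qed
    finally show ?thesis by simp
  qed
  have "emeasure lborel {t \<in> {a..a + T}. near_boundary k l t x} \<le> emeasure lborel (\<Union>i. \<Union>v\<in>V i. ?J i v)"
    using sub by (intro emeasure_mono) (auto simp: V_def)
  also have "\<dots> \<le> (\<Sum>i\<in>UNIV. emeasure lborel (\<Union>v\<in>V i. ?J i v))"
    by (intro emeasure_subadditive_finite) (auto simp: V_def)
  also have "\<dots> \<le> (\<Sum>i\<in>(UNIV::'n set). ennreal (6 * T / 2 ^ m))"
  proof (rule sum_mono)
    fix i :: 'n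
    have "emeasure lborel (\<Union>v\<in>V i. ?J i v) \<le> (\<Sum>v\<in>V i. emeasure lborel (?J i v))"
      by (intro emeasure_subadditive_finite) (auto simp: V_def)
    also have "\<dots> = (\<Sum>v\<in>V i. ennreal (2 * l))" using l by (intro sum.cong) auto
    also have "\<dots> = ennreal (real (card (V i)) * (2 * l))" using l by (simp add: ennreal_mult ennreal_of_nat_eq_real_of_nat)
    also have "\<dots> \<le> ennreal (6 * T / 2 ^ m)" by (intro ennreal_leI card)
    finally show "emeasure lborel (\<Union>v\<in>V i. ?J i v) \<le> ennreal (6 * T / 2 ^ m)" .
  qed
  also have "\<dots> = ennreal (6 * real CARD('n) * T / 2 ^ m)"
  proof -
    have "0 \<le> 6 * T / 2 ^ m" using T0 by simp
    then have "of_nat CARD('n) * ennreal (6 * T / 2 ^ m) = ennreal (real CARD('n) * (6 * T / 2 ^ m))"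
      using ennreal_mult[of "real CARD('n)" "6 * T / 2 ^ m"] by (simp only: ennreal_of_nat_eq_real_of_nat of_nat_0_le_iff)
    then show ?thesis by (simp add: mult_ac)
  qed
  finally show ?thesis .
qed

text \<open>A grid scale about 2^m times larger than \<open>l\<close>. Larger \<open>m\<close> makes
  points near a boundary rarer but worsens the comparison of averages.\<close>

definition scale_exp :: "nat \<Rightarrow> real \<Rightarrow> int" where
  "scale_exp m l = \<lceil>log 2 l\<rceil> + int m"

lemma scale_exp:
  assumes "0 < l"
  shows "2 ^ m * l \<le> 2 powi (scale_exp m l)" "2 powi (scale_exp m l) < 2 ^ (m + 1) * l"
proof -
  have "l = 2 powr (log 2 l)" using assms by simp
  also have "\<dots> \<le> 2 powr (of_int \<lceil>log 2 l\<rceil>)" by (intro powr_mono) auto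
  finally have 1: "l \<le> 2 powi \<lceil>log 2 l\<rceil>" by (simp add: powr_real_of_int')
  have "2 powr (of_int \<lceil>log 2 l\<rceil>) < 2 powr (log 2 l + 1)" by (intro powr_less_mono) linarith+
  also have "\<dots> = 2 * l" using assms by (simp add: powr_add)
  finally have 2: "2 powi \<lceil>log 2 l\<rceil> < 2 * l" by (simp add: powr_real_of_int')
  show "2 ^ m * l \<le> 2 powi (scale_exp m l)" "2 powi (scale_exp m l) < 2 ^ (m + 1) * l"
    using 1 2 by (simp_all add: scale_exp_def power_int_add mult.commute)
qed

lemma ennreal_half_bound:
  fixes a b s :: ennreal
  assumes "s = a + b" "s < \<infinity>" "2 * b \<le> s"
  shows "s \<le> 2 * a"
proof -
  have "a < \<infinity>" "b < \<infinity>" using assms by (auto simp: less_top)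
  then obtain x y where xy: "a = ennreal x" "b = ennreal y" "0 \<le> x" "0 \<le> y"
    by (metis ennreal_cases infinity_ennreal_def less_irrefl)
  have "ennreal (2 * y) \<le> ennreal (x + y)" using assms(1,3) xy by (simp add: ennreal_mult)
  then have "y \<le> x" using xy by (simp add: ennreal_le_iff del: ennreal_plus)
  then have "ennreal (x + y) \<le> ennreal (2 * x)" by (intro ennreal_leI) simp
  then show ?thesis using assms(1) xy by (simp add: ennreal_mult)
qed

text \<open>Each point is near the boundary of the shifted grid for a proportion of about \<open>2 ^ - M i\<close> of the
  shifts.  By Markov's inequality the shifts that are bad for \<open>i\<close> have proportion summable in \<open>i\<close>.\<close>

lemma exists_good_shift:
  fixes \<phi> :: "nat \<Rightarrow> nat \<Rightarrow> real^'n::finite \<Rightarrow> ennreal" and a T :: real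
  assumes \<phi>[measurable]: "\<And>i l. \<phi> i l \<in> borel_measurable borel" and T: "0 < T"
    and l: "\<And>i l. 0 < r i l" "\<And>i l. 2 ^ M i * r i l \<le> 2 powi (k i l)" "\<And>i. 1 \<le> M i"
    and fin: "\<And>i. (\<Sum>l. \<integral>\<^sup>+x. \<phi> i l x \<partial>lborel) < \<infinity>"
    and small: "(\<Sum>i. ennreal (12 * real CARD('n) / 2 ^ M i)) < 1"
  shows "\<exists>t\<in>{a..a + T}. \<forall>i. (\<Sum>l. \<integral>\<^sup>+x. \<phi> i l x \<partial>lborel) \<le>
    2 * (\<Sum>l. \<integral>\<^sup>+x. \<phi> i l x * (if 2 powi (k i l) \<le> T \<and> near_boundary (k i l) (r i l) t x then 0 else 1) \<partial>lborel)"
proof -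
  let ?n = "real CARD('n)" and ?J = "{a..a + T}"
  \<comment> \<open>Scales above \<open>T\<close> are never counted as bad; they are later compared
    with the top cube directly.\<close>
  define B where "B i l t x \<longleftrightarrow> 2 powi (k i l) \<le> T \<and> near_boundary (k i l) (r i l) t x" for i l t and x :: "real^'n"
  define TI where "TI i = (\<Sum>l. \<integral>\<^sup>+x. \<phi> i l x \<partial>lborel)" for i
  define bad where "bad i t = (\<Sum>l. \<integral>\<^sup>+x. \<phi> i l x * (if B i l t x then 1 else 0) \<partial>lborel)" for i t
  define good where "good i t = (\<Sum>l. \<integral>\<^sup>+x. \<phi> i l x * (if B i l t x then 0 else 1) \<partial>lborel)" for i t
  have Bm[measurable]: "Measurable.pred (borel \<Otimes>\<^sub>M borel) (\<lambda>p. B i l (fst p) (snd p))" for i l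
    unfolding B_def by measurable
  have Bm'[measurable]: "Measurable.pred (borel \<Otimes>\<^sub>M borel) (\<lambda>p. B i l (snd p) (fst p))" for i l
    unfolding B_def by measurable
  have Jm[measurable]: "(\<lambda>p :: (real^'n) \<times> real. indicator ?J (snd p) :: ennreal) \<in> borel_measurable (lborel \<Otimes>\<^sub>M lborel)"
    by (rule measurable_compose[OF measurable_snd]) simp
  have Bm1[measurable]: "Measurable.pred borel (\<lambda>x. B i l t x)" for i l t
    unfolding B_def by measurable
  have Bm2[measurable]: "Measurable.pred borel (\<lambda>t. B i l t x)" for i l x
    unfolding B_def by measurable
  have badm: "(\<lambda>t. \<integral>\<^sup>+x. \<phi> i l x * (if B i l t x then 1 else 0) \<partial>lborel) \<in> borel_measurable borel" for i l
    by (rule lborel.borel_measurable_nn_integral) (unfold case_prod_beta', measurable)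
  have bm[measurable]: "bad i \<in> borel_measurable borel" for i
    unfolding bad_def using badm by measurable
  have split: "TI i = good i t + bad i t" for i t
  proof -
    have "(\<integral>\<^sup>+x. \<phi> i l x \<partial>lborel) = (\<integral>\<^sup>+x. \<phi> i l x * (if B i l t x then 0 else 1) \<partial>lborel) + (\<integral>\<^sup>+x. \<phi> i l x * (if B i l t x then 1 else 0) \<partial>lborel)" for l
      by (subst nn_integral_add[symmetric]) (auto intro!: nn_integral_cong)
    then show ?thesis unfolding TI_def good_def bad_def by (simp add: suminf_add)
  qed
  have avg: "(\<integral>\<^sup>+t. bad i t * indicator ?J t \<partial>lborel) \<le> ennreal (6 * ?n * T / 2 ^ M i) * TI i" for i
  proof -
    have "(\<integral>\<^sup>+t. bad i t * indicator ?J t \<partial>lborel) = (\<integral>\<^sup>+t. (\<Sum>l. (\<integral>\<^sup>+x. \<phi> i l x * (if B i l t x then 1 else 0) \<partial>lborel) * indicator ?J t) \<partial>lborel)"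
      unfolding bad_def by simp
    also have "\<dots> = (\<Sum>l. \<integral>\<^sup>+t. (\<integral>\<^sup>+x. \<phi> i l x * (if B i l t x then 1 else 0) \<partial>lborel) * indicator ?J t \<partial>lborel)"
      using badm by (intro nn_integral_suminf) measurable
    also have "\<dots> \<le> (\<Sum>l. ennreal (6 * ?n * T / 2 ^ M i) * (\<integral>\<^sup>+x. \<phi> i l x \<partial>lborel))"
    proof (rule suminf_le)
      fix l'
      have "(\<integral>\<^sup>+t. (\<integral>\<^sup>+x. \<phi> i l' x * (if B i l' t x then 1 else 0) \<partial>lborel) * indicator ?J t \<partial>lborel) =
        (\<integral>\<^sup>+t. \<integral>\<^sup>+x. \<phi> i l' x * (if B i l' t x then 1 else 0) * indicator ?J t \<partial>lborel \<partial>lborel)"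
        by (intro nn_integral_cong nn_integral_multc[symmetric]) measurable
      also have "\<dots> = (\<integral>\<^sup>+x. \<integral>\<^sup>+t. \<phi> i l' x * (if B i l' t x then 1 else 0) * indicator ?J t \<partial>lborel \<partial>lborel)"
        by (rule lborel_pair.Fubini') (unfold case_prod_beta', measurable)
      also have "\<dots> \<le> (\<integral>\<^sup>+x. ennreal (6 * ?n * T / 2 ^ M i) * \<phi> i l' x \<partial>lborel)"
      proof (rule nn_integral_mono)
        fix x
        have "(\<integral>\<^sup>+t. \<phi> i l' x * (if B i l' t x then 1 else 0) * indicator ?J t \<partial>lborel) = (\<integral>\<^sup>+t. \<phi> i l' x * indicator {t \<in> ?J. B i l' t x} t \<partial>lborel)"
          by (intro nn_integral_cong) (auto simp: indicator_def)
        also have "\<dots> = \<phi> i l' x * emeasure lborel {t \<in> ?J. B i l' t x}"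
        proof (rule nn_integral_cmult_indicator)
          have "{t \<in> ?J. B i l' t x} = {t \<in> space borel. t \<in> ?J \<and> B i l' t x}" by auto
          also have "\<dots> \<in> sets borel" by measurable
          finally show "{t \<in> ?J. B i l' t x} \<in> sets lborel" by simp
        qed
        also have "\<dots> \<le> \<phi> i l' x * ennreal (6 * ?n * T / 2 ^ M i)"
        proof (rule mult_left_mono)
          show "emeasure lborel {t \<in> ?J. B i l' t x} \<le> ennreal (6 * ?n * T / 2 ^ M i)"
          proof (cases "2 powi (k i l') \<le> T")
            case True
            then show ?thesis using near_boundary_measure[OF l(1) l(2) l(3) True, of a x] by (simp add: B_def)
          qed (simp add: B_def)
        qed simp
        finally show "(\<integral>\<^sup>+t. \<phi> i l' x * (if B i l' t x then 1 else 0) * indicator ?J t \<partial>lborel) \<le> ennreal (6 * ?n * T / 2 ^ M i) * \<phi> i l' x"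
          by (simp only: mult.commute)
      qed
      also have "\<dots> = ennreal (6 * ?n * T / 2 ^ M i) * (\<integral>\<^sup>+x. \<phi> i l' x \<partial>lborel)"
        by (rule nn_integral_cmult) measurable
      finally show "(\<integral>\<^sup>+t. (\<integral>\<^sup>+x. \<phi> i l' x * (if B i l' t x then 1 else 0) \<partial>lborel) * indicator ?J t \<partial>lborel)
         \<le> ennreal (6 * ?n * T / 2 ^ M i) * (\<integral>\<^sup>+x. \<phi> i l' x \<partial>lborel)" .
    qed auto
    also have "\<dots> = ennreal (6 * ?n * T / 2 ^ M i) * TI i" unfolding TI_def by (rule ennreal_suminf_cmult)
    finally show ?thesis .
  qed
  \<comment> \<open>Normalised so that \<open>\<Psi> t < 1\<close> forces the bad part at
    \<open>t\<close> to be at most half of \<open>TI i\<close>. If \<open>TI i = 0\<close> the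
    quotient is infinite, but its product with \<open>TI i\<close> is 0.\<close>
  define c where "c i = 2 / TI i" for i
  have cT: "c i * TI i \<le> 2" and cT': "TI i \<noteq> 0 \<Longrightarrow> TI i * c i = 2" for i
  proof -
    have "TI i * c i = 2" if "TI i \<noteq> 0"
    proof -
      have "TI i < \<infinity>" using fin[of i] by (simp add: TI_def)
      then obtain x where x: "TI i = ennreal x" "0 \<le> x"
        by (cases "TI i") auto
      then have "0 < x" using that by (auto simp: less_le)
      note x = x(1) this
      have "2 / TI i = ennreal (2 / x)" using divide_ennreal[of 2 x] x by simp
      then show ?thesis using x by (simp add: c_def ennreal_mult[symmetric])
    qed
    then show "TI i \<noteq> 0 \<Longrightarrow> TI i * c i = 2" "c i * TI i \<le> 2" by (cases "TI i = 0"; simp add: mult.commute)+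
  qed
  define \<Psi> where "\<Psi> t = (\<Sum>i. c i * bad i t)" for t
  have "(\<integral>\<^sup>+t. \<Psi> t * indicator ?J t \<partial>lborel) = (\<integral>\<^sup>+t. (\<Sum>i. c i * (bad i t * indicator ?J t)) \<partial>lborel)"
    unfolding \<Psi>_def by (simp add: mult.assoc flip: ennreal_suminf_multc)
  also have "\<dots> = (\<Sum>i. \<integral>\<^sup>+t. c i * (bad i t * indicator ?J t) \<partial>lborel)"
    by (rule nn_integral_suminf) measurable
  also have "\<dots> = (\<Sum>i. c i * (\<integral>\<^sup>+t. bad i t * indicator ?J t \<partial>lborel))"
    by (intro suminf_cong nn_integral_cmult) measurable
  also have "\<dots> \<le> (\<Sum>i. ennreal (12 * ?n / 2 ^ M i) * ennreal T)"
  proof (rule suminf_le)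
    fix i
    have "c i * (\<integral>\<^sup>+t. bad i t * indicator ?J t \<partial>lborel) \<le> c i * (ennreal (6 * ?n * T / 2 ^ M i) * TI i)"
      by (intro mult_left_mono avg) auto
    also have "\<dots> = (c i * TI i) * ennreal (6 * ?n * T / 2 ^ M i)" by (simp only: mult_ac)
    also have "\<dots> \<le> 2 * ennreal (6 * ?n * T / 2 ^ M i)" by (intro mult_right_mono cT) auto
    also have "\<dots> = ennreal (12 * ?n / 2 ^ M i) * ennreal T"
    proof -
      have "2 * ennreal (6 * ?n * T / 2 ^ M i) = ennreal (2 * (6 * ?n * T / 2 ^ M i))" using T by (subst ennreal_mult) auto
      also have "2 * (6 * ?n * T / 2 ^ M i) = 12 * ?n / 2 ^ M i * T" by simp
      also have "ennreal (12 * ?n / 2 ^ M i * T) = ennreal (12 * ?n / 2 ^ M i) * ennreal T"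
        using T by (intro ennreal_mult) auto
      finally show ?thesis .
    qed
    finally show "c i * (\<integral>\<^sup>+t. bad i t * indicator ?J t \<partial>lborel) \<le> ennreal (12 * ?n / 2 ^ M i) * ennreal T" .
  qed auto
  also have "\<dots> = (\<Sum>i. ennreal (12 * ?n / 2 ^ M i)) * ennreal T" by (rule ennreal_suminf_multc)
  also have "\<dots> < 1 * ennreal T" using small T by (intro ennreal_mult_strict_right_mono) auto
  finally have lt: "(\<integral>\<^sup>+t. \<Psi> t * indicator ?J t \<partial>lborel) < ennreal T" by simp
  \<comment> \<open>The mean of \<open>\<Psi>\<close> over the window is below 1, so some shift is
    good for all \<open>i\<close> simultaneously.\<close>
  have "\<exists>t\<in>?J. \<Psi> t < 1"
  proof (rule ccontr)
    assume "\<not> (\<exists>t\<in>?J. \<Psi> t < 1)"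
    then have "(\<integral>\<^sup>+t. indicator ?J t \<partial>lborel) \<le> (\<integral>\<^sup>+t. \<Psi> t * indicator ?J t \<partial>lborel)"
      by (intro nn_integral_mono) (auto simp: indicator_def not_less)
    moreover have "(\<integral>\<^sup>+t. indicator ?J t \<partial>lborel) = ennreal T" using T by simp
    ultimately show False using lt by simp
  qed
  then obtain t where t: "t \<in> ?J" "\<Psi> t < 1" by blast
  have "TI i \<le> 2 * good i t" for i
  proof (cases "TI i = 0")
    case False
    have "c i * bad i t \<le> \<Psi> t" unfolding \<Psi>_def by (rule ennreal_le_suminf)
    then have "TI i * (c i * bad i t) \<le> TI i * 1" using t(2) by (intro mult_left_mono) auto
    then have "2 * bad i t \<le> TI i" using cT'[OF False] by (simp add: mult.assoc[symmetric])
    then show ?thesis using ennreal_half_bound[OF split[of i t]] fin[of i] by (simp add: TI_def)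
  qed simp
  then show ?thesis using t(1) unfolding TI_def good_def B_def by blast
qed

text \<open>The sparse form for Borel data and real exponents.\<close>

definition avg_sum :: "(real^'n::finite) set set \<Rightarrow> real \<Rightarrow> real \<Rightarrow> (real^'n \<Rightarrow> real) \<Rightarrow> (real^'n \<Rightarrow> real) \<Rightarrow> ennreal" where
  "avg_sum S p q F G = (\<Sum>\<^sub>\<infinity>Q\<in>S. ennreal (measure lborel Q * avg p Q F * avg q Q G))"

lemma finite_sum_le_infsum_ennreal:
  fixes f :: "'a \<Rightarrow> ennreal"
  assumes "finite A" "A \<subseteq> S"
  shows "sum f A \<le> (\<Sum>\<^sub>\<infinity>x\<in>S. f x)"
  by (subst nonneg_infsum_complete) (use assms in \<open>auto intro!: SUP_upper\<close>)

lemma powr_le_of_le_one: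
  fixes x :: real
  assumes "0 \<le> x" "x \<le> y" "1 \<le> y" "0 \<le> e" "e \<le> 1"
  shows "x powr e \<le> y"
proof -
  have "x powr e \<le> y powr e" using assms by (intro powr_mono2) auto
  also have "\<dots> \<le> y powr 1" using assms by (intro powr_mono) auto
  finally show ?thesis using assms by simp
qed

text \<open>Away from the boundary, the cube about \<open>x\<close> lies in one grid cube of scale
  \<open>k\<close>, of volume at most 2^(m n) times larger, which in turn lies in a stopping cube
  with comparable averages. As that stopping cube contains \<open>x\<close>, integration over
  \<open>x\<close> produces its measure.\<close>

lemma good_scale_bound:
  fixes F G :: "real^'n::finite \<Rightarrow> real"
  assumes F: "test_fun F" and G: "test_fun G" and supp: "\<And>x. norm x > \<rho> \<Longrightarrow> F x = 0"
    and x0: "x0 = (\<chi> i. t)" and Q0: "\<And>x. norm x \<le> \<rho> \<Longrightarrow> x \<in> dyadic_cube x0 K 0"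
    and r: "0 < r" "2 powi k < 2 ^ (m + 1) * r" and k: "k \<le> K"
    and p: "1 \<le> p" and q: "1 \<le> q"
    and S: "S \<subseteq> {Q \<in> dyadic_grid x0. Q \<subseteq> dyadic_cube x0 K 0}"
    and dom: "\<And>Q. Q \<in> dyadic_grid x0 \<Longrightarrow> Q \<subseteq> dyadic_cube x0 K 0 \<Longrightarrow> \<exists>P\<in>S. Q \<subseteq> P \<and>
       (LINT x|lborel. indicator Q x * F x powr p) / measure lborel Q \<le> c * ((LINT x|lborel. indicator P x * F x powr p) / measure lborel P) \<and>
       (LINT x|lborel. indicator Q x * G x powr q) / measure lborel Q \<le> c * ((LINT x|lborel. indicator P x * G x powr q) / measure lborel P)"
    and c: "1 \<le> c"
  shows "(\<integral>\<^sup>+x. ennreal (avg p (sup_cube x r) F * avg q (sup_cube x r) G) * (if near_boundary k r t x then 0 else 1) \<partial>lborel)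
    \<le> ennreal (((2 ^ m) ^ CARD('n) * c)\<^sup>2) * avg_sum S p q F G"
proof -
  let ?n = "CARD('n)"
  let ?Q0 = "dyadic_cube x0 K 0"
  define V where "V = {v :: int^'n. dyadic_cube x0 k v \<subseteq> ?Q0}"
  have finV: "finite V"
  proof (rule finite_subset[OF _ finite_bounded_int_vec])
    show "V \<subseteq> {v. \<forall>i. v $ i \<in> {0..\<lfloor>2 powi K / 2 powi k :: real\<rfloor>}}"
    proof (intro subsetI CollectI allI)
      fix v :: "int^'n" and i assume "v \<in> V"
      moreover have "(\<chi> i. x0 $ i + 2 powi k * of_int (v $ i)) \<in> dyadic_cube x0 k v" by (simp add: dyadic_cube_def)
      ultimately have "(\<chi> i. x0 $ i + 2 powi k * of_int (v $ i)) \<in> ?Q0" by (auto simp: V_def)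
      then have "0 \<le> (2::real) powi k * of_int (v $ i)" "2 powi k * of_int (v $ i) < (2::real) powi K"
        unfolding dyadic_cube_def by (auto simp: vec_eq_iff dest: spec[of _ i])
      moreover have "(0::real) < 2 powi k" by simp
      ultimately show "v $ i \<in> {0..\<lfloor>2 powi K / 2 powi k :: real\<rfloor>}"
        by (auto simp: zero_le_mult_iff le_floor_iff field_simps not_le)
    qed
  qed auto
  \<comment> \<open>Fixing one stopping cube per grid cube makes the dominating sum finite, since
    only finitely many grid cubes of scale \<open>k\<close> fit into the top cube.\<close>
  define parent where "parent v = (SOME P. P \<in> S \<and> dyadic_cube x0 k v \<subseteq> P \<and>
       (LINT x|lborel. indicator (dyadic_cube x0 k v) x * F x powr p) / measure lborel (dyadic_cube x0 k v) \<le> c * ((LINT x|lborel. indicator P x * F x powr p) / measure lborel P) \<and>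
       (LINT x|lborel. indicator (dyadic_cube x0 k v) x * G x powr q) / measure lborel (dyadic_cube x0 k v) \<le> c * ((LINT x|lborel. indicator P x * G x powr q) / measure lborel P))" for v
  have parent: "parent v \<in> S" "dyadic_cube x0 k v \<subseteq> parent v"
       "(LINT x|lborel. indicator (dyadic_cube x0 k v) x * F x powr p) / measure lborel (dyadic_cube x0 k v) \<le> c * ((LINT x|lborel. indicator (parent v) x * F x powr p) / measure lborel (parent v))"
       "(LINT x|lborel. indicator (dyadic_cube x0 k v) x * G x powr q) / measure lborel (dyadic_cube x0 k v) \<le> c * ((LINT x|lborel. indicator (parent v) x * G x powr q) / measure lborel (parent v))"
    if "v \<in> V" for v
  proof -
    have "dyadic_cube x0 k v \<in> dyadic_grid x0" by (auto simp: dyadic_grid_def)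
    from dom[OF this] that have "\<exists>P. P \<in> S \<and> dyadic_cube x0 k v \<subseteq> P \<and>
       (LINT x|lborel. indicator (dyadic_cube x0 k v) x * F x powr p) / measure lborel (dyadic_cube x0 k v) \<le> c * ((LINT x|lborel. indicator P x * F x powr p) / measure lborel P) \<and>
       (LINT x|lborel. indicator (dyadic_cube x0 k v) x * G x powr q) / measure lborel (dyadic_cube x0 k v) \<le> c * ((LINT x|lborel. indicator P x * G x powr q) / measure lborel P)"
      unfolding V_def by blast
    from someI_ex[OF this]
    show "parent v \<in> S" "dyadic_cube x0 k v \<subseteq> parent v"
       "(LINT x|lborel. indicator (dyadic_cube x0 k v) x * F x powr p) / measure lborel (dyadic_cube x0 k v) \<le> c * ((LINT x|lborel. indicator (parent v) x * F x powr p) / measure lborel (parent v))"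
       "(LINT x|lborel. indicator (dyadic_cube x0 k v) x * G x powr q) / measure lborel (dyadic_cube x0 k v) \<le> c * ((LINT x|lborel. indicator (parent v) x * G x powr q) / measure lborel (parent v))"
      unfolding parent_def by blast+
  qed
  \<comment> \<open>Taking the \<open>s\<close>-th root does not increase the factor, because
    \<open>c\<close> and \<open>s\<close> are at least 1.\<close>
  have up: "avg s Q H \<le> c * avg s P H"
    if "(LINT x|lborel. indicator Q x * H x powr s) / measure lborel Q \<le> c * ((LINT x|lborel. indicator P x * H x powr s) / measure lborel P)" "1 \<le> s"
    for Q P s and H :: "real^'n \<Rightarrow> real"
  proof -
    have I0: "0 \<le> (LINT x|lborel. indicator E x * H x powr s) / measure lborel E" for E
      by (intro divide_nonneg_nonneg integral_nonneg_AE) auto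
    have "avg s Q H \<le> (c * ((LINT x|lborel. indicator P x * H x powr s) / measure lborel P)) powr (1 / s)"
      unfolding avg_def using that I0 by (intro powr_mono2) auto
    also have "\<dots> = c powr (1 / s) * avg s P H" unfolding avg_def using c I0[of P] by (subst powr_mult) auto
    also have "\<dots> \<le> c * avg s P H" using c that(2) by (intro mult_right_mono powr_le_of_le_one avg_nonneg) auto
    finally show ?thesis .
  qed
  let ?b = "\<lambda>P. avg p P F * avg q P G"
  let ?A = "((2 ^ m) ^ ?n * c)\<^sup>2"
  have PD: "P \<in> sets borel \<and> 0 \<le> measure lborel P \<and> emeasure lborel P = ennreal (measure lborel P)" if "P \<in> S" for P
    using subsetD[OF S that] by (auto simp: dyadic_grid_def dyadic_cube_measure)
  have "(\<integral>\<^sup>+x. ennreal (avg p (sup_cube x r) F * avg q (sup_cube x r) G) * (if near_boundary k r t x then 0 else 1) \<partial>lborel)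
    \<le> (\<integral>\<^sup>+x. (\<Sum>P\<in>parent ` V. ennreal (?A * ?b P) * indicator P x) \<partial>lborel)"
  proof (rule nn_integral_mono)
    fix x :: "real^'n"
    show "ennreal (avg p (sup_cube x r) F * avg q (sup_cube x r) G) * (if near_boundary k r t x then 0 else 1)
      \<le> (\<Sum>P\<in>parent ` V. ennreal (?A * ?b P) * indicator P x)"
    proof (cases "near_boundary k r t x \<or> (\<forall>y\<in>sup_cube x r. F y = 0)")
      case True
      then show ?thesis using avg_zero[of "sup_cube x r" F p] by auto
    next
      case False
      define v where "v = (\<chi> i. \<lfloor>(x $ i - x0 $ i) / 2 powi k\<rfloor>)"
      let ?R = "dyadic_cube x0 k v"
      have xQ: "x \<in> ?R" unfolding mem_dyadic_cube_iff v_def ..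
      have CQ: "sup_cube x r \<subseteq> ?R"
      proof
        fix y assume y: "y \<in> sup_cube x r"
        show "y \<in> ?R" unfolding dyadic_cube_def
        proof (intro CollectI allI)
          fix i
          have nb: "r < \<bar>x $ i - t - 2 powi k * of_int w\<bar>" for w using False by (auto simp: near_boundary_def not_le)
          have xi: "t + 2 powi k * of_int (v $ i) \<le> x $ i" "x $ i < t + 2 powi k * (of_int (v $ i) + 1)"
            using xQ x0 by (auto simp: dyadic_cube_def)
          have yi: "\<bar>y $ i - x $ i\<bar> \<le> r" using y by (simp add: sup_cube_def)
          have "r < x $ i - t - 2 powi k * of_int (v $ i)" using nb[of "v $ i"] xi by linarith
          moreover have "r < t + 2 powi k * (of_int (v $ i) + 1) - x $ i" using nb[of "v $ i + 1"] xi by (simp add: abs_if split: if_splits)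
          ultimately show "x0 $ i + 2 powi k * of_int (v $ i) \<le> y $ i \<and> y $ i < x0 $ i + 2 powi k * (of_int (v $ i) + 1)"
            using yi x0 by (simp add: abs_le_iff)
        qed
      qed
      \<comment> \<open>The grid cube meets the support of \<open>F\<close>, hence the top cube, and
        being of no larger scale it is contained in it.\<close>
      have vV: "v \<in> V"
      proof -
        obtain y where y: "y \<in> sup_cube x r" "F y \<noteq> 0" using False by blast
        then have "norm y \<le> \<rho>" using supp[of y] by force
        then have "y \<in> ?Q0" by (rule Q0)
        then show ?thesis using dyadic_cube_nested[OF _ _ k, of y x0 v 0] y(1) CQ by (auto simp: V_def)
      qed
      let ?P = "parent v"
      have mC: "measure lborel (sup_cube x r) = (2 * r) ^ ?n" using r by (simp add: measure_sup_cube)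
      have ratio: "measure lborel ?R / measure lborel (sup_cube x r) \<le> (2 ^ m) ^ ?n"
      proof -
        have "measure lborel ?R / measure lborel (sup_cube x r) = (2 powi k / (2 * r)) ^ ?n"
          by (simp add: dyadic_cube_measure mC power_divide)
        also have "\<dots> \<le> (2 ^ m) ^ ?n" using r by (intro power_mono) (auto simp: field_simps)
        finally show ?thesis .
      qed
      have one: "avg s (sup_cube x r) H \<le> (2 ^ m) ^ ?n * avg s ?R H" if "test_fun H" "1 \<le> s" for s and H :: "real^'n \<Rightarrow> real"
      proof -
        have "avg s (sup_cube x r) H \<le> (measure lborel ?R / measure lborel (sup_cube x r)) powr (1 / s) * avg s ?R H"
          using that CQ r by (intro avg_subset) (auto simp: mC dyadic_cube_measure)
        also have "\<dots> \<le> (2 ^ m) ^ ?n * avg s ?R H"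
          using that(2) ratio by (intro mult_right_mono powr_le_of_le_one avg_nonneg) (auto intro!: one_le_power)
        finally show ?thesis .
      qed
      have a1: "avg p (sup_cube x r) F \<le> ((2 ^ m) ^ ?n * c) * avg p ?P F"
        using order_trans[OF one[OF F p] mult_left_mono[OF up[OF parent(3)[OF vV] p]]] by (simp add: mult.assoc)
      have a2: "avg q (sup_cube x r) G \<le> ((2 ^ m) ^ ?n * c) * avg q ?P G"
        using order_trans[OF one[OF G q] mult_left_mono[OF up[OF parent(4)[OF vV] q]]] by (simp add: mult.assoc)
      have "avg p (sup_cube x r) F * avg q (sup_cube x r) G \<le> (((2 ^ m) ^ ?n * c) * avg p ?P F) * (((2 ^ m) ^ ?n * c) * avg q ?P G)"
        using c by (intro mult_mono a1 a2 avg_nonneg mult_nonneg_nonneg) auto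
      also have "\<dots> = ?A * ?b ?P" by (simp add: power2_eq_square)
      finally have "ennreal (avg p (sup_cube x r) F * avg q (sup_cube x r) G) \<le> ennreal (?A * ?b ?P) * indicator ?P x"
        using parent(2)[OF vV] xQ by (auto intro!: ennreal_leI)
      also have "\<dots> \<le> (\<Sum>P\<in>parent ` V. ennreal (?A * ?b P) * indicator P x)"
        using finV vV by (intro member_le_sum) auto
      finally show ?thesis by auto
    qed
  qed
  also have "\<dots> = (\<Sum>P\<in>parent ` V. ennreal (?A * ?b P) * emeasure lborel P)"
  proof (subst nn_integral_sum)
    show "(\<lambda>x. ennreal (?A * ?b P) * indicator P x) \<in> borel_measurable lborel" if "P \<in> parent ` V" for P
    proof -
      have "P \<in> sets borel" using that parent(1) PD by auto
      then show ?thesis by measurable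
    qed
    show "(\<Sum>P\<in>parent ` V. \<integral>\<^sup>+x. ennreal (?A * ?b P) * indicator P x \<partial>lborel) = (\<Sum>P\<in>parent ` V. ennreal (?A * ?b P) * emeasure lborel P)"
      using parent(1) PD by (intro sum.cong refl nn_integral_cmult_indicator) auto
  qed
  also have "\<dots> = (\<Sum>P\<in>parent ` V. ennreal ?A * ennreal (measure lborel P * avg p P F * avg q P G))"
  proof (intro sum.cong refl)
    fix P assume "P \<in> parent ` V"
    then have *: "emeasure lborel P = ennreal (measure lborel P)" "0 \<le> measure lborel P" using parent(1) PD by auto
    have "ennreal (?A * ?b P) * ennreal (measure lborel P) = ennreal (?A * ?b P * measure lborel P)"
      using *(2) by (intro ennreal_mult[symmetric] mult_nonneg_nonneg avg_nonneg) auto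
    also have "?A * ?b P * measure lborel P = ?A * (measure lborel P * avg p P F * avg q P G)" by (simp only: mult_ac)
    also have "ennreal \<dots> = ennreal ?A * ennreal (measure lborel P * avg p P F * avg q P G)"
      using *(2) by (intro ennreal_mult mult_nonneg_nonneg avg_nonneg) auto
    finally show "ennreal (?A * ?b P) * emeasure lborel P = ennreal ?A * ennreal (measure lborel P * avg p P F * avg q P G)"
      unfolding *(1) .
  qed
  also have "\<dots> = ennreal ?A * (\<Sum>P\<in>parent ` V. ennreal (measure lborel P * avg p P F * avg q P G))"
    by (rule sum_distrib_left[symmetric])
  also have "\<dots> \<le> ennreal ?A * avg_sum S p q F G"
    unfolding avg_sum_def using finV parent(1) by (intro mult_left_mono finite_sum_le_infsum_ennreal) auto
  finally show ?thesis .
qed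

text \<open>Cubes of radius \<open>r\<close> are not much smaller than the top cube, which contains
  both supports, so the averages are compared with those over the top cube alone. With
  \<open>Y\<close> the ratio of volumes, the total is about Y powr (1/p + 1/q - 1) times the top
  term, and the exponent lies between 0 and 1.\<close>

lemma large_scale_bound:
  fixes F G :: "real^'n::finite \<Rightarrow> real"
  assumes F: "test_fun F" and G: "test_fun G" and supp: "\<And>x. norm x > \<rho> \<Longrightarrow> F x = 0" "\<And>x. norm x > \<rho> \<Longrightarrow> G x = 0"
    and Q0: "\<And>x. norm x \<le> \<rho> \<Longrightarrow> x \<in> dyadic_cube x0 K 0" and \<rho>: "0 \<le> \<rho>" "4 * \<rho> \<le> 2 powi K"
    and r: "0 < r" "2 powi K \<le> 4 * (2 ^ (m + 1) * r)"
    and p: "1 \<le> p" "p \<le> 2" and q: "1 \<le> q" "q \<le> 2"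
    and S: "dyadic_cube x0 K 0 \<in> S"
  shows "local_form p q r F G \<le> ennreal (((2 ^ (m + 2)) ^ CARD('n))\<^sup>2) * avg_sum S p q F G"
proof -
  let ?n = "CARD('n)"
  let ?Q0 = "dyadic_cube x0 K 0"
  define \<mu> where "\<mu> = ((2::real) powi K) ^ ?n"
  define Y where "Y = \<mu> / (2 * r) ^ ?n"
  have \<mu>: "0 < \<mu>" by (simp add: \<mu>_def)
  have Y: "0 < Y" using \<mu> r by (simp add: Y_def)
  have mQ: "measure lborel ?Q0 = \<mu>" by (simp add: dyadic_cube_measure \<mu>_def)
  let ?a = "avg p ?Q0 F" and ?b = "avg q ?Q0 G"
  have one: "avg s (sup_cube x r) H \<le> Y powr (1 / s) * avg s ?Q0 H"
    if "test_fun H" "1 \<le> s" "\<And>x. norm x > \<rho> \<Longrightarrow> H x = 0" for s x and H :: "real^'n \<Rightarrow> real"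
  proof -
    have "avg s (sup_cube x r) H \<le> (measure lborel ?Q0 / measure lborel (sup_cube x r)) powr (1 / s) * avg s ?Q0 H"
    proof (rule avg_subset[OF that(1)])
      show "y \<in> ?Q0" if "H y \<noteq> 0" for y using \<open>\<And>x. norm x > \<rho> \<Longrightarrow> H x = 0\<close>[of y] that by (intro Q0) force
    qed (use that r in \<open>auto simp: measure_sup_cube dyadic_cube_measure\<close>)
    then show ?thesis using r by (simp add: mQ measure_sup_cube Y_def)
  qed
  \<comment> \<open>A bound for the integrand that does not depend on \<open>x\<close>; the
    integrand vanishes unless the cube about \<open>x\<close> meets the support of
    \<open>F\<close>.\<close>
  define d where "d = Y powr (1 / p + 1 / q) * (?a * ?b)"
  have d: "0 \<le> d" unfolding d_def by (intro mult_nonneg_nonneg avg_nonneg) auto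
  have "local_form p q r F G \<le> (\<integral>\<^sup>+x. ennreal d * indicator (sup_cube (0::real^'n) (\<rho> + r)) x \<partial>lborel)"
    unfolding local_form_def
  proof (rule nn_integral_mono)
    fix x :: "real^'n"
    show "ennreal (avg p (sup_cube x r) F * avg q (sup_cube x r) G) \<le> ennreal d * indicator (sup_cube 0 (\<rho> + r)) x"
    proof (cases "\<forall>y\<in>sup_cube x r. F y = 0")
      case True
      then show ?thesis using avg_zero[of "sup_cube x r" F p] by simp
    next
      case False
      then obtain y where y: "y \<in> sup_cube x r" "F y \<noteq> 0" by blast
      then have "norm y \<le> \<rho>" using supp(1)[of y] by force
      then have "\<bar>x $ i\<bar> \<le> \<rho> + r" for i
        using y(1) component_le_norm_cart[of y i] unfolding sup_cube_def mem_Collect_eq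
        by (auto simp: abs_le_iff dest!: spec[of _ i])
      then have "x \<in> sup_cube 0 (\<rho> + r)" by (simp add: sup_cube_def)
      moreover have "avg p (sup_cube x r) F * avg q (sup_cube x r) G \<le> (Y powr (1 / p) * ?a) * (Y powr (1 / q) * ?b)"
        by (intro mult_mono one F G p q supp avg_nonneg mult_nonneg_nonneg) auto
      then have "avg p (sup_cube x r) F * avg q (sup_cube x r) G \<le> d" by (simp add: d_def powr_add mult_ac)
      ultimately show ?thesis by (simp add: ennreal_leI)
    qed
  qed
  also have "\<dots> = ennreal (d * (2 * (\<rho> + r)) ^ ?n)"
    using r \<rho> d by (simp add: nn_integral_cmult_indicator emeasure_sup_cube ennreal_mult)
  also have "\<dots> \<le> ennreal (((2 ^ (m + 2)) ^ ?n)\<^sup>2 * (measure lborel ?Q0 * ?a * ?b))"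
  proof (rule ennreal_leI)
    let ?Z = "((2::real) ^ (m + 2)) ^ ?n"
    have b1: "2 * (\<rho> + r) \<le> 2 ^ (m + 2) * (2 * r)"
    proof -
      have "\<rho> \<le> 2 ^ (m + 1) * r" using \<rho> r by linarith
      moreover have "r \<le> 2 ^ (m + 1) * r" using r one_le_power[of "2::real" "m + 1"] by simp
      ultimately show ?thesis by simp
    qed
    have "(2 * (\<rho> + r)) ^ ?n \<le> (2 ^ (m + 2) * (2 * r)) ^ ?n" using \<rho> r by (intro power_mono b1) auto
    also have "\<dots> = ?Z * (\<mu> / Y)"
    proof -
      have "\<mu> / Y = (2 * r) ^ ?n" using \<mu> by (simp add: Y_def)
      then show ?thesis by (simp only: power_mult_distrib)
    qed
    finally have b2: "(2 * (\<rho> + r)) ^ ?n \<le> ?Z * (\<mu> / Y)" .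
    have YZ: "Y \<le> ?Z"
    proof -
      have "Y = (2 powi K / (2 * r)) ^ ?n" by (simp add: Y_def \<mu>_def power_divide)
      also have "\<dots> \<le> ?Z" using r by (intro power_mono) (auto simp: field_simps)
      finally show ?thesis .
    qed
    have "1 / 2 \<le> 1 / p" "1 / p \<le> 1" "1 / 2 \<le> 1 / q" "1 / q \<le> 1" using p q by (auto simp: field_simps)
    moreover have "1 \<le> ?Z" by (rule one_le_power, rule one_le_power) simp
    ultimately have e: "Y powr (1 / p + 1 / q - 1) \<le> ?Z"
      using Y YZ by (intro powr_le_of_le_one) linarith+
    have "d * (2 * (\<rho> + r)) ^ ?n \<le> d * (?Z * (\<mu> / Y))" by (intro mult_left_mono b2 d)
    also have "\<dots> = ?Z * Y powr (1 / p + 1 / q - 1) * (\<mu> * (?a * ?b))" using Y by (simp add: d_def powr_diff)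
    also have "\<dots> \<le> ?Z * ?Z * (\<mu> * (?a * ?b))"
      using \<mu> by (intro mult_right_mono mult_left_mono e mult_nonneg_nonneg avg_nonneg) auto
    finally show "d * (2 * (\<rho> + r)) ^ ?n \<le> ?Z\<^sup>2 * (measure lborel ?Q0 * ?a * ?b)" by (simp add: mQ power2_eq_square mult.assoc)
  qed
  also have "\<dots> = ennreal (((2 ^ (m + 2)) ^ ?n)\<^sup>2) * ennreal (measure lborel ?Q0 * ?a * ?b)"
    using \<mu> by (intro ennreal_mult mult_nonneg_nonneg avg_nonneg) (auto simp: mQ)
  also have "\<dots> \<le> ennreal (((2 ^ (m + 2)) ^ ?n)\<^sup>2) * avg_sum S p q F G"
    using finite_sum_le_infsum_ennreal[of "{?Q0}" S "\<lambda>Q. ennreal (measure lborel Q * avg p Q F * avg q Q G)"] S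
    unfolding avg_sum_def by (intro mult_left_mono) auto
  finally show ?thesis .
qed

text \<open>All ingredients are run for countably many exponent pairs at once. The constants come
  from \<open>p\<close>, \<open>q\<close>, \<open>\<omega>\<close>, \<open>r\<close> and the
  dimension, before \<open>F\<close> and \<open>G\<close> are given; only the grid and the family
  depend on the functions.\<close>

lemma sparse_domination:
  fixes p q :: "nat \<Rightarrow> real" and \<omega> r :: "nat \<Rightarrow> nat \<Rightarrow> real"
  assumes p: "\<And>i. 1 \<le> p i" "\<And>i. p i \<le> 2" and q: "\<And>i. 1 \<le> q i" "\<And>i. q i \<le> 2"
    and \<omega>: "\<And>i. (\<Sum>l. ennreal (\<omega> i l)) < \<infinity>" and r: "\<And>i l. 0 < r i l"
  shows "\<exists>c :: nat \<Rightarrow> real. \<forall>F G :: real^'n::finite \<Rightarrow> real. test_fun F \<longrightarrow> test_fun G \<longrightarrow>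
    (\<exists>S. sparse_family (1 / 4) S \<and> (\<forall>i. (\<Sum>l. ennreal (\<omega> i l) * local_form (p i) (q i) (r i l) F G)
       \<le> ennreal (c i) * avg_sum S (p i) (q i) F G))"
proof -
  let ?n = "CARD('n)"
  \<comment> \<open>With \<open>M i = i + m0 + 1\<close> the bad proportions 12 n / 2^(M i) add up
    to 12 n / 2^m0, which is below 1/4.\<close>
  obtain m0 where m0: "48 * real ?n < 2 ^ m0" using real_arch_pow[of 2 "48 * real ?n"] by auto
  define M where "M i = i + m0 + 1" for i :: nat
  \<comment> \<open>The densities of \<open>F\<close> and \<open>G\<close> for the
    \<open>i\<close>-th pair will have the indices 2 i and 2 i + 1, whose thresholds are 2^(2 i + 2)
    and 2^(2 i + 3); the larger one is taken for both.\<close>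
  define c where "c i = (2::real) ^ (2 * i + 3)" for i :: nat
  define A where "A i = ((2 ^ M i) ^ ?n * c i)\<^sup>2 + ((2 ^ (M i + 2)) ^ ?n)\<^sup>2" for i
  define \<Omega> where "\<Omega> i = enn2real (\<Sum>l. ennreal (\<omega> i l))" for i
  have \<Omega>: "(\<Sum>l. ennreal (\<omega> i l)) = ennreal (\<Omega> i)" "0 \<le> \<Omega> i" for i
    using \<omega>[of i] by (auto simp: \<Omega>_def)
  define k where "k i l = scale_exp (M i) (r i l)" for i l
  have k: "2 ^ M i * r i l \<le> 2 powi (k i l)" "2 powi (k i l) < 2 ^ (M i + 1) * r i l" for i l
    using scale_exp[OF r, of "M i" i l] by (auto simp: k_def)
  have small: "(\<Sum>i. ennreal (12 * real ?n / 2 ^ M i)) < 1"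
  proof -
    have "(\<lambda>i. 6 * real ?n / 2 ^ m0 * (1 / 2) ^ i) sums (6 * real ?n / 2 ^ m0 * (1 / (1 - 1 / 2)))"
      by (intro sums_mult geometric_sums) simp
    then have "(\<lambda>i. 12 * real ?n / 2 ^ M i) sums (12 * real ?n / 2 ^ m0)" by (simp add: M_def power_add power_one_over field_simps)
    then have "(\<Sum>i. ennreal (12 * real ?n / 2 ^ M i)) = ennreal (12 * real ?n / 2 ^ m0)" by (intro suminf_ennreal_eq) auto
    also have "\<dots> < ennreal 1" using m0 by (intro ennreal_lessI) (auto simp: field_simps)
    finally show ?thesis by simp
  qed
  show ?thesis
  proof (intro exI[of _ "\<lambda>i. 2 * (\<Omega> i * A i)"] allI impI)
    fix F G :: "real^'n \<Rightarrow> real"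
    assume F: "test_fun F" and G: "test_fun G"
    have [measurable]: "F \<in> borel_measurable borel" "G \<in> borel_measurable borel" using F G by (auto intro: test_fun_measurable)
    obtain \<rho>1 \<rho>2 where "\<And>x. norm x > \<rho>1 \<Longrightarrow> F x = 0" "\<And>x. norm x > \<rho>2 \<Longrightarrow> G x = 0"
      using F G unfolding test_fun_def by blast
    then obtain \<rho> where \<rho>: "0 \<le> \<rho>" and suppF: "\<And>x. norm x > \<rho> \<Longrightarrow> F x = 0" and suppG: "\<And>x. norm x > \<rho> \<Longrightarrow> G x = 0"
      by (intro that[of "max 0 (max \<rho>1 \<rho>2)"]) auto
    obtain k0 where k0: "4 * \<rho> < 2 ^ k0" using real_arch_pow[of 2 "4 * \<rho>"] by auto
    define K where "K = int k0"
    have K: "4 * \<rho> \<le> 2 powi K" using k0 by (simp add: K_def)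
    have K0: "(0::real) < 2 powi K" by simp
    \<comment> \<open>The shifts run between -1/2 and -1/4 of the side of the top cube. As \<rho> is
      at most a quarter of that side, the top cube contains the ball of radius \<rho> for each of
      them.\<close>
    define T :: real where "T = 2 powi K / 4"
    define a :: real where "a = - (2 powi K / 2)"
    have T: "0 < T" by (simp add: T_def)
    define \<phi> where "\<phi> i l x = ennreal (\<omega> i l) * ennreal (avg (p i) (sup_cube x (r i l)) F * avg (q i) (sup_cube x (r i l)) G)" for i l x
    have \<phi>m: "\<phi> i l \<in> borel_measurable borel" for i l unfolding \<phi>_def by measurable
    have \<phi>i: "(\<integral>\<^sup>+x. \<phi> i l x \<partial>lborel) = ennreal (\<omega> i l) * local_form (p i) (q i) (r i l) F G" for i l
      unfolding \<phi>_def local_form_def by (rule nn_integral_cmult) measurable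
    have fin: "(\<Sum>l. \<integral>\<^sup>+x. \<phi> i l x \<partial>lborel) < \<infinity>" for i
    proof -
      let ?b = "(LINT x|lborel. F x powr 2) + (LINT x|lborel. G x powr 2)"
      have "(\<Sum>l. \<integral>\<^sup>+x. \<phi> i l x \<partial>lborel) \<le> (\<Sum>l. ennreal (\<omega> i l) * ennreal ?b)"
        unfolding \<phi>i using p[of i] q[of i] by (intro suminf_le mult_left_mono local_form_bounded F G r) auto
      also have "\<dots> = ennreal (\<Omega> i) * ennreal ?b" by (simp add: \<Omega>)
      finally show ?thesis by (auto intro: order.strict_trans1 simp: ennreal_mult_less_top)
    qed
    obtain t where t: "t \<in> {a..a + T}" and tb: "\<And>i. (\<Sum>l. \<integral>\<^sup>+x. \<phi> i l x \<partial>lborel) \<le>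
      2 * (\<Sum>l. \<integral>\<^sup>+x. \<phi> i l x * (if 2 powi (k i l) \<le> T \<and> near_boundary (k i l) (r i l) t x then 0 else 1) \<partial>lborel)"
      using exists_good_shift[where \<phi> = \<phi> and T = T and r = r and M = M and k = k and a = a, OF \<phi>m T r k(1) _ fin small]
      by (auto simp: M_def)
    define x0 :: "real^'n" where "x0 = (\<chi> i. t)"
    have Q0: "x \<in> dyadic_cube x0 K 0" if "norm x \<le> \<rho>" for x
    proof -
      have c: "\<bar>x $ i\<bar> \<le> \<rho>" for i using component_le_norm_cart[of x i] that by linarith
      have "t \<le> x $ i \<and> x $ i < t + 2 powi K" for i
      proof -
        have "- (2 powi K / 2) \<le> t" "t \<le> - (2 powi K / 2) + 2 powi K / 4" using t by (auto simp: T_def a_def)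
        moreover have "- \<rho> \<le> x $ i" "x $ i \<le> \<rho>" using c[of i] by auto
        ultimately show ?thesis using K K0 by linarith
      qed
      then show ?thesis by (simp add: dyadic_cube_def x0_def)
    qed
    \<comment> \<open>The powers of \<open>F\<close> and of \<open>G\<close> are interleaved into a
      single sequence of densities.\<close>
    define H where "H j = (if even j then (\<lambda>x. F x powr p (j div 2)) else (\<lambda>x. G x powr q (j div 2)))" for j
    have Hi: "integrable lborel (H j)" for j
      using p(1)[of "j div 2"] q(1)[of "j div 2"] by (auto simp: H_def intro!: test_fun_powr_integrable F G)
    have H0: "0 \<le> H j x" for j x by (simp add: H_def)
    obtain S where S: "sparse_family (1 / 4) S" "S \<subseteq> {Q \<in> dyadic_grid x0. Q \<subseteq> dyadic_cube x0 K 0}" "dyadic_cube x0 K 0 \<in> S"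
      and dom: "\<forall>Q\<in>dyadic_grid x0. Q \<subseteq> dyadic_cube x0 K 0 \<longrightarrow> (\<exists>P\<in>S. Q \<subseteq> P \<and>
        (\<forall>j. (LINT x|lborel. indicator Q x * H j x) / measure lborel Q \<le> 2 ^ (j + 2) * ((LINT x|lborel. indicator P x * H j x) / measure lborel P)))"
      using universal_sparse_family[of H x0 K 0, OF Hi H0] by (elim exE conjE) (rule that)
    have dom': "\<exists>P\<in>S. Q \<subseteq> P \<and>
       (LINT x|lborel. indicator Q x * F x powr p i) / measure lborel Q \<le> c i * ((LINT x|lborel. indicator P x * F x powr p i) / measure lborel P) \<and>
       (LINT x|lborel. indicator Q x * G x powr q i) / measure lborel Q \<le> c i * ((LINT x|lborel. indicator P x * G x powr q i) / measure lborel P)"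
      if Q: "Q \<in> dyadic_grid x0" "Q \<subseteq> dyadic_cube x0 K 0" for Q i
    proof -
      obtain P where P: "P \<in> S" "Q \<subseteq> P" and j: "\<And>j. (LINT x|lborel. indicator Q x * H j x) / measure lborel Q \<le> 2 ^ (j + 2) * ((LINT x|lborel. indicator P x * H j x) / measure lborel P)"
        using bspec[OF dom Q(1), rule_format, OF Q(2)] by (elim bexE conjE) (rule that, auto)
      have "(2::real) ^ (2 * i + 2) \<le> c i" unfolding c_def by (intro power_increasing) auto
      moreover have "0 \<le> (LINT x|lborel. indicator P x * F x powr p i) / measure lborel P"
        by (intro divide_nonneg_nonneg integral_nonneg_AE) auto
      ultimately have "2 ^ (2 * i + 2) * ((LINT x|lborel. indicator P x * F x powr p i) / measure lborel P) \<le> c i * ((LINT x|lborel. indicator P x * F x powr p i) / measure lborel P)"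
        by (rule mult_right_mono)
      then show ?thesis using P j[of "2 * i"] j[of "2 * i + 1"]
        by (intro bexI[of _ P]) (auto simp: H_def c_def numeral_3_eq_3)
    qed
    have one: "(\<integral>\<^sup>+x. \<phi> i l x * (if 2 powi (k i l) \<le> T \<and> near_boundary (k i l) (r i l) t x then 0 else 1) \<partial>lborel)
      \<le> ennreal (\<omega> i l) * (ennreal (A i) * avg_sum S (p i) (q i) F G)" for i l
    proof (cases "2 powi (k i l) \<le> T")
      case True
      have "(2::real) powi (k i l) \<le> 2 powi K" using True K0 unfolding T_def by linarith
      then have kK: "k i l \<le> K"
        using power_int_strict_increasing[of K "k i l" "2::real"] by (meson linorder_not_less one_less_numeral_iff semiring_norm(76))
      have "(\<integral>\<^sup>+x. \<phi> i l x * (if 2 powi (k i l) \<le> T \<and> near_boundary (k i l) (r i l) t x then 0 else 1) \<partial>lborel) =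
        (\<integral>\<^sup>+x. ennreal (\<omega> i l) * (ennreal (avg (p i) (sup_cube x (r i l)) F * avg (q i) (sup_cube x (r i l)) G) * (if near_boundary (k i l) (r i l) t x then 0 else 1)) \<partial>lborel)"
        using True by (simp add: \<phi>_def mult.assoc)
      also have "\<dots> = ennreal (\<omega> i l) * (\<integral>\<^sup>+x. ennreal (avg (p i) (sup_cube x (r i l)) F * avg (q i) (sup_cube x (r i l)) G) * (if near_boundary (k i l) (r i l) t x then 0 else 1) \<partial>lborel)"
        by (rule nn_integral_cmult) measurable
      also have "\<dots> \<le> ennreal (\<omega> i l) * (ennreal (((2 ^ M i) ^ ?n * c i)\<^sup>2) * avg_sum S (p i) (q i) F G)"
        by (intro mult_left_mono good_scale_bound[OF F G suppF x0_def Q0 r k(2) kK p(1) q(1) S(2) dom']) (auto simp: c_def)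
      also have "\<dots> \<le> ennreal (\<omega> i l) * (ennreal (A i) * avg_sum S (p i) (q i) F G)"
        by (intro mult_left_mono mult_right_mono ennreal_leI) (auto simp: A_def)
      finally show ?thesis .
    next
      case False
      \<comment> \<open>The factor 4 comes from \<open>T\<close>, a quarter of the side of the top
        cube.\<close>
      then have "2 powi K \<le> 4 * (2 ^ (M i + 1) * r i l)" using k(2)[of i l] by (simp add: T_def)
      then have "local_form (p i) (q i) (r i l) F G \<le> ennreal (((2 ^ (M i + 2)) ^ ?n)\<^sup>2) * avg_sum S (p i) (q i) F G"
        by (intro large_scale_bound[OF F G suppF suppG Q0 \<rho> K r _ p q S(3)])
      also have "\<dots> \<le> ennreal (A i) * avg_sum S (p i) (q i) F G"
        by (intro mult_right_mono ennreal_leI) (auto simp: A_def)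
      finally show ?thesis using False by (simp add: \<phi>i mult_left_mono)
    qed
    show "\<exists>S. sparse_family (1 / 4) S \<and> (\<forall>i. (\<Sum>l. ennreal (\<omega> i l) * local_form (p i) (q i) (r i l) F G)
       \<le> ennreal (2 * (\<Omega> i * A i)) * avg_sum S (p i) (q i) F G)"
    proof (intro exI[of _ S] conjI allI S(1))
      fix i
      have "(\<Sum>l. ennreal (\<omega> i l) * local_form (p i) (q i) (r i l) F G) \<le> 2 * (\<Sum>l. ennreal (\<omega> i l) * (ennreal (A i) * avg_sum S (p i) (q i) F G))"
        using tb[of i] unfolding \<phi>i by (rule order_trans) (intro mult_left_mono suminf_le one; auto)
      also have "\<dots> = 2 * (ennreal (\<Omega> i) * (ennreal (A i) * avg_sum S (p i) (q i) F G))" by (simp add: \<Omega>)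
      also have "\<dots> = ennreal (2 * (\<Omega> i * A i)) * avg_sum S (p i) (q i) F G"
      proof -
        have "0 \<le> A i" by (simp add: A_def)
        then have "ennreal (2 * (\<Omega> i * A i)) = 2 * (ennreal (\<Omega> i) * ennreal (A i))"
          using \<Omega>(2)[of i] by (simp add: ennreal_mult)
        then show ?thesis by (simp add: mult.assoc)
      qed
      finally show "(\<Sum>l. ennreal (\<omega> i l) * local_form (p i) (q i) (r i l) F G) \<le> ennreal (2 * (\<Omega> i * A i)) * avg_sum S (p i) (q i) F G" .
    qed
  qed
qed

section \<open>Return to the averages and forms of the statement\<close>

lemma suminf_prod_decode_ennreal:
  fixes f :: "nat \<Rightarrow> nat \<Rightarrow> ennreal"
  shows "(\<Sum>l. case prod_decode l of (i, j) \<Rightarrow> f i j) = (\<Sum>i. \<Sum>j. f i j)"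
proof -
  have "(\<Sum>l. case prod_decode l of (i, j) \<Rightarrow> f i j) = (\<integral>\<^sup>+l. (case prod_decode l of (i, j) \<Rightarrow> f i j) \<partial>count_space UNIV)"
    by (rule nn_integral_count_space_nat[symmetric])
  also have "\<dots> = (\<integral>\<^sup>+x. (case x of (i, j) \<Rightarrow> f i j) \<partial>count_space UNIV)"
    by (rule nn_integral_bij_count_space[OF bij_prod_decode])
  also have "\<dots> = (\<integral>\<^sup>+i. \<integral>\<^sup>+j. f i j \<partial>count_space UNIV \<partial>count_space UNIV)"
    by (subst nn_integral_fst_count_space[symmetric]) simp
  also have "\<dots> = (\<Sum>i. \<Sum>j. f i j)" by (simp add: nn_integral_count_space_nat)
  finally show ?thesis .
qed

lemma lp_average_eq_avg:
  fixes f f0 :: "real^'n::finite \<Rightarrow> complex"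
  assumes f: "f \<in> borel_measurable lebesgue" and f0: "AE x in lborel. f x = f0 x" "f0 \<in> borel_measurable borel" and Q: "Q \<in> sets borel"
  shows "lp_average (ereal p) Q f = avg p Q (\<lambda>x. cmod (f0 x))"
proof -
  have Qm: "(\<lambda>x. indicator Q x :: real) \<in> borel_measurable lebesgue" using Q by (intro borel_measurable_indicator) simp
  have [measurable]: "f0 \<in> borel_measurable borel" "Q \<in> sets borel" using f0 Q by auto
  have "(LINT x:Q|lebesgue. cmod (f x) powr p) = (LINT x|lborel. indicator Q x *\<^sub>R cmod (f0 x) powr p)"
    unfolding set_lebesgue_integral_def
  proof (rule integral_lebesgue_borel_version)
    show "(\<lambda>x. indicator Q x *\<^sub>R cmod (f x) powr p) \<in> borel_measurable lebesgue"
    proof (rule borel_measurable_scaleR[OF Qm])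
      have "(\<lambda>z::complex. cmod z powr p) \<in> borel_measurable borel" by measurable
      then show "(\<lambda>x. cmod (f x) powr p) \<in> borel_measurable lebesgue" by (rule measurable_compose[OF f])
    qed
    show "AE x in lborel. indicator Q x *\<^sub>R cmod (f x) powr p = indicator Q x *\<^sub>R cmod (f0 x) powr p"
      using f0(1) by eventually_elim simp
  qed measurable
  moreover have "measure lebesgue Q = measure lborel Q" using Q by (intro measure_completion) simp
  ultimately show ?thesis by (simp add: lp_average_def avg_def)
qed

text \<open>For finite exponents this is monotonicity of averages; for the infinite exponent, an
  average is at most the essential supremum.\<close>

lemma avg_le_lp_average:
  fixes f f0 :: "real^'n::finite \<Rightarrow> complex"
  assumes f: "bounded_compact_support f" and f0: "AE x in lborel. f x = f0 x" "borel_bounded_compact f0"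
    and Q: "Q \<in> sets borel" "0 < measure lborel Q" "emeasure lborel Q < \<infinity>" and p: "1 \<le> p" "ereal p \<le> P"
  shows "avg p Q (\<lambda>x. cmod (f0 x)) \<le> lp_average P Q f"
proof -
  have fm: "f \<in> borel_measurable lebesgue" using f by (simp add: bounded_compact_support_def)
  have f0m[measurable]: "f0 \<in> borel_measurable borel" using f0(2) by (simp add: borel_bounded_compact_def)
  have tf: "test_fun (\<lambda>x. cmod (f0 x))" by (rule test_fun_cmod[OF f0(2)])
  show ?thesis
  proof (cases P)
    case (real P')
    then show ?thesis
      using p avg_mono_exponent[OF tf Q(1,2), of p P'] lp_average_eq_avg[OF fm f0(1) f0m Q(1), of P'] by simp
  next
    case PInf
    let ?R = "restrict_space lebesgue Q"
    let ?e = "esssup ?R (\<lambda>x. ereal (cmod (f x)))"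
    have Ql: "Q \<in> sets lebesgue" using Q(1) by simp
    have fR: "(\<lambda>x. ereal (cmod (f x))) \<in> borel_measurable ?R"
    proof (rule measurable_restrict_space1)
      have "(\<lambda>z::complex. ereal (cmod z)) \<in> borel_measurable borel" by measurable
      then show "(\<lambda>x. ereal (cmod (f x))) \<in> borel_measurable lebesgue" by (rule measurable_compose[OF fm])
    qed
    obtain B where B: "\<And>x. cmod (f x) \<le> B"
      using f by (auto simp: bounded_compact_support_def bounded_iff)
    \<comment> \<open>\<open>lp_average\<close> converts the essential supremum to a real number,
      which would turn an infinite value into 0; finiteness is therefore secured first.\<close>
    have eB: "?e \<le> ereal B" by (rule esssup_I[OF fR]) (simp add: B)
    have "AE x in ?R. ereal (cmod (f x)) \<le> ?e" by (rule esssup_AE)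
    then have "AE x in lebesgue. x \<in> Q \<longrightarrow> ereal (cmod (f x)) \<le> ?e"
      by (subst (asm) AE_restrict_space_iff) (use Ql in auto)
    then have ae: "AE x in lborel. x \<in> Q \<longrightarrow> ereal (cmod (f x)) \<le> ?e" by (simp add: AE_completion_iff)
    \<comment> \<open>A negative value would mean that \<open>Q\<close> is a null set.\<close>
    have "0 \<le> ?e"
    proof (rule ccontr)
      assume "\<not> 0 \<le> ?e"
      then have neg: "?e < 0" by simp
      have "AE x in lborel. x \<notin> Q"
        using ae
      proof eventually_elim
        case (elim x)
        show ?case
        proof
          assume "x \<in> Q"
          then have "ereal (cmod (f x)) < 0" using elim neg by (blast intro: le_less_trans)
          then show False using norm_ge_zero[of "f x"] by (simp del: norm_ge_zero)
        qed
      qed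
      then have "emeasure lborel Q = 0" using Q(1) by (subst (asm) AE_iff_measurable[OF _ refl]) auto
      then show False using Q(2) by (simp add: measure_def)
    qed
    then obtain \<nu> where \<nu>: "?e = ereal \<nu>" "0 \<le> \<nu>" using eB by (cases ?e) auto
    have ae': "AE x in lborel. indicator Q x * cmod (f0 x) powr p \<le> indicator Q x * \<nu> powr p"
      using ae f0(1)
    proof eventually_elim
      case (elim x)
      then show ?case using p \<nu> by (auto simp: indicator_def intro!: powr_mono2)
    qed
    have "(LINT x|lborel. indicator Q x * cmod (f0 x) powr p) \<le> (LINT x|lborel. indicator Q x * \<nu> powr p)"
      using ae' Q p by (intro integral_mono_AE test_fun_powr_integrable_on tf integrable_mult_left integrable_real_indicator) auto
    also have "\<dots> = measure lborel Q * \<nu> powr p" using Q by simp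
    finally have le: "(LINT x|lborel. indicator Q x * cmod (f0 x) powr p) / measure lborel Q \<le> \<nu> powr p"
      using Q(2) by (simp add: field_simps)
    have "0 \<le> (LINT x|lborel. indicator Q x * cmod (f0 x) powr p)" by (intro integral_nonneg_AE) auto
    then have "avg p Q (\<lambda>x. cmod (f0 x)) \<le> (\<nu> powr p) powr (1 / p)"
      unfolding avg_def using le p Q(2) by (intro powr_mono2) auto
    also have "\<dots> = \<nu>" using \<nu> p by (simp add: powr_powr)
    finally show ?thesis using \<nu> PInf by (simp add: lp_average_def)
  qed (use p in auto)
qed

lemma avg_sum_le_sparse_form:
  fixes f g f0 g0 :: "real^'n::finite \<Rightarrow> complex"
  assumes f: "bounded_compact_support f" "AE x in lborel. f x = f0 x" "borel_bounded_compact f0"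
    and g: "bounded_compact_support g" "AE x in lborel. g x = g0 x" "borel_bounded_compact g0"
    and S: "sparse_family \<eta> S" and p: "1 \<le> p" "ereal p \<le> P" and q: "1 \<le> q" "ereal q \<le> P'"
  shows "avg_sum S p q (\<lambda>x. cmod (f0 x)) (\<lambda>x. cmod (g0 x)) \<le> sparse_form S P P' f g"
  unfolding avg_sum_def sparse_form_def
proof (rule infsum_mono)
  fix Q assume "Q \<in> S"
  then obtain x0 k v where Q: "Q = dyadic_cube x0 k v" using S unfolding sparse_family_def dyadic_grid_def by blast
  have Q': "Q \<in> sets borel" "0 < measure lborel Q" "emeasure lborel Q < \<infinity>" unfolding Q by (auto simp: dyadic_cube_measure)
  have m: "measure lebesgue Q = measure lborel Q" using Q'(1) by (intro measure_completion) simp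
  have "avg p Q (\<lambda>x. cmod (f0 x)) * avg q Q (\<lambda>x. cmod (g0 x)) \<le> lp_average P Q f * lp_average P' Q g"
    using avg_le_lp_average[OF f Q' p] avg_le_lp_average[OF g Q' q] avg_nonneg
    by (intro mult_mono) (auto intro: order_trans[OF avg_nonneg])
  then show "ennreal (measure lborel Q * avg p Q (\<lambda>x. cmod (f0 x)) * avg q Q (\<lambda>x. cmod (g0 x)))
    \<le> ennreal (measure lebesgue Q * lp_average P Q f * lp_average P' Q g)"
    unfolding m mult.assoc by (intro ennreal_leI mult_left_mono) auto
qed (auto intro: nonneg_summable_on_complete)

section \<open>Exponents\<close>

text \<open>Clamping to [1, 2] turns every rational into a legitimate exponent, so the list of pairs
  needs no case distinctions.\<close>

definition rat_exponent :: "rat \<Rightarrow> real" where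
  "rat_exponent a = max 1 (min 2 (real_of_rat a))"

lemma rat_exponent_bounds: "1 \<le> rat_exponent a" "rat_exponent a \<le> 2"
  by (auto simp: rat_exponent_def)

text \<open>The approximation is from below, so that averages with the rational exponent are
  dominated by those with \<open>p\<close>, while the reciprocal increases by less than
  \<open>d\<close>.\<close>

lemma rat_exponent_approx:
  assumes p: "1 \<le> p" "p \<le> 2" and d: "0 < d"
  shows "\<exists>a. rat_exponent a \<le> p \<and> 1 / rat_exponent a < 1 / p + d"
proof -
  define y where "y = 1 / (1 / p + d)"
  have y: "0 < y" "y < p" "1 / y = 1 / p + d" using p d by (auto simp: y_def field_simps add_pos_pos)
  obtain a where a: "y < real_of_rat a" "real_of_rat a < p" using of_rat_dense[OF y(2)] by blast
  have r: "rat_exponent a \<le> p" "real_of_rat a \<le> rat_exponent a" using a p by (auto simp: rat_exponent_def)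
  have "1 / rat_exponent a < 1 / y" using a r y by (intro divide_strict_left_mono) auto
  then show ?thesis using r y(3) by auto
qed

definition exponent_pair :: "nat \<Rightarrow> real \<times> real" where
  "exponent_pair i = (let (a, b) = from_nat i :: rat \<times> rat in (rat_exponent a, rat_exponent b))"

lemma exponent_pair_bounds:
  "1 \<le> fst (exponent_pair i)" "fst (exponent_pair i) \<le> 2" "1 \<le> snd (exponent_pair i)" "snd (exponent_pair i) \<le> 2"
  by (auto simp: exponent_pair_def rat_exponent_bounds split: prod.split)

definition admissible :: "nat \<Rightarrow> real \<Rightarrow> nat \<Rightarrow> bool" where
  "admissible n b i \<longleftrightarrow> real n * (1 / fst (exponent_pair i) + 1 / snd (exponent_pair i) - 1) < b"

lemma admissible_approx:
  assumes n: "0 < n" and p: "1 \<le> p" "p \<le> 2" and q: "1 \<le> q" "q \<le> 2" and gap: "real n * (1 / p + 1 / q - 1) < b"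
  shows "\<exists>i. admissible n b i \<and> fst (exponent_pair i) \<le> p \<and> snd (exponent_pair i) \<le> q"
proof -
  \<comment> \<open>The slack in the strict inequality, divided by n and shared equally between the
    two exponents.\<close>
  define d where "d = (b - real n * (1 / p + 1 / q - 1)) / (2 * real n)"
  have d: "0 < d" using gap n by (simp add: d_def)
  obtain a where a: "rat_exponent a \<le> p" "1 / rat_exponent a < 1 / p + d" using rat_exponent_approx[OF p d] by blast
  obtain a' where a': "rat_exponent a' \<le> q" "1 / rat_exponent a' < 1 / q + d" using rat_exponent_approx[OF q d] by blast
  have ep: "exponent_pair (to_nat (a, a')) = (rat_exponent a, rat_exponent a')" by (simp add: exponent_pair_def)
  have "real n * (1 / rat_exponent a + 1 / rat_exponent a' - 1) < real n * ((1 / p + 1 / q - 1) + 2 * d)"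
    using a a' n by (intro mult_strict_left_mono) auto
  also have "\<dots> = b" using n by (simp add: d_def field_simps)
  finally have "admissible n b (to_nat (a, a'))" by (simp add: admissible_def ep)
  then show ?thesis using a a' by (intro exI[of _ "to_nat (a, a')"]) (simp add: ep)
qed

lemma conj_exponent_eq:
  shows "conj_exponent \<infinity> = 1" and "conj_exponent 1 = \<infinity>" and "1 < s \<Longrightarrow> conj_exponent (ereal s) = ereal (s / (s - 1))"
proof -
  show "conj_exponent \<infinity> = 1" "conj_exponent 1 = \<infinity>" by (auto simp: conj_exponent_def one_ereal_def)
  assume s: "1 < s"
  then have "1 - 1 / ereal s = ereal ((s - 1) / s)" by (simp add: one_ereal_def field_simps)
  then show "conj_exponent (ereal s) = ereal (s / (s - 1))" using s by (simp add: conj_exponent_def)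
qed

text \<open>In the first region \<open>q = 2\<close> is at most the conjugate of \<open>s\<close>,
  and 1/p + 1/q - 1 = 1/r - 1/2. In the second, \<open>q\<close> is the conjugate of
  \<open>s\<close> itself, and the same expression equals 1/r - 1/s; for infinite \<open>s\<close>
  this means \<open>q = 1\<close>.\<close>

lemma exponent_region:
  fixes r s :: ereal
  assumes \<alpha>: "\<alpha> \<noteq> 0"
    and h: "(ereal \<bar>\<beta>\<bar> > ereal (real n * \<bar>\<alpha>\<bar>) * (1 / r - 1 / 2) \<and> 1 \<le> r \<and> r \<le> s \<and> s \<le> 2) \<or>
      (ereal \<bar>\<beta>\<bar> > ereal (real n * \<bar>\<alpha>\<bar>) * (1 / r - 1 / s) \<and> 1 \<le> r \<and> r \<le> 2 \<and> 2 \<le> s \<and> s \<le> conj_exponent r)"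
  shows "\<exists>p q. 1 \<le> p \<and> p \<le> 2 \<and> 1 \<le> q \<and> q \<le> 2 \<and> ereal p \<le> r \<and> ereal q \<le> conj_exponent s \<and>
     real n * (1 / p + 1 / q - 1) < \<bar>\<beta>\<bar> / \<bar>\<alpha>\<bar>"
proof -
  have "1 \<le> r" "r \<le> 2" using h by auto
  then obtain p where p: "r = ereal p" "1 \<le> p" "p \<le> 2" by (cases r) (auto simp: one_ereal_def numeral_eq_ereal)
  have gap: "real n * x < \<bar>\<beta>\<bar> / \<bar>\<alpha>\<bar>" if "real n * \<bar>\<alpha>\<bar> * x < \<bar>\<beta>\<bar>" for x
    using that \<alpha> by (simp add: field_simps)
  have two: "(2::ereal) = ereal 2" by (simp add: numeral_eq_ereal)
  from h show ?thesis
  proof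
    assume a: "ereal \<bar>\<beta>\<bar> > ereal (real n * \<bar>\<alpha>\<bar>) * (1 / r - 1 / 2) \<and> 1 \<le> r \<and> r \<le> s \<and> s \<le> 2"
    then obtain s' where s': "s = ereal s'" "1 \<le> s'" "s' \<le> 2" using p by (cases s) (auto simp: two)
    have "real n * \<bar>\<alpha>\<bar> * (1 / p - 1 / 2) < \<bar>\<beta>\<bar>" using a p by (simp add: one_ereal_def two)
    then have "real n * (1 / p + 1 / 2 - 1) < \<bar>\<beta>\<bar> / \<bar>\<alpha>\<bar>" using gap[of "1 / p - 1 / 2"] by simp
    moreover have "ereal 2 \<le> conj_exponent s"
    proof (cases "s' = 1")
      case True
      then show ?thesis using conj_exponent_eq(2) s' by (simp add: one_ereal_def)
    next
      case False
      then show ?thesis using conj_exponent_eq(3)[of s'] s' by (simp add: field_simps)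
    qed
    ultimately show ?thesis using p by (intro exI[of _ p] exI[of _ 2]) auto
  next
    assume a: "ereal \<bar>\<beta>\<bar> > ereal (real n * \<bar>\<alpha>\<bar>) * (1 / r - 1 / s) \<and> 1 \<le> r \<and> r \<le> 2 \<and> 2 \<le> s \<and> s \<le> conj_exponent r"
    show ?thesis
    proof (cases s)
      case PInf
      then have "real n * \<bar>\<alpha>\<bar> * (1 / p) < \<bar>\<beta>\<bar>" using a p by (simp add: one_ereal_def)
      then have "real n * (1 / p + 1 / 1 - 1) < \<bar>\<beta>\<bar> / \<bar>\<alpha>\<bar>" using gap[of "1 / p"] by simp
      then show ?thesis using p PInf conj_exponent_eq(1) by (intro exI[of _ p] exI[of _ 1]) (auto simp: one_ereal_def)
    next
      case (real s')
      then have s': "2 \<le> s'" using a by (simp add: two)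
      have q: "1 \<le> s' / (s' - 1)" "s' / (s' - 1) \<le> 2" "1 / (s' / (s' - 1)) = 1 - 1 / s'" using s' by (auto simp: field_simps)
      have "real n * \<bar>\<alpha>\<bar> * (1 / p - 1 / s') < \<bar>\<beta>\<bar>" using a p s' real by (simp add: one_ereal_def)
      then have "real n * (1 / p + 1 / (s' / (s' - 1)) - 1) < \<bar>\<beta>\<bar> / \<bar>\<alpha>\<bar>" using gap[of "1 / p - 1 / s'"] q(3) by simp
      then show ?thesis using p q conj_exponent_eq(3)[of s'] s' real
        by (intro exI[of _ p] exI[of _ "s' / (s' - 1)"]) auto
    qed (use a in auto)
  qed
qed

text \<open>The pieces of all admissible pairs are handed to \<open>sparse_domination\<close>
  together, so that one family dominates the form for every admissible index. The weights do not
  depend on \<open>m\<close>, \<open>f\<close>, \<open>g\<close>, hence neither does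
  \<open>c\<close>.\<close>

lemma multiplier_sparse:
  fixes A :: "('n::finite \<Rightarrow> nat) \<Rightarrow> real"
  assumes ab: "\<alpha> * \<beta> > 0"
  shows "\<exists>c :: nat \<Rightarrow> real. \<forall>(m :: real^'n \<Rightarrow> complex) f g. is_symbol \<alpha> \<beta> A m \<longrightarrow> borel_bounded_compact f \<longrightarrow> borel_bounded_compact g \<longrightarrow>
    (\<exists>S. sparse_family (1 / 4) S \<and> (\<forall>i. admissible CARD('n) (\<beta> / \<alpha>) i \<longrightarrow>
      ennreal (cmod (freq_form m f g)) \<le> ennreal (c i) *
        avg_sum S (fst (exponent_pair i)) (snd (exponent_pair i)) (\<lambda>x. cmod (f x)) (\<lambda>x. cmod (g x))))"
proof -
  let ?p = "\<lambda>i. fst (exponent_pair i)" and ?q = "\<lambda>i. snd (exponent_pair i)"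
  let ?adm = "admissible CARD('n) (\<beta> / \<alpha>)"
  let ?bd = "\<lambda>i W \<Lambda>. (\<forall>(m :: real^'n \<Rightarrow> complex) f g. is_symbol \<alpha> \<beta> A m \<longrightarrow> borel_bounded_compact f \<longrightarrow> borel_bounded_compact g \<longrightarrow>
      ennreal (cmod (freq_form m f g)) \<le> (\<Sum>j. ennreal (W j) * (\<Sum>h. ennreal ((1 / 2) ^ h) *
         local_form (?p i) (?q i) (2 ^ (h + 1) * \<Lambda> j) (\<lambda>x. cmod (f x)) (\<lambda>x. cmod (g x)))))"
  define good where "good i WL \<longleftrightarrow> (\<forall>j. 0 \<le> fst WL j) \<and> summable (fst WL) \<and> (\<forall>j. 0 < snd WL j) \<and> (?adm i \<longrightarrow> ?bd i (fst WL) (snd WL))"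
    for i and WL :: "(nat \<Rightarrow> real) \<times> (nat \<Rightarrow> real)"
  have "\<exists>WL. good i WL" for i
  proof (cases "?adm i")
    case True
    then have gap: "real CARD('n) * (1 / ?p i + 1 / ?q i - 1) < \<beta> / \<alpha>" unfolding admissible_def .
    show ?thesis
      using multiplier_bound[OF ab exponent_pair_bounds[of i] gap, where A = A]
    proof (elim exE conjE)
      fix W \<Lambda> assume *: "\<forall>i. 0 \<le> W i" "summable W" "\<forall>i. 0 < \<Lambda> i" "?bd i W \<Lambda>"
      show ?thesis unfolding good_def
        by (rule exI[of _ "(W, \<Lambda>)"], unfold fst_conv snd_conv, intro conjI *(1-3)) (rule impI, rule *(4))
    qed
  next
    case False
    \<comment> \<open>Indices that are not admissible receive dummy weights 0 and radii 1, so that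
      the family of weights is defined for all indices.\<close>
    then show ?thesis unfolding good_def by (intro exI[of _ "(\<lambda>_. 0, \<lambda>_. 1)"]) simp
  qed
  then have "\<forall>i. \<exists>WL. good i WL" by (rule allI)
  from choice[OF this] obtain WL where WL: "\<forall>i. good i (WL i)" ..
  define W where "W i = fst (WL i)" for i
  define \<Lambda> where "\<Lambda> i = snd (WL i)" for i
  have WL': "good i (W i, \<Lambda> i)" for i using WL by (simp add: W_def \<Lambda>_def)
  have W: "0 \<le> W i j" "summable (W i)" and \<Lambda>: "0 < \<Lambda> i j" for i j
    using WL'[of i] unfolding good_def fst_conv snd_conv by (elim conjE, simp only: simp_thms)+
  have bd: "?bd i (W i) (\<Lambda> i)" if "?adm i" for i
    using WL'[of i] that unfolding good_def fst_conv snd_conv by (elim conjE) (rule mp)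
  \<comment> \<open>The frequency index \<open>j\<close> and the shell index \<open>h\<close> are
    merged into one index \<open>l\<close>.\<close>
  define \<omega> where "\<omega> i l = (case prod_decode l of (j, h) \<Rightarrow> W i j * (1 / 2) ^ h)" for i l
  define R where "R i l = (case prod_decode l of (j, h) \<Rightarrow> 2 ^ (h + 1) * \<Lambda> i j)" for i l
  have R: "0 < R i l" for i l using \<Lambda> by (auto simp: R_def split: prod.split)
  have \<omega>: "(\<Sum>l. ennreal (\<omega> i l)) < \<infinity>" for i
  proof -
    have "(\<Sum>l. ennreal (\<omega> i l)) = (\<Sum>j. \<Sum>h. ennreal (W i j * (1 / 2) ^ h))"
      unfolding suminf_prod_decode_ennreal[symmetric] \<omega>_def by (intro suminf_cong) (auto split: prod.split)
    also have "\<dots> = (\<Sum>j. ennreal (2 * W i j))"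
    proof (rule suminf_cong)
      fix j
      have "(\<lambda>h. W i j * (1 / 2) ^ h) sums (W i j * (1 / (1 - 1 / 2)))" by (intro sums_mult geometric_sums) simp
      then have "(\<lambda>h. W i j * (1 / 2) ^ h) sums (2 * W i j)" by (simp add: mult.commute)
      then show "(\<Sum>h. ennreal (W i j * (1 / 2) ^ h)) = ennreal (2 * W i j)"
        using W(1)[of i j] by (intro suminf_ennreal_eq) auto
    qed
    also have "\<dots> = ennreal (\<Sum>j. 2 * W i j)"
      using W by (intro suminf_ennreal_eq summable_sums summable_mult) auto
    finally show ?thesis by simp
  qed
  obtain c where c: "\<And>F G :: real^'n \<Rightarrow> real. test_fun F \<Longrightarrow> test_fun G \<Longrightarrow>
    (\<exists>S. sparse_family (1 / 4) S \<and> (\<forall>i. (\<Sum>l. ennreal (\<omega> i l) * local_form (?p i) (?q i) (R i l) F G)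
       \<le> ennreal (c i) * avg_sum S (?p i) (?q i) F G))"
    using sparse_domination[where p = ?p and q = ?q and \<omega> = \<omega> and r = R, OF exponent_pair_bounds \<omega> R] by blast
  show ?thesis
  proof (intro exI[of _ c] allI impI)
    fix m f g :: "real^'n \<Rightarrow> complex"
    assume m: "is_symbol \<alpha> \<beta> A m" and f: "borel_bounded_compact f" and g: "borel_bounded_compact g"
    let ?F = "\<lambda>x. cmod (f x)" and ?G = "\<lambda>x. cmod (g x)"
    obtain S where S: "sparse_family (1 / 4) S"
      and le: "\<And>i. (\<Sum>l. ennreal (\<omega> i l) * local_form (?p i) (?q i) (R i l) ?F ?G) \<le> ennreal (c i) * avg_sum S (?p i) (?q i) ?F ?G"
      using c[OF test_fun_cmod[OF f] test_fun_cmod[OF g]] by blast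
    show "\<exists>S. sparse_family (1 / 4) S \<and> (\<forall>i. ?adm i \<longrightarrow>
      ennreal (cmod (freq_form m f g)) \<le> ennreal (c i) * avg_sum S (?p i) (?q i) ?F ?G)"
    proof (intro exI[of _ S] conjI S allI impI)
      fix i assume i: "?adm i"
      have "ennreal (cmod (freq_form m f g)) \<le> (\<Sum>j. ennreal (W i j) * (\<Sum>h. ennreal ((1 / 2) ^ h) *
         local_form (?p i) (?q i) (2 ^ (h + 1) * \<Lambda> i j) ?F ?G))"
        using bd[OF i] m f g by blast
      also have "\<dots> = (\<Sum>j. \<Sum>h. ennreal (W i j * (1 / 2) ^ h) * local_form (?p i) (?q i) (2 ^ (h + 1) * \<Lambda> i j) ?F ?G)"
        using W(1) by (intro suminf_cong) (simp add: ennreal_mult mult.assoc flip: ennreal_suminf_cmult)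
      also have "\<dots> = (\<Sum>l. ennreal (\<omega> i l) * local_form (?p i) (?q i) (R i l) ?F ?G)"
        unfolding suminf_prod_decode_ennreal[symmetric] \<omega>_def R_def by (intro suminf_cong) (auto split: prod.split)
      also have "\<dots> \<le> ennreal (c i) * avg_sum S (?p i) (?q i) ?F ?G" by (rule le)
      finally show "ennreal (cmod (freq_form m f g)) \<le> ennreal (c i) * avg_sum S (?p i) (?q i) ?F ?G" .
    qed
  qed
qed

theorem theorem5p1:
  fixes \<alpha> \<beta> :: real and A :: "('n::finite \<Rightarrow> nat) \<Rightarrow> real"
  assumes "\<alpha> \<noteq> 0"
  shows "\<exists>(\<eta>::real) (C :: ereal \<Rightarrow> ereal \<Rightarrow> real). 0 < \<eta> \<and> \<eta> < 1 \<and>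
    (\<forall>(m :: real^'n \<Rightarrow> complex) T f g.
       is_symbol \<alpha> \<beta> A m \<longrightarrow> multiplier_operator m T \<longrightarrow>
       bounded_compact_support f \<longrightarrow> bounded_compact_support g \<longrightarrow>
       (\<exists>S S'. sparse_family \<eta> S \<and> sparse_family \<eta> S' \<and>
         (\<forall>r s :: ereal.
            \<alpha> * \<beta> > 0 \<and>
            ((ereal \<bar>\<beta>\<bar> > ereal (real CARD('n) * \<bar>\<alpha>\<bar>) * (1 / r - 1 / 2) \<and>
                1 \<le> r \<and> r \<le> s \<and> s \<le> 2) \<or>
             (ereal \<bar>\<beta>\<bar> > ereal (real CARD('n) * \<bar>\<alpha>\<bar>) * (1 / r - 1 / s) \<and>
                1 \<le> r \<and> r \<le> 2 \<and> 2 \<le> s \<and> s \<le> conj_exponent r)) \<longrightarrow>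
            ennreal (cmod (L2_pairing (T f) g))
              \<le> ennreal (C r s) * sparse_form S r (conj_exponent s) f g \<and>
            ennreal (cmod (L2_pairing (T f) g))
              \<le> ennreal (C r s) * sparse_form S' (conj_exponent s) r f g)))"
proof (cases "\<alpha> * \<beta> > 0")
  case False
  \<comment> \<open>If \<alpha> \<beta> is not positive, the bounds are claimed for no pair and the
    empty family will do.\<close>
  have "sparse_family (1 / 4) ({} :: (real^'n) set set)" by (auto simp: sparse_family_def disjoint_family_on_def)
  with False show ?thesis
    by (intro exI[of _ "1 / 4 :: real"] exI[of _ "\<lambda>_ _. 0"]) (auto intro!: exI[of _ "{} :: (real^'n) set set"])
next
  case True
  let ?p = "\<lambda>i. fst (exponent_pair i)" and ?q = "\<lambda>i. snd (exponent_pair i)"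
  let ?adm = "admissible CARD('n) (\<beta> / \<alpha>)"
  obtain c where c: "\<And>(m :: real^'n \<Rightarrow> complex) f g. is_symbol \<alpha> \<beta> A m \<Longrightarrow> borel_bounded_compact f \<Longrightarrow> borel_bounded_compact g \<Longrightarrow>
    (\<exists>S. sparse_family (1 / 4) S \<and> (\<forall>i. ?adm i \<longrightarrow> ennreal (cmod (freq_form m f g)) \<le> ennreal (c i) *
        avg_sum S (?p i) (?q i) (\<lambda>x. cmod (f x)) (\<lambda>x. cmod (g x))))"
    using multiplier_sparse[OF True, of A] by blast
  \<comment> \<open>The chosen index depends on the target exponents only, and so does the constant
    \<open>C\<close>. The maximum is taken because the two orders of the exponents may select
    different indices.\<close>
  define idx where "idx p q = (SOME i. ?adm i \<and> ereal (?p i) \<le> p \<and> ereal (?q i) \<le> q)" for p q :: ereal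
  define C where "C r s = max (c (idx r (conj_exponent s))) (c (idx (conj_exponent s) r))" for r s :: ereal
  have abs: "\<bar>\<beta>\<bar> / \<bar>\<alpha>\<bar> = \<beta> / \<alpha>" using True by (auto simp: zero_less_mult_iff)
  show ?thesis
  proof (intro exI[of _ "1 / 4 :: real"] exI[of _ C] conjI allI impI)
    fix m f g :: "real^'n \<Rightarrow> complex" and T
    assume m: "is_symbol \<alpha> \<beta> A m" and T: "multiplier_operator m T" and f: "bounded_compact_support f" and g: "bounded_compact_support g"
    obtain f0 where f0: "borel_bounded_compact f0" "AE x in lborel. f x = f0 x" using borel_bounded_compact_version[OF f] by blast
    obtain g0 where g0: "borel_bounded_compact g0" "AE x in lborel. g x = g0 x" using borel_bounded_compact_version[OF g] by blast
    obtain S where S: "sparse_family (1 / 4) S" and le: "\<And>i. ?adm i \<Longrightarrow> ennreal (cmod (freq_form m f0 g0)) \<le> ennreal (c i) *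
        avg_sum S (?p i) (?q i) (\<lambda>x. cmod (f0 x)) (\<lambda>x. cmod (g0 x))"
      using c[OF m f0(1) g0(1)] by blast
    \<comment> \<open>The factor (2 pi)^n from Parseval's identity is at least 1 and is
      dropped.\<close>
    have pairing: "cmod (L2_pairing (T f) g) \<le> cmod (freq_form m f0 g0)"
    proof -
      have "(2 * pi) ^ CARD('n) * L2_pairing (T f) g = freq_form m f0 g0"
        unfolding freq_form_def
        by (rule multiplier_pairing[OF symbol_measurable[OF m] symbol_bounded[OF m True] T f g f0 g0])
      then have "cmod (freq_form m f0 g0) = (2 * pi) ^ CARD('n) * cmod (L2_pairing (T f) g)"
        by (metis norm_mult norm_of_real norm_power abs_of_nonneg of_real_mult of_real_power of_real_numeral less_imp_le two_pi_power_pos(1))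
      then show ?thesis using mult_right_mono[OF two_pi_power_pos(2)[of "CARD('n)"], of "cmod (L2_pairing (T f) g)"] by simp
    qed
    have bound: "ennreal (cmod (L2_pairing (T f) g)) \<le> ennreal (c (idx p q)) * sparse_form S p q f g"
      if "\<exists>i. ?adm i \<and> ereal (?p i) \<le> p \<and> ereal (?q i) \<le> q" for p q
    proof -
      let ?i = "idx p q"
      have i: "?adm ?i" "ereal (?p ?i) \<le> p" "ereal (?q ?i) \<le> q" using someI_ex[OF that] unfolding idx_def by auto
      have "ennreal (cmod (L2_pairing (T f) g)) \<le> ennreal (cmod (freq_form m f0 g0))" by (intro ennreal_leI pairing)
      also have "\<dots> \<le> ennreal (c ?i) * avg_sum S (?p ?i) (?q ?i) (\<lambda>x. cmod (f0 x)) (\<lambda>x. cmod (g0 x))" by (rule le[OF i(1)])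
      also have "\<dots> \<le> ennreal (c ?i) * sparse_form S p q f g"
        by (intro mult_left_mono avg_sum_le_sparse_form[OF f f0(2,1) g g0(2,1) S] exponent_pair_bounds i) auto
      finally show ?thesis .
    qed
    show "\<exists>S S'. sparse_family (1 / 4) S \<and> sparse_family (1 / 4) S' \<and>
         (\<forall>r s :: ereal.
            \<alpha> * \<beta> > 0 \<and>
            ((ereal \<bar>\<beta>\<bar> > ereal (real CARD('n) * \<bar>\<alpha>\<bar>) * (1 / r - 1 / 2) \<and>
                1 \<le> r \<and> r \<le> s \<and> s \<le> 2) \<or>
             (ereal \<bar>\<beta>\<bar> > ereal (real CARD('n) * \<bar>\<alpha>\<bar>) * (1 / r - 1 / s) \<and>
                1 \<le> r \<and> r \<le> 2 \<and> 2 \<le> s \<and> s \<le> conj_exponent r)) \<longrightarrow>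
            ennreal (cmod (L2_pairing (T f) g))
              \<le> ennreal (C r s) * sparse_form S r (conj_exponent s) f g \<and>
            ennreal (cmod (L2_pairing (T f) g))
              \<le> ennreal (C r s) * sparse_form S' (conj_exponent s) r f g)"
    \<comment> \<open>The list of exponent pairs contains approximations to both orders of the
      exponents, so the same \<open>S\<close> is used for both forms.\<close>
    proof (rule exI[of _ S], rule exI[of _ S], intro conjI S allI impI; elim conjE)
      fix r s :: ereal
      assume "(ereal \<bar>\<beta>\<bar> > ereal (real CARD('n) * \<bar>\<alpha>\<bar>) * (1 / r - 1 / 2) \<and>
                1 \<le> r \<and> r \<le> s \<and> s \<le> 2) \<or>
             (ereal \<bar>\<beta>\<bar> > ereal (real CARD('n) * \<bar>\<alpha>\<bar>) * (1 / r - 1 / s) \<and>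
                1 \<le> r \<and> r \<le> 2 \<and> 2 \<le> s \<and> s \<le> conj_exponent r)"
      from exponent_region[OF assms this]
      obtain p q where pq: "1 \<le> p" "p \<le> 2" "1 \<le> q" "q \<le> 2" "ereal p \<le> r" "ereal q \<le> conj_exponent s"
        and gap: "real CARD('n) * (1 / p + 1 / q - 1) < \<beta> / \<alpha>"
        unfolding abs by auto
      have gap': "real CARD('n) * (1 / q + 1 / p - 1) < \<beta> / \<alpha>" using gap by (simp add: add.commute)
      have ex1: "\<exists>i. ?adm i \<and> ereal (?p i) \<le> r \<and> ereal (?q i) \<le> conj_exponent s"
        using admissible_approx[OF _ pq(1-4) gap] pq(5,6) by (auto intro: order_trans[OF ereal_less_eq(3)[THEN iffD2]])
      have ex2: "\<exists>i. ?adm i \<and> ereal (?p i) \<le> conj_exponent s \<and> ereal (?q i) \<le> r"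
        using admissible_approx[OF _ pq(3,4,1,2) gap'] pq(5,6) by (auto intro: order_trans[OF ereal_less_eq(3)[THEN iffD2]])
      show "ennreal (cmod (L2_pairing (T f) g)) \<le> ennreal (C r s) * sparse_form S r (conj_exponent s) f g"
        by (rule order_trans[OF bound[OF ex1]]) (intro mult_right_mono ennreal_leI, auto simp: C_def)
      show "ennreal (cmod (L2_pairing (T f) g)) \<le> ennreal (C r s) * sparse_form S (conj_exponent s) r f g"
        by (rule order_trans[OF bound[OF ex2]]) (intro mult_right_mono ennreal_leI, auto simp: C_def)
    qed
  qed auto
qed

end
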